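(* Let $L>0$, $\mathbb{T}=\mathbb{R}/2L\mathbb{Z}$, and $u_0\in H^2(\mathbb{T})$. Then there exist a finite time $T>0$, depending only on $\|u_0\|_{H^2(\mathbb{T})}$, and a constant $\lambda_0>0$ such that the following holds. Let $\Delta x=2L/N\to 0$ ($N$ odd) with $\Delta t=\mathcal{O}(\Delta x)$ in the sense that $\Delta t/\Delta x\le\lambda_0$. Let $u_{\Delta x}$ be the interpolated difference approximations built from the scheme $$u^{n+1}_j=u^n_j+\Delta t\,\mathbb{G}(u^{n+1/2})_j+\Delta t\,\mathbb{H}_{\rm per}^{\Delta}(D_+D_-u^{n+1/2})_j,\quad n\ge0,\ j=0,\dots,N-1,\qquad u^0_j=u_0(x_j).$$ Then $u_{\Delta x}$ converges uniformly in $C(\mathbb{T}\times[0,T])$ to the unique solution $u$ of the periodic Benjamin--Ono initial value problem $$u_t=uu_x+\mathbb{H}_{\rm per}u_{xx},\quad x\in\mathbb{T},\ 0\le t\le T,\qquad u|_{t=0}=u_0.$$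
   Context: $\mathbb{H}_{\rm per}$ is the periodic Hilbert transform, $\mathbb{H}_{\rm per}u(x)=\mathrm{P.V.}\,\frac1{2L}\int_{-L}^{L}\cot\big(\frac{\pi}{2L}y\big)u(x-y)\,dy$. All functions are real-valued; the period parameter $L$ is fixed. Grid: $N$ is an odd natural number, $\Delta x=2L/N$, $x_j=-L+j\Delta x$; grid functions $p=(p_j)$ are $N$-periodic in $j$; $\Delta t>0$, $t_n=n\Delta t$. $D_\pm p_j=\pm\frac1{\Delta x}(p_{j\pm1}-p_j)$, $D=\frac12(D_++D_-)$, $\tilde p_j=\frac13(p_{j+1}+p_j+p_{j-1})$, $\mathbb{G}(p)_j=\tilde p_j\,Dp_j$. The discrete periodic Hilbert transform is $(\mathbb{H}_{\rm per}^{\Delta}p)_n=\sum_{j=0}^{N-1}c_{n-j}p_j$ with $$c_n=\frac{1-(-1)^n}{2N}\cot\Big(\frac{\pi n}{2N}\Big)-\frac{1+(-1)^n}{2N}\tan\Big(\frac{\pi n}{2N}\Big)$$ (a term whose prefactor vanishes is taken to be $0$, so $c_0=0$; $c$ is $N$-periodic because $N$ is odd). Norms: $\|p\|=\big(\Delta x\sum_{j=0}^{N-1}p_j^2\big)^{1/2}$, $\|p\|_{h^2}=(\|p\|^2+\|D_+p\|^2+\|D_+D_-p\|^2)^{1/2}$. Scheme: $u^{n+1/2}=\frac12(u^n+u^{n+1})$. The scheme is implicit; $u^{n+1}$ is the solution obtained from $v=u^n$ as the limit of the fixed point iteration $w_0=v$, $w_{\ell+1}=v+\Delta t\,\mathbb{G}\big(\frac{v+w_\ell}{2}\big)+\frac12\Delta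 t\,\mathbb{H}_{\rm per}^{\Delta}\big(D_+D_-(v+w_{\ell+1})\big)$. Interpolation: $u^n(x)=u^n_j+(x-x_j)Du^n_j+\frac12(x-x_j)^2D_+D_-u^n_j$ for $x\in[x_j,x_{j+1})$, and $u_{\Delta x}(x,t)=u^n(x)+\frac{t-t_n}{\Delta t}\big(u^{n+1}(x)-u^n(x)\big)$ for $t\in[t_n,t_{n+1}]$. "Solution" means strong solution: $u,u_x,u_{xx},u_t\in L^\infty(0,T;L^2(\mathbb{T}))$, the equation holds as an identity in $L^2$, and $u(\cdot,0)=u_0$. *)

theory Defs
  imports "HOL-Analysis.Analysis"
begin

section \<open>Function spaces on the torus of length 2L\<close>

text \<open>Functions on the torus are 2L-periodic functions on the real line; elements of the
  Lebesgue spaces are represented by functions, and equality in them is equality almost everywhere.\<close>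

definition periodic :: "real \<Rightarrow> (real \<Rightarrow> real) \<Rightarrow> bool" where
  "periodic L f \<longleftrightarrow> (\<forall>x. f (x + 2 * L) = f x)"

definition smooth :: "(real \<Rightarrow> real) \<Rightarrow> bool" where
  "smooth f \<longleftrightarrow> (\<forall>k x. ((deriv ^^ k) f) differentiable (at x))"

definition L2_per :: "real \<Rightarrow> (real \<Rightarrow> real) set" where
  "L2_per L = {f. periodic L f \<and> f \<in> borel_measurable lebesgue \<and>
                  set_integrable lebesgue {-L..L} (\<lambda>x. (f x)\<^sup>2)}"

definition norm_L2 :: "real \<Rightarrow> (real \<Rightarrow> real) \<Rightarrow> real" where
  "norm_L2 L f = sqrt (LINT x:{-L..L}|lebesgue. (f x)\<^sup>2)"

definition weak_deriv :: "real \<Rightarrow> (real \<Rightarrow> real) \<Rightarrow> (real \<Rightarrow> real) \<Rightarrow> bool" where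
  "weak_deriv L f g \<longleftrightarrow>
     (\<forall>\<phi>. smooth \<phi> \<and> periodic L \<phi> \<longrightarrow>
        (LINT x:{-L..L}|lebesgue. f x * deriv \<phi> x) = - (LINT x:{-L..L}|lebesgue. g x * \<phi> x))"

definition H2_per :: "real \<Rightarrow> (real \<Rightarrow> real) set" where
  "H2_per L = {f \<in> L2_per L. \<exists>g\<in>L2_per L. \<exists>h\<in>L2_per L. weak_deriv L f g \<and> weak_deriv L g h}"

text \<open>The weak derivative in L2 is unique almost everywhere, so the choice does not affect norms.\<close>

definition wderiv :: "real \<Rightarrow> (real \<Rightarrow> real) \<Rightarrow> real \<Rightarrow> real" where
  "wderiv L f = (SOME g. g \<in> L2_per L \<and> weak_deriv L f g)"

definition norm_H2 :: "real \<Rightarrow> (real \<Rightarrow> real) \<Rightarrow> real" where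
  "norm_H2 L f = sqrt ((norm_L2 L f)\<^sup>2 + (norm_L2 L (wderiv L f))\<^sup>2
                        + (norm_L2 L (wderiv L (wderiv L f)))\<^sup>2)"


section \<open>Periodic Hilbert transform and strong solutions\<close>

text \<open>The principal value at x exists and equals l. For f in L2 it exists for almost every x.\<close>

definition has_hilbert_per :: "real \<Rightarrow> (real \<Rightarrow> real) \<Rightarrow> real \<Rightarrow> real \<Rightarrow> bool" where
  "has_hilbert_per L f x l \<longleftrightarrow>
     ((\<lambda>\<epsilon>. 1 / (2 * L) *
         (LINT y:{y. \<epsilon> \<le> \<bar>y\<bar> \<and> \<bar>y\<bar> \<le> L}|lebesgue. cot (pi / (2 * L) * y) * f (x - y)))
       \<longlongrightarrow> l) (at_right 0)"

text \<open>Space-time functions take the time argument first, so that \<open>F t\<close> is a function on the torus.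
  As L2 of the torus is separable, (classes of) strongly measurable L2-valued functions of time are
  those given by jointly measurable functions.\<close>

definition Linf_L2 :: "real \<Rightarrow> real \<Rightarrow> (real \<Rightarrow> real \<Rightarrow> real) \<Rightarrow> bool" where
  "Linf_L2 L T F \<longleftrightarrow>
     (\<lambda>(t, x). F t x) \<in> borel_measurable (lebesgue_on ({0..T} \<times> UNIV)) \<and>
     (AE t in lebesgue_on {0..T}. F t \<in> L2_per L) \<and>
     (\<exists>C. AE t in lebesgue_on {0..T}. norm_L2 L (F t) \<le> C)"

text \<open>Weak derivative of an L2-valued function on (0,T): the Bochner integrals in L2 of
  \<open>deriv \<psi> * F\<close> and \<open>- \<psi> * G\<close> agree; these are computed pointwise for almost every x.\<close>

definition weak_time_deriv ::
    "real \<Rightarrow> (real \<Rightarrow> real \<Rightarrow> real) \<Rightarrow> (real \<Rightarrow> real \<Rightarrow> real) \<Rightarrow> bool" where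
  "weak_time_deriv T F G \<longleftrightarrow>
     (\<forall>\<psi>. smooth \<psi> \<and> (\<exists>a b. 0 < a \<and> b < T \<and> (\<forall>t. \<psi> t \<noteq> 0 \<longrightarrow> t \<in> {a..b})) \<longrightarrow>
        (AE x in lebesgue.
           (LINT t:{0..T}|lebesgue. deriv \<psi> t * F t x)
             = - (LINT t:{0..T}|lebesgue. \<psi> t * G t x)))"

text \<open>A function with \<open>u\<close> and \<open>u\<^sub>t\<close> in \<open>L\<^sup>\<infinity>(0,T;L2)\<close> has a unique representative continuous
  on [0,T] with values in L2; the solution is that representative, which gives meaning to its
  value at time 0.\<close>

definition strong_solution ::
    "real \<Rightarrow> real \<Rightarrow> (real \<Rightarrow> real) \<Rightarrow> (real \<Rightarrow> real \<Rightarrow> real) \<Rightarrow> bool" where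
  "strong_solution L T u0 u \<longleftrightarrow>
     (\<forall>t\<in>{0..T}. u t \<in> L2_per L) \<and>
     (\<forall>s\<in>{0..T}. ((\<lambda>t. norm_L2 L (\<lambda>x. u t x - u s x)) \<longlongrightarrow> 0) (at s within {0..T})) \<and>
     (AE x in lebesgue. u 0 x = u0 x) \<and>
     (\<exists>ux uxx ut.
        Linf_L2 L T u \<and> Linf_L2 L T ux \<and> Linf_L2 L T uxx \<and> Linf_L2 L T ut \<and>
        (AE t in lebesgue_on {0..T}. weak_deriv L (u t) (ux t) \<and> weak_deriv L (ux t) (uxx t)) \<and>
        weak_time_deriv T u ut \<and>
        (AE t in lebesgue_on {0..T}. AE x in lebesgue.
           \<exists>h. has_hilbert_per L (uxx t) x h \<and> ut t x = u t x * ux t x + h))"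


section \<open>The difference scheme\<close>

definition grid_fun :: "nat \<Rightarrow> (int \<Rightarrow> real) \<Rightarrow> bool" where
  "grid_fun N p \<longleftrightarrow> (\<forall>j. p (j + int N) = p j)"

definition dx :: "real \<Rightarrow> nat \<Rightarrow> real" where
  "dx L N = 2 * L / real N"

definition gridpt :: "real \<Rightarrow> nat \<Rightarrow> int \<Rightarrow> real" where
  "gridpt L N j = - L + real_of_int j * dx L N"

definition Dplus :: "real \<Rightarrow> nat \<Rightarrow> (int \<Rightarrow> real) \<Rightarrow> int \<Rightarrow> real" where
  "Dplus L N p j = (p (j + 1) - p j) / dx L N"

definition Dminus :: "real \<Rightarrow> nat \<Rightarrow> (int \<Rightarrow> real) \<Rightarrow> int \<Rightarrow> real" where
  "Dminus L N p j = - (p (j - 1) - p j) / dx L N"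

definition Dcent :: "real \<Rightarrow> nat \<Rightarrow> (int \<Rightarrow> real) \<Rightarrow> int \<Rightarrow> real" where
  "Dcent L N p j = (Dplus L N p j + Dminus L N p j) / 2"

definition avg3 :: "(int \<Rightarrow> real) \<Rightarrow> int \<Rightarrow> real" where
  "avg3 p j = (p (j + 1) + p j + p (j - 1)) / 3"

definition Gop :: "real \<Rightarrow> nat \<Rightarrow> (int \<Rightarrow> real) \<Rightarrow> int \<Rightarrow> real" where
  "Gop L N p j = avg3 p j * Dcent L N p j"

text \<open>Where \<open>cot\<close> or \<open>tan\<close> has a pole, its prefactor is 0.\<close>

definition hilbert_coeff :: "nat \<Rightarrow> int \<Rightarrow> real" where
  "hilbert_coeff N n =
     (1 - (-1) powi n) / (2 * real N) * cot (pi * real_of_int n / (2 * real N))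
     - (1 + (-1) powi n) / (2 * real N) * tan (pi * real_of_int n / (2 * real N))"

definition discrete_hilbert :: "nat \<Rightarrow> (int \<Rightarrow> real) \<Rightarrow> int \<Rightarrow> real" where
  "discrete_hilbert N p n = (\<Sum>j<N. hilbert_coeff N (n - int j) * p (int j))"

definition fixpoint_iteration ::
    "real \<Rightarrow> nat \<Rightarrow> real \<Rightarrow> (int \<Rightarrow> real) \<Rightarrow> (nat \<Rightarrow> int \<Rightarrow> real) \<Rightarrow> bool" where
  "fixpoint_iteration L N dt v w \<longleftrightarrow>
     w 0 = v \<and>
     (\<forall>l. grid_fun N (w l)) \<and>
     (\<forall>l j. w (Suc l) j = v j + dt * Gop L N (\<lambda>i. (v i + w l i) / 2) j
              + dt / 2 * discrete_hilbert N (Dplus L N (Dminus L N (\<lambda>i. v i + w (Suc l) i))) j)"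

text \<open>One time step: \<open>v'\<close> solves the implicit scheme and is the limit of the iteration from \<open>v\<close>.\<close>

definition scheme_step ::
    "real \<Rightarrow> nat \<Rightarrow> real \<Rightarrow> (int \<Rightarrow> real) \<Rightarrow> (int \<Rightarrow> real) \<Rightarrow> bool" where
  "scheme_step L N dt v v' \<longleftrightarrow>
     grid_fun N v' \<and>
     (\<forall>j. v' j = v j + dt * Gop L N (\<lambda>i. (v i + v' i) / 2) j
            + dt * discrete_hilbert N (Dplus L N (Dminus L N (\<lambda>i. (v i + v' i) / 2))) j) \<and>
     (\<exists>w. fixpoint_iteration L N dt v w \<and> (\<forall>j. (\<lambda>l. w l j) \<longlonglongrightarrow> v' j))"

text \<open>Solutions of the scheme up to time T; \<open>U n\<close> is unconstrained for the later time levels,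
  which the interpolation on [0,T] does not see.\<close>

definition scheme_solution ::
    "real \<Rightarrow> nat \<Rightarrow> real \<Rightarrow> real \<Rightarrow> (real \<Rightarrow> real) \<Rightarrow> (nat \<Rightarrow> int \<Rightarrow> real) \<Rightarrow> bool" where
  "scheme_solution L N dt T u0 U \<longleftrightarrow>
     (\<forall>j. U 0 j = u0 (gridpt L N j)) \<and>
     (\<forall>n. real n * dt \<le> T \<longrightarrow> scheme_step L N dt (U n) (U (Suc n)))"

text \<open>The cell index of x is \<open>j\<close> with x in \<open>[x\<^sub>j, x\<^sub>j\<^sub>+\<^sub>1)\<close>.\<close>

definition interp_space :: "real \<Rightarrow> nat \<Rightarrow> (int \<Rightarrow> real) \<Rightarrow> real \<Rightarrow> real" where
  "interp_space L N p x =
     (let j = \<lfloor>(x + L) / dx L N\<rfloor>; y = x - gridpt L N j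
      in p j + y * Dcent L N p j + y\<^sup>2 / 2 * Dplus L N (Dminus L N p) j)"

definition interp :: "real \<Rightarrow> nat \<Rightarrow> real \<Rightarrow> (nat \<Rightarrow> int \<Rightarrow> real) \<Rightarrow> real \<Rightarrow> real \<Rightarrow> real" where
  "interp L N dt U t x =
     (let n = nat \<lfloor>t / dt\<rfloor>
      in interp_space L N (U n) x
         + (t - real n * dt) / dt * (interp_space L N (U (Suc n)) x - interp_space L N (U n) x))"

end

(* The scheme is skew up to commutators: the discrete Hilbert term drops out of the energy of u and of
   D+ D- u, and the nonlinear term costs only |D+ u|_inf |D+ D- u|^2, so |D+ D- u| stays bounded on a
   time interval depending on its initial size. This bounds the slopes of the interpolants uniformly and
   makes them Hoelder-1/2 in time, hence Arzela-Ascoli gives uniformly convergent subsequences. The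
   discrete Fourier coefficients of the scheme are a consistent Euler scheme for the Fourier coefficients
   of the limit, which therefore solve the equation mode by mode; Bessel's inequality passes to the limit
   and gives the second space derivative, and the principal value is identified with the conjugate
   Fourier series at Lebesgue points by comparing with the conjugate Poisson kernel. Strong solutions are
   unique by an L2 energy estimate, so the whole sequence converges. *)

theory Submission
  imports Defs "HOL-Complex_Analysis.Great_Picard" "HOL-Real_Asymp.Real_Asymp"
begin

text \<open>The one-step energy inequality is quadratic in the unknown new level and does not
  exclude a large solution; what closes it is the a priori bound inherited from the fixed point
  iteration, whose limit the step is required to be. In the iteration the nonlinear term is
  evaluated at the previous iterate and nothing cancels in it: it costs a factor 1/h, and this is
  what the restriction on dt/h pays for. Skewness of the Hilbert term rests on N being odd: the
  coefficients made of cot and tan are then exactly the kernel of the multiplier -i sgn(k) on the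
  modes |k| <= (N-1)/2, which commutes with D+ D-. Bounds that survive the limit need constants free
  of N, so the discrete Sobolev inequalities are proved with constants depending on L alone.
  Functions known only up to null sets are represented by Abel limits of their Fourier series, which
  are measurable jointly in time and space. In the uniqueness proof the time derivative exists only
  weakly; the energy is therefore not differentiated, and its increments are estimated as pairings
  with a function frozen in time, up to an error quadratic in the time step.\<close>

section \<open>Periodic grid functions: sums, norms and discrete Sobolev inequalities\<close>

definition gsum :: "nat => (int => 'a::ab_group_add) => 'a" where
 "gsum N f = (\<Sum>j<N. f (int j))"

lemma gsum_shift1:
 assumes "!!j. f (j + int N) = f j"
 shows "gsum N (%j. f (j + 1)) = gsum N f"
proof -
 have "gsum N (%j. f (j+1)) = (\<Sum>j<N. f (int (Suc j)))"
  by (simp add: gsum_def add.commute)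
 also have "... = (\<Sum>j<Suc N. f (int j)) - f 0"
  by (subst sum.lessThan_Suc_shift) simp
 also have "... = gsum N f"
  using assms[of 0] by (simp add: gsum_def)
 finally show ?thesis .
qed

lemma gsum_shift:
 assumes "!!j. f (j + int N) = f j"
 shows "gsum N (%j. f (j + a)) = gsum N f"
proof -
 have per: "f (j + int N + b) = f (j + b)" for j b
  using assms[of "j + b"] by (simp add: algebra_simps)
 show ?thesis
 proof (induction a rule: int_induct[where k = 0])
  case base
  show ?case by simp
 next
  case (step1 i)
  have "gsum N (%j. f (j + 1 + i)) = gsum N (%j. f (j + i))"
   by (rule gsum_shift1) (use per[of _ i] in simp)
  then show ?case using step1 by (simp add: algebra_simps)
 next
  case (step2 i)
  have "gsum N (%j. f (j + 1 + (i - 1))) = gsum N (%j. f (j + (i - 1)))"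
   by (rule gsum_shift1) (use per[of _ "i-1"] in simp)
  then show ?case using step2 by (simp add: algebra_simps)
 qed
qed

lemma gsum_plus1: "(!!j. f (j + int N) = f j) ==> gsum N (%j. f (j + 1)) = gsum N f"
 and gsum_minus1: "(!!j. f (j + int N) = f j) ==> gsum N (%j. f (j - 1)) = gsum N f"
 using gsum_shift[of f N 1] gsum_shift[of f N "-1"] by auto

lemma gsum_add: "gsum N (%j. f j + g j) = gsum N f + gsum N g"
 and gsum_diff: "gsum N (%j. f j - g j) = gsum N f - gsum N g"
 by (simp_all add: gsum_def sum.distrib sum_subtractf)

lemma gsum_cmult: "gsum N (%j. c * f j) = c * gsum N f" for c :: "'a::ring"
 by (simp add: gsum_def sum_distrib_left)

lemma gsum_mono: "(!!j. f j <= g j) ==> gsum N f <= gsum N g"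
 for f :: "int => 'a::ordered_ab_group_add"
 by (simp add: gsum_def sum_mono)

lemma gsum_nonneg: "(!!j. 0 <= f j) ==> 0 <= gsum N f"
 for f :: "int => 'a::ordered_ab_group_add"
 by (simp add: gsum_def sum_nonneg)

lemma grid_fun_mult_period:
 assumes "grid_fun N p"
 shows "p (j + int N * t) = p j"
proof (induction t rule: int_induct[where k = 0])
 case base
 show ?case by simp
next
 case (step1 i)
 then show ?case using assms[unfolded grid_fun_def, rule_format, of "j + int N * i"]
  by (simp add: algebra_simps)
next
 case (step2 i)
 then show ?case using assms[unfolded grid_fun_def, rule_format, of "j + int N * (i - 1)"]
  by (simp add: algebra_simps)
qed

text \<open>Written through \<open>L2_set\<close>, so that the triangle and Cauchy-Schwarz
  inequalities for finite families apply directly. It takes \<open>L\<close> and \<open>N\<close> as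
  arguments because later estimates run along a sequence of grids.\<close>

definition gnorm :: "real => nat => (int => real) => real" where
 "gnorm L N p = sqrt (dx L N) * L2_set (%j. p (int j)) {..<N}"

abbreviation "DD L N p \<equiv> Dplus L N (Dminus L N p)"

locale odd_grid =
 fixes L :: real and N :: nat
 assumes L_pos: "L > 0" and N_odd: "odd N"
begin

abbreviation "h \<equiv> dx L N"
abbreviation "Q \<equiv> DD L N"
abbreviation "G \<equiv> Gop L N"
abbreviation "H \<equiv> discrete_hilbert N"
abbreviation "nrm \<equiv> gnorm L N"

lemma N_pos: "N > 0"
 using N_odd by (rule odd_pos)

lemma h_pos: "h > 0"
 using L_pos N_pos by (simp add: dx_def)

lemma h_le: "h <= 2 * L"
 using L_pos N_pos by (simp add: dx_def field_simps)

lemma h_N: "h * real N = 2 * L"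
 using N_pos by (simp add: dx_def)

lemma Q_eq: "Q p j = (p (j + 1) - 2 * p j + p (j - 1)) / h^2"
 using h_pos by (simp add: Dplus_def Dminus_def field_simps power2_eq_square)

lemma Dcent_eq: "Dcent L N p j = (p (j + 1) - p (j - 1)) / (2 * h)"
 using h_pos by (simp add: Dcent_def Dplus_def Dminus_def field_simps)

lemma G_eq: "G p j = (p (j + 1) + p j + p (j - 1)) * (p (j + 1) - p (j - 1)) / (6 * h)"
 by (simp add: Gop_def avg3_def Dcent_eq)

lemma grid_fun_ops:
 assumes "grid_fun N p"
 shows "grid_fun N (Dplus L N p)" "grid_fun N (Q p)" "grid_fun N (G p)" "grid_fun N (Dcent L N p)"
  "grid_fun N (avg3 p)"
proof -
 have *: "p (j + int N + a) = p (j + a)" for j a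
  using assms[unfolded grid_fun_def, rule_format, of "j + a"] by (simp add: algebra_simps)
 note ** = *[of _ 0, simplified] *[of _ 1] *[of _ "-1", simplified]
 show "grid_fun N (Q p)" "grid_fun N (G p)" "grid_fun N (Dcent L N p)" "grid_fun N (avg3 p)"
  by (simp_all add: grid_fun_def Q_eq G_eq Dcent_eq avg3_def **)
 show "grid_fun N (Dplus L N p)"
  by (simp add: grid_fun_def Dplus_def **)
qed

lemma nrm_sq: "(nrm p)^2 = h * gsum N (%j. (p j)^2)"
 using h_pos by (simp add: gnorm_def power_mult_distrib L2_set_def gsum_def sum_nonneg)

lemma nrm_nonneg [simp]: "0 <= nrm p"
 using h_pos by (simp add: gnorm_def)

lemma nrm_triangle: "nrm (%j. p j + q j) <= nrm p + nrm q"
proof -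
 have "sqrt h * L2_set (%j. p (int j) + q (int j)) {..<N}
   <= sqrt h * (L2_set (%j. p (int j)) {..<N} + L2_set (%j. q (int j)) {..<N})"
  by (intro mult_left_mono L2_set_triangle_ineq) (use h_pos in auto)
 then show ?thesis by (simp add: gnorm_def algebra_simps)
qed

lemma nrm_cmult: "nrm (%j. c * p j) = \<bar>c\<bar> * nrm p"
proof (rule power2_eq_imp_eq)
 show "(nrm (%j. c * p j))^2 = (\<bar>c\<bar> * nrm p)^2"
  unfolding power_mult_distrib nrm_sq by (simp add: gsum_cmult)
qed auto

lemma nrm_leI:
 assumes "h * gsum N (%j. (p j)^2) <= B^2" "0 <= B"
 shows "nrm p <= B"
 by (rule power2_le_imp_le) (use assms in \<open>simp_all add: nrm_sq\<close>)

lemma cauchy_schwarz: "h * gsum N (%j. \<bar>p j\<bar> * \<bar>q j\<bar>) <= nrm p * nrm q"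
proof -
 have "gsum N (%j. \<bar>p j\<bar> * \<bar>q j\<bar>) <= L2_set (%j. p (int j)) {..<N} * L2_set (%j. q (int j)) {..<N}"
  unfolding gsum_def by (rule L2_set_mult_ineq)
 then have "h * gsum N (%j. \<bar>p j\<bar> * \<bar>q j\<bar>) \<le>
  (sqrt h * sqrt h) * (L2_set (%j. p (int j)) {..<N} * L2_set (%j. q (int j)) {..<N})"
  using h_pos by simp
 then show ?thesis by (simp only: gnorm_def mult.assoc mult.left_commute mult.commute)
qed

lemma cauchy_schwarz_le: "h * gsum N (%j. p j * q j) <= nrm p * nrm q"
proof -
 have "h * gsum N (%j. p j * q j) <= h * gsum N (%j. \<bar>p j\<bar> * \<bar>q j\<bar>)"
  by (intro mult_left_mono gsum_mono) (use h_pos in \<open>auto simp: abs_mult[symmetric]\<close>)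
 with cauchy_schwarz show ?thesis by (rule order_trans[rotated])
qed

lemma nrm_one: "nrm (%j. 1) = sqrt (2 * L)"
proof (rule power2_eq_imp_eq)
 show "(nrm (%j. 1))^2 = (sqrt (2 * L))^2"
  unfolding nrm_sq using h_N L_pos by (simp add: gsum_def)
qed (use L_pos in auto)

lemma sum_abs_le: "h * gsum N (%j. \<bar>p j\<bar>) <= sqrt (2 * L) * nrm p"
 using cauchy_schwarz[of p "%_. 1"] by (simp add: nrm_one mult.commute)

lemma nrm_shift:
 assumes "grid_fun N p"
 shows "nrm (%j. p (j + a)) = nrm p"
proof (rule power2_eq_imp_eq)
 show "(nrm (%j. p (j + a)))^2 = (nrm p)^2"
  unfolding nrm_sq using gsum_shift[of "%j. (p j)^2" N a] assms
  by (simp add: grid_fun_def)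
qed auto

text \<open>By periodicity \<open>i\<close> is reached from \<open>j\<close> in fewer than
  \<open>N\<close> forward steps, so the increments met on the way are among those of one full
  period.\<close>

lemma oscillation_le:
 assumes p: "grid_fun N p"
 shows "\<bar>p i - p j\<bar> <= h * gsum N (%j. \<bar>Dplus L N p j\<bar>)"
proof -
 define n where "n = nat ((i - j) mod int N)"
 have n: "int n = (i - j) mod int N" "n < N"
  using N_pos by (auto simp: n_def nat_less_iff)
 have "i = (j + int n) + int N * ((i - j) div int N)"
  unfolding n(1) using mult_div_mod_eq[of "int N" "i - j"] by linarith
 then have pi: "p i = p (j + int n)"
  using grid_fun_mult_period[OF p] by metis
 have "\<bar>p (j + int k) - p j\<bar> <= (\<Sum>i<k. \<bar>p (j + int i + 1) - p (j + int i)\<bar>)" for k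
 proof (induction k)
  case (Suc k)
  have e: "j + int (Suc k) = j + int k + 1" by simp
  show ?case unfolding e sum.lessThan_Suc using Suc by linarith
 qed simp
 from this[of n] have "\<bar>p i - p j\<bar> <= (\<Sum>i<n. \<bar>p (j + int i + 1) - p (j + int i)\<bar>)"
  by (simp add: pi)
 also have "... <= (\<Sum>i<N. \<bar>p (j + int i + 1) - p (j + int i)\<bar>)"
  using n by (intro sum_mono2) auto
 also have "... = gsum N (%i. \<bar>p (i + 1 + j) - p (i + j)\<bar>)"
  by (simp add: gsum_def add_ac)
 also have "... = gsum N (%i. \<bar>p (i + 1) - p i\<bar>)"
 proof -
  have "gsum N (%i. \<bar>p (i + j + 1) - p (i + j)\<bar>) = gsum N (%i. \<bar>p (i + 1) - p i\<bar>)"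
  proof (rule gsum_shift)
  fix i
  show "\<bar>p (i + int N + 1) - p (i + int N)\<bar> = \<bar>p (i + 1) - p i\<bar>"
   using p[unfolded grid_fun_def, rule_format, of "i + 1"] p[unfolded grid_fun_def, rule_format, of i]
   by (simp add: add_ac)
  qed
  then show ?thesis by (simp add: add_ac)
 qed
 also have "... = gsum N (%j. h * \<bar>Dplus L N p j\<bar>)"
  using h_pos by (simp add: Dplus_def)
 finally show ?thesis by (simp add: gsum_cmult)
qed

text \<open>Averaging \<open>p i - p j\<close> over \<open>j\<close> replaces the comparison value
  by the mean. For difference quotients the mean vanishes; for squares it becomes the L2
  norm.\<close>

lemma sup_le_mean_oscillation:
 assumes p: "grid_fun N p"
 shows "\<bar>p i\<bar> <= \<bar>gsum N p\<bar> / N + h * gsum N (%j. \<bar>Dplus L N p j\<bar>)"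
proof -
 let ?B = "h * gsum N (%j. \<bar>Dplus L N p j\<bar>)"
 have "\<bar>gsum N (%j. p i - p j)\<bar> <= gsum N (%j. \<bar>p i - p j\<bar>)"
  unfolding gsum_def by (rule sum_abs)
 also have "... <= gsum N (%_. ?B)"
  by (intro gsum_mono oscillation_le p)
 also have "... = N * ?B" by (simp add: gsum_def)
 finally have *: "\<bar>gsum N (%j. p i - p j)\<bar> <= N * ?B" .
 have "N * p i = gsum N p + gsum N (%j. p i - p j)"
  by (simp add: gsum_diff) (simp add: gsum_def)
 then have "N * \<bar>p i\<bar> <= \<bar>gsum N p\<bar> + N * ?B"
  using * by (metis abs_mult abs_of_nat abs_triangle_ineq add_left_mono order_trans)
 then show ?thesis using N_pos by (simp add: field_simps)
qed

text \<open>The sum of \<open>Dplus L N p\<close> telescopes around the period, so its mean is zero,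
  and its own forward difference is a shift of \<open>Q p\<close>. Slopes are thus controlled by
  \<open>nrm (Q p)\<close> alone, uniformly in \<open>N\<close>.\<close>

lemma sup_Dplus_le:
 assumes p: "grid_fun N p"
 shows "\<bar>Dplus L N p i\<bar> <= sqrt (2 * L) * nrm (Q p)"
proof -
 let ?d = "Dplus L N p"
 have d: "grid_fun N ?d" using grid_fun_ops(1)[OF p] .
 have "gsum N ?d = (gsum N (%j. p (j + 1)) - gsum N p) / h"
  unfolding Dplus_def gsum_def by (simp only: sum_subtractf sum_divide_distrib[symmetric])
 also have "... = 0"
  by (subst gsum_plus1[of p N]) (use p in \<open>auto simp: grid_fun_def\<close>)
 finally have "\<bar>?d i\<bar> <= h * gsum N (%j. \<bar>Dplus L N ?d j\<bar>)"
  using sup_le_mean_oscillation[OF d, of i] by simp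
 also have "... <= sqrt (2 * L) * nrm (Dplus L N ?d)"
  by (rule sum_abs_le)
 also have "Dplus L N ?d = (%j. Q p (j + 1))"
  by (simp add: fun_eq_iff Dplus_def Dminus_def add.commute)
 also have "nrm ... = nrm (Q p)"
  by (rule nrm_shift) (rule grid_fun_ops[OF p])
 finally show ?thesis .
qed

text \<open>Constant of the discrete Sobolev embedding. It depends on \<open>L\<close> alone, which
  lets one bound on dt/dx serve all grids.\<close>

definition "CS = 1 / sqrt (2 * L) + 2 * L * sqrt (2 * L)"

lemma CS_pos: "CS > 0"
 unfolding CS_def using L_pos by (simp add: add_pos_pos)

lemma sup_le_mean:
 assumes p: "grid_fun N p"
 shows "\<bar>p i\<bar> <= nrm p / sqrt (2 * L) + h * gsum N (%j. \<bar>Dplus L N p j\<bar>)"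
proof -
 have "\<bar>gsum N p\<bar> <= gsum N (%j. \<bar>p j\<bar>)"
  unfolding gsum_def by (rule sum_abs)
 then have "h * \<bar>gsum N p\<bar> <= sqrt (2 * L) * nrm p"
  using sum_abs_le[of p] h_pos by (meson mult_left_mono less_imp_le order_trans)
 then have "(h * \<bar>gsum N p\<bar>) / (h * N) <= sqrt (2 * L) * nrm p / (2 * L)"
  unfolding h_N using L_pos by (simp add: divide_right_mono)
 also have "... = nrm p / sqrt (2 * L)"
  using L_pos real_div_sqrt[of "2 * L"] by (simp add: field_simps)
 finally have "\<bar>gsum N p\<bar> / N <= nrm p / sqrt (2 * L)"
  using h_pos by simp
 then show ?thesis using sup_le_mean_oscillation[OF p, of i] by linarith
qed

lemma sup_le:
 assumes p: "grid_fun N p"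
 shows "\<bar>p i\<bar> <= CS * (nrm p + nrm (Q p))"
proof -
 have "gsum N (%j. \<bar>Dplus L N p j\<bar>) <= gsum N (%_. sqrt (2 * L) * nrm (Q p))"
  by (intro gsum_mono sup_Dplus_le p)
 then have "h * gsum N (%j. \<bar>Dplus L N p j\<bar>) <= (h * N) * (sqrt (2 * L) * nrm (Q p))"
  using h_pos by (simp add: gsum_def)
 then have "\<bar>p i\<bar> <= nrm p / sqrt (2 * L) + 2 * L * (sqrt (2 * L) * nrm (Q p))"
  unfolding h_N using sup_le_mean[OF p, of i] by linarith
 also have "... <= CS * (nrm p + nrm (Q p))"
  unfolding CS_def using L_pos by (simp add: algebra_simps)
 finally show ?thesis .
qed

text \<open>The oscillation bound applied to the squares, whose difference quotient is
  \<open>(p (j + 1) + p j) * Dplus L N p j\<close>: a discrete Agmon inequality. If the slopes are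
  bounded, the sup norm is small like the square root of the L2 norm, which is the source of the
  Hoelder exponent 1/2 in time.\<close>

lemma sup_sq_le:
 assumes p: "grid_fun N p"
 shows "(p i)^2 <= (nrm p)^2 / (2 * L) + 2 * nrm p * nrm (Dplus L N p)"
proof -
 define r where "r = (%j. (p j)^2)"
 have r: "grid_fun N r" using p by (simp add: r_def grid_fun_def)
 have "\<bar>Dplus L N r j\<bar> <= \<bar>p (j + 1)\<bar> * \<bar>Dplus L N p j\<bar> + \<bar>p j\<bar> * \<bar>Dplus L N p j\<bar>" for j
 proof -
  have "Dplus L N r j = p (j + 1) * Dplus L N p j + p j * Dplus L N p j"
   using h_pos by (simp add: Dplus_def r_def field_simps power2_eq_square)
  then show ?thesis by (metis abs_mult abs_triangle_ineq)
 qed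
 then have "h * gsum N (%j. \<bar>Dplus L N r j\<bar>) \<le>
   h * gsum N (%j. \<bar>p (j + 1)\<bar> * \<bar>Dplus L N p j\<bar> + \<bar>p j\<bar> * \<bar>Dplus L N p j\<bar>)"
  using h_pos by (intro mult_left_mono gsum_mono) auto
 also have "... <= nrm (%j. p (j + 1)) * nrm (Dplus L N p) + nrm p * nrm (Dplus L N p)"
  unfolding gsum_add distrib_left by (intro add_mono cauchy_schwarz)
 also have "... = 2 * nrm p * nrm (Dplus L N p)"
  using nrm_shift[OF p, of 1] by simp
 finally have 1: "h * gsum N (%j. \<bar>Dplus L N r j\<bar>) <= 2 * nrm p * nrm (Dplus L N p)" .
 have "gsum N r / N = h * gsum N r / (h * N)" using h_pos by simp
 then have "\<bar>gsum N r\<bar> / N = (nrm p)^2 / (2 * L)"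
  by (simp add: h_N nrm_sq r_def abs_of_nonneg[OF gsum_nonneg])
 then show ?thesis
  using sup_le_mean_oscillation[OF r, of i] 1 by (simp add: r_def)
qed

section \<open>The discrete nonlinearity: skewness, Leibniz rule and energy estimate\<close>

text \<open>The three-point average is made for this: \<open>6 * h * G p j * p j\<close> is the sum
  of two backward differences, of \<open>(p j)^2 * p (j + 1)\<close> and of
  \<open>p j * (p (j + 1))^2\<close>, and both telescope over the period.\<close>

lemma G_skew:
 assumes p: "grid_fun N p"
 shows "gsum N (%j. G p j * p j) = 0"
proof -
 define a where "a = (%j. (p j)^2 * p (j + 1))"
 define b where "b = (%j. p j * (p (j + 1))^2)"
 have *: "p (j + int N + i) = p (j + i)" for j i
  using p[unfolded grid_fun_def, rule_format, of "j + i"] by (simp add: algebra_simps)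
 have ab: "a (j + int N) = a j" "b (j + int N) = b j" for j
  using *[of j 0] *[of j 1] by (simp_all add: a_def b_def)
 have "gsum N (%j. G p j * p j) = gsum N (%j. (1 / (6 * h)) * ((a j - a (j - 1)) + (b j - b (j - 1))))"
  using h_pos by (intro arg_cong[where f = "gsum N"] ext)
   (simp add: G_eq a_def b_def field_simps power2_eq_square)
 also have "... = 0"
  unfolding gsum_cmult gsum_add gsum_diff using gsum_minus1[of a N, OF ab(1)] gsum_minus1[of b N, OF ab(2)]
  by simp
 finally show ?thesis .
qed

text \<open>Discrete Leibniz rule for D+ D- of \<open>avg3 v * Dcent L N v\<close>, split
  symmetrically about the centre. Only the first summand contains a third difference of
  \<open>v\<close>; the other two are products of a first and a second difference.\<close>

lemma Q_G_eq:
 "Q (G v) j = avg3 v j * ((Q v (j + 1) - Q v (j - 1)) / (2 * h))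
  + avg3 (Q v) j * ((Dcent L N v (j + 1) + Dcent L N v (j - 1)) / 2)
  + avg3 (Dcent L N v) j * ((Q v (j + 1) + 2 * Q v j + Q v (j - 1)) / 2)"
proof -
 have e: "j + 1 + 1 = j + 2" "j - 1 - 1 = j - 2" "j + 1 - 1 = j" "j - 1 + 1 = j" for j :: int by auto
 have g: "(x * B + A * S + D * (E / 2)) / h^2 = x * (B / h^2) + A / h^2 * S + D / (2 * h) * (E / h)"
  for x A B D E S :: real
  using h_pos by (simp add: field_simps power2_eq_square)
 define a b where "a = avg3 v" and "b = Dcent L N v"
 have "Q (G v) j = (a (j+1) * b (j+1) - 2 * (a j * b j) + a (j-1) * b (j-1)) / h^2"
  by (simp add: Q_eq Gop_def a_def b_def)
 also have "a (j+1) * b (j+1) - 2 * (a j * b j) + a (j-1) * b (j-1) =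
   a j * (b (j+1) - 2 * b j + b (j-1)) + (a (j+1) - 2 * a j + a (j-1)) * ((b (j+1) + b (j-1)) / 2)
   + (a (j+1) - a (j-1)) * ((b (j+1) - b (j-1)) / 2)"
  by (simp add: field_simps)
 also have "(a j * (b (j+1) - 2 * b j + b (j-1)) + (a (j+1) - 2 * a j + a (j-1)) * ((b (j+1) + b (j-1)) / 2)
   + (a (j+1) - a (j-1)) * ((b (j+1) - b (j-1)) / 2)) / h^2 = a j * Q b j + Q a j * ((b (j+1) + b (j-1)) / 2)
   + (a (j+1) - a (j-1)) / (2 * h) * ((b (j+1) - b (j-1)) / h)"
  unfolding Q_eq by (rule g)
 also have "Q b j = (Q v (j + 1) - Q v (j - 1)) / (2 * h)"
  unfolding Q_eq b_def Dcent_eq e using h_pos by (simp add: divide_simps)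
 also have "Q a j = avg3 (Q v) j"
  unfolding Q_eq a_def avg3_def e using h_pos by (simp add: divide_simps)
 also have "(a (j+1) - a (j-1)) / (2 * h) = avg3 (Dcent L N v) j"
  unfolding Dcent_eq a_def avg3_def e using h_pos by (simp add: divide_simps)
 also have "(b (j+1) - b (j-1)) / h = (Q v (j + 1) + 2 * Q v j + Q v (j - 1)) / 2"
  unfolding Dcent_eq b_def Q_eq e using h_pos by (simp add: divide_simps power2_eq_square)
 finally show ?thesis by (simp add: a_def b_def)
qed

end

lemma abs_mean_le: "\<bar>x\<bar> <= B ==> \<bar>y\<bar> <= B ==> \<bar>(x + y) / 2\<bar> <= B" for x y B :: real
 using abs_triangle_ineq[of x y] by simp

lemma abs_weighted_le: "\<bar>(x + 2 * y + z) / 2\<bar> <= (\<bar>x\<bar> + 2 * \<bar>y\<bar> + \<bar>z\<bar>) / 2" for x y z :: real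
 using abs_triangle_ineq[of "x + 2 * y" z] abs_triangle_ineq[of x "2 * y"] by (simp add: abs_mult)

lemma abs_avg3_le: "\<bar>avg3 q j\<bar> <= (\<bar>q (j + 1)\<bar> + \<bar>q j\<bar> + \<bar>q (j - 1)\<bar>) / 3"
 using abs_triangle_ineq[of "q (j + 1) + q j" "q (j - 1)"] abs_triangle_ineq[of "q (j + 1)" "q j"]
 by (simp add: avg3_def)

context odd_grid begin

lemma gsum_sq_shift:
 assumes "grid_fun N q"
 shows "gsum N (%j. (q (j + a))^2) = gsum N (%j. (q j)^2)"
 by (rule gsum_shift) (use assms in \<open>simp add: grid_fun_def\<close>)

text \<open>Cauchy-Schwarz on the three neighbours and shift invariance of the sum; it turns
  pointwise stencil bounds into bounds of norms.\<close>

lemma nrm_le_three_point: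
 assumes q: "grid_fun N q" and K: "0 <= K"
  and f: "!!j. \<bar>f j\<bar> <= K * (\<bar>q (j + 1)\<bar> + \<bar>q j\<bar> + \<bar>q (j - 1)\<bar>)"
 shows "nrm f <= 3 * K * nrm q"
proof (rule nrm_leI)
 have sq: "(x + y + z)^2 <= 3 * (x^2 + y^2 + z^2)" for x y z :: real
  using sum_squares_bound[of x y] sum_squares_bound[of x z] sum_squares_bound[of y z]
  by (simp add: power2_sum algebra_simps)
 have "(f j)^2 <= (3 * K^2) * ((q (j + 1))^2 + (q j)^2 + (q (j - 1))^2)" for j
 proof -
  have "(f j)^2 <= (K * (\<bar>q (j + 1)\<bar> + \<bar>q j\<bar> + \<bar>q (j - 1)\<bar>))^2"
   using power_mono[OF f[of j], of 2] by simp
  also have "... <= K^2 * (3 * (\<bar>q (j + 1)\<bar>\<^sup>2 + \<bar>q j\<bar>\<^sup>2 + \<bar>q (j - 1)\<bar>\<^sup>2))"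
   unfolding power_mult_distrib by (intro mult_left_mono sq) simp
  finally show ?thesis by (simp add: algebra_simps)
 qed
 then have "gsum N (%j. (f j)^2) <= (3 * K^2) * (3 * gsum N (%j. (q j)^2))"
  using gsum_mono[of "%j. (f j)^2" "%j. (3 * K^2) * ((q (j + 1))^2 + (q j)^2 + (q (j - 1))^2)" N]
  unfolding gsum_cmult gsum_add gsum_sq_shift[OF q] gsum_sq_shift[OF q, of "-1", simplified] by simp
 then have "h * gsum N (%j. (f j)^2) <= h * ((3 * K^2) * (3 * gsum N (%j. (q j)^2)))"
  using h_pos by (intro mult_left_mono) auto
 also have "... = (3 * K * nrm q)^2"
  unfolding power_mult_distrib nrm_sq by (simp add: mult_ac)
 finally show "h * gsum N (%j. (f j)^2) <= (3 * K * nrm q)^2" .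
qed (use K in auto)

lemma Dcent_le:
 assumes "!!j. \<bar>Dplus L N v j\<bar> <= M"
 shows "\<bar>Dcent L N v j\<bar> <= M"
proof -
 have "Dcent L N v j = (Dplus L N v j + Dplus L N v (j - 1)) / 2"
  using h_pos by (simp add: Dcent_def Dplus_def Dminus_def field_simps)
 then show ?thesis using assms[of j] assms[of "j - 1"] by (simp add: abs_le_iff)
qed

lemma avg3_le:
 assumes "!!j. \<bar>v j\<bar> <= M"
 shows "\<bar>avg3 v j\<bar> <= M"
 using assms[of j] assms[of "j - 1"] assms[of "j + 1"] by (simp add: avg3_def abs_le_iff)

text \<open>Inverse inequality: a difference quotient is traded for a factor 1/h, affordable where a
  factor of order \<open>h\<close> stands in front.\<close>

lemma Dplus_le_sup:
 assumes "!!j. \<bar>v j\<bar> <= A"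
 shows "\<bar>Dcent L N v j\<bar> <= A / h"
proof -
 have "\<bar>v (j + 1) - v (j - 1)\<bar> <= 2 * A"
  using assms[of "j + 1"] assms[of "j - 1"] by (simp add: abs_le_iff)
 then have "\<bar>v (j + 1) - v (j - 1)\<bar> / (2 * h) <= 2 * A / (2 * h)"
  using h_pos by (intro divide_right_mono) auto
 then show ?thesis using h_pos by (simp add: Dcent_eq)
qed

text \<open>All three Leibniz terms are estimated crudely, the third difference included, each at
  the price of 1/h. The fixed point iteration has to use such a bound: it evaluates \<open>G\<close>
  at the previous iterate, so summation by parts against the new one gains nothing.\<close>

lemma Q_G_bound:
 assumes v: "grid_fun N v" and A: "!!j. \<bar>v j\<bar> <= A"
 shows "nrm (Q (G v)) <= 4 * A / h * nrm (Q v)"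
proof -
 have A0: "0 <= A" using A[of 0] by simp
 let ?q = "Q v"
 have "\<bar>Q (G v) j\<bar> <= (4 / 3 * A / h) * (\<bar>?q (j + 1)\<bar> + \<bar>?q j\<bar> + \<bar>?q (j - 1)\<bar>)" for j
 proof -
  note D = Dplus_le_sup[of v A, OF A]
  have 1: "\<bar>avg3 v j * ((?q (j + 1) - ?q (j - 1)) / (2 * h))\<bar> <= A * ((\<bar>?q (j + 1)\<bar> + \<bar>?q (j - 1)\<bar>) / (2 * h))"
   unfolding abs_mult abs_divide
   by (intro mult_mono avg3_le A divide_mono abs_triangle_ineq4) (use h_pos A0 in auto)
  have 2: "\<bar>avg3 ?q j * ((Dcent L N v (j + 1) + Dcent L N v (j - 1)) / 2)\<bar> \<le>
    ((\<bar>?q (j + 1)\<bar> + \<bar>?q j\<bar> + \<bar>?q (j - 1)\<bar>) / 3) * (A / h)"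
   unfolding abs_mult
  proof (rule mult_mono)
   show "\<bar>(Dcent L N v (j + 1) + Dcent L N v (j - 1)) / 2\<bar> <= A / h"
    by (rule abs_mean_le) (rule D)+
  qed (rule abs_avg3_le, use A0 h_pos in auto)
  have 3: "\<bar>avg3 (Dcent L N v) j * ((?q (j + 1) + 2 * ?q j + ?q (j - 1)) / 2)\<bar> \<le>
    (A / h) * ((\<bar>?q (j + 1)\<bar> + 2 * \<bar>?q j\<bar> + \<bar>?q (j - 1)\<bar>) / 2)"
   unfolding abs_mult
  proof (rule mult_mono)
   show "\<bar>avg3 (Dcent L N v) j\<bar> <= A / h" by (rule avg3_le[OF D])
  qed (rule abs_weighted_le, use A0 h_pos in auto)
  have "\<bar>Q (G v) j\<bar> <= A * ((\<bar>?q (j + 1)\<bar> + \<bar>?q (j - 1)\<bar>) / (2 * h))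
   + ((\<bar>?q (j + 1)\<bar> + \<bar>?q j\<bar> + \<bar>?q (j - 1)\<bar>) / 3) * (A / h)
   + (A / h) * ((\<bar>?q (j + 1)\<bar> + 2 * \<bar>?q j\<bar> + \<bar>?q (j - 1)\<bar>) / 2)"
   unfolding Q_G_eq using 1 2 3 by linarith
  also have "... = (4 / 3 * A / h) * (\<bar>?q (j + 1)\<bar> + \<bar>?q j\<bar> + \<bar>?q (j - 1)\<bar>)"
   using h_pos by (simp add: field_simps)
  finally show ?thesis .
 qed
 from nrm_le_three_point[OF grid_fun_ops(2)[OF v] _ this] show ?thesis
  using A0 h_pos by simp
qed

text \<open>The product \<open>avg3 * Dcent\<close> is split so that each summand contains the
  difference \<open>d\<close> once. The Lipschitz constant of order 1/h is what decides the
  contraction.\<close>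

lemma G_diff_bound:
 assumes v: "grid_fun N v" "grid_fun N w" and A: "!!j. \<bar>v j\<bar> <= A" "!!j. \<bar>w j\<bar> <= A"
 shows "nrm (%j. G v j - G w j) <= 3 * A / h * nrm (%j. v j - w j)"
proof -
 have A0: "0 <= A" using A(1)[of 0] by simp
 define d where "d = (%j. v j - w j)"
 have d: "grid_fun N d" using v by (simp add: d_def grid_fun_def)
 have "\<bar>G v j - G w j\<bar> <= (A / h) * (\<bar>d (j + 1)\<bar> + \<bar>d j\<bar> + \<bar>d (j - 1)\<bar>)" for j
 proof -
  have "Dcent L N v j - Dcent L N w j = Dcent L N d j" "avg3 v j - avg3 w j = avg3 d j"
   unfolding Dcent_eq avg3_def d_def using h_pos by (simp_all add: field_simps)
  then have v_eq: "Dcent L N v j = Dcent L N w j + Dcent L N d j" "avg3 v j = avg3 w j + avg3 d j"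
   by linarith+
  have "G v j - G w j = avg3 v j * Dcent L N d j + avg3 d j * Dcent L N w j"
   unfolding Gop_def v_eq by (simp add: algebra_simps)
  moreover have "\<bar>avg3 v j * Dcent L N d j\<bar> <= A * ((\<bar>d (j + 1)\<bar> + \<bar>d (j - 1)\<bar>) / (2 * h))"
   unfolding abs_mult Dcent_eq abs_divide
   by (intro mult_mono avg3_le A divide_mono abs_triangle_ineq4) (use h_pos A0 in auto)
  moreover have "\<bar>avg3 d j * Dcent L N w j\<bar> <= ((\<bar>d (j + 1)\<bar> + \<bar>d j\<bar> + \<bar>d (j - 1)\<bar>) / 3) * (A / h)"
   unfolding abs_mult
  proof (rule mult_mono)
   show "\<bar>Dcent L N w j\<bar> <= A / h" by (rule Dplus_le_sup[OF A(2)])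
  qed (rule abs_avg3_le, use A0 h_pos in auto)
  ultimately have "\<bar>G v j - G w j\<bar> <= A * ((\<bar>d (j + 1)\<bar> + \<bar>d (j - 1)\<bar>) / (2 * h))
   + ((\<bar>d (j + 1)\<bar> + \<bar>d j\<bar> + \<bar>d (j - 1)\<bar>) / 3) * (A / h)"
   by linarith
  also have "... = (A / h) * (5 / 6 * \<bar>d (j + 1)\<bar> + 1 / 3 * \<bar>d j\<bar> + 5 / 6 * \<bar>d (j - 1)\<bar>)"
   using h_pos by (simp add: field_simps)
  also have "... <= (A / h) * (\<bar>d (j + 1)\<bar> + \<bar>d j\<bar> + \<bar>d (j - 1)\<bar>)"
   using A0 h_pos by (intro mult_left_mono) auto
  finally show ?thesis .
 qed
 from nrm_le_three_point[OF d _ this] show ?thesis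
  using A0 h_pos by (simp add: d_def)
qed

text \<open>The loss of a derivative in \<open>\<langle>a D q, q\<rangle>\<close>, \<open>q = D\<^sub>+D\<^sub>-v\<close>, is avoided by a summation by parts.\<close>

lemma energy_estimate:
 assumes v: "grid_fun N v" and M: "!!j. \<bar>Dplus L N v j\<bar> <= M"
 shows "gsum N (%j. Q (G v) j * Q v j) <= 4 * M * gsum N (%j. (Q v j)^2)"
proof -
 have M0: "0 <= M" using M[of 0] by simp
 define q a b where "q = Q v" and "a = avg3 v" and "b = Dcent L N v"
 have q: "grid_fun N q" unfolding q_def by (rule grid_fun_ops[OF v])
 have a: "grid_fun N a" unfolding a_def by (rule grid_fun_ops[OF v])
 \<comment> \<open>\<open>Y j - Z (j - 1)\<close> is the third-difference term multiplied by
   \<open>q j\<close>. After a shift of the sum over \<open>Z\<close> both products carry the same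
   \<open>q j * q (j + 1)\<close>, and what remains is \<open>(a j - a (j + 1)) / h\<close>, a mean
   of three slopes.\<close>
 define Y Z where "Y = (%j. a j * (q j * q (j + 1)) / (2 * h))" and "Z = (%j. a (j + 1) * (q j * q (j + 1)) / (2 * h))"
 have am: "\<bar>x * y\<bar> <= (x^2 + y^2) / 2" for x y :: real
  using sum_squares_bound[of x y] sum_squares_bound[of x "-y"] by (simp add: abs_le_iff)
 have per: "p (j + int N + 1) = p (j + 1)" if "grid_fun N p" for p j
  using that[unfolded grid_fun_def, rule_format, of "j + 1"] by (simp add: add_ac)
 have Z: "Z (j + int N) = Z j" for j
  using a q per[OF a] per[OF q] by (simp add: Z_def grid_fun_def)
 have b: "\<bar>b j\<bar> <= M" for j unfolding b_def by (rule Dcent_le[OF M])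
 have mq: "\<bar>x\<bar> <= M ==> \<bar>y\<bar> <= B ==> x * y <= M * B" for x y B
  using mult_mono[of "\<bar>x\<bar>" M "\<bar>y\<bar>" B] M0 abs_ge_self[of "x * y"] by (simp add: abs_mult)
 have YZ: "Y j - Z j <= M * (((q j)^2 + (q (j + 1))^2) / 4)" for j
 proof -
  have e: "j + 1 - 1 = j" "j + 1 + 1 = j + 2" by auto
  have "(a j - a (j + 1)) / h = - (Dplus L N v (j - 1) + Dplus L N v j + Dplus L N v (j + 1)) / 3"
   unfolding a_def avg3_def Dplus_def e using h_pos by (simp add: field_simps)
  moreover have "\<bar>- (x + y + z) / 3\<bar> <= M" if "\<bar>x\<bar> <= M" "\<bar>y\<bar> <= M" "\<bar>z\<bar> <= M" for x y z
   using that by (simp add: abs_le_iff)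
  ultimately have 1: "\<bar>(a j - a (j + 1)) / h\<bar> <= M"
   using M by metis
  have "Y j - Z j = (a j - a (j + 1)) / h * (q j * q (j + 1) / 2)"
   using h_pos by (simp add: Y_def Z_def field_simps)
  also have "... <= M * (((q j)^2 + (q (j + 1))^2) / 4)"
   by (rule mq[OF 1]) (use am[of "q j" "q (j + 1)"] in simp)
  finally show ?thesis .
 qed
 have pw: "Q (G v) j * Q v j <= (Y j - Z (j - 1))
  + M * (2 / 3 * (q j)^2 + (q (j + 1))^2 / 6 + (q (j - 1))^2 / 6)
  + M * (3 / 2 * (q j)^2 + (q (j + 1))^2 / 4 + (q (j - 1))^2 / 4)" for j
 proof -
  note amj = am[of "q (j + 1)" "q j"] am[of "q (j - 1)" "q j"]
  have 1: "a j * ((q (j + 1) - q (j - 1)) / (2 * h)) * q j = Y j - Z (j - 1)"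
   using h_pos by (simp add: Y_def Z_def field_simps)
  have 2: "((b (j + 1) + b (j - 1)) / 2) * (avg3 q j * q j)
    <= M * (2 / 3 * (q j)^2 + (q (j + 1))^2 / 6 + (q (j - 1))^2 / 6)"
  proof (rule mq)
   show "\<bar>(b (j + 1) + b (j - 1)) / 2\<bar> <= M" by (rule abs_mean_le[OF b b])
   have "avg3 q j * q j = (q (j + 1) * q j + (q j)^2 + q (j - 1) * q j) / 3"
    by (simp add: avg3_def algebra_simps power2_eq_square add_divide_distrib)
   note e = this
   have tri: "\<bar>(x + y + z) / 3\<bar> <= (B + y + C) / 3" if "\<bar>x\<bar> <= B" "\<bar>z\<bar> <= C" "0 <= y" for x y z B C :: real
    using that by (simp add: abs_le_iff)
   have "\<bar>avg3 q j * q j\<bar> <= (((q (j + 1))^2 + (q j)^2) / 2 + (q j)^2 + ((q (j - 1))^2 + (q j)^2) / 2) / 3"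
    unfolding e by (rule tri[OF amj zero_le_power2])
   then show "\<bar>avg3 q j * q j\<bar> <= 2 / 3 * (q j)^2 + (q (j + 1))^2 / 6 + (q (j - 1))^2 / 6"
    by (simp add: field_simps)
  qed
  have 3: "avg3 b j * (((q (j + 1) + 2 * q j + q (j - 1)) / 2) * q j)
    <= M * (3 / 2 * (q j)^2 + (q (j + 1))^2 / 4 + (q (j - 1))^2 / 4)"
  proof (rule mq)
   show "\<bar>avg3 b j\<bar> <= M" by (rule avg3_le[OF b])
   have "((q (j + 1) + 2 * q j + q (j - 1)) / 2) * q j = (q (j + 1) * q j + 2 * (q j)^2 + q (j - 1) * q j) / 2"
    by (simp add: algebra_simps power2_eq_square add_divide_distrib)
   note e = this
   have tri: "\<bar>(x + 2 * y + z) / 2\<bar> <= (B + 2 * y + C) / 2" if "\<bar>x\<bar> <= B" "\<bar>z\<bar> <= C" "0 <= y" for x y z B C :: real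
    using that by (simp add: abs_le_iff)
   have "\<bar>((q (j + 1) + 2 * q j + q (j - 1)) / 2) * q j\<bar> \<le>
     (((q (j + 1))^2 + (q j)^2) / 2 + 2 * (q j)^2 + ((q (j - 1))^2 + (q j)^2) / 2) / 2"
    unfolding e by (rule tri[OF amj zero_le_power2])
   then show "\<bar>((q (j + 1) + 2 * q j + q (j - 1)) / 2) * q j\<bar> <= 3 / 2 * (q j)^2 + (q (j + 1))^2 / 4 + (q (j - 1))^2 / 4"
    by (simp add: field_simps)
  qed
  have "Q (G v) j * Q v j = a j * ((q (j + 1) - q (j - 1)) / (2 * h)) * q j
   + ((b (j + 1) + b (j - 1)) / 2) * (avg3 q j * q j)
   + avg3 b j * (((q (j + 1) + 2 * q j + q (j - 1)) / 2) * q j)"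
   unfolding Q_G_eq q_def a_def b_def by (simp only: distrib_right distrib_left mult_ac)
  then show ?thesis using 1 2 3 by linarith
 qed
 let ?s = "gsum N (%j. (q j)^2)"
 note sh = gsum_sq_shift[OF q, of 1] gsum_sq_shift[OF q, of "-1", simplified]
 have cd: "gsum N (%j. f j / c) = gsum N f / c" for f and c :: real
  by (simp add: gsum_def sum_divide_distrib)
 have "gsum N (%j. Q (G v) j * Q v j) <= (gsum N Y - gsum N (%j. Z (j - 1)))
  + M * (2 / 3 * ?s + ?s / 6 + ?s / 6) + M * (3 / 2 * ?s + ?s / 4 + ?s / 4)"
 proof -
  have "gsum N (%j. Q (G v) j * Q v j) <= gsum N (%j. (Y j - Z (j - 1))
  + M * (2 / 3 * (q j)^2 + (q (j + 1))^2 / 6 + (q (j - 1))^2 / 6)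
  + M * (3 / 2 * (q j)^2 + (q (j + 1))^2 / 4 + (q (j - 1))^2 / 4))"
   by (rule gsum_mono) (rule pw)
  then show ?thesis unfolding gsum_add gsum_diff gsum_cmult cd sh .
 qed
 also have "gsum N (%j. Z (j - 1)) = gsum N Z" by (rule gsum_minus1) (rule Z)
 also have "gsum N Y - gsum N Z <= M * ((?s + ?s) / 4)"
 proof -
  have "gsum N (%j. Y j - Z j) <= gsum N (%j. M * (((q j)^2 + (q (j + 1))^2) / 4))"
   by (rule gsum_mono) (rule YZ)
  then show ?thesis unfolding gsum_add gsum_diff gsum_cmult cd sh .
 qed
 also have "M * ((?s + ?s) / 4) + M * (2 / 3 * ?s + ?s / 6 + ?s / 6) + M * (3 / 2 * ?s + ?s / 4 + ?s / 4)
   = 7 / 2 * M * ?s" by (simp add: algebra_simps)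
 \<comment> \<open>The three Leibniz terms contribute 1/2, 1 and 2, which add up to 7/2; the
   constant 4 is a rounding.\<close>
 also have "... <= 4 * M * ?s"
  using M0 gsum_nonneg[of "%j. (q j)^2" N] by (intro mult_right_mono) auto
 finally show ?thesis by (simp add: q_def)
qed

end

section \<open>Discrete Fourier analysis and the discrete Hilbert transform\<close>

text \<open>Closed form of the conjugate Dirichlet kernel; the products of sines telescope. It is
  kept in multiplied form so that \<open>sin a = 0\<close> is no exception.\<close>

lemma sum_sin_eq: "2 * sin a * (\<Sum>k=1..m. sin (2 * real k * a)) = cos a - cos ((2 * real m + 1) * a)"
proof (induction m)
 case (Suc m)
 have "2 * sin a * sin (2 * real (Suc m) * a) = cos ((2 * real m + 1) * a) - cos ((2 * real (Suc m) + 1) * a)"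
  using sin_times_sin[of "2 * real (Suc m) * a" a] by (simp add: algebra_simps)
 then show ?case using Suc by (simp add: distrib_left)
qed simp

definition om :: "nat => nat => int => complex" where
 "om N k j = cis (2 * pi * real k * real_of_int j / real N)"

text \<open>Normalised by 1/N, so that up to a sign caused by the left end of the grid it is a
  Riemann sum of a Fourier coefficient.\<close>

definition dft :: "nat => (int => real) => nat => complex" where
 "dft N p k = (\<Sum>j<N. of_real (p (int j)) * cnj (om N k (int j))) / of_nat N"

lemma om_add: "om N k (i + j) = om N k i * om N k j"
 by (simp add: om_def cis_mult add_divide_distrib distrib_left)

lemma om_mult: "om N k j * om N l j = om N (k + l) j"
 by (simp add: om_def cis_mult add_divide_distrib distrib_left distrib_right)

lemma om_cnj: "cnj (om N k j) * om N k j = 1" "om N k j * cnj (om N k j) = 1"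
 by (simp_all add: om_def cis_cnj cis_mult)

context odd_grid begin

definition "m = (N - 1) div 2"

lemma N_eq: "N = 2 * m + 1"
 using N_odd unfolding m_def by presburger

text \<open>With \<open>a = pi * d / N\<close> and \<open>N = 2 * m + 1\<close> the closed form of
  the sine sum ends in cos (pi d), which is 1 or -1 by the parity of \<open>d\<close>. Half-angle
  formulas turn \<open>cos a - 1\<close> into the tangent and \<open>cos a + 1\<close> into the
  cotangent. All properties of \<open>H\<close> are derived from this Fourier form.\<close>

lemma hilbert_coeff_eq:
 "hilbert_coeff N d = 2 / N * (\<Sum>k=1..m. sin (2 * pi * real k * real_of_int d / N))"
proof -
 define a b S where "a = pi * real_of_int d / N" and "b = pi * real_of_int d / (2 * real N)"
  and "S = (\<Sum>k=1..m. sin (2 * pi * real k * real_of_int d / N))"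
 have ab: "a = 2 * b" by (simp add: a_def b_def)
 have S_alt: "S = (\<Sum>k=1..m. sin (2 * real k * a))"
  by (simp add: S_def a_def mult_ac)
 have Na: "(2 * real m + 1) * a = pi * real_of_int d"
 proof -
  have "2 * real m + 1 = real N" by (subst N_eq) simp
  then show ?thesis using N_pos by (simp add: a_def)
 qed
 have ab2: "sin a = 2 * sin b * cos b" "cos a = 1 - 2 * (sin b)^2" "cos a = 2 * (cos b)^2 - 1"
  unfolding ab by (rule sin_double cos_double_sin cos_double_cos)+
 have S: "2 * sin a * S = cos a - (if even d then 1 else -1)"
  unfolding S_alt sum_sin_eq Na by simp
 \<comment> \<open>Every summand is then the sine of a multiple of pi. This settles the arguments at
   which solving for \<open>S\<close> would divide by zero.\<close>
 have S0: "S = 0" if s: "sin a = 0"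
 proof -
  obtain i :: int where i: "a = i * pi" using s sin_zero_iff_int2 by blast
  have "sin (2 * real k * a) = 0" for k
  proof -
   have "2 * real k * a = pi * real_of_int (2 * int k * i)" by (simp add: i)
   then show ?thesis by (metis sin_npi_int)
  qed
  then show ?thesis by (simp add: S_alt)
 qed
 have "hilbert_coeff N d = 2 / N * S"
 proof (cases "even d")
  case True
  have "2 * sin b * (2 * cos b * S + sin b) = 0"
   using S True unfolding ab2(1,2) by (simp add: algebra_simps power2_eq_square)
  moreover have "tan b = - 2 * S"
  proof (cases "sin b = 0")
   case True
   then show ?thesis using S0 by (simp add: ab2(1) tan_def)
  next
   case False
   then have e: "sin b = - (2 * cos b * S)" using calculation by simp
   then have "cos b \<noteq> 0" using False by auto
   then show ?thesis unfolding tan_def e by simp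
  qed
  ultimately show ?thesis
   using True by (simp add: hilbert_coeff_def power_int_minus_left b_def[symmetric])
 next
  case False
  have "2 * cos b * (2 * sin b * S - cos b) = 0"
   using S False unfolding ab2(1,3) by (simp add: algebra_simps power2_eq_square)
  moreover have "cot b = 2 * S"
  proof (cases "cos b = 0")
   case True
   then show ?thesis using S0 by (simp add: ab2(1) cot_def)
  next
   case False
   then have e: "cos b = 2 * sin b * S" using calculation by simp
   then have "sin b \<noteq> 0" using False by auto
   then show ?thesis unfolding cot_def e by simp
  qed
  ultimately show ?thesis
   using False by (simp add: hilbert_coeff_def power_int_minus_left b_def[symmetric])
 qed
 then show ?thesis by (simp add: S_def)
qed

lemma om_period: "om N k (j + int N) = om N k j"
proof -
 have "om N k (int N) = 1"
  using N_pos by (simp add: om_def cis.ctr complex_eq_iff mult.assoc[symmetric])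
   (metis cos_int_2pin of_int_of_nat_eq sin_int_2pin)
 then show ?thesis by (simp add: om_add)
qed

text \<open>Since \<open>Im z = Re (- \<i> * z)\<close>, this exhibits the transform as
  multiplication of the modes 1..m by \<open>- \<i>\<close>, with the mean removed.\<close>

lemma H_eq: "H p n = 2 * (\<Sum>k=1..m. Im (om N k n * dft N p k))"
proof -
 have "Im (om N k n * dft N p k) = (\<Sum>j<N. p (int j) * sin (2 * pi * real k * real_of_int (n - int j) / N)) / N" for k
 proof -
  have "om N k n * dft N p k = (\<Sum>j<N. of_real (p (int j)) * (om N k n * cnj (om N k (int j)))) / of_nat N"
   by (simp add: dft_def sum_distrib_left mult_ac)
  also have "(%j. om N k n * cnj (om N k (int j))) = (%j. cis (2 * pi * real k * real_of_int (n - int j) / N))"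
   by (simp add: om_def cis_cnj cis_mult diff_divide_distrib right_diff_distrib)
  finally show ?thesis
   by (simp add: Im_divide_of_nat)
 qed
 then have "2 * (\<Sum>k=1..m. Im (om N k n * dft N p k)) =
  (\<Sum>k=1..m. \<Sum>j<N. 2 / N * sin (2 * pi * real k * real_of_int (n - int j) / N) * p (int j))"
  by (simp add: sum_distrib_left sum_divide_distrib mult_ac)
 also have "... = (\<Sum>j<N. \<Sum>k=1..m. 2 / N * sin (2 * pi * real k * real_of_int (n - int j) / N) * p (int j))"
  by (rule sum.swap)
 also have "... = H p n"
  unfolding discrete_hilbert_def hilbert_coeff_eq by (simp only: sum_distrib_left sum_distrib_right)
 finally show ?thesis ..
qed

lemma grid_fun_H: "grid_fun N (H p)"
 by (simp add: grid_fun_def H_eq om_period)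

lemma om_shift_sum: "om N k (n + 1) + om N k (n - 1) = of_real (2 * cos (2 * pi * real k / N)) * om N k n"
proof -
 have 1: "om N k (n + 1) = om N k n * cis (2 * pi * real k / N)"
  by (simp add: om_add) (simp add: om_def)
 have 2: "om N k (n - 1) = om N k n * cis (- (2 * pi * real k / N))"
  using om_add[of N k n "-1"] by (simp add: om_def)
 show ?thesis unfolding 1 2 by (simp add: distrib_left[symmetric] complex_eq_iff)
qed

text \<open>Symbol of D+ D-. For fixed \<open>k\<close> it tends to minus the squared wave number as
  the grid is refined.\<close>

definition "dsym k = (2 * cos (2 * pi * real k / N) - 2) / h^2"

lemma sum_cgrid:
 assumes "grid_fun N p"
 shows "gsum N (%j. of_real (p (j + a)) * cnj (om N k j)) = om N k a * gsum N (%j. of_real (p j) * cnj (om N k j))"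
proof -
 have "gsum N (%j. of_real (p (j + a)) * cnj (om N k j))
   = gsum N (%j. (%j. of_real (p j) * cnj (om N k (j - a))) (j + a))" by simp
 also have "... = gsum N (%j. of_real (p j) * cnj (om N k (j - a)))"
 proof (rule gsum_shift)
  fix j
  have "om N k (j + int N - a) = om N k (j - a)"
   using om_period[of k "j - a"] by (simp add: algebra_simps)
  then show "of_real (p (j + int N)) * cnj (om N k (j + int N - a)) = of_real (p j) * cnj (om N k (j - a))"
   using assms by (simp add: grid_fun_def)
 qed
 also have "om N k (j - a) = om N k j * cnj (om N k a)" for j
  using om_add[of N k "j - a" a] om_cnj[of N k a] by (simp add: mult.assoc)
 then have "gsum N (%j. of_real (p j) * cnj (om N k (j - a))) =
  gsum N (%j. om N k a * (of_real (p j) * cnj (om N k j)))"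
  by (simp add: mult_ac)
 finally show ?thesis by (simp only: gsum_cmult)
qed

lemma dft_gsum: "dft N p k = gsum N (%j. of_real (p j) * cnj (om N k j)) / of_nat N"
 by (simp add: dft_def gsum_def)

lemma dft_shift: "grid_fun N p ==> dft N (%j. p (j + a)) k = om N k a * dft N p k"
 by (simp add: dft_gsum sum_cgrid)

lemma dft_linear: "dft N (%j. a * p j + b * q j) k = of_real a * dft N p k + of_real b * dft N q k"
 by (simp add: dft_def sum.distrib sum_distrib_left add_divide_distrib algebra_simps)

lemma dft_Q:
 assumes "grid_fun N p"
 shows "dft N (Q p) k = of_real (dsym k) * dft N p k"
proof -
 have q: "Q p = (%j. (1 / h^2) * (1 * p (j + 1) + 1 * p (j + - 1)) + (- 2 / h^2) * p j)"
  using h_pos by (simp add: fun_eq_iff Q_eq field_simps)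
 have "om N k 1 + om N k (-1) = of_real (2 * cos (2 * pi * real k / N))"
  using om_shift_sum[of k 0] by (simp add: om_def)
 then have *: "om N k 1 * x + om N k (-1) * x = of_real (2 * cos (2 * pi * real k / N)) * x" for x
  by (simp add: distrib_right[symmetric])
 show ?thesis
  unfolding q dft_linear dft_shift[OF assms] dsym_def
  by (simp add: * diff_divide_distrib left_diff_distrib)
qed

lemma H_linear: "H (%j. a * p j + b * q j) n = a * H p n + b * H q n"
 by (simp add: discrete_hilbert_def sum.distrib sum_distrib_left distrib_left mult_ac)

text \<open>Both operators are diagonal in the modes \<open>om N k\<close>; for \<open>Q\<close>
  this is the addition formula for the two shifted modes, whose sum is a real multiple of the mode
  itself.\<close>

lemma H_Q:
 assumes "grid_fun N p"
 shows "H (Q p) = Q (H p)"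
proof
 fix n
 have "Q (H p) n = (\<Sum>k=1..m. 2 * (Im (om N k (n + 1) * dft N p k) - 2 * Im (om N k n * dft N p k)
   + Im (om N k (n - 1) * dft N p k)) / h^2)"
  unfolding Q_eq H_eq by (simp only: sum_divide_distrib[symmetric] sum_distrib_left[symmetric] sum.distrib sum_subtractf)
   (simp add: algebra_simps)
 also have "... = (\<Sum>k=1..m. 2 * (dsym k * Im (om N k n * dft N p k)))"
 proof (intro sum.cong refl)
  fix k
  have "Im (om N k (n + 1) * dft N p k) + Im (om N k (n - 1) * dft N p k)
   = Im ((om N k (n + 1) + om N k (n - 1)) * dft N p k)" by (simp add: distrib_right)
  also have "... = Im (of_real (2 * cos (2 * pi * real k / N)) * (om N k n * dft N p k))"
   by (simp only: om_shift_sum mult.assoc)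
  also have "... = 2 * cos (2 * pi * real k / N) * Im (om N k n * dft N p k)"
   by (simp only: Im_complex_of_real Re_complex_of_real times_complex.sel mult_zero_left add_0_right)
  finally have *: "Im (om N k (n + 1) * dft N p k) + Im (om N k (n - 1) * dft N p k)
   = 2 * cos (2 * pi * real k / N) * Im (om N k n * dft N p k)" .
  have "2 * (Im (om N k (n + 1) * dft N p k) - 2 * Im (om N k n * dft N p k) + Im (om N k (n - 1) * dft N p k)) / h^2
   = 2 * ((Im (om N k (n + 1) * dft N p k) + Im (om N k (n - 1) * dft N p k)) - 2 * Im (om N k n * dft N p k)) / h^2"
   by simp
  also have "... = 2 * (dsym k * Im (om N k n * dft N p k))"
   unfolding * dsym_def by (simp add: left_diff_distrib)
  finally show "2 * (Im (om N k (n + 1) * dft N p k) - 2 * Im (om N k n * dft N p k) + Im (om N k (n - 1) * dft N p k)) / h^2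
   = 2 * (dsym k * Im (om N k n * dft N p k))" .
 qed
 also have "... = H (Q p) n"
 proof -
  have "Im (om N k n * dft N (Q p) k) = dsym k * Im (om N k n * dft N p k)" for k
   unfolding dft_Q[OF assms] by (simp add: algebra_simps)
  then show ?thesis by (simp add: H_eq sum_distrib_left)
 qed
 finally show "H (Q p) n = Q (H p) n" ..
qed

lemma gsum_om: "gsum N (%j. of_real (q j) * om N k j) = of_nat N * cnj (dft N q k)"
 using N_pos by (simp add: dft_def gsum_def)

lemma gsum_H_mult: "gsum N (%n. H p n * q n) = 2 * N * (\<Sum>k=1..m. Im (dft N p k * cnj (dft N q k)))"
proof -
 have "gsum N (%n. H p n * q n) = 2 * (\<Sum>k=1..m. gsum N (%n. Im (om N k n * dft N p k) * q n))"
  unfolding gsum_def H_eq sum_distrib_left sum_distrib_right mult.assoc by (subst sum.swap) simp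
 also have "... = 2 * (\<Sum>k=1..m. Im (dft N p k * gsum N (%n. of_real (q n) * om N k n)))"
  by (simp add: gsum_def sum_distrib_left algebra_simps)
 also have "... = 2 * (\<Sum>k=1..m. N * Im (dft N p k * cnj (dft N q k)))"
  unfolding gsum_om by (simp add: algebra_simps)
 finally show ?thesis by (simp add: sum_distrib_left mult_ac)
qed

lemma H_skew: "gsum N (%n. H p n * q n) = - gsum N (%n. H q n * p n)"
proof -
 have "Im (dft N p k * cnj (dft N q k)) = - Im (dft N q k * cnj (dft N p k))" for k
  by (simp add: algebra_simps)
 then have "(\<Sum>k=1..m. Im (dft N p k * cnj (dft N q k))) = - (\<Sum>k=1..m. Im (dft N q k * cnj (dft N p k)))"
  unfolding sum_negf[symmetric] by (intro sum.cong refl)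
 then show ?thesis unfolding gsum_H_mult by (simp only: mult_minus_right)
qed

lemma Q_symmetric:
 assumes "grid_fun N p" "grid_fun N q"
 shows "gsum N (%j. Q p j * q j) = gsum N (%j. p j * Q q j)"
proof -
 have *: "x (j + int N + a) = x (j + a)" if "grid_fun N x" for x j a
  using that[unfolded grid_fun_def, rule_format, of "j + a"] by (simp add: algebra_simps)
 note ** = *[OF assms(1), of _ 0, simplified] *[OF assms(2), of _ 0, simplified] *[OF assms(1), of _ 1] *[OF assms(2), of _ 1]
 have p: "gsum N (%j. p (j + 1) * q j) = gsum N (%j. p j * q (j - 1))"
  using gsum_plus1[of "%j. p j * q (j - 1)" N] ** *[OF assms(2), of _ "-1", simplified] by simp
 have m: "gsum N (%j. p (j - 1) * q j) = gsum N (%j. p j * q (j + 1))"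
  using gsum_minus1[of "%j. p j * q (j + 1)" N] ** by simp
 have "gsum N (%j. Q p j * q j) = gsum N (%j. (1 / h^2) * (p (j + 1) * q j - 2 * (p j * q j) + p (j - 1) * q j))"
  by (intro arg_cong[where f = "gsum N"] ext) (simp add: Q_eq algebra_simps add_divide_distrib diff_divide_distrib)
 also have "... = gsum N (%j. (1 / h^2) * (p j * q (j - 1) - 2 * (p j * q j) + p j * q (j + 1)))"
  unfolding gsum_cmult gsum_add gsum_diff p m ..
 also have "... = gsum N (%j. p j * Q q j)"
  by (intro arg_cong[where f = "gsum N"] ext) (simp add: Q_eq algebra_simps add_divide_distrib diff_divide_distrib)
 finally show ?thesis .
qed

text \<open>A skew operator composed with a symmetric one that commutes with it is skew, so the
  pairing equals its own negative.\<close>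

lemma H_Q_skew:
 assumes p: "grid_fun N p"
 shows "gsum N (%j. H (Q p) j * p j) = 0"
proof -
 have "gsum N (%j. H (Q p) j * p j) = - gsum N (%j. H p j * Q p j)"
  by (rule H_skew)
 also have "gsum N (%j. H p j * Q p j) = gsum N (%j. H (Q p) j * p j)"
  unfolding H_Q[OF p] by (rule Q_symmetric[OF grid_fun_H p, symmetric])
 finally show ?thesis by simp
qed

lemma gsum_om_zero:
 assumes "0 < k" "k < N"
 shows "gsum N (om N k) = 0"
proof -
 define z where "z = cis (2 * pi * real k / N)"
 have "om N k (int j) = z ^ j" for j
  unfolding om_def z_def Complex.DeMoivre by (simp add: mult_ac)
 moreover have "z \<noteq> 1"
 proof
  assume "z = 1"
  then have "cos (2 * pi * real k / N) = 1" by (simp add: z_def complex_eq_iff)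
  then obtain i :: int where "2 * pi * real k / N = real_of_int i * 2 * pi"
   using cos_one_2pi_int by auto
  then have "real k = real_of_int i * real N" using N_pos by (simp add: field_simps)
  then have e: "int k = i * int N" by (metis of_int_eq_iff of_int_mult of_int_of_nat_eq)
  then have "0 < i * int N" using assms by linarith
  then have "0 < i" by (simp add: zero_less_mult_iff)
  then have "int N <= i * int N" using mult_right_mono[of 1 i "int N"] by simp
  then show False using e assms by linarith
 qed
 moreover have "z ^ N = 1"
  using om_period[of k 0] calculation(1)[of N] by (simp add: om_def)
 ultimately show ?thesis
  by (simp add: gsum_def geometric_sum)
qed

lemma gsum_om_cnj:
 assumes "k <= m" "l <= m"
 shows "gsum N (%j. om N k j * cnj (om N l j)) = (if k = l then of_nat N else 0)"
proof -
 have *: "gsum N (%j. om N k j * cnj (om N l j)) = 0" if "l < k" "k <= m" for k l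
 proof -
  have "om N k j * cnj (om N l j) = om N (k - l) j" for j
   using om_mult[of N "k - l" j l] that om_cnj[of N l j] by (metis add_diff_inverse_nat add.commute mult.assoc mult.right_neutral order_less_imp_not_less)
  then show ?thesis using gsum_om_zero[of "k - l"] that N_eq by simp
 qed
 consider "k = l" | "l < k" | "k < l" by linarith
 then show ?thesis
 proof cases
  case 3
  have "gsum N (%j. om N k j * cnj (om N l j)) = cnj (gsum N (%j. om N l j * cnj (om N k j)))"
   by (simp add: gsum_def mult.commute)
  then show ?thesis using *[of k l] 3 assms by simp
 qed (use * assms in \<open>auto simp: om_cnj, simp add: gsum_def\<close>)
qed

text \<open>There is no aliasing, because \<open>0 < k + l\<close> and
  \<open>k + l <= 2 * m < N\<close>.\<close>

lemma gsum_om_om: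
 assumes "1 <= k" "k <= m" "l <= m"
 shows "gsum N (%j. cnj (om N k j) * cnj (om N l j)) = 0"
proof -
 have "gsum N (%j. cnj (om N k j) * cnj (om N l j)) = cnj (gsum N (om N (k + l)))"
  by (simp add: gsum_def om_mult[symmetric])
 then show ?thesis using gsum_om_zero[of "k + l"] assms N_eq by simp
qed

lemma dft_Re:
 assumes "1 <= k" "k <= m" "l <= m"
 shows "dft N (%n. Re (b * om N k n)) l = (if k = l then b / 2 else 0)"
proof -
 have "of_nat N * dft N (%n. Re (b * om N k n)) l =
  gsum N (%n. (b / 2) * (om N k n * cnj (om N l n)) + (cnj b / 2) * (cnj (om N k n) * cnj (om N l n)))"
 proof -
  have e: "complex_of_real (Re z) = (z + cnj z) / 2" for z
   by (simp add: complex_add_cnj)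
  have "of_real (Re (b * om N k n)) * cnj (om N l n) =
   (b / 2) * (om N k n * cnj (om N l n)) + (cnj b / 2) * (cnj (om N k n) * cnj (om N l n))" for n
   unfolding e by (simp add: algebra_simps)
  then show ?thesis unfolding dft_gsum using N_pos by simp
 qed
 also have "... = (if k = l then of_nat N * (b / 2) else 0)"
  unfolding gsum_add gsum_cmult gsum_om_cnj[OF assms(2,3)] gsum_om_om[OF assms] by simp
 finally show ?thesis using N_pos by (simp split: if_splits)
qed

lemma dft_sum: "dft N (%n. \<Sum>k\<in>K. f k n) l = (\<Sum>k\<in>K. dft N (f k) l)"
 unfolding dft_def by (simp add: sum_distrib_right sum_divide_distrib) (rule sum.swap)

lemma dft_sum_Re:
 assumes "1 <= l" "l <= m"
 shows "dft N (%n. 2 * (\<Sum>k=1..m. Re (b k * om N k n))) l = b l"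
proof -
 have "dft N (%n. 2 * (\<Sum>k=1..m. Re (b k * om N k n))) l = 2 * dft N (%n. \<Sum>k=1..m. Re (b k * om N k n)) l"
  using dft_linear[of 2 "%n. \<Sum>k=1..m. Re (b k * om N k n)" 0 "%_. 0" l] by simp
 also have "... = 2 * (\<Sum>k=1..m. if k = l then b k / 2 else 0)"
  unfolding dft_sum by (intro arg_cong2[where f = "(*)"] sum.cong refl dft_Re) (use assms in auto)
 finally show ?thesis using assms by simp
qed

lemma dft_H:
 assumes "1 <= l" "l <= m"
 shows "dft N (H p) l = - \<i> * dft N p l"
proof -
 have "H p = (%n. 2 * (\<Sum>k=1..m. Re ((- \<i> * dft N p k) * om N k n)))"
  by (simp add: fun_eq_iff H_eq algebra_simps)
 then show ?thesis by (simp only: dft_sum_Re[OF assms])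
qed

lemma dft_H_0: "dft N (H p) 0 = 0"
proof -
 have "H p = (%n. 2 * (\<Sum>k=1..m. Re ((- \<i> * dft N p k) * om N k n)) + 0 * 0)"
  by (simp add: fun_eq_iff H_eq algebra_simps)
 then have "dft N (H p) 0 = 2 * dft N (%n. \<Sum>k=1..m. Re ((- \<i> * dft N p k) * om N k n)) 0"
  using dft_linear[of 2 "%n. \<Sum>k=1..m. Re ((- \<i> * dft N p k) * om N k n)" 0 "%_. 0" 0]
  by (simp only: of_real_0 mult_zero_left add_0_right) simp
 also have "... = 2 * (\<Sum>k=1..m. if k = 0 then (- \<i> * dft N p k) / 2 else 0)"
  unfolding dft_sum by (intro arg_cong2[where f = "(*)"] sum.cong refl dft_Re) auto
 also have "... = 0" by simp
 finally show ?thesis .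
qed

text \<open>Expand the squared distance of \<open>p\<close> to its part \<open>s\<close> in the
  modes 1..m. The factor 2 counts each mode together with its conjugate; the mean is left out, as
  \<open>H\<close> and \<open>Q\<close> annihilate it.\<close>

lemma bessel_grid: "2 * N * (\<Sum>k=1..m. (cmod (dft N p k))^2) <= gsum N (%j. (p j)^2)"
proof -
 define s where "s = (%n. 2 * (\<Sum>k=1..m. Re (dft N p k * om N k n)))"
 define B where "B = 2 * N * (\<Sum>k=1..m. (cmod (dft N p k))^2)"
 have sq: "gsum N (%n. s n * q n) = B" if "!!k. k \<in> {1..m} ==> dft N q k = dft N p k" for q
 proof -
  have "gsum N (%n. s n * q n) = 2 * (\<Sum>k=1..m. gsum N (%n. Re (dft N p k * om N k n) * q n))"
   unfolding gsum_def s_def sum_distrib_left sum_distrib_right mult.assoc by (subst sum.swap) simp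
  also have "... = 2 * (\<Sum>k=1..m. Re (dft N p k * gsum N (%n. of_real (q n) * om N k n)))"
   by (simp add: gsum_def sum_distrib_left algebra_simps)
  also have "... = 2 * (\<Sum>k=1..m. N * (cmod (dft N p k))^2)"
   unfolding gsum_om using that
   by (intro arg_cong2[where f = "(*)"] sum.cong refl) (simp add: complex_norm_square[symmetric] cmod_power2 power2_eq_square algebra_simps)
  finally show ?thesis by (simp add: B_def sum_distrib_left mult_ac)
 qed
 have ss: "gsum N (%n. s n * s n) = B"
  by (rule sq) (simp only: s_def, rule dft_sum_Re, auto)
 have sp: "gsum N (%n. s n * p n) = B"
  by (rule sq) simp
 have "0 <= gsum N (%n. (p n - s n)^2)" by (rule gsum_nonneg) simp
 also have "(%n. (p n - s n)^2) = (%n. (p n)^2 - 2 * (s n * p n) + s n * s n)"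
  by (simp add: fun_eq_iff power2_eq_square algebra_simps)
 also have "gsum N ... = gsum N (%n. (p n)^2) - B"
  unfolding gsum_add gsum_diff gsum_cmult ss sp by simp
 finally show ?thesis by (simp add: B_def)
qed

lemma nrm_H_le: "nrm (H p) <= nrm p"
proof (rule nrm_leI)
 have "gsum N (%n. H p n * H p n) = 2 * N * (\<Sum>k=1..m. (cmod (dft N p k))^2)"
  unfolding gsum_H_mult
  by (intro arg_cong2[where f = "(*)"] sum.cong refl) (simp add: dft_H cmod_power2 flip: power2_eq_square)
 then have "gsum N (%n. (H p n)^2) <= gsum N (%j. (p j)^2)"
  using bessel_grid[of p] by (simp add: power2_eq_square)
 then show "h * gsum N (%n. (H p n)^2) <= (nrm p)^2"
  unfolding nrm_sq using h_pos by simp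
qed simp

section \<open>Solvability of one implicit step by the fixed point iteration\<close>

lemma abs_le_nrm:
 assumes "grid_fun N p"
 shows "\<bar>p j\<bar> <= nrm p / sqrt h"
proof -
 have "(p j)^2 = (%i. (p (i + j))^2) (int 0)" by simp
 also have "... <= gsum N (%i. (p (i + j))^2)"
  unfolding gsum_def by (rule member_le_sum) (use N_pos in auto)
 also have "... = gsum N (%i. (p i)^2)"
  by (rule gsum_sq_shift[OF assms])
 finally have "h * (p j)^2 <= (nrm p)^2"
  unfolding nrm_sq using h_pos by simp
 then have "(sqrt h * \<bar>p j\<bar>)^2 <= (nrm p)^2"
  using h_pos by (simp add: power_mult_distrib)
 then have "sqrt h * \<bar>p j\<bar> <= nrm p"
  by (rule power2_le_imp_le) simp
 then show ?thesis using h_pos by (simp add: field_simps)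
qed

text \<open>The consecutive differences are dominated pointwise by a geometric series. Pointwise
  control costs a factor 1/sqrt h, which is a constant on a fixed grid.\<close>

lemma contraction_converges:
 assumes w: "!!l. grid_fun N (w l)" and \<theta>: "0 <= \<theta>" "\<theta> < 1"
  and step: "!!l. nrm (%j. w (Suc (Suc l)) j - w (Suc l) j) <= \<theta> * nrm (%j. w (Suc l) j - w l j)"
 obtains v where "grid_fun N v" "!!j. (%l. w l j) \<longlonglongrightarrow> v j"
proof -
 define C where "C = nrm (%j. w (Suc 0) j - w 0 j)"
 have b: "nrm (%j. w (Suc l) j - w l j) <= C * \<theta> ^ l" for l
 proof (induction l)
  case (Suc l)
  have "nrm (%j. w (Suc (Suc l)) j - w (Suc l) j) <= \<theta> * (C * \<theta> ^ l)"
   using order_trans[OF step mult_left_mono[OF Suc \<theta>(1)]] .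
  then show ?case by (simp add: mult_ac)
 qed (simp add: C_def)
 have "convergent (%l. w l j)" for j
 proof -
  have d: "grid_fun N (%j. w (Suc l) j - w l j)" for l
   using w[of l] w[of "Suc l"] by (simp add: grid_fun_def)
  have bd: "norm (w (Suc l) j - w l j) <= C / sqrt h * \<theta> ^ l" for l
   using order_trans[OF abs_le_nrm[OF d] divide_right_mono[OF b]] h_pos by simp
  have "summable (%l. C / sqrt h * \<theta> ^ l)"
   by (intro summable_mult summable_geometric) (use \<theta> in simp)
  then have "summable (%l. w (Suc l) j - w l j)"
   by (rule summable_comparison_test'[where N = 0]) (rule bd)
  then have "convergent (%n. \<Sum>l<n. w (Suc l) j - w l j)"
   by (simp add: summable_iff_convergent)
  from convergent_add[OF this[unfolded sum_lessThan_telescope[of "%l. w l j"]] convergent_const[of "w 0 j"]]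
  have "convergent (%n. (w n j - w 0 j) + w 0 j)" .
  then show ?thesis by simp
 qed
 then have c: "(%l. w l j) \<longlonglongrightarrow> lim (%l. w l j)" for j
  by (simp add: convergent_LIMSEQ_iff)
 have "grid_fun N (%j. lim (%l. w l j))"
  using w by (simp add: grid_fun_def)
 then show ?thesis using that c by blast
qed

lemma tendsto_H_Q:
 assumes "!!j. ((%l. w l j) \<longlongrightarrow> v j) F"
 shows "((%l. H (Q (w l)) j) \<longlongrightarrow> H (Q v) j) F"
 unfolding discrete_hilbert_def Q_eq by (intro tendsto_intros assms) (use h_pos in auto)

lemma tendsto_G:
 assumes "!!j. ((%l. w l j) \<longlongrightarrow> v j) F"
 shows "((%l. G (w l) j) \<longlongrightarrow> G v j) F"
 unfolding G_eq by (intro tendsto_intros assms) (use h_pos in auto)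

lemma tendsto_nrm:
 assumes "!!j. ((%l. w l j) \<longlongrightarrow> v j) F"
 shows "((%l. nrm (w l)) \<longlongrightarrow> nrm v) F"
 unfolding gnorm_def L2_set_def by (intro tendsto_intros assms)

lemma tendsto_Q:
 assumes "!!j. ((%l. w l j) \<longlongrightarrow> v j) F"
 shows "((%l. Q (w l) j) \<longlongrightarrow> Q v j) F"
 unfolding Q_eq by (intro tendsto_intros assms) (use h_pos in auto)

lemma Q_linear: "Q (%j. a * p j + b * q j) = (%j. a * Q p j + b * Q q j)"
 using h_pos by (simp add: fun_eq_iff Q_eq field_simps)

lemma H_Q_linear: "H (Q (%j. a * p j + b * q j)) j = a * H (Q p) j + b * H (Q q) j"
 unfolding Q_linear H_linear ..

lemma nrm_Q_le: "grid_fun N p ==> nrm (Q p) <= 6 / h^2 * nrm p"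
proof -
 assume p: "grid_fun N p"
 have "\<bar>Q p j\<bar> <= 2 / h^2 * (\<bar>p (j + 1)\<bar> + \<bar>p j\<bar> + \<bar>p (j - 1)\<bar>)" for j
 proof -
  have le: "x <= 2 * (a + b + c)" if "x <= y + c" "y <= a + 2 * b" "0 <= a" "0 <= c" for x y a b c :: real
   using that by argo
  have "\<bar>p (j + 1) - 2 * p j + p (j - 1)\<bar> <= 2 * (\<bar>p (j + 1)\<bar> + \<bar>p j\<bar> + \<bar>p (j - 1)\<bar>)"
   by (rule le[OF abs_triangle_ineq abs_triangle_ineq4[of "p (j + 1)" "2 * p j", unfolded abs_mult abs_numeral]])
    simp_all
  from divide_right_mono[OF this, of "h^2"] show ?thesis by (simp add: Q_eq abs_divide)
 qed
 from nrm_le_three_point[OF p _ this] show ?thesis by simp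
qed

text \<open>Crank-Nicolson energy identity: pairing with \<open>v + y\<close> makes the left side a
  difference of squares and removes the Hilbert term whatever \<open>c\<close> is, so the linear
  part puts no restriction on \<open>dt\<close>. The factors \<open>1 *\<close> give the sum the
  shape of the linearity rules for \<open>Q\<close> and \<open>H\<close>.\<close>

lemma step_bound:
 assumes y: "grid_fun N y" and v: "grid_fun N v" and dt: "0 <= dt"
  and eq: "!!j. y j = v j + dt * g j + c * H (Q (%i. 1 * v i + 1 * y i)) j"
 shows "nrm y <= nrm v + dt * nrm g"
proof -
 define s where "s = (%i. 1 * v i + 1 * y i)"
 have s: "grid_fun N s" using y v by (simp add: s_def grid_fun_def)
 have "(nrm y)^2 - (nrm v)\<^sup>2 = h * gsum N (%j. (y j - v j) * s j)"
  unfolding nrm_sq right_diff_distrib[symmetric] gsum_diff[symmetric]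
  by (intro arg_cong2[where f = "(*)"] arg_cong[where f = "gsum N"] ext refl)
   (simp add: s_def power2_eq_square algebra_simps)
 also have "... = h * gsum N (%j. dt * (g j * s j) + c * (H (Q s) j * s j))"
  using eq unfolding s_def[symmetric]
  by (intro arg_cong2[where f = "(*)"] arg_cong[where f = "gsum N"] ext refl) (simp add: algebra_simps)
 also have "... = dt * (h * gsum N (%j. g j * s j))"
  unfolding gsum_add gsum_cmult H_Q_skew[OF s] by simp
 also have "... <= dt * (nrm g * nrm s)"
  by (intro mult_left_mono cauchy_schwarz_le dt)
 also have "... <= dt * (nrm g * (nrm v + nrm y))"
  using nrm_triangle[of v y] dt by (intro mult_left_mono) (auto simp: s_def)
 finally have *: "(nrm y - nrm v) * (nrm v + nrm y) <= (dt * nrm g) * (nrm v + nrm y)"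
  by (simp add: power2_eq_square algebra_simps)
 show ?thesis
 proof (cases "nrm v + nrm y = 0")
  case True
  then have "nrm y = 0" "nrm v = 0" using nrm_nonneg[of y] nrm_nonneg[of v] by linarith+
  then show ?thesis using dt by simp
 next
  case False
  then have "0 < nrm v + nrm y" using nrm_nonneg[of y] nrm_nonneg[of v] by linarith
  with * have "nrm y - nrm v <= dt * nrm g" by (simp only: mult_le_cancel_right_pos)
  then show ?thesis by simp
 qed
qed

text \<open>As \<open>Q\<close> commutes with \<open>H\<close>, the function \<open>Q y\<close>
  solves the same equation with data \<open>Q v\<close> and \<open>Q g\<close>.\<close>

lemma step_bound_Q:
 assumes y: "grid_fun N y" and v: "grid_fun N v" and g: "grid_fun N g" and dt: "0 <= dt"
  and eq: "!!j. y j = v j + dt * g j + c * H (Q (%i. 1 * v i + 1 * y i)) j"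
 shows "nrm (Q y) <= nrm (Q v) + dt * nrm (Q g)"
proof (rule step_bound[OF grid_fun_ops(2)[OF y] grid_fun_ops(2)[OF v] dt])
 fix j
 let ?s = "%i. 1 * v i + 1 * y i"
 have s: "grid_fun N ?s" using y v by (simp add: grid_fun_def)
 have "y = (%j. 1 * (1 * v j + dt * g j) + c * H (Q ?s) j)"
  by (rule ext) (subst eq, simp only: mult_1)
 then have "Q y = Q (%j. 1 * (1 * v j + dt * g j) + c * H (Q ?s) j)" by (rule arg_cong)
 also have "... = (%j. 1 * (1 * Q v j + dt * Q g j) + c * Q (H (Q ?s)) j)"
  unfolding Q_linear ..
 also have "Q (H (Q ?s)) = H (Q (%i. 1 * Q v i + 1 * Q y i))"
  unfolding H_Q[OF grid_fun_ops(2)[OF s], symmetric] by (simp only: Q_linear)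
 finally have "Q y j = 1 * (1 * Q v j + dt * Q g j) + c * H (Q (%i. 1 * Q v i + 1 * Q y i)) j"
  by (rule fun_cong)
 then show "Q y j = Q v j + dt * Q g j + c * H (Q (%i. 1 * Q v i + 1 * Q y i)) j"
  by (simp only: mult_1)
qed

text \<open>Damped Richardson iteration for the skew perturbation \<open>w - \<mu> H Q w = r\<close> of the identity.\<close>

lemma resolvent_exists:
 assumes r: "grid_fun N r"
 obtains a where "grid_fun N a" "!!j. a j = r j + \<mu> * H (Q a) j"
proof -
 define K where "K = \<bar>\<mu>\<bar> * (6 / h^2)"
 \<comment> \<open>By skewness the cross term vanishes, and the squared contraction factor is at
   most \<open>(1 - e)^2 + e^2 * K^2\<close>. This choice of \<open>e\<close> minimises it, and the
   minimum is \<open>1 - e\<close>.\<close>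
 define e where "e = 1 / (1 + K^2)"
 have e: "0 < e" "e <= 1" "e * (1 + K^2) = 1"
  using add_pos_nonneg[of 1 "K^2"] by (auto simp: e_def)
 define T where "T = (%a j. (1 - e) * a j + (e * \<mu>) * H (Q a) j + e * r j)"
 define w where "w = (%l. (T ^^ l) r)"
 have w: "grid_fun N (w l)" for l
 proof (induction l)
  case (Suc l)
  then show ?case using r grid_fun_H by (simp add: w_def T_def grid_fun_def)
 qed (simp add: w_def r)
 have wS: "w (Suc l) = T (w l)" for l by (simp add: w_def)
 have contr: "nrm (%j. T a j - T b j) <= sqrt (1 - e) * nrm (%j. a j - b j)"
  if "grid_fun N a" "grid_fun N b" for a b
 proof (rule nrm_leI)
  define d where "d = (%j. 1 * a j + (-1) * b j)"
  have d: "grid_fun N d" using that by (simp add: d_def grid_fun_def)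
  have "T a j - T b j = (1 - e) * d j + (e * \<mu>) * H (Q d) j" for j
   unfolding T_def d_def H_Q_linear by (simp add: algebra_simps)
  then have "(T a j - T b j)^2 = (1 - e)^2 * (d j)^2 + (2 * (1 - e) * (e * \<mu>)) * (H (Q d) j * d j) + (e * \<mu>)^2 * (H (Q d) j)^2" for j
   by (simp add: power2_sum power_mult_distrib mult_ac)
  then have "h * gsum N (%j. (T a j - T b j)^2) =
    h * gsum N (%j. (1 - e)^2 * (d j)^2 + (2 * (1 - e) * (e * \<mu>)) * (H (Q d) j * d j) + (e * \<mu>)^2 * (H (Q d) j)^2)"
   by simp
  also have "... = (1 - e)^2 * (nrm d)^2 + (e * \<mu>)^2 * (nrm (H (Q d)))^2"
   unfolding gsum_add gsum_cmult H_Q_skew[OF d] nrm_sq by (simp add: algebra_simps)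
  also have "... <= (1 - e)^2 * (nrm d)^2 + e^2 * (K * nrm d)^2"
  proof -
   have "nrm (H (Q d)) <= 6 / h^2 * nrm d"
    using nrm_H_le[of "Q d"] nrm_Q_le[OF d] by simp
   then have "\<bar>\<mu>\<bar> * nrm (H (Q d)) <= \<bar>\<mu>\<bar> * (6 / h^2 * nrm d)"
    by (rule mult_left_mono) simp
   then have "\<bar>\<mu>\<bar> * nrm (H (Q d)) <= K * nrm d"
    by (simp add: K_def mult_ac)
   then have "(\<bar>\<mu>\<bar> * nrm (H (Q d)))^2 <= (K * nrm d)^2"
    by (intro power_mono) auto
   then have "e^2 * (\<bar>\<mu>\<bar> * nrm (H (Q d)))^2 <= e^2 * (K * nrm d)^2"
    by (intro mult_left_mono) auto
   then show ?thesis by (simp add: power_mult_distrib mult_ac)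
  qed
  also have "... = (1 - 2 * e + e * (e * (1 + K^2))) * (nrm d)^2"
   by (simp add: power2_eq_square algebra_simps)
  also have "... = (sqrt (1 - e) * nrm (%j. a j - b j))^2"
   using e by (simp add: power_mult_distrib d_def)
  finally show "h * gsum N (%j. (T a j - T b j)^2) <= (sqrt (1 - e) * nrm (%j. a j - b j))^2" .
 qed (use e in auto)
 obtain a where a: "grid_fun N a" "!!j. (%l. w l j) \<longlonglongrightarrow> a j"
 proof (rule contraction_converges[OF w, of "sqrt (1 - e)"])
  show "nrm (%j. w (Suc (Suc l)) j - w (Suc l) j) <= sqrt (1 - e) * nrm (%j. w (Suc l) j - w l j)" for l
   unfolding wS[of "Suc l"] wS[of l] using contr[OF w w, of "Suc l" l] by (simp add: wS)
 qed (use e in auto)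
 have "(%l. w (Suc l) j) \<longlonglongrightarrow> T a j" for j
  unfolding wS T_def by (intro tendsto_intros tendsto_H_Q a)
 then have "T a j = a j" for j
  using LIMSEQ_unique LIMSEQ_Suc[OF a(2)] by blast
 then have "(1 - e) * a j + (e * \<mu>) * H (Q a) j + e * r j = a j" for j
  by (simp add: T_def)
 then have "e * a j = e * (r j + \<mu> * H (Q a) j)" for j
  unfolding left_diff_distrib distrib_left mult.assoc by (smt (verit) mult_1)
 then have "a j = r j + \<mu> * H (Q a) j" for j using e by simp
 then show ?thesis using that a(1) by blast
qed

lemma G_zero: "G (%_. 0) = (%_. 0)"
 by (simp add: fun_eq_iff G_eq)

lemma nrm_mean_le: "nrm (%i. (v i + y i) / 2) <= (nrm v + nrm y) / 2"
proof -
 have "(%i. (v i + y i) / 2) = (%i. (1 / 2) * (v i + y i))" by auto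
 then have "nrm (%i. (v i + y i) / 2) = (1 / 2) * nrm (%i. v i + y i)"
  by (simp only: nrm_cmult)
 then show ?thesis using nrm_triangle[of v y] by simp
qed

lemma Q_mean: "Q (%i. (v i + y i) / 2) = (%i. (Q v i + Q y i) / 2)"
 using Q_linear[of "1/2" v "1/2" y] by (simp add: add_divide_distrib)

text \<open>Data lie in the ball of radius \<open>R\<close> and iterates in the ball of radius
  \<open>2 * R\<close>, so midpoints lie in radius \<open>3 / 2 * R\<close>; the Sobolev bound adds
  two such terms, which gives \<open>3 * CS * R\<close>.\<close>

lemma mean_bounds:
 assumes v: "grid_fun N v" "grid_fun N y"
  and R: "nrm v <= R" "nrm (Q v) <= R" "nrm y <= 2 * R" "nrm (Q y) <= 2 * R"
 shows "grid_fun N (%i. (v i + y i) / 2)" "nrm (%i. (v i + y i) / 2) <= 3 / 2 * R"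
  "nrm (Q (%i. (v i + y i) / 2)) <= 3 / 2 * R" "\<bar>(v j + y j) / 2\<bar> <= 3 * CS * R"
proof -
 show g: "grid_fun N (%i. (v i + y i) / 2)" using v by (simp add: grid_fun_def)
 show 1: "nrm (%i. (v i + y i) / 2) <= 3 / 2 * R"
  using nrm_mean_le[of v y] R by simp
 show 2: "nrm (Q (%i. (v i + y i) / 2)) <= 3 / 2 * R"
  unfolding Q_mean using nrm_mean_le[of "Q v" "Q y"] R by simp
 have "\<bar>(v j + y j) / 2\<bar> <= CS * (3 / 2 * R + 3 / 2 * R)"
  using order_trans[OF sup_le[OF g] mult_left_mono[OF add_mono[OF 1 2]]] CS_pos by simp
 then show "\<bar>(v j + y j) / 2\<bar> <= 3 * CS * R" by (simp add: mult_ac)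
qed

lemma G_bounds:
 assumes "grid_fun N z" "!!j. \<bar>z j\<bar> <= A"
 shows "nrm (G z) <= 3 * A / h * nrm z"
proof -
 have "0 <= A" using assms(2)[of 0] by simp
 then show ?thesis using G_diff_bound[of z "%_. 0" A] assms by (simp add: G_zero grid_fun_def)
qed

text \<open>Both step bounds apply with \<open>G\<close> taken at the previous midpoint. The
  increment is at most \<open>dt * (18 * (CS * R) / h * R)\<close>, and the restriction on
  \<open>dt\<close> makes this at most \<open>R\<close>; hence the ball of radius
  \<open>2 * R\<close> is invariant.\<close>

lemma fixpoint_iteration_bounds:
 assumes w: "fixpoint_iteration L N dt v w" and R: "0 < R" "nrm v <= R" "nrm (Q v) <= R"
  and dt: "0 < dt" "dt * (100 * CS * R) <= h"
 shows "nrm (w l) <= 2 * R \<and> nrm (Q (w l)) <= 2 * R"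
proof (induction l)
 case 0
 show ?case using w R by (simp add: fixpoint_iteration_def)
next
 case (Suc l)
 have gw: "grid_fun N (w k)" for k using w by (simp add: fixpoint_iteration_def)
 have v: "grid_fun N v" using w gw[of 0] by (simp add: fixpoint_iteration_def)
 define z where "z = (%i. (v i + w l i) / 2)"
 have eq: "w (Suc l) j = v j + dt * G z j + dt / 2 * H (Q (%i. 1 * v i + 1 * w (Suc l) i)) j" for j
  unfolding z_def mult_1 using w unfolding fixpoint_iteration_def by blast
 note z = mean_bounds[OF v gw R(2,3), of l, folded z_def]
 have z1: "grid_fun N z" and z2: "nrm z <= 3 / 2 * R" and z3: "nrm (Q z) <= 3 / 2 * R"
  and z4: "\<bar>z j\<bar> <= 3 * CS * R" for j
  using z Suc by (auto simp: z_def)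
 have small: "dt * (18 * (CS * R) / h * R) <= R"
 proof -
  have "dt * (18 * (CS * R)) <= dt * (100 * CS * R)"
   using dt CS_pos R by (intro mult_left_mono) auto
  then have "dt * (18 * (CS * R)) <= h" using dt by linarith
  then have "dt * (18 * (CS * R)) / h <= 1" using h_pos by simp
  then have "dt * (18 * (CS * R)) / h * R <= 1 * R" using R by (intro mult_right_mono) auto
  then show ?thesis by simp
 qed
 have "nrm (G z) <= 3 * (3 * CS * R) / h * nrm z" by (rule G_bounds[OF z1 z4])
 also have "... <= 3 * (3 * CS * R) / h * (3 / 2 * R)"
  using h_pos CS_pos R by (intro mult_left_mono z2) auto
 also have "... <= 18 * (CS * R) / h * R"
  using h_pos CS_pos R by (simp add: field_simps)
 finally have "dt * nrm (G z) <= dt * (18 * (CS * R) / h * R)"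
  by (rule mult_left_mono) (use dt in simp)
 moreover have "nrm (Q (G z)) <= 4 * (3 * CS * R) / h * nrm (Q z)" by (rule Q_G_bound[OF z1 z4])
 then have "nrm (Q (G z)) <= 4 * (3 * CS * R) / h * (3 / 2 * R)"
  using h_pos CS_pos R by (elim order_trans) (intro mult_left_mono z3, auto)
 then have "nrm (Q (G z)) <= 18 * (CS * R) / h * R" by (simp add: mult_ac)
 then have "dt * nrm (Q (G z)) <= dt * (18 * (CS * R) / h * R)"
  by (rule mult_left_mono) (use dt in simp)
 ultimately show ?case
  using step_bound[OF gw v _ eq] step_bound_Q[OF gw v grid_fun_ops(3)[OF z1] _ eq] small dt R by simp
qed

text \<open>The difference of consecutive iterates solves the same linear problem with zero initial
  value and source \<open>g\<close>, so \<open>step_bound\<close> reduces the claim to the Lipschitz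
  constant of \<open>G\<close>, which is beaten by \<open>dt\<close>.\<close>

lemma fixpoint_iteration_contraction:
 assumes w: "fixpoint_iteration L N dt v w" and R: "0 < R" "nrm v <= R" "nrm (Q v) <= R"
  and dt: "0 < dt" "dt * (100 * CS * R) <= h"
 shows "nrm (%j. w (Suc (Suc l)) j - w (Suc l) j) <= 1 / 2 * nrm (%j. w (Suc l) j - w l j)"
proof -
 have gw: "grid_fun N (w k)" for k using w by (simp add: fixpoint_iteration_def)
 have v: "grid_fun N v" using w gw[of 0] by (simp add: fixpoint_iteration_def)
 define z where "z = (%l i. (v i + w l i) / 2)"
 have eq: "w (Suc l) j = v j + dt * G (z l) j + dt / 2 * H (Q (%i. 1 * v i + 1 * w (Suc l) i)) j" for l j
  unfolding z_def mult_1 using w unfolding fixpoint_iteration_def by blast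
 note b = fixpoint_iteration_bounds[OF assms]
 have z: "grid_fun N (z l)" "\<bar>z l j\<bar> <= 3 * CS * R" for l j
  using mean_bounds(1,4)[OF v gw R(2,3), of l] b by (auto simp: z_def)
 define d where "d = (%j. w (Suc (Suc l)) j - w (Suc l) j)"
 have d: "grid_fun N d" using gw[of "Suc l"] gw[of "Suc (Suc l)"] by (simp add: d_def grid_fun_def)
 define g where "g = (%j. G (z (Suc l)) j - G (z l) j)"
 have "d j = 0 + dt * g j + dt / 2 * H (Q (%i. 1 * 0 + 1 * d i)) j" for j
 proof -
  have e: "(%i. 1 * 0 + 1 * d i) = (%i. 1 * (1 * v i + 1 * w (Suc (Suc l)) i) + (-1) * (1 * v i + 1 * w (Suc l) i))"
   by (simp add: d_def fun_eq_iff)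
  show ?thesis
   unfolding e H_Q_linear[of 1 "%i. 1 * v i + 1 * w (Suc (Suc l)) i" "-1"]
   using eq[of "Suc l" j] eq[of l j] unfolding d_def g_def by (simp add: algebra_simps)
 qed
 note deq = this
 have "nrm d <= nrm (%_. 0) + dt * nrm g"
  by (rule step_bound[where v = "%_. 0" and c = "dt / 2", OF d _ _ deq]) (use dt in \<open>auto simp: grid_fun_def\<close>)
 also have "nrm (%_. 0) = 0" by (simp add: gnorm_def L2_set_def)
 also have "nrm g <= 3 * (3 * CS * R) / h * nrm (%j. z (Suc l) j - z l j)"
  unfolding g_def by (rule G_diff_bound[OF z(1) z(1) z(2) z(2)])
 also have "(%j. z (Suc l) j - z l j) = (%j. (1 / 2) * (w (Suc l) j - w l j))"
  by (simp add: z_def fun_eq_iff field_simps)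
 also have "nrm ... = 1 / 2 * nrm (%j. w (Suc l) j - w l j)" by (simp only: nrm_cmult)
 finally have "nrm d <= (dt * (9 * CS * R) / h) * (1 / 2 * nrm (%j. w (Suc l) j - w l j))"
  using dt by (simp add: mult_left_mono mult_ac)
 also have "... <= 1 * (1 / 2 * nrm (%j. w (Suc l) j - w l j))"
 proof (intro mult_right_mono)
  have "dt * (9 * CS * R) <= dt * (100 * CS * R)"
   using dt CS_pos R by (intro mult_left_mono mult_right_mono) auto
  then show "dt * (9 * CS * R) / h <= 1" using dt h_pos by simp
 qed auto
 finally show ?thesis by (simp add: d_def)
qed

text \<open>Each iterate is implicit in the linear term; \<open>resolvent_exists\<close> with
  \<open>dt / 2\<close> produces it once \<open>H (Q v)\<close> has been moved to the right-hand
  side.\<close>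

lemma fixpoint_iteration_exists:
 assumes v: "grid_fun N v"
 obtains w where "fixpoint_iteration L N dt v w"
proof -
 define P where "P = (%w w'. grid_fun N w' \<and> (\<forall>j. w' j = v j + dt * G (%i. (v i + w i) / 2) j
       + dt / 2 * H (Q (%i. v i + w' i)) j))"
 have ex: "\<exists>w'. P w w'" if w: "grid_fun N w" for w
 proof -
  have z: "grid_fun N (%i. (v i + w i) / 2)" using v w by (simp add: grid_fun_def)
  have "grid_fun N (%j. v j + dt * G (%i. (v i + w i) / 2) j + dt / 2 * H (Q v) j)"
   using v grid_fun_ops(3)[OF z] grid_fun_H[of "Q v"] by (simp add: grid_fun_def)
  from resolvent_exists[OF this, of "dt / 2"] obtain a where a: "grid_fun N a"
   "!!j. a j = v j + dt * G (%i. (v i + w i) / 2) j + dt / 2 * H (Q v) j + dt / 2 * H (Q a) j" by blast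
  have "a j = v j + dt * G (%i. (v i + w i) / 2) j + dt / 2 * H (Q (%i. v i + a i)) j" for j
   using a(2)[of j] H_Q_linear[of 1 v 1 a j] by (simp add: algebra_simps)
  then show ?thesis using a(1) unfolding P_def by blast
 qed
 define w where "w = rec_nat v (%_ w. SOME w'. P w w')"
 have w0: "w 0 = v" and wS: "w (Suc l) = (SOME w'. P (w l) w')" for l by (simp_all add: w_def)
 have P: "grid_fun N (w l) \<and> P (w l) (w (Suc l))" for l
 proof (induction l)
  case 0
  show ?case using v someI_ex[OF ex[OF v]] by (simp add: w0 wS)
 next
  case (Suc l)
  then have "grid_fun N (w (Suc l))" by (simp add: P_def)
  then show ?case using someI_ex[OF ex] wS[of "Suc l"] by metis
 qed
 have "fixpoint_iteration L N dt v w"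
  unfolding fixpoint_iteration_def using w0 P unfolding P_def by blast
 then show ?thesis by (rule that)
qed

lemma scheme_step_exists:
 assumes v: "grid_fun N v" and R: "0 < R" "nrm v <= R" "nrm (Q v) <= R"
  and dt: "0 < dt" "dt * (100 * CS * R) <= h"
 shows "\<exists>v'. scheme_step L N dt v v'"
proof -
 obtain w where w: "fixpoint_iteration L N dt v w" using fixpoint_iteration_exists[OF v] .
 have gw: "grid_fun N (w k)" for k using w by (simp add: fixpoint_iteration_def)
 obtain v' where v': "grid_fun N v'" "!!j. (%l. w l j) \<longlonglongrightarrow> v' j"
  using contraction_converges[of w "1/2", OF gw _ _ fixpoint_iteration_contraction[OF w R dt]] by auto
 have "v' j = v j + dt * G (%i. (v i + v' i) / 2) j + dt * H (Q (%i. (v i + v' i) / 2)) j" for j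
 proof -
  have "(%l. w (Suc l) j) \<longlonglongrightarrow> v j + dt * G (%i. (v i + v' i) / 2) j + dt / 2 * H (Q (%i. v i + v' i)) j"
  proof -
   have e: "(%l. w (Suc l) j) = (%l. v j + dt * G (%i. (v i + w l i) / 2) j + dt / 2 * H (Q (%i. v i + w (Suc l) i)) j)"
    unfolding fun_eq_iff using w unfolding fixpoint_iteration_def by blast
   show ?thesis unfolding e
    by (intro tendsto_add tendsto_mult tendsto_const tendsto_G tendsto_H_Q tendsto_divide v' LIMSEQ_Suc) auto
  qed
  then have e: "v' j = v j + dt * G (%i. (v i + v' i) / 2) j + dt / 2 * H (Q (%i. v i + v' i)) j"
   using LIMSEQ_unique LIMSEQ_Suc[OF v'(2)] by blast
  have "H (Q (%i. (v i + v' i) / 2)) j = 1 / 2 * H (Q (%i. v i + v' i)) j"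
   using H_Q_linear[of "1/2" "%i. v i + v' i" 0 "%_. 0" j] by simp
  then show ?thesis using e by simp
 qed
 then show ?thesis unfolding scheme_step_def using v' w by blast
qed

section \<open>Stability of the scheme on a time interval determined by the data\<close>

text \<open>The equation is paired with the midpoint, at which both the nonlinear and the Hilbert
  term are skew; the norm is therefore conserved exactly.\<close>

lemma scheme_step_mass:
 assumes v: "grid_fun N v" and s: "scheme_step L N dt v v'"
 shows "nrm v' = nrm v"
proof -
 define z where "z = (%i. (v i + v' i) / 2)"
 have v': "grid_fun N v'" using s unfolding scheme_step_def by blast
 have z: "grid_fun N z" using v v' by (simp add: z_def grid_fun_def)
 have eq: "v' j = v j + dt * G z j + dt * H (Q z) j" for j
  using s unfolding scheme_step_def z_def by blast
 have "(nrm v')^2 - (nrm v)\<^sup>2 = h * gsum N (%j. (2 * dt) * (G z j * z j) + (2 * dt) * (H (Q z) j * z j))"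
 proof -
  have "(v' j)^2 - (v j)\<^sup>2 = (2 * dt) * (G z j * z j) + (2 * dt) * (H (Q z) j * z j)" for j
  proof -
   have "(v' j)^2 - (v j)\<^sup>2 = (v' j - v j) * (2 * z j)" by (simp add: z_def power2_eq_square algebra_simps)
   also have "v' j - v j = dt * G z j + dt * H (Q z) j" using eq[of j] by simp
   finally show ?thesis by (simp add: algebra_simps)
  qed
  then show ?thesis unfolding nrm_sq right_diff_distrib[symmetric] gsum_diff[symmetric] by simp
 qed
 also have "... = 0" unfolding gsum_add gsum_cmult G_skew[OF z] H_Q_skew[OF z] by simp
 finally show ?thesis by (simp add: power2_eq_iff_nonneg)
qed

text \<open>\<open>Q\<close> of the equation is paired with \<open>Q\<close> of the midpoint
  \<open>z\<close>. Bounding the slopes of \<open>z\<close> by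
  \<open>sqrt (2 * L) * nrm (Q z)\<close> makes the right side cubic in the two levels, and division
  by their sum leaves a quadratic.\<close>

lemma scheme_step_growth:
 assumes v: "grid_fun N v" and s: "scheme_step L N dt v v'" and dt: "0 <= dt"
 shows "nrm (Q v') <= nrm (Q v) + dt * (sqrt (2 * L) * (nrm (Q v) + nrm (Q v'))^2)"
proof -
 define z where "z = (%i. (v i + v' i) / 2)"
 have v': "grid_fun N v'" using s unfolding scheme_step_def by blast
 have z: "grid_fun N z" using v v' by (simp add: z_def grid_fun_def)
 have Qz: "grid_fun N (Q z)" by (rule grid_fun_ops[OF z])
 have eq: "v' = (%j. 1 * (1 * v j + dt * G z j) + dt * H (Q z) j)"
  unfolding z_def fun_eq_iff mult_1 using s unfolding scheme_step_def by blast
 have "Q v' = Q (%j. 1 * (1 * v j + dt * G z j) + dt * H (Q z) j)"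
  by (subst eq) (rule refl)
 then have Qeq: "Q v' j = Q v j + dt * Q (G z) j + dt * H (Q (Q z)) j" for j
  unfolding Q_linear H_Q[OF Qz, symmetric] by simp
 define a b c where "a = nrm (Q v')" "b = nrm (Q v)" "c = sqrt (2 * L)"
 have ab: "0 <= a" "0 <= b" "0 <= c" using L_pos by (auto simp: a_b_c_def)
 have Qzn: "nrm (Q z) <= (a + b) / 2"
  unfolding z_def Q_mean a_b_c_def using nrm_mean_le[of "Q v" "Q v'"] by simp
 have "a^2 - b\<^sup>2 = h * gsum N (%j. (2 * dt) * (Q (G z) j * Q z j) + (2 * dt) * (H (Q (Q z)) j * Q z j))"
 proof -
  have "(Q v' j)^2 - (Q v j)\<^sup>2 = (2 * dt) * (Q (G z) j * Q z j) + (2 * dt) * (H (Q (Q z)) j * Q z j)" for j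
  proof -
   have "Q z j = (Q v j + Q v' j) / 2" unfolding z_def Q_mean ..
   then have "(Q v' j)^2 - (Q v j)\<^sup>2 = (Q v' j - Q v j) * (2 * Q z j)" by (simp add: power2_eq_square algebra_simps)
   also have "Q v' j - Q v j = dt * Q (G z) j + dt * H (Q (Q z)) j" using Qeq[of j] by simp
   finally show ?thesis by (simp add: algebra_simps)
  qed
  then show ?thesis unfolding a_b_c_def nrm_sq right_diff_distrib[symmetric] gsum_diff[symmetric] by simp
 qed
 also have "... = 2 * dt * (h * gsum N (%j. Q (G z) j * Q z j))"
  unfolding gsum_add gsum_cmult H_Q_skew[OF Qz] by simp
 also have "... <= 2 * dt * (h * (4 * (c * nrm (Q z)) * gsum N (%j. (Q z j)^2)))"
  using energy_estimate[OF z sup_Dplus_le[OF z]] dt h_pos unfolding a_b_c_def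
  by (intro mult_left_mono) auto
 also have "... = 2 * dt * (4 * c * nrm (Q z) ^ 3)"
 proof -
  have "h * (4 * (c * nrm (Q z)) * gsum N (%j. (Q z j)^2))
    = 4 * (c * nrm (Q z)) * (h * gsum N (%j. (Q z j)^2))" by (simp only: mult_ac)
  also have "... = 4 * c * nrm (Q z) ^ 3"
   unfolding nrm_sq[symmetric] by (simp add: power2_eq_square power3_eq_cube)
  finally show ?thesis by (simp only:)
 qed
 also have "... <= 2 * dt * (4 * c * ((a + b) / 2) ^ 3)"
  using dt ab Qzn by (intro mult_left_mono power_mono) auto
 also have "... = dt * (c * (a + b) ^ 3)" by (simp add: power_divide)
 finally have *: "(a - b) * (a + b) <= (dt * (c * (a + b)^2)) * (a + b)"
  by (simp add: power2_eq_square power3_eq_cube algebra_simps)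
 have "a <= b + dt * (c * (b + a)^2)"
 proof (cases "a + b = 0")
  case True
  then have "a = 0" "b = 0" using ab by linarith+
  then show ?thesis by simp
 next
  case False
  then have "0 < a + b" using ab by linarith
  with * have "a - b <= dt * (c * (a + b)^2)" by (simp only: mult_le_cancel_right_pos)
  then show ?thesis by (simp add: add.commute)
 qed
 then show ?thesis by (simp add: a_b_c_def)
qed

text \<open>The bound \<open>2 * R\<close> comes from the iterates, not from the energy. Inserted
  into the growth inequality, where the new level stands on both sides, it yields an explicit
  increment with 9 = (1 + 2)^2.\<close>

lemma scheme_step_bounds:
 assumes v: "grid_fun N v" and s: "scheme_step L N dt v v'"
  and R: "0 < R" "nrm v <= R" "nrm (Q v) <= R"
  and dt: "0 < dt" "dt * (100 * CS * R) <= h"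
 shows "grid_fun N v'" "nrm v' = nrm v" "nrm (Q v') <= 2 * R"
  "nrm (Q v') <= nrm (Q v) + dt * (9 * sqrt (2 * L) * R^2)"
proof -
 show "grid_fun N v'" using s unfolding scheme_step_def by blast
 show "nrm v' = nrm v" by (rule scheme_step_mass[OF v s])
 obtain w where w: "fixpoint_iteration L N dt v w" "!!j. (%l. w l j) \<longlonglongrightarrow> v' j"
  using s unfolding scheme_step_def by blast
 show b: "nrm (Q v') <= 2 * R"
  by (rule LIMSEQ_le_const2[OF tendsto_nrm[OF tendsto_Q[OF w(2)]]])
   (use fixpoint_iteration_bounds[OF w(1) R dt] in blast)
 have "nrm (Q v') <= nrm (Q v) + dt * (sqrt (2 * L) * (nrm (Q v) + nrm (Q v'))^2)"
  using scheme_step_growth[OF v s] dt by simp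
 also have "... <= nrm (Q v) + dt * (sqrt (2 * L) * (R + 2 * R)^2)"
  using dt R b L_pos by (intro add_left_mono mult_left_mono power_mono add_mono) auto
 finally show "nrm (Q v') <= nrm (Q v) + dt * (9 * sqrt (2 * L) * R^2)"
  by (simp add: power2_eq_square)
qed

text \<open>The norm of \<open>Q (U n)\<close> starts at \<open>R / 2\<close> and may grow to
  \<open>R\<close>. The total growth \<open>9 * sqrt (2 * L) * R^2 * T\<close> fits into the
  remaining \<open>R / 2\<close> precisely under the condition on \<open>T\<close>.\<close>

lemma scheme_bounds:
 assumes U0: "grid_fun N (U 0)" "nrm (U 0) <= R / 2" "nrm (Q (U 0)) <= R / 2"
  and R: "0 < R" and dt: "0 < dt" "dt * (100 * CS * R) <= h"
  and T: "18 * sqrt (2 * L) * R * T <= 1"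
  and step: "!!k. k < n ==> scheme_step L N dt (U k) (U (Suc k))" and n: "real n * dt <= T"
 shows "grid_fun N (U n) \<and> nrm (U n) <= R / 2 \<and> nrm (Q (U n)) <= R"
proof -
 have *: "R / 2 + real k * dt * (9 * sqrt (2 * L) * R^2) <= R" if "real k * dt <= T" for k
 proof -
  have "real k * dt * (18 * sqrt (2 * L) * R) <= T * (18 * sqrt (2 * L) * R)"
   using that L_pos R by (intro mult_right_mono) auto
  also have "... <= 1" using T by (simp add: mult_ac)
  finally have "real k * dt * (18 * sqrt (2 * L) * R) * (R / 2) <= 1 * (R / 2)"
   using R by (intro mult_right_mono) auto
  then show ?thesis by (simp add: power2_eq_square mult_ac)
 qed
 have "k <= n ==> grid_fun N (U k) \<and> nrm (U k) <= R / 2 \<and>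
   nrm (Q (U k)) <= R / 2 + real k * dt * (9 * sqrt (2 * L) * R^2)" for k
 proof (induction k)
  case (Suc k)
  then have IH: "grid_fun N (U k)" "nrm (U k) <= R / 2"
   "nrm (Q (U k)) <= R / 2 + real k * dt * (9 * sqrt (2 * L) * R^2)" by auto
  have "real k * dt <= T" using Suc.prems n dt
   by (meson Suc_leD mult_right_mono of_nat_le_iff order_trans less_imp_le)
  then have "nrm (Q (U k)) <= R" using IH(3) *[of k] by linarith
  from scheme_step_bounds[OF IH(1) step _ _ this dt] R IH Suc.prems
  show ?case by (simp add: algebra_simps)
 qed (use U0 in simp)
 from this[of n] *[OF n] show ?thesis by simp
qed

lemma scheme_solution_exists:
 assumes u0: "grid_fun N (%j. u0 (gridpt L N j))" "nrm (%j. u0 (gridpt L N j)) <= R / 2"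
   "nrm (Q (%j. u0 (gridpt L N j))) <= R / 2"
  and R: "0 < R" and dt: "0 < dt" "dt * (100 * CS * R) <= h"
  and T: "18 * sqrt (2 * L) * R * T <= 1"
 shows "\<exists>U. scheme_solution L N dt T u0 U"
proof -
 define U where "U = rec_nat (%j. u0 (gridpt L N j)) (%_ v. SOME v'. scheme_step L N dt v v')"
 have U0: "U 0 = (%j. u0 (gridpt L N j))" and US: "U (Suc n) = (SOME v'. scheme_step L N dt (U n) v')" for n
  by (simp_all add: U_def)
 have "real n * dt <= T ==> scheme_step L N dt (U n) (U (Suc n))" for n
 \<comment> \<open>Strong induction, since solvability at level \<open>n\<close> needs the bound
   there, and that bound rests on all earlier levels being steps of the scheme.\<close>
 proof (induction n rule: less_induct)
  case (less n)
  have "scheme_step L N dt (U k) (U (Suc k))" if "k < n" for k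
  proof (rule less.IH[OF that])
   have "real k * dt <= real n * dt" using that dt by simp
   then show "real k * dt <= T" using less.prems by linarith
  qed
  from scheme_bounds[of U, OF _ _ _ R dt T this less.prems] u0
  have "grid_fun N (U n)" "nrm (U n) <= R" "nrm (Q (U n)) <= R" using R by (auto simp: U0)
  from scheme_step_exists[OF this(1) R this(2,3) dt] show ?case
   unfolding US by (rule someI_ex)
 qed
 then show ?thesis unfolding scheme_solution_def using U0 by metis
qed

end

section \<open>Lebesgue integration of periodic functions and the space L2\<close>

text \<open>Bridge to negligible sets, for which translation, reflection and countable unions are at
  hand.\<close>

lemma AE_lebesgue_iff_negligible: "(AE x in lebesgue. P x) \<longleftrightarrow> negligible {x. \<not> P x}"
 unfolding negligible_iff_null_sets
 using AE_iff_null_sets[of "{x. \<not> P x}" lebesgue] AE_E3[of P lebesgue]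
 by (auto simp: eventually_ae_filter intro: complete_measure.complete2 null_sets_completion_subset)

lemma LINT_reflect: "(LINT y:{a..b}|lebesgue. F (x - y)) = (LINT z:{x-b..x-a}|lebesgue. F z)"
 for F :: "real => 'a::euclidean_space"
proof -
 have "indicator {x-b..x-a} (x + (-1) * y) = (indicator {a..b} y :: real)" for y :: real
  by (auto simp: indicator_def)
 then show ?thesis
  using lebesgue_integral_real_affine[of "-1" "%z. indicator {x-b..x-a} z *\<^sub>R F z" x]
  by (simp add: set_lebesgue_integral_def)
qed

lemma set_integrable_reflect:
 "set_integrable lebesgue {x-b..x-a} F ==> set_integrable lebesgue {a..b} (%y. F (x - y))"
 for F :: "real => 'a::euclidean_space"
proof -
 assume "set_integrable lebesgue {x-b..x-a} F"
 moreover have "indicator {x-b..x-a} (x + (-1) * y) = (indicator {a..b} y :: real)" for y :: real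
  by (auto simp: indicator_def)
 ultimately show ?thesis
  using lebesgue_integrable_real_affine[of "%z. indicator {x-b..x-a} z *\<^sub>R F z" "-1" x]
  by (simp add: set_integrable_def)
qed

lemma LINT_shift: "(LINT y:{a..b}|lebesgue. F (t + y)) = (LINT z:{a+t..b+t}|lebesgue. F z)"
 for F :: "real => 'a::euclidean_space"
proof -
 have "indicator {a+t..b+t} (t + 1 * y) = (indicator {a..b} y :: real)" for y :: real
  by (auto simp: indicator_def)
 then show ?thesis
  using lebesgue_integral_real_affine[of 1 "%z. indicator {a+t..b+t} z *\<^sub>R F z" t]
  by (simp add: set_lebesgue_integral_def)
qed

lemma set_integrable_shift:
 "set_integrable lebesgue {a+t..b+t} F ==> set_integrable lebesgue {a..b} (%y. F (t + y))"
 for F :: "real => 'a::euclidean_space"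
proof -
 assume "set_integrable lebesgue {a+t..b+t} F"
 moreover have "indicator {a+t..b+t} (t + 1 * y) = (indicator {a..b} y :: real)" for y :: real
  by (auto simp: indicator_def)
 ultimately show ?thesis
  using lebesgue_integrable_real_affine[of "%z. indicator {a+t..b+t} z *\<^sub>R F z" 1 t]
  by (simp add: set_integrable_def)
qed

lemma LINT_combine:
 fixes F :: "real => 'a::euclidean_space"
 assumes "set_integrable lebesgue {a..b} F" "a <= c" "c <= b"
 shows "(LINT x:{a..c}|lebesgue. F x) + (LINT x:{c..b}|lebesgue. F x) = (LINT x:{a..b}|lebesgue. F x)"
 using integral_combine[of a b F c] assms
 by (simp add: set_lebesgue_integral_def set_integrable_def integral_restrict_space integrable_restrict_space)

text \<open>Young's inequality with a weight. The optimal weight B/A is perturbed by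
  \<open>d > 0\<close> to avoid a division by a vanishing norm, and \<open>d\<close> is tied to an
  arbitrary error \<open>e\<close>.\<close>

lemma integral_cauchy_schwarz:
 fixes f g :: "'a => real"
 assumes f: "f \<in> borel_measurable M" "integrable M (%x. (f x)^2)"
  and g: "g \<in> borel_measurable M" "integrable M (%x. (g x)^2)"
 shows "integrable M (%x. f x * g x)"
  and "(LINT x|M. \<bar>f x * g x\<bar>) <= sqrt (LINT x|M. (f x)^2) * sqrt (LINT x|M. (g x)^2)"
proof -
 have am: "\<bar>x * y\<bar> <= (s * x^2 + y^2 / s) / 2" if "0 < s" for x y s :: real
 proof -
  have "0 <= (sqrt s * \<bar>x\<bar> - \<bar>y\<bar> / sqrt s)^2" by simp
  also have "... = s * x^2 + y^2 / s - 2 * (\<bar>x\<bar> * \<bar>y\<bar>)"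
   using that by (simp add: power2_diff power_mult_distrib power_divide)
  finally show ?thesis by (simp add: abs_mult)
 qed
 show int: "integrable M (%x. f x * g x)"
  by (rule Bochner_Integration.integrable_bound[of _ "%x. ((f x)^2 + (g x)^2) / 2"])
   (use f g am[of 1] in auto)
 define A B where "A = sqrt (LINT x|M. (f x)^2)" and "B = sqrt (LINT x|M. (g x)^2)"
 have AB: "0 <= A" "0 <= B" by (auto simp: A_def B_def)
 have A2: "(LINT x|M. (f x)^2) = A^2" and B2: "(LINT x|M. (g x)^2) = B^2"
  by (simp_all add: A_def B_def)
 have "(LINT x|M. \<bar>f x * g x\<bar>) <= A * B + e" if "0 < e" for e
 proof -
  define d where "d = e / (A + B + 1)"
  have d: "0 < d" using that AB by (simp add: d_def)
  define s where "s = (B + d) / (A + d)"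
  have s: "0 < s" using AB d by (simp add: s_def)
  have "(LINT x|M. \<bar>f x * g x\<bar>) <= (LINT x|M. (s * (f x)^2 + (g x)^2 / s) / 2)"
   by (rule integral_mono) (use int f g am[OF s] in auto)
  also have "... = (s * A^2 + B^2 / s) / 2"
   using f g by (simp add: A2 B2)
  also have "s * A^2 <= A * (B + d)"
  proof -
   have "s * A^2 = (A * (B + d)) * (A / (A + d))" by (simp add: s_def power2_eq_square)
   also have "... <= (A * (B + d)) * 1" using AB d by (intro mult_left_mono) auto
   finally show ?thesis by simp
  qed
  also have "B^2 / s <= B * (A + d)"
  proof -
   have "B^2 / s = (B * (A + d)) * (B / (B + d))" by (simp add: s_def power2_eq_square)
   also have "... <= (B * (A + d)) * 1" using AB d by (intro mult_left_mono) auto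
   finally show ?thesis by simp
  qed
  also have "(A * (B + d) + B * (A + d)) / 2 <= A * B + d * (A + B + 1)"
   using d AB by (simp add: field_simps)
  also have "d * (A + B + 1) = e" using AB by (simp add: d_def)
  finally show ?thesis by simp
 qed
 then have "(LINT x|M. \<bar>f x * g x\<bar>) <= A * B" by (rule field_le_epsilon)
 then show "(LINT x|M. \<bar>f x * g x\<bar>) <= sqrt (LINT x|M. (f x)^2) * sqrt (LINT x|M. (g x)^2)"
  by (simp add: A_def B_def)
qed

locale torus =
 fixes L :: real
 assumes L_pos: "L > 0"
begin

abbreviation "M \<equiv> lebesgue_on {-L..L}"

lemma set_integrable_iff: "set_integrable lebesgue {-L..L} F \<longleftrightarrow> integrable M F"
 for F :: "real => 'a::euclidean_space"
 by (simp add: set_integrable_def integrable_restrict_space)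

lemma LINT_M: "(LINT x:{-L..L}|lebesgue. F x) = integral\<^sup>L M F"
 for F :: "real => 'a::euclidean_space"
 by (simp add: set_lebesgue_integral_def integral_restrict_space)

sublocale M: finite_measure M
 by (rule finite_measure_lebesgue_on) simp

lemma AE_M: "(AE x in M. P x) \<longleftrightarrow> (AE x in lebesgue. x \<in> {-L..L} \<longrightarrow> P x)"
 by (subst AE_restrict_space_iff) auto

lemma periodic_int:
 assumes "!!x. F (x + 2 * L) = F x"
 shows "F (x + 2 * L * of_int k) = F x"
proof (induction k rule: int_induct[where k = 0])
 case (step1 i)
 then show ?case using assms[of "x + 2 * L * of_int i"] by (simp add: algebra_simps)
next
 case (step2 i)
 then show ?case using assms[of "x + 2 * L * of_int (i - 1)"] by (simp add: algebra_simps)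
qed simp

text \<open>The exceptional set is covered by countably many translates of its part in
  \<open>{-L..L}\<close>.\<close>

lemma AE_periodic:
 assumes "AE x in M. P x" and P: "!!x. P (x + 2 * L) \<longleftrightarrow> P x"
 shows "AE x in lebesgue. P x"
proof -
 let ?N = "{x. \<not> (x \<in> {-L..L} \<longrightarrow> P x)}"
 have N: "negligible ?N"
  using assms(1) unfolding AE_M AE_lebesgue_iff_negligible .
 have "{x. \<not> P x} \<subseteq> (\<Union>k::int. (%x. 2 * L * of_int k + x) ` ?N)"
 proof safe
  fix x assume x: "\<not> P x"
  define k where "k = \<lfloor>(x + L) / (2 * L)\<rfloor>"
  have "of_int k <= (x + L) / (2 * L)" "(x + L) / (2 * L) < of_int k + 1"
   by (simp_all add: k_def)
  then have k: "2 * L * of_int k <= x + L" "x + L <= 2 * L * of_int k + 2 * L"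
   using L_pos by (simp_all add: field_simps)
  have "P ((x - 2 * L * of_int k) + 2 * L * of_int k) = P (x - 2 * L * of_int k)"
   by (rule periodic_int) (rule P)
  then have "\<not> P (x - 2 * L * of_int k)" using x by simp
  with k show "x \<in> (\<Union>k::int. (%x. 2 * L * of_int k + x) ` ?N)"
   by (intro UN_I[of k] image_eqI[of _ _ "x - 2 * L * of_int k"]) auto
 qed
 moreover have "negligible (\<Union>k::int. (%x. 2 * L * of_int k + x) ` ?N)"
 proof (rule negligible_countable_Union)
  show "countable (range (%k::int. (%x. 2 * L * of_int k + x) ` ?N))" by simp
 qed (use N negligible_translation in auto)
 ultimately show ?thesis
  unfolding AE_lebesgue_iff_negligible by (rule negligible_subset[rotated])
qed

lemma periodic_integrable:
 fixes F :: "real => 'a::euclidean_space"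
 assumes F: "integrable M F" and P: "!!x. F (x + 2 * L) = F x"
 shows "set_integrable lebesgue {a..b} F"
proof -
 have 1: "set_integrable lebesgue {-L + 2 * L * of_int k..L + 2 * L * of_int k} F" for k
 proof -
  have "set_integrable lebesgue {(-L + 2 * L * of_int k) + (- (2 * L * of_int k))..(L + 2 * L * of_int k) + (- (2 * L * of_int k))} F"
   using F by (simp add: set_integrable_iff)
  from set_integrable_shift[OF this]
  have "set_integrable lebesgue {-L + 2 * L * of_int k..L + 2 * L * of_int k} (%y. F (- (2 * L * of_int k) + y))" .
  moreover have "F (- (2 * L * of_int k) + y) = F y" for y
   using periodic_int[of F "y - 2 * L * of_int k" k, OF P] by simp
  ultimately show ?thesis by simp
 qed
 have 2: "set_integrable lebesgue {-L - 2 * L * real n..L + 2 * L * real n} F" for n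
 proof (induction n)
  case 0
  then show ?case using F by (simp add: set_integrable_iff)
 next
  case (Suc n)
  have e: "{-L - 2 * L * real (Suc n)..L + 2 * L * real (Suc n)} \<subseteq>
   ({-L - 2 * L * real n..L + 2 * L * real n} \<union> {-L + 2 * L * of_int (int n + 1)..L + 2 * L * of_int (int n + 1)})
   \<union> {-L + 2 * L * of_int (- int n - 1)..L + 2 * L * of_int (- int n - 1)}"
   using L_pos by (auto simp: algebra_simps)
  show ?case
   by (rule set_integrable_subset[OF _ _ e]) (intro set_integrable_Un 1 Suc | simp)+
 qed
 obtain n :: nat where n: "(\<bar>a\<bar> + \<bar>b\<bar>) / (2 * L) < n" using reals_Archimedean2 by blast
 then have "\<bar>a\<bar> + \<bar>b\<bar> < 2 * L * n" using L_pos by (simp add: field_simps)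
 then have "{a..b} \<subseteq> {-L - 2 * L * real n..L + 2 * L * real n}" using L_pos by auto
 then show ?thesis by (intro set_integrable_subset[OF 2]) auto
qed

lemma periodic_integral:
 fixes F :: "real => 'a::euclidean_space"
 assumes F: "integrable M F" and P: "!!x. F (x + 2 * L) = F x"
 shows "(LINT y:{x-L..x+L}|lebesgue. F y) = integral\<^sup>L M F"
proof -
 note int = periodic_integrable[OF assms]
 define k where "k = \<lfloor>x / (2 * L)\<rfloor>"
 \<comment> \<open>\<open>p\<close> is the end of a fundamental cell that lies in the window. The
   piece of the window to the left of \<open>p\<close> is moved one period to the right, which
   leaves the full cell from \<open>p\<close> to \<open>p + 2 * L\<close>.\<close>
 define p where "p = 2 * L * of_int k + L"
 have "of_int k <= x / (2 * L)" "x / (2 * L) < of_int k + 1"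
  by (simp_all add: k_def)
 then have p: "x - L <= p" "p <= x + L"
  using L_pos by (simp_all add: p_def field_simps)
 have Ps: "F (2 * L * of_int i + y) = F y" for i y
  using periodic_int[of F y i, OF P] by (simp add: add.commute)
 have "(LINT y:{x-L..x+L}|lebesgue. F y) = (LINT y:{x-L..p}|lebesgue. F y) + (LINT y:{p..x+L}|lebesgue. F y)"
  using LINT_combine[OF int p] by simp
 also have "(LINT y:{x-L..p}|lebesgue. F y) = (LINT y:{x+L..p+2*L}|lebesgue. F y)"
  using LINT_shift[of "x - L" p F "2 * L * of_int 1"] unfolding Ps by (simp add: algebra_simps)
 also have "(LINT y:{x+L..p+2*L}|lebesgue. F y) + (LINT y:{p..x+L}|lebesgue. F y) = (LINT y:{p..p+2*L}|lebesgue. F y)"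
  using LINT_combine[OF int, of p "x+L" "p+2*L"] p by (simp add: add.commute)
 also have "... = (LINT y:{-L..L}|lebesgue. F y)"
  using LINT_shift[of "-L" L F "2 * L * of_int (k + 1)"] unfolding Ps by (simp add: p_def algebra_simps)
 finally show ?thesis by (simp only: LINT_M)
qed

lemma periodic_integral_reflect:
 fixes F :: "real => 'a::euclidean_space"
 assumes F: "integrable M F" and P: "!!x. F (x + 2 * L) = F x"
 shows "integrable M (%y. F (x - y))" "(LINT y|M. F (x - y)) = integral\<^sup>L M F"
proof -
 have e: "x - - L = x + L" by simp
 show "integrable M (%y. F (x - y))"
  unfolding set_integrable_iff[symmetric] by (rule set_integrable_reflect) (rule periodic_integrable[OF assms])
 show "(LINT y|M. F (x - y)) = integral\<^sup>L M F"
  using LINT_reflect[of "-L" L F x] periodic_integral[OF assms, of x] unfolding LINT_M e by simp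
qed

lemma L2_perD:
 assumes "f \<in> L2_per L"
 shows "f (x + 2 * L) = f x" "f \<in> borel_measurable lebesgue" "f \<in> borel_measurable M"
  "integrable M (%x. (f x)^2)"
 using assms by (auto simp: L2_per_def periodic_def set_integrable_iff intro: measurable_restrict_space1)

lemma L2_perI:
 "(!!x. f (x + 2 * L) = f x) ==> f \<in> borel_measurable lebesgue ==> integrable M (%x. (f x)^2) ==> f \<in> L2_per L"
 by (auto simp: L2_per_def periodic_def set_integrable_iff)

lemma norm_L2_eq: "norm_L2 L f = sqrt (LINT x|M. (f x)^2)"
 by (simp add: norm_L2_def LINT_M)

lemma norm_L2_sq: "(norm_L2 L f)^2 = (LINT x|M. (f x)^2)"
 by (simp add: norm_L2_eq integral_nonneg)

lemma norm_L2_nonneg [simp]: "0 <= norm_L2 L f"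
 by (simp add: norm_L2_eq)

lemma L2_mult:
 assumes "f \<in> L2_per L" "g \<in> L2_per L"
 shows "integrable M (%x. f x * g x)" "\<bar>LINT x|M. f x * g x\<bar> <= norm_L2 L f * norm_L2 L g"
  "(LINT x|M. \<bar>f x * g x\<bar>) <= norm_L2 L f * norm_L2 L g"
proof -
 note cs = integral_cauchy_schwarz[OF L2_perD(3,4)[OF assms(1)] L2_perD(3,4)[OF assms(2)]]
 show "integrable M (%x. f x * g x)" by (rule cs)
 show "(LINT x|M. \<bar>f x * g x\<bar>) <= norm_L2 L f * norm_L2 L g"
  using cs(2) by (simp add: norm_L2_eq)
 then show "\<bar>LINT x|M. f x * g x\<bar> <= norm_L2 L f * norm_L2 L g"
  using integral_abs_bound[of M "%x. f x * g x"] by linarith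
qed

lemma L2_lincomb:
 assumes "f \<in> L2_per L" "g \<in> L2_per L"
 shows "(%x. a * f x + b * g x) \<in> L2_per L"
proof (rule L2_perI)
 note f = L2_perD[OF assms(1)] and g = L2_perD[OF assms(2)]
 show "a * f (x + 2 * L) + b * g (x + 2 * L) = a * f x + b * g x" for x using f g by simp
 show "(%x. a * f x + b * g x) \<in> borel_measurable lebesgue" using f g by simp
 have "integrable M (%x. a^2 * (f x)^2 + b^2 * (g x)^2 + 2 * a * b * (f x * g x))"
  using f g L2_mult[OF assms] by auto
 then show "integrable M (%x. (a * f x + b * g x)^2)"
  by (simp add: power2_sum power_mult_distrib mult_ac)
qed

lemma L2_diff: "f \<in> L2_per L ==> g \<in> L2_per L ==> (%x. f x - g x) \<in> L2_per L"
 using L2_lincomb[of f g 1 "-1"] by simp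

lemma L2_add: "f \<in> L2_per L ==> g \<in> L2_per L ==> (%x. f x + g x) \<in> L2_per L"
 using L2_lincomb[of f g 1 1] by simp

lemma continuous_L2:
 assumes "continuous_on UNIV f" "!!x. f (x + 2 * L) = f x"
 shows "f \<in> L2_per L"
proof (rule L2_perI)
 show "f \<in> borel_measurable lebesgue"
  using assms by (simp add: borel_measurable_continuous_onI measurable_completion)
 show "integrable M (%x. (f x)^2)"
  by (intro continuous_imp_integrable_real continuous_intros continuous_on_subset[OF assms(1)]) auto
qed (use assms in auto)

lemma L2_integrable: "f \<in> L2_per L ==> integrable M f"
 using L2_mult(1)[of f "%_. 1"] continuous_L2[of "%_. 1"] by simp

lemma norm_L2_triangle:
 assumes "f \<in> L2_per L" "g \<in> L2_per L"
 shows "norm_L2 L (%x. f x + g x) <= norm_L2 L f + norm_L2 L g"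
proof (rule power2_le_imp_le)
 have "(norm_L2 L (%x. f x + g x))^2 = (norm_L2 L f)^2 + (norm_L2 L g)^2 + 2 * (LINT x|M. f x * g x)"
  unfolding norm_L2_sq using L2_perD[OF assms(1)] L2_perD[OF assms(2)] L2_mult(1)[OF assms]
  by (simp add: power2_sum mult.assoc)
 also have "... <= (norm_L2 L f + norm_L2 L g)^2"
  using L2_mult(2)[OF assms] by (simp add: power2_sum)
 finally show "(norm_L2 L (%x. f x + g x))^2 <= (norm_L2 L f + norm_L2 L g)^2" .
qed simp

lemma norm_L2_cong_AE:
 assumes "AE x in lebesgue. f x = g x" "f \<in> L2_per L" "g \<in> L2_per L"
 shows "norm_L2 L f = norm_L2 L g"
proof -
 have "(LINT x|M. (f x)^2) = (LINT x|M. (g x)^2)"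
  by (rule integral_cong_AE) (use L2_perD[OF assms(2)] L2_perD[OF assms(3)] assms(1) in \<open>auto simp: AE_M\<close>)
 then show ?thesis by (simp add: norm_L2_eq)
qed

lemma norm_L2_zero_imp_AE:
 assumes "f \<in> L2_per L" "norm_L2 L f = 0"
 shows "AE x in lebesgue. f x = 0"
proof (rule AE_periodic)
 have "(LINT x|M. (f x)^2) = 0" using assms(2) by (simp add: norm_L2_eq)
 then show "AE x in M. f x = 0"
  using integral_nonneg_eq_0_iff_AE[of M "%x. (f x)^2"] L2_perD[OF assms(1)] by simp
qed (use L2_perD[OF assms(1)] in auto)

section \<open>Fourier series of real functions on the torus\<close>

definition ex :: "nat => real => complex" where
 "ex n x = cis (real n * (pi / L * x))"

text \<open>Functions are real, so coefficients of negative index are the conjugates of those of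
  positive index and only \<open>n >= 0\<close> is kept; the weight 2 accounts for the omitted
  half.\<close>

definition wt :: "nat => real" where
 "wt n = (if n = 0 then 1 else 2)"

definition fc :: "(real => real) => nat => complex" where
 "fc f n = (LINT x|M. of_real (f x) * cnj (ex n x)) / of_real (2 * L)"

definition tm :: "(nat => complex) => nat => real => real" where
 "tm c n x = wt n * Re (c n * ex n x)"

definition fs :: "(nat => complex) => nat => real => real" where
 "fs c m x = (\<Sum>n\<le>m. tm c n x)"

lemma wt_pos: "0 < wt n" "0 <= wt n" "wt n <= 2" by (auto simp: wt_def)

lemma ex_periodic: "ex n (x + 2 * L) = ex n x"
proof -
 have "ex n (x + 2 * L) = ex n x * cis (2 * pi * real n)"
  using L_pos by (simp add: ex_def cis_mult field_simps)
 also have "cis (2 * pi * real n) = 1"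
  by (simp add: complex_eq_iff mult.commute[of 2 pi] mult.assoc) (metis mult.assoc mult.commute cos_2npi sin_2npi)
 finally show ?thesis by simp
qed

lemma ex_add: "ex n (x + y) = ex n x * ex n y"
 by (simp add: ex_def cis_mult distrib_left)

lemma ex_minus: "ex n (- x) = cnj (ex n x)"
 by (simp add: ex_def cis_cnj)

lemma cmod_ex [simp]: "cmod (ex n x) = 1"
 by (simp add: ex_def)

lemma continuous_ex [continuous_intros]:
 "continuous_on A g ==> continuous_on A (%x. ex n (g x))"
 unfolding ex_def cis_conv_exp using L_pos by (intro continuous_intros) auto

lemma continuous_fs: "continuous_on UNIV (fs c m)"
 unfolding fs_def[abs_def] tm_def by (intro continuous_intros)

lemma fs_periodic: "fs c m (x + 2 * L) = fs c m x"
 by (simp add: fs_def tm_def ex_periodic)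

lemma fs_L2: "fs c m \<in> L2_per L"
 by (intro continuous_L2 continuous_fs fs_periodic)

lemma integrable_mult_ex:
 assumes "integrable M f"
 shows "integrable M (%x. of_real (f x) * ex n x)" "integrable M (%x. of_real (f x) * cnj (ex n x))"
proof -
 have m: "(%x. ex n x) \<in> borel_measurable M"
  by (intro measurable_restrict_space1 measurable_completion) (simp add: borel_measurable_continuous_onI continuous_ex)
 have m2: "(%x. cnj (ex n x)) \<in> borel_measurable M"
  by (intro measurable_restrict_space1 measurable_completion)
   (simp add: borel_measurable_continuous_onI continuous_ex continuous_on_cnj)
 have i: "integrable M (%x. complex_of_real (f x))" using assms by simp
 show "integrable M (%x. of_real (f x) * ex n x)"
  by (rule Bochner_Integration.integrable_bound[OF i]) (use m assms in \<open>auto simp: norm_mult\<close>)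
 show "integrable M (%x. of_real (f x) * cnj (ex n x))"
  by (rule Bochner_Integration.integrable_bound[OF i]) (use m2 assms in \<open>auto simp: norm_mult\<close>)
qed

lemma integral_cis:
 assumes "k \<noteq> 0"
 shows "(LINT x|M. cis (real_of_int k * (pi / L * x))) = 0"
proof -
 let ?a = "\<i> * of_real (real_of_int k * (pi / L))"
 have a: "?a \<noteq> 0" using assms L_pos by simp
 have e: "cis (real_of_int k * (pi / L * x)) = exp (?a * of_real x)" for x
  by (simp add: cis_conv_exp mult_ac)
 have "((%x. exp (?a * of_real x)) has_integral (exp (?a * of_real L) / ?a - exp (?a * of_real (-L)) / ?a)) {-L..L}"
 proof (rule fundamental_theorem_of_calculus)
  fix x
  have "((%z. exp (?a * z) / ?a) has_field_derivative exp (?a * of_real x)) (at (of_real x))"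
   using a by (auto intro!: derivative_eq_intros)
  from has_vector_derivative_real_field[OF this]
  show "((%x. exp (?a * of_real x) / ?a) has_vector_derivative exp (?a * of_real x)) (at x within {-L..L})" .
 qed (use L_pos in simp)
 moreover have "exp (?a * of_real L) = exp (?a * of_real (-L))"
 proof -
  have "?a * of_real L = \<i> * of_real (real_of_int k * pi)" using L_pos by simp
  moreover have "?a * of_real (-L) = - (\<i> * of_real (real_of_int k * pi))" using L_pos by simp
  moreover have "exp (\<i> * of_real (real_of_int k * pi)) = exp (- (\<i> * of_real (real_of_int k * pi)))"
   using cis_conv_exp[of "real_of_int k * pi"] cis_conv_exp[of "- (real_of_int k * pi)"]
   by (simp add: complex_eq_iff mult.commute[of "real_of_int k" pi])
  ultimately show ?thesis by simp
 qed
 ultimately have "((%x. cis (real_of_int k * (pi / L * x))) has_integral 0) {-L..L}"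
  unfolding e by simp
 moreover have "set_integrable lebesgue {-L..L} (%x. cis (real_of_int k * (pi / L * x)))"
  unfolding cis_conv_exp
  by (intro absolutely_integrable_continuous_real continuous_intros) (use L_pos in auto)
 ultimately show ?thesis
  unfolding LINT_M[symmetric] by (metis has_integral_set_lebesgue has_integral_unique)
qed

lemma ex_orth: "(LINT x|M. ex k x * cnj (ex l x)) = (if k = l then of_real (2 * L) else 0)"
proof (cases "k = l")
 case True
 have "ex k x * cnj (ex k x) = 1" for x by (simp add: complex_norm_square[symmetric])
 then show ?thesis using True L_pos by (simp add: measure_restrict_space scaleR_conv_of_real)
next
 case False
 have "ex k x * cnj (ex l x) = cis (real_of_int (int k - int l) * (pi / L * x))" for x
  by (simp add: ex_def cis_cnj cis_mult algebra_simps diff_divide_distrib)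
 then show ?thesis using integral_cis[of "int k - int l"] False by simp
qed

lemma ex_orth': "k + l \<noteq> 0 ==> (LINT x|M. cnj (ex k x) * cnj (ex l x)) = 0"
proof -
 assume "k + l \<noteq> 0"
 have "cnj (ex k x) * cnj (ex l x) = cis (real_of_int (- int k - int l) * (pi / L * x))" for x
  by (simp add: ex_def cis_cnj cis_mult algebra_simps)
 then show ?thesis using integral_cis[of "- int k - int l"] \<open>k + l \<noteq> 0\<close> by simp
qed

lemma fc_lincomb:
 assumes "integrable M f" "integrable M g"
 shows "fc (%x. a * f x + b * g x) n = of_real a * fc f n + of_real b * fc g n"
proof -
 have "of_real (a * f x + b * g x) * cnj (ex n x)
  = of_real a * (of_real (f x) * cnj (ex n x)) + of_real b * (of_real (g x) * cnj (ex n x))" for x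
  by (simp add: algebra_simps)
 then show ?thesis
  unfolding fc_def using integrable_mult_ex(2)[OF assms(1), of n] integrable_mult_ex(2)[OF assms(2), of n]
  by (simp add: add_divide_distrib)
qed

lemma fc_diff: "integrable M f ==> integrable M g ==> fc (%x. f x - g x) n = fc f n - fc g n"
 using fc_lincomb[of f g 1 "-1" n] by simp

lemma fc_0: "integrable M f ==> fc f 0 = of_real ((LINT x|M. f x) / (2 * L))"
 by (simp add: fc_def ex_def)

lemma integral_mult_ex:
 assumes "integrable M f"
 shows "(LINT x|M. of_real (f x) * ex n x) = of_real (2 * L) * cnj (fc f n)"
proof -
 have "(LINT x|M. of_real (f x) * ex n x) = (LINT x|M. cnj (of_real (f x) * cnj (ex n x)))" by simp
 also have "... = cnj (LINT x|M. of_real (f x) * cnj (ex n x))" by (rule Bochner_Integration.integral_cnj)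
 finally show ?thesis using L_pos by (simp add: fc_def)
qed

lemma integral_mult_tm:
 assumes "integrable M f"
 shows "integrable M (%x. f x * tm c n x)"
  "(LINT x|M. f x * tm c n x) = 2 * L * (wt n * Re (c n * cnj (fc f n)))"
proof -
 have e: "f x * tm c n x = Re (of_real (wt n) * c n * (of_real (f x) * ex n x))" for x
  by (simp add: tm_def algebra_simps)
 have i: "integrable M (%x. of_real (wt n) * c n * (of_real (f x) * ex n x))"
  by (intro integrable_mult_right integrable_mult_ex assms)
 show "integrable M (%x. f x * tm c n x)" unfolding e by (rule integrable_Re[OF i])
 have "(LINT x|M. f x * tm c n x) = Re (of_real (wt n) * c n * (of_real (2 * L) * cnj (fc f n)))"
  unfolding e integral_Re[OF i] by (simp only: integral_mult_right_zero integral_mult_ex[OF assms])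
 then show "(LINT x|M. f x * tm c n x) = 2 * L * (wt n * Re (c n * cnj (fc f n)))"
  by (simp add: algebra_simps)
qed

lemma integral_mult_fs:
 assumes "integrable M f"
 shows "integrable M (%x. f x * fs c m x)"
  "(LINT x|M. f x * fs c m x) = 2 * L * (\<Sum>n\<le>m. wt n * Re (c n * cnj (fc f n)))"
 using integral_mult_tm[OF assms, of c] by (simp_all add: fs_def sum_distrib_left)

text \<open>The expansion of the real part produces the frequencies \<open>k\<close> and
  \<open>-k\<close>; they coincide only for \<open>k = 0\<close>, where the imaginary part of
  \<open>c 0\<close> would be lost, hence the hypothesis.\<close>

lemma fc_tm:
 assumes "Im (c 0) = 0"
 shows "fc (tm c k) n = (if n = k then c k else 0)"
proof -
 have i: "integrable M (%x. ex k x * cnj (ex n x))" "integrable M (%x. cnj (ex k x) * cnj (ex n x))"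
  by (intro continuous_imp_integrable_real continuous_intros)+
 have e: "of_real (tm c k x) * cnj (ex n x) =
  (of_real (wt k / 2) * c k) * (ex k x * cnj (ex n x)) + (of_real (wt k / 2) * cnj (c k)) * (cnj (ex k x) * cnj (ex n x))" for x
 proof -
  have "complex_of_real (Re z) = (z + cnj z) / 2" for z by (simp add: complex_add_cnj)
  then show ?thesis unfolding tm_def of_real_mult by (simp only: complex_cnj_mult of_real_divide of_real_numeral) (simp add: field_simps)
 qed
 have I: "(LINT x|M. of_real (tm c k x) * cnj (ex n x)) =
  (of_real (wt k / 2) * c k) * (LINT x|M. ex k x * cnj (ex n x)) + (of_real (wt k / 2) * cnj (c k)) * (LINT x|M. cnj (ex k x) * cnj (ex n x))"
  unfolding e using i by simp
 show ?thesis
 proof (cases "k + n = 0")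
  case True
  then have "k = 0" "n = 0" by auto
  moreover have "cnj (c 0) = c 0" using assms by (simp add: complex_eq_iff)
  ultimately show ?thesis unfolding fc_def I
   using L_pos by (simp add: ex_def wt_def measure_restrict_space scaleR_conv_of_real)
 next
  case False
  then show ?thesis unfolding fc_def I ex_orth using ex_orth'[OF False] L_pos
   by (auto simp: wt_def)
 qed
qed

lemma fc_fs:
 assumes "Im (c 0) = 0"
 shows "fc (fs c m) n = (if n <= m then c n else 0)"
proof -
 have i: "integrable M (%x. of_real (tm c k x) * cnj (ex n x))" for k
  unfolding tm_def by (intro continuous_imp_integrable_real continuous_intros)
 have "fc (fs c m) n = (\<Sum>k\<le>m. fc (tm c k) n)"
  unfolding fc_def fs_def using i by (simp add: sum_distrib_right sum_divide_distrib)
 then show ?thesis using fc_tm[where c = c, OF assms] by simp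
qed

lemma norm_fs_sq:
 assumes "Im (c 0) = 0"
 shows "(norm_L2 L (fs c m))^2 = 2 * L * (\<Sum>n\<le>m. wt n * (cmod (c n))^2)"
proof -
 have "(norm_L2 L (fs c m))^2 = 2 * L * (\<Sum>n\<le>m. wt n * Re (c n * cnj (fc (fs c m) n)))"
  unfolding norm_L2_sq using integral_mult_fs(2)[OF L2_integrable[OF fs_L2], of c m c m]
  by (simp add: power2_eq_square)
 also have "(\<Sum>n\<le>m. wt n * Re (c n * cnj (fc (fs c m) n))) = (\<Sum>n\<le>m. wt n * (cmod (c n))^2)"
  by (intro sum.cong refl) (simp add: fc_fs[where c = c, OF assms] cmod_power2 flip: power2_eq_square)
 finally show ?thesis .
qed

lemma bessel:
 assumes "f \<in> L2_per L"
 shows "2 * L * (\<Sum>n\<le>m. wt n * (cmod (fc f n))^2) <= (norm_L2 L f)^2"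
proof -
 define B where "B = 2 * L * (\<Sum>n\<le>m. wt n * (cmod (fc f n))^2)"
 let ?s = "fs (fc f) m"
 have i: "integrable M f" by (rule L2_integrable[OF assms])
 have 0: "Im (fc f 0) = 0" using fc_0[OF i] by simp
 have ss: "(LINT x|M. (?s x)^2) = B"
  using norm_fs_sq[where c = "fc f", OF 0] by (simp add: norm_L2_sq B_def)
 have fs: "(LINT x|M. f x * ?s x) = B"
  unfolding integral_mult_fs[OF i] B_def by (simp add: cmod_power2 flip: power2_eq_square)
 have "0 <= (LINT x|M. (f x - ?s x)^2)" by simp
 also have "... = (LINT x|M. (f x)^2 + (?s x)^2 - 2 * (f x * ?s x))"
  by (simp add: power2_diff mult.assoc)
 also have "... = (LINT x|M. (f x)^2) + B - 2 * B"
  using L2_perD[OF assms] L2_perD[OF fs_L2] L2_mult(1)[OF assms fs_L2] ss fs by simp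
 finally show ?thesis by (simp add: B_def norm_L2_sq)
qed

lemma norm_L2_one: "norm_L2 L (%_. 1) = sqrt (2 * L)"
 using L_pos by (simp add: norm_L2_eq measure_restrict_space)

lemma L1_le_L2: "f \<in> L2_per L ==> (LINT x|M. \<bar>f x\<bar>) <= sqrt (2 * L) * norm_L2 L f"
 using L2_mult(3)[of "%_. 1" f] continuous_L2[of "%_. 1"] by (simp add: norm_L2_one)

lemma cmod_fc_le:
 assumes "f \<in> L2_per L"
 shows "cmod (fc f n) <= norm_L2 L f / sqrt (2 * L)"
proof -
 have "1 * (cmod (fc f n))^2 <= wt n * (cmod (fc f n))^2"
  by (intro mult_right_mono) (auto simp: wt_def)
 also have "... <= (\<Sum>k\<le>n. wt k * (cmod (fc f k))^2)"
  by (rule member_le_sum) (auto simp: wt_pos)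
 finally have "2 * L * (cmod (fc f n))^2 <= 2 * L * (\<Sum>k\<le>n. wt k * (cmod (fc f k))^2)"
  using L_pos by simp
 also have "... <= (norm_L2 L f)^2" by (rule bessel[OF assms])
 finally have "(sqrt (2 * L) * cmod (fc f n))^2 <= (norm_L2 L f)^2"
  using L_pos by (simp add: power_mult_distrib)
 then have "sqrt (2 * L) * cmod (fc f n) <= norm_L2 L f" by (rule power2_le_imp_le) simp
 then show ?thesis using L_pos by (simp add: field_simps)
qed

lemma norm_fs_diff:
 assumes "Im (c 0) = 0" "m <= l"
 shows "(norm_L2 L (%x. fs c l x - fs c m x))^2
  = 2 * L * ((\<Sum>n\<le>l. wt n * (cmod (c n))^2) - (\<Sum>n\<le>m. wt n * (cmod (c n))^2))"
proof -
 define d where "d = (%n. if n <= m then 0 else c n)"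
 have split: "(\<Sum>n\<le>l. g n) = (\<Sum>n\<le>m. g n) + (\<Sum>n\<in>{m<..l}. g n)" for g :: "nat => real"
  using assms(2) by (subst sum.union_disjoint[symmetric]) (auto intro: sum.cong)
 have "fs c l x - fs c m x = fs d l x" for x
  unfolding fs_def split by (simp add: tm_def d_def cong: sum.cong_simp)
 moreover have "Im (d 0) = 0" by (simp add: d_def)
 ultimately have "(norm_L2 L (%x. fs c l x - fs c m x))^2 = 2 * L * (\<Sum>n\<le>l. wt n * (cmod (d n))^2)"
  using norm_fs_sq[of d l] by simp
 then show ?thesis unfolding split by (simp add: d_def cong: sum.cong_simp)
qed

text \<open>The partial sums are Cauchy in L2, hence in L1, so a subsequence converges almost
  everywhere. Fatou's lemma shows both that the pointwise limit is square integrable and that the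
  partial sums approach it at the rate of the tail of the series.\<close>

lemma riesz_fischer:
 assumes s: "summable (%n. wt n * (cmod (c n))^2)" and c0: "Im (c 0) = 0"
 obtains f where "f \<in> L2_per L" "!!n. fc f n = c n" "(%m. norm_L2 L (%x. f x - fs c m x)) \<longlonglongrightarrow> 0"
proof -
 define S where "S = (%m. \<Sum>n\<le>m. wt n * (cmod (c n))^2)"
 define A where "A = (\<Sum>n. wt n * (cmod (c n))^2)"
 have S: "S \<longlonglongrightarrow> A" unfolding S_def A_def using s by (rule summable_LIMSEQ')
 have SA: "S m <= A" for m
  unfolding S_def A_def by (intro sum_le_suminf s) (auto simp: wt_pos)
 have nd: "(norm_L2 L (%x. fs c l x - fs c m x))^2 <= 2 * L * \<bar>S l - S m\<bar>" for l m
 proof (cases "m <= l")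
  case True
  then show ?thesis using norm_fs_diff[of c m l, OF c0] L_pos by (simp add: S_def)
 next
  case False
  have "norm_L2 L (%x. fs c l x - fs c m x) = norm_L2 L (%x. fs c m x - fs c l x)"
   by (simp add: norm_L2_eq power2_commute)
  then show ?thesis using norm_fs_diff[of c l m, OF c0] L_pos False
   by (simp add: S_def abs_minus_commute)
 qed
 have dL2: "(%x. fs c l x - fs c m x) \<in> L2_per L" for l m
  by (intro L2_diff fs_L2)
 obtain r where r: "strict_mono r" "AE x in M. Cauchy (%i. fs c (r i) x)"
 proof (rule cauchy_L1_AE_cauchy_subseq[of M "fs c"])
  show "integrable M (fs c n)" for n by (rule L2_integrable[OF fs_L2])
  show "\<exists>N. \<forall>i\<ge>N. \<forall>j\<ge>N. LINT x|M. norm (fs c i x - fs c j x) < e" if e: "0 < e" for e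
  proof -
   have "0 < (e / (2 * L))^2" using e L_pos by simp
   then obtain N where N: "!!i j. i \<ge> N ==> j \<ge> N ==> \<bar>S i - S j\<bar> < (e / (2 * L))^2"
    using LIMSEQ_imp_Cauchy[OF S] unfolding Cauchy_def dist_real_def by meson
   have "(LINT x|M. norm (fs c i x - fs c j x)) < e" if "i \<ge> N" "j \<ge> N" for i j
   proof -
    have "(norm_L2 L (%x. fs c i x - fs c j x))^2 < 2 * L * (e / (2 * L))^2"
     using nd[of i j] N[OF that] L_pos by (intro le_less_trans[OF nd]) simp
    also have "... = (e / sqrt (2 * L))^2"
     using L_pos by (simp add: power_divide power2_eq_square)
    finally have "norm_L2 L (%x. fs c i x - fs c j x) < e / sqrt (2 * L)"
     by (rule power2_less_imp_less) (use e L_pos in simp)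
    then have "sqrt (2 * L) * norm_L2 L (%x. fs c i x - fs c j x) < e"
     using L_pos by (simp add: field_simps)
    then show ?thesis using L1_le_L2[OF dL2, of i j] by simp
   qed
   then show ?thesis by blast
  qed
 qed
 \<comment> \<open>Where the subsequence diverges, \<open>lim\<close> still denotes some number, the
   same at \<open>x\<close> and at \<open>x + 2 * L\<close>; so \<open>f\<close> is periodic without
   exception.\<close>
 define f where "f = (%x. lim (%i. fs c (r i) x))"
 have fm: "f \<in> borel_measurable lebesgue"
  unfolding f_def by (intro borel_measurable_lim_metric L2_perD(2) fs_L2)
 have lim: "AE x in M. (%i. fs c (r i) x) \<longlonglongrightarrow> f x"
  using r(2) by eventually_elim (simp add: f_def Cauchy_convergent_iff convergent_LIMSEQ_iff)
 have key: "integrable M (%x. (f x - fs c m x)^2) \<and> (LINT x|M. (f x - fs c m x)^2) <= 2 * L * (A - S m)" for m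
 proof -
  let ?g = "%i x. (fs c (r i) x - fs c m x)^2"
  have gm: "?g i \<in> borel_measurable M" for i using L2_perD(3)[OF dL2] by simp
  have m: "(%x. (f x - fs c m x)^2) \<in> borel_measurable M"
   using measurable_restrict_space1[OF fm] L2_perD(3)[OF fs_L2] by simp
  have "(\<integral>\<^sup>+x. ennreal ((f x - fs c m x)^2) \<partial>M) = (\<integral>\<^sup>+x. liminf (%i. ennreal (?g i x)) \<partial>M)"
  proof (rule nn_integral_cong_AE)
   show "AE x in M. ennreal ((f x - fs c m x)^2) = liminf (%i. ennreal (?g i x))"
    using lim
   proof eventually_elim
    case (elim x)
    then have "(%i. ennreal (?g i x)) \<longlonglongrightarrow> ennreal ((f x - fs c m x)^2)"
     by (intro tendsto_ennrealI tendsto_intros)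
    from lim_imp_Liminf[OF sequentially_bot this] show ?case by (rule sym)
   qed
  qed
  also have "... <= liminf (%i. \<integral>\<^sup>+x. ennreal (?g i x) \<partial>M)"
   by (rule nn_integral_liminf) (use gm in simp)
  also have "... <= ennreal (2 * L * (A - S m))"
  proof (rule Liminf_le)
   show "\<forall>\<^sub>F i in sequentially. (\<integral>\<^sup>+x. ennreal (?g i x) \<partial>M) <= ennreal (2 * L * (A - S m))"
    using eventually_ge_at_top[of m]
   proof eventually_elim
    case (elim i)
    then have "m <= r i" using seq_suble[OF r(1), of i] by linarith
    then have "S m <= S (r i)" unfolding S_def by (intro sum_mono2) (auto simp: wt_pos)
    have "(\<integral>\<^sup>+x. ennreal (?g i x) \<partial>M) = ennreal (LINT x|M. ?g i x)"
     by (rule nn_integral_eq_integral) (use L2_perD(4)[OF dL2] in auto)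
    also have "(LINT x|M. ?g i x) <= 2 * L * (S (r i) - S m)"
     using nd[of "r i" m] \<open>S m <= S (r i)\<close> by (simp add: norm_L2_sq)
    also have "... <= 2 * L * (A - S m)" using SA[of "r i"] L_pos by simp
    finally show ?case by (simp add: ennreal_leI)
   qed
  qed simp
  finally have le: "(\<integral>\<^sup>+x. ennreal ((f x - fs c m x)^2) \<partial>M) <= ennreal (2 * L * (A - S m))" .
  have int: "integrable M (%x. (f x - fs c m x)^2)"
   by (rule integrableI_nonneg[OF m]) (use le_less_trans[OF le] in auto)
  have "ennreal (LINT x|M. (f x - fs c m x)^2) <= ennreal (2 * L * (A - S m))"
   using le nn_integral_eq_integral[OF int] by simp
  then show ?thesis using int SA[of m] L_pos by (simp add: ennreal_le_iff)
 qed
 have fp: "f (x + 2 * L) = f x" for x by (simp add: f_def fs_periodic)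
 have gL2: "(%x. f x - fs c m x) \<in> L2_per L" for m
  using key[of m] fm L2_perD(2)[OF fs_L2] by (intro L2_perI) (auto simp: fp fs_periodic)
 have fL2: "f \<in> L2_per L" using L2_add[OF gL2[of 0] fs_L2[of c 0]] by simp
 have conv: "(%m. norm_L2 L (%x. f x - fs c m x)) \<longlonglongrightarrow> 0"
 proof (rule tendsto_sandwich[of "%_. 0"])
  show "\<forall>\<^sub>F m in sequentially. norm_L2 L (%x. f x - fs c m x) <= sqrt (2 * L * (A - S m))"
   using key by (simp add: norm_L2_eq)
  have "(%m. sqrt (2 * L * (A - S m))) \<longlonglongrightarrow> sqrt (2 * L * (A - A))"
   by (intro tendsto_intros S)
  then show "(%m. sqrt (2 * L * (A - S m))) \<longlonglongrightarrow> 0" by simp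
 qed auto
 have "fc f n = c n" for n
 proof -
  have "(%m. cmod (fc f n - c n)) \<longlonglongrightarrow> 0"
  proof (rule tendsto_sandwich[of "%_. 0"])
   show "\<forall>\<^sub>F m in sequentially. cmod (fc f n - c n) <= norm_L2 L (%x. f x - fs c m x) / sqrt (2 * L)"
    using eventually_ge_at_top[of n]
   proof eventually_elim
    case (elim m)
    have "fc f n - c n = fc (%x. f x - fs c m x) n"
     using elim by (simp add: fc_diff[OF L2_integrable[OF fL2] L2_integrable[OF fs_L2]] fc_fs[where c = c, OF c0])
    then show ?case using cmod_fc_le[OF gL2] by simp
   qed
   show "(%m. norm_L2 L (%x. f x - fs c m x) / sqrt (2 * L)) \<longlonglongrightarrow> 0"
    using tendsto_divide[OF conv tendsto_const[of "sqrt (2 * L)"]] L_pos by simp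
  qed auto
  then show ?thesis by (simp add: LIMSEQ_const_iff)
 qed
 then show ?thesis using that fL2 conv by blast
qed

section \<open>Abel means, the Poisson kernels and Lebesgue points\<close>

lemma ex_power: "ex n y = ex 1 y ^ n"
 by (simp add: ex_def Complex.DeMoivre)

lemma fc_reflect_sum:
 fixes f :: "real => real"
 assumes f: "integrable M f" and p: "!!x. f (x + 2 * L) = f x"
 shows "(LINT y|M. of_real (f (x - y)) * ex n y) = of_real (2 * L) * (fc f n * ex n x)"
  and "integrable M (%y. of_real (f (x - y)) * ex n y)"
proof -
 let ?F = "%z. of_real (f z) * ex n (x - z)"
 have e: "?F z = ex n x * (of_real (f z) * cnj (ex n z))" for z
  using ex_add[of n x "-z"] by (simp add: ex_minus mult_ac)
 have F: "integrable M ?F" unfolding e using integrable_mult_ex(2)[OF f] by simp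
 have P: "?F (z + 2 * L) = ?F z" for z unfolding e by (simp add: p ex_periodic)
 note r = periodic_integral_reflect[of ?F x, OF F P]
 show "integrable M (%y. of_real (f (x - y)) * ex n y)" using r(1) by simp
 have "(LINT y|M. of_real (f (x - y)) * ex n y) = (LINT z|M. ?F z)" using r(2) by simp
 also have "... = ex n x * (LINT z|M. of_real (f z) * cnj (ex n z))"
  unfolding e by simp
 finally show "(LINT y|M. of_real (f (x - y)) * ex n y) = of_real (2 * L) * (fc f n * ex n x)"
  using L_pos by (simp add: fc_def)
qed

text \<open>The Herglotz kernel \<open>(1 + z) / (1 - z)\<close> at \<open>z = r * ex 1 y\<close>.
  Its real part is the Poisson kernel and its imaginary part the conjugate Poisson kernel, so both
  Abel means come out of one complex computation.\<close>

definition pk :: "real => real => complex" where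
 "pk r y = (1 + of_real r * ex 1 y) / (1 - of_real r * ex 1 y)"

lemma pk_sums:
 assumes "0 <= r" "r < 1"
 shows "(%n. of_real (wt n * r ^ n) * ex n y) sums pk r y"
proof -
 let ?z = "of_real r * ex 1 y"
 have n: "norm ?z < 1" using assms by (simp add: norm_mult)
 have 1: "(%n. ?z ^ n) sums (1 / (1 - ?z))" by (rule geometric_sums[OF n])
 have "(%n. 2 * ?z ^ n - (if n = 0 then 1 else 0)) sums (2 * (1 / (1 - ?z)) - 1)"
  by (intro sums_diff sums_mult 1) (use sums_single[of 0 "%_. 1"] in simp)
 moreover have "2 * ?z ^ n - (if n = 0 then 1 else 0) = of_real (wt n * r ^ n) * ex n y" for n
  by (auto simp: wt_def ex_power[of n] power_mult_distrib)
 moreover have "?z \<noteq> 1" using n by auto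
 then have "2 * (1 / (1 - ?z)) - 1 = pk r y"
  by (simp add: pk_def field_simps)
 ultimately show ?thesis by simp
qed

text \<open>The geometric series is integrated term by term; its terms have L1 norm
  \<open>wt n * r ^ n\<close> times that of \<open>f\<close>, which is summable.\<close>

lemma poisson_sum:
 fixes f :: "real => real"
 assumes f: "integrable M f" and p: "!!x. f (x + 2 * L) = f x" and r: "0 <= r" "r < 1"
 shows "(%n. of_real (wt n * r ^ n) * (fc f n * ex n x)) sums
  ((LINT y|M. of_real (f (x - y)) * pk r y) / of_real (2 * L))"
proof -
 let ?g = "%n y. of_real (f (x - y)) * (of_real (wt n * r ^ n) * ex n y)"
 have e: "?g n y = of_real (wt n * r ^ n) * (of_real (f (x - y)) * ex n y)" for n y
  by (simp add: mult_ac)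
 have gi: "integrable M (?g n)" for n unfolding e
  by (intro integrable_mult_right fc_reflect_sum(2)[OF f p])
 have fi: "integrable M (%y. f (x - y))" by (rule periodic_integral_reflect(1)[OF f p])
 have ng: "norm (?g n y) = wt n * r ^ n * \<bar>f (x - y)\<bar>" for n y
  using r by (simp add: norm_mult norm_power wt_pos abs_mult)
 have sr: "summable (%n. wt n * r ^ n)"
  by (rule summable_comparison_test'[of "%n. 2 * r ^ n"])
   (use r in \<open>auto intro!: summable_mult summable_geometric mult_right_mono simp: abs_mult wt_pos\<close>)
 have "(%n. integral\<^sup>L M (?g n)) sums (LINT y|M. (\<Sum>n. ?g n y))"
 proof (rule sums_integral[OF gi])
  show "AE y in M. summable (%n. norm (?g n y))"
   unfolding ng by (intro AE_I2 summable_mult2 sr)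
  have "(LINT y|M. norm (?g n y)) = (wt n * r ^ n) * (LINT y|M. \<bar>f (x - y)\<bar>)" for n
   unfolding ng by simp
  then show "summable (%n. LINT y|M. norm (?g n y))"
   by (simp only:) (intro summable_mult2 sr)
 qed
 moreover have "(\<Sum>n. ?g n y) = of_real (f (x - y)) * pk r y" for y
  using sums_unique[OF sums_mult[OF pk_sums[OF r]]] by simp
 moreover have "integral\<^sup>L M (?g n) = of_real (2 * L) * (of_real (wt n * r ^ n) * (fc f n * ex n x))" for n
 proof -
  have "integral\<^sup>L M (?g n) = of_real (wt n * r ^ n) * (LINT y|M. of_real (f (x - y)) * ex n y)"
   unfolding e by (rule integral_mult_right_zero)
  then show ?thesis unfolding fc_reflect_sum(1)[OF f p] by (simp only: mult_ac)
 qed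
 ultimately have "(%n. of_real (2 * L) * (of_real (wt n * r ^ n) * (fc f n * ex n x))) sums
  (LINT y|M. of_real (f (x - y)) * pk r y)" by simp
 from sums_divide[OF this, of "of_real (2 * L)"] show ?thesis using L_pos by simp
qed

text \<open>The window is cut out by an indicator under the fixed measure \<open>M\<close>, because
  the kernels below are integrated over one period. It is centred, as both sides of \<open>x\<close>
  enter a principal value.\<close>

definition lebesgue_point :: "(real => real) => real => bool" where
 "lebesgue_point f x \<longleftrightarrow>
  ((%h. (LINT y|M. indicator {-h..h} y * \<bar>f (x - y) - f x\<bar>) / h) \<longlongrightarrow> 0) (at_right 0)"

text \<open>For each rational \<open>q\<close> the averages of \<open>|f - q|\<close> over
  \<open>[x, x + h]\<close> converge outside a null set, and \<open>f x\<close> is approximated by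
  rationals. The left half of the window is obtained from the same statement for the reflected
  function.\<close>

lemma lebesgue_point_AE:
 fixes f :: "real => real"
 assumes f: "integrable M f" and p: "!!x. f (x + 2 * L) = f x"
 shows "AE x in lebesgue. lebesgue_point f x"
proof -
 define g where "g = (%(q::rat) z. \<bar>f z - of_rat q\<bar>)"
 have gi: "set_integrable lebesgue {a..b} (g q)" for a b q
 proof -
  have "integrable M (g q)" using f by (simp add: g_def)
  then show ?thesis by (rule periodic_integrable) (simp add: g_def p)
 qed
 have gi': "set_integrable lebesgue {a..b} (%z. g q (- z))" for a b q
  using set_integrable_reflect[of 0 b a "g q"] gi by simp
 define good where "good = (%(u :: real => real) x. \<forall>e>0. \<exists>d>0. \<forall>h. 0 < h \<and> h < d \<longrightarrow>
   \<bar>(LINT z:{x..x+h}|lebesgue. u z) / h - u x\<bar> < e)"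
 have ex: "\<exists>N. negligible N \<and> (\<forall>x. x \<notin> N \<longrightarrow> good u x)" if u: "!!a b. set_integrable lebesgue {a..b} u" for u
 proof -
  have "u integrable_on cbox a b" for a b
   using set_lebesgue_integral_eq_integral(1)[OF u] by simp
  then obtain N where N: "negligible N"
   "!!x e. [|x \<notin> N; 0 < e|] ==> \<exists>d>0. \<forall>h. 0 < h \<and> h < d \<longrightarrow>
     norm (integral (cbox x (x + h *\<^sub>R One)) u /\<^sub>R h ^ DIM(real) - u x) < e"
   by (rule integrable_ccontinuous_explicit[of u]) blast
  have "good u x" if "x \<notin> N" for x
   using N(2)[OF that] unfolding good_def
   by (simp add: set_lebesgue_integral_eq_integral(2)[OF u] divide_inverse mult.commute)
  then show ?thesis using N(1) by blast
 qed
 have "\<exists>N. \<forall>q. negligible (N q) \<and> (\<forall>x. x \<notin> N q \<longrightarrow> good (g q) x)"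
  using ex[OF gi] by metis
 then obtain N1 where N1: "!!q. negligible (N1 q)" "!!q x. x \<notin> N1 q ==> good (g q) x" by blast
 have "\<exists>N. \<forall>q. negligible (N q) \<and> (\<forall>x. x \<notin> N q \<longrightarrow> good (%z. g q (- z)) x)"
  using ex[OF gi'] by metis
 then obtain N2 where N2: "!!q. negligible (N2 q)" "!!q x. x \<notin> N2 q ==> good (%z. g q (- z)) x" by blast
 have "lebesgue_point f x" if x: "!!q. x \<notin> N1 q" "!!q. - x \<notin> N2 q" for x
  unfolding lebesgue_point_def
 proof (rule tendstoI)
  fix e :: real assume e: "0 < e"
  \<comment> \<open>Budget relative to \<open>h\<close>: each half window costs \<open>e / 5\<close>
    for \<open>|f - q|\<close>, and the difference of \<open>q\<close> and \<open>f x\<close> costs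
    \<open>e / 5\<close> over both halves, in all \<open>3 * e / 5\<close>.\<close>
  have "f x - e / 10 < f x + e / 10" using e by simp
  then obtain q where "f x - e / 10 < of_rat q" "of_rat q < f x + e / 10"
   using of_rat_dense by blast
  then have q: "\<bar>f x - of_rat q\<bar> < e / 10" unfolding abs_less_iff by linarith
  obtain d1 where d1: "d1 > 0" "!!h. 0 < h ==> h < d1 ==> \<bar>(LINT z:{x..x+h}|lebesgue. g q z) / h - g q x\<bar> < e / 10"
   using N1(2)[OF x(1)] e unfolding good_def by (metis divide_pos_pos zero_less_numeral)
  obtain d2 where d2: "d2 > 0" "!!h. 0 < h ==> h < d2 ==> \<bar>(LINT z:{-x..-x+h}|lebesgue. g q (- z)) / h - g q (- (- x))\<bar> < e / 10"
   using N2(2)[OF x(2)] e unfolding good_def by (metis divide_pos_pos zero_less_numeral)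
  define d where "d = min (min d1 d2) L"
  have bound: "\<bar>(LINT y|M. indicator {-h..h} y * \<bar>f (x - y) - f x\<bar>) / h\<bar> < e" if h: "0 < h" "h < d" for h
  proof -
   have h': "h < d1" "h < d2" "h < L" using h by (auto simp: d_def)
   have gx: "g q x < e / 10" using q by (simp add: g_def)
   have "(LINT z:{x..x+h}|lebesgue. g q z) / h < e / 5" using d1(2)[OF h(1) h'(1)] gx by linarith
   then have I1: "(LINT z:{x..x+h}|lebesgue. g q z) < e / 5 * h" using h by (simp add: field_simps)
   have "(LINT z:{-x..-x+h}|lebesgue. g q (- z)) / h < e / 5" using d2(2)[OF h(1) h'(2)] gx unfolding minus_minus by linarith
   then have "(LINT z:{-x..-x+h}|lebesgue. g q (- z)) < e / 5 * h" using h by (simp add: field_simps)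
   then have I2: "(LINT z:{x-h..x}|lebesgue. g q z) < e / 5 * h"
    using LINT_reflect[of "-x" "-x+h" "g q" 0] by simp
   have I: "(LINT z:{x-h..x+h}|lebesgue. g q z) < 2 * e / 5 * h"
    using LINT_combine[OF gi, of "x-h" x "x+h" q] I1 I2 h by simp
   have i0: "integrable M (%y. f (x - y))" by (rule periodic_integral_reflect(1)[OF f p])
   have ind: "(%y. indicator {-h..h} y :: real) \<in> borel_measurable M"
    by (intro measurable_restrict_space1 measurable_completion) simp
   have i1: "integrable M (%y. indicator {-h..h} y * u y)" if "integrable M u" for u :: "real => real"
    by (rule Bochner_Integration.integrable_bound[OF that]) (use that ind in \<open>auto simp: indicator_def\<close>)
   have "(LINT y|M. indicator {-h..h} y * \<bar>f (x - y) - f x\<bar>)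
     <= (LINT y|M. indicator {-h..h} y * g q (x - y) + indicator {-h..h} y * (e / 10))"
   proof (rule integral_mono)
    show "integrable M (%y. indicator {-h..h} y * \<bar>f (x - y) - f x\<bar>)"
     by (rule i1) (use i0 in simp)
    show "integrable M (%y. indicator {-h..h} y * g q (x - y) + indicator {-h..h} y * (e / 10))"
     by (intro Bochner_Integration.integrable_add i1) (use i0 in \<open>simp_all add: g_def\<close>)
    show "indicator {-h..h} y * \<bar>f (x - y) - f x\<bar> <= indicator {-h..h} y * g q (x - y) + indicator {-h..h} y * (e / 10)" for y
    proof -
     have "\<bar>f (x - y) - f x\<bar> <= g q (x - y) + e / 10" using q unfolding g_def by linarith
     then show ?thesis by (simp add: indicator_def)
    qed
   qed
   also have "... = (LINT y|M. indicator {-h..h} y * g q (x - y)) + (LINT y|M. indicator {-h..h} y * (e / 10))"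
    by (intro Bochner_Integration.integral_add i1) (use i0 in \<open>simp_all add: g_def\<close>)
   also have "(LINT y|M. indicator {-h..h} y * (e / 10)) = 2 * h * (e / 10)"
    using h h' by (simp add: measure_restrict_space Int_absorb1)
   also have "(LINT y|M. indicator {-h..h} y * g q (x - y)) = (LINT y:{-h..h}|lebesgue. g q (x - y))"
    unfolding LINT_M[symmetric] set_lebesgue_integral_def
    by (intro Bochner_Integration.integral_cong) (use h' in \<open>auto simp: indicator_def\<close>)
   also have "... = (LINT z:{x-h..x+h}|lebesgue. g q z)"
    using LINT_reflect[of "-h" h "g q" x] by simp
   finally have le: "(LINT y|M. indicator {-h..h} y * \<bar>f (x - y) - f x\<bar>) < 3 * e / 5 * h"
    using I by (simp add: algebra_simps)
   have ge: "0 <= (LINT y|M. indicator {-h..h} y * \<bar>f (x - y) - f x\<bar>)"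
    by (intro Bochner_Integration.integral_nonneg) simp
   have "(LINT y|M. indicator {-h..h} y * \<bar>f (x - y) - f x\<bar>) / h < 3 * e / 5"
    using le h by (simp only: pos_divide_less_eq)
   then have "(LINT y|M. indicator {-h..h} y * \<bar>f (x - y) - f x\<bar>) / h < e"
    using e by linarith
   moreover have "0 <= (LINT y|M. indicator {-h..h} y * \<bar>f (x - y) - f x\<bar>) / h" using ge h by simp
   ultimately show ?thesis by linarith
  qed
  have "0 < d" using d1 d2 L_pos by (simp add: d_def)
  then show "\<forall>\<^sub>F h in at_right 0. dist ((LINT y|M. indicator {-h..h} y * \<bar>f (x - y) - f x\<bar>) / h) 0 < e"
   unfolding eventually_at_right_field dist_real_def using bound by (auto intro!: exI[of _ d])
 qed
 then have "{x. \<not> lebesgue_point f x} \<subseteq> (\<Union>q. N1 q) \<union> (\<Union>q. uminus ` N2 q)"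
  by (force simp: image_iff)
 moreover have "negligible ((\<Union>q. N1 q) \<union> (\<Union>q. uminus ` N2 q))"
 proof (intro negligible_Un negligible_countable_Union)
  show "negligible t" if "t \<in> range (%q. uminus ` N2 q)" for t
   using that N2(1) by (auto intro!: negligible_differentiable_image_negligible)
 qed (use N1(1) in auto)
 ultimately show ?thesis
  unfolding AE_lebesgue_iff_negligible by (rule negligible_subset[rotated])
qed

end

section \<open>Approximate identities and bounds for the Poisson kernel\<close>

text \<open>By concavity the sine lies above its chord from 0 to pi/2.\<close>

lemma jordan_sin:
 assumes "0 <= x" "x <= pi / 2"
 shows "2 * x / pi <= sin x"
proof -
 have "concave_on {0..pi/2} sin"
  by (rule f''_le0_imp_concave[where f' = cos and f'' = "%x. - sin x"])
   (auto intro!: derivative_eq_intros sin_ge_zero)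
 then have "(1 - 2 * x / pi) * sin 0 + (2 * x / pi) * sin (pi / 2) <= sin ((1 - 2 * x / pi) *\<^sub>R 0 + (2 * x / pi) *\<^sub>R (pi / 2))"
  by (rule concave_onD) (use assms in \<open>auto simp: field_simps\<close>)
 then show ?thesis by simp
qed

lemma one_minus_cos_ge:
 assumes "\<bar>t\<bar> <= pi"
 shows "2 * t^2 / pi^2 <= 1 - cos t"
proof -
 have "2 * (\<bar>t\<bar> / 2) / pi <= sin (\<bar>t\<bar> / 2)"
  by (rule jordan_sin) (use assms in auto)
 then have "(\<bar>t\<bar> / pi)^2 <= (sin (\<bar>t\<bar> / 2))^2"
  by (intro power_mono) auto
 moreover have "cos t = 1 - 2 * (sin (\<bar>t\<bar> / 2))^2"
  using cos_double_sin[of "\<bar>t\<bar> / 2"] by simp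
 ultimately show ?thesis by (simp add: power_divide)
qed

context torus begin

text \<open>Kernels dominated by a multiple of \<open>min (1/\<delta>) (\<delta>/y^2)\<close> are compared with
 a sum of dyadic averages.\<close>

lemma approximate_identity:
 fixes k :: "real => real => real" and g :: "real => real"
 assumes g: "integrable M g"
  and avg: "((%h. (LINT y|M. indicator {-h..h} y * \<bar>g y\<bar>) / h) \<longlongrightarrow> 0) (at_right 0)"
  and d0: "0 < d0" and C: "0 <= C"
  and km: "!!d. 0 < d ==> d < d0 ==> k d \<in> borel_measurable M"
  and k1: "!!d y. 0 < d ==> d < d0 ==> \<bar>y\<bar> <= L ==> \<bar>k d y\<bar> <= C / d"
  and k2: "!!d y. 0 < d ==> d < d0 ==> \<bar>y\<bar> <= L ==> \<bar>k d y\<bar> * y^2 <= C * d"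
 shows "((%d. LINT y|M. k d y * g y) \<longlongrightarrow> 0) (at_right 0)"
proof (rule tendstoI)
 fix e :: real assume e: "0 < e"
 define \<eta> where "\<eta> = e / (16 * (C + 1))"
 have \<eta>: "0 < \<eta>" using e C by (simp add: \<eta>_def)
 define \<Psi> where "\<Psi> = (%h. LINT y|M. indicator {-h..h} y * \<bar>g y\<bar>)"
 obtain b where b: "0 < b" "!!h. 0 < h ==> h < b ==> \<bar>\<Psi> h / h\<bar> < \<eta>"
  using tendstoD[OF avg \<eta>] unfolding eventually_at_right_field \<Psi>_def dist_real_def by auto
 \<comment> \<open>Half of \<open>b\<close>, so that the last dyadic radius, which may overshoot
   \<open>h0\<close> by a factor of two, stays below \<open>b\<close>.\<close>
 define h0 where "h0 = b / 2"
 have h0: "0 < h0" using b by (simp add: h0_def)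
 have ind: "(%y. indicator {-h..h} y :: real) \<in> borel_measurable M" for h
  by (intro measurable_restrict_space1 measurable_completion) simp
 have i1: "integrable M (%y. indicator {-h..h} y * u y)" if "integrable M u" for u :: "real => real" and h
  by (rule Bochner_Integration.integrable_bound[OF that]) (use that ind in \<open>auto simp: indicator_def\<close>)
 have gabs: "integrable M (%y. \<bar>g y\<bar>)" using g by simp
 define G where "G = (LINT y|M. \<bar>g y\<bar>)"
 have G: "0 <= G" unfolding G_def by (intro Bochner_Integration.integral_nonneg) simp
 \<comment> \<open>The last entry makes the part of the integral beyond \<open>h0\<close>, at most
   \<open>C * d / h0^2 * G\<close>, smaller than \<open>e / 2\<close>.\<close>
 define d1 where "d1 = min (min d0 h0) (e * h0^2 / (2 * (C * G + 1)))"
 have d1: "0 < d1" using d0 h0 e C G by (simp add: d1_def add_nonneg_pos)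
 have bound: "\<bar>LINT y|M. k d y * g y\<bar> < e" if d: "0 < d" "d < d1" for d
 proof -
  have dd: "d < d0" "d < h0" "d < e * h0^2 / (2 * (C * G + 1))" using d by (auto simp: d1_def)
  define J where "J = (LEAST j. h0 <= 2 ^ j * d)"
  have "\<exists>j. h0 <= 2 ^ j * d"
  proof -
   obtain j where "h0 / d < 2 ^ j" using real_arch_pow[of 2 "h0 / d"] by auto
   then show ?thesis using d by (intro exI[of _ j]) (simp add: field_simps)
  qed
  then have J: "h0 <= 2 ^ J * d" unfolding J_def by (rule LeastI_ex)
  have J2: "2 ^ j * d < b" if "j <= J" for j
  proof (cases j)
   case 0
   then show ?thesis using dd b by (simp add: h0_def)
  next
   case (Suc i)
   then have "\<not> h0 <= 2 ^ i * d" using that not_less_Least[of i "%j. h0 <= 2 ^ j * d"] by (simp add: J_def)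
   then show ?thesis using Suc by (simp add: h0_def)
  qed
  \<comment> \<open>Every \<open>y\<close> within \<open>h0\<close> is charged to the summand of its
    own dyadic shell. There \<open>|y|\<close> exceeds half of \<open>2 ^ i * d\<close>, and the
    decay \<open>C * d / y^2\<close> becomes \<open>4 * C / (4 ^ i * d)\<close>; on the innermost
    ball the bound \<open>C / d\<close> is used.\<close>
  have pw: "\<bar>k d y * g y\<bar> <= (\<Sum>j\<le>J. (4 * C / (4 ^ j * d)) * (indicator {-(2^j*d)..2^j*d} y * \<bar>g y\<bar>)) + (C * d / h0^2) * \<bar>g y\<bar>"
   if y: "\<bar>y\<bar> <= L" for y
  proof -
   have nn: "0 <= (4 * C / (4 ^ j * d)) * (indicator {-(2^j*d)..2^j*d} y * \<bar>g y\<bar>)" for j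
    using C d by simp
   show ?thesis
   proof (cases "\<bar>y\<bar> <= h0")
    case True
    define i where "i = (LEAST j. \<bar>y\<bar> <= 2 ^ j * d)"
    have ex: "\<bar>y\<bar> <= 2 ^ J * d" using True J by simp
    then have i: "\<bar>y\<bar> <= 2 ^ i * d" "i <= J" unfolding i_def by (auto intro: LeastI Least_le)
    have "\<bar>k d y\<bar> <= 4 * C / (4 ^ i * d)"
    proof (cases i)
     case 0
     have "C / d <= 4 * C / (4 ^ 0 * d)" using C d by (simp add: divide_right_mono)
     then show ?thesis using k1[OF d(1) dd(1) y] 0 by simp
    next
     case (Suc n)
     then have "\<not> \<bar>y\<bar> <= 2 ^ n * d" using not_less_Least[of n "%j. \<bar>y\<bar> <= 2 ^ j * d"] by (simp add: i_def)
     then have yn: "2 ^ n * d < \<bar>y\<bar>" by simp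
     then have "(2 ^ n * d)^2 <= \<bar>y\<bar>\<^sup>2" using d by (intro power_mono) auto
     then have "\<bar>k d y\<bar> * (2 ^ n * d)^2 <= \<bar>k d y\<bar> * y^2" by (intro mult_left_mono) auto
     also have "... <= C * d" by (rule k2[OF d(1) dd(1) y])
     also have "(2 ^ n * d)^2 = 4 ^ n * d^2"
      by (simp add: power2_eq_square mult_ac flip: power_mult_distrib[of 2 2])
     finally have *: "\<bar>k d y\<bar> * (4 ^ n * d^2) <= C * d" .
     have "\<bar>k d y\<bar> <= C * d / (4 ^ n * d^2)"
      using * d by (simp add: pos_le_divide_eq)
     also have "... = 4 * C / (4 ^ i * d)" using d Suc by (simp add: power2_eq_square)
     finally show ?thesis .
    qed
    then have "\<bar>k d y\<bar> * \<bar>g y\<bar> <= (4 * C / (4 ^ i * d)) * \<bar>g y\<bar>"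
     by (rule mult_right_mono) simp
    moreover have "indicator {-(2^i*d)..2^i*d} y = (1::real)"
     using i(1) by (auto simp: indicator_def abs_le_iff)
    ultimately have "\<bar>k d y * g y\<bar> <= (4 * C / (4 ^ i * d)) * (indicator {-(2^i*d)..2^i*d} y * \<bar>g y\<bar>)"
     by (simp only: abs_mult mult_1)
    also have "... <= (\<Sum>j\<le>J. (4 * C / (4 ^ j * d)) * (indicator {-(2^j*d)..2^j*d} y * \<bar>g y\<bar>))"
     using i nn by (intro member_le_sum) auto
    finally show ?thesis using C d by (simp add: add_increasing2)
   next
    case False
    then have "h0^2 <= \<bar>y\<bar>\<^sup>2" using h0 by (intro power_mono) auto
    then have "\<bar>k d y\<bar> * h0^2 <= \<bar>k d y\<bar> * y^2" by (intro mult_left_mono) auto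
    also have "... <= C * d" by (rule k2[OF d(1) dd(1) y])
    finally have "\<bar>k d y\<bar> <= C * d / h0^2" using h0 by (simp add: field_simps)
    then have "\<bar>k d y\<bar> * \<bar>g y\<bar> <= (C * d / h0^2) * \<bar>g y\<bar>" by (rule mult_right_mono) simp
    then have "\<bar>k d y * g y\<bar> <= (C * d / h0^2) * \<bar>g y\<bar>" by (simp only: abs_mult)
    moreover have "0 <= (\<Sum>j\<le>J. (4 * C / (4 ^ j * d)) * (indicator {-(2^j*d)..2^j*d} y * \<bar>g y\<bar>))"
     by (intro sum_nonneg nn)
    ultimately show ?thesis by linarith
   qed
  qed
  let ?R = "%y. (\<Sum>j\<le>J. (4 * C / (4 ^ j * d)) * (indicator {-(2^j*d)..2^j*d} y * \<bar>g y\<bar>)) + (C * d / h0^2) * \<bar>g y\<bar>"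
  have iR: "integrable M ?R"
   by (intro Bochner_Integration.integrable_add Bochner_Integration.integrable_sum integrable_mult_right i1 gabs)
  have ik: "integrable M (%y. k d y * g y)"
   by (rule Bochner_Integration.integrable_bound[OF iR])
    (use km[OF d(1) dd(1)] g pw in \<open>auto intro!: AE_I2 order_trans[OF _ abs_ge_self] simp: abs_le_iff\<close>)
  have "\<bar>LINT y|M. k d y * g y\<bar> <= (LINT y|M. \<bar>k d y * g y\<bar>)" by (rule integral_abs_bound)
  also have "... <= (LINT y|M. ?R y)"
   by (rule integral_mono) (use ik iR pw in \<open>auto simp: abs_le_iff\<close>)
  also have "... = (\<Sum>j\<le>J. (4 * C / (4 ^ j * d)) * \<Psi> (2 ^ j * d)) + (C * d / h0^2) * G"
  proof -
   have s: "(LINT y|M. (\<Sum>j\<le>J. (4 * C / (4 ^ j * d)) * (indicator {-(2^j*d)..2^j*d} y * \<bar>g y\<bar>)))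
    = (\<Sum>j\<le>J. LINT y|M. (4 * C / (4 ^ j * d)) * (indicator {-(2^j*d)..2^j*d} y * \<bar>g y\<bar>))"
    by (rule Bochner_Integration.integral_sum) (intro integrable_mult_right i1 gabs)
   have "(LINT y|M. ?R y) = (LINT y|M. (\<Sum>j\<le>J. (4 * C / (4 ^ j * d)) * (indicator {-(2^j*d)..2^j*d} y * \<bar>g y\<bar>)))
    + (LINT y|M. (C * d / h0^2) * \<bar>g y\<bar>)"
    by (rule Bochner_Integration.integral_add) (intro Bochner_Integration.integrable_sum integrable_mult_right i1 gabs)+
   then show ?thesis unfolding s integral_mult_right_zero \<Psi>_def G_def .
  qed
  also have "(\<Sum>j\<le>J. (4 * C / (4 ^ j * d)) * \<Psi> (2 ^ j * d)) <= (\<Sum>j\<le>J. 4 * C * \<eta> * (1 / 2) ^ j)"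
  proof (rule sum_mono)
   fix j assume "j \<in> {..J}"
   have pd: "0 < 2 ^ j * d" using d by simp
   have "\<bar>\<Psi> (2 ^ j * d) / (2 ^ j * d)\<bar> < \<eta>" using b(2)[OF pd J2] \<open>j \<in> {..J}\<close> by simp
   then have "\<Psi> (2 ^ j * d) / (2 ^ j * d) <= \<eta>" by linarith
   then have "\<Psi> (2 ^ j * d) <= \<eta> * (2 ^ j * d)" using pd by (simp only: pos_divide_le_eq)
   then have "(4 * C / (4 ^ j * d)) * \<Psi> (2 ^ j * d) <= (4 * C / (4 ^ j * d)) * (\<eta> * (2 ^ j * d))"
    using C d by (intro mult_left_mono) auto
   also have "... = 4 * C * \<eta> * (2 ^ j / 4 ^ j)" using d by simp
   also have "(2 ^ j / 4 ^ j :: real) = (1 / 2) ^ j" by (simp add: power_divide[symmetric])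
   finally show "(4 * C / (4 ^ j * d)) * \<Psi> (2 ^ j * d) <= 4 * C * \<eta> * (1 / 2) ^ j" .
  qed
  also have "(\<Sum>j\<le>J. 4 * C * \<eta> * (1 / 2) ^ j) <= 8 * C * \<eta>"
  proof -
   have "(\<Sum>j\<le>J. (1 / 2 :: real) ^ j) <= (\<Sum>j. (1 / 2) ^ j)"
    by (intro sum_le_suminf) auto
   also have "... = 2" using suminf_geometric[of "1/2 :: real"] by simp
   finally have "4 * C * \<eta> * (\<Sum>j\<le>J. (1 / 2 :: real) ^ j) <= 4 * C * \<eta> * 2"
    using C \<eta> by (intro mult_left_mono) auto
   then show ?thesis by (simp add: sum_distrib_left)
  qed
  also have "8 * C * \<eta> <= e / 2"
  proof -
   have "8 * C * \<eta> = (e / 2) * (C / (C + 1))" using C by (simp add: \<eta>_def field_simps)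
   also have "... <= (e / 2) * 1" using C e by (intro mult_left_mono) auto
   finally show ?thesis by simp
  qed
  also have "(C * d / h0^2) * G < e / 2"
  proof -
   have pos: "0 < C * G + 1" using C G by (simp add: add_nonneg_pos)
   have "d * (C * G + 1) < e * h0^2 / 2"
    using dd(3) pos by (simp add: field_simps)
   moreover have "d * (C * G) <= d * (C * G + 1)" using d by (intro mult_left_mono) auto
   ultimately have "d * (C * G) < e * h0^2 / 2" by linarith
   then show ?thesis using h0 by (simp add: field_simps)
  qed
  finally show ?thesis by simp
 qed
 show "\<forall>\<^sub>F d in at_right 0. dist (LINT y|M. k d y * g y) 0 < e"
  unfolding eventually_at_right_field dist_real_def using bound d1 by (auto intro!: exI[of _ d1])
qed

lemma approximate_identity_point:
 fixes k :: "real => real => real"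
 assumes f: "integrable M f" and p: "!!x. f (x + 2 * L) = f x" and x: "lebesgue_point f x"
  and k: "0 < d0" "0 <= C"
  "!!d. 0 < d ==> d < d0 ==> k d \<in> borel_measurable M"
  "!!d y. 0 < d ==> d < d0 ==> \<bar>y\<bar> <= L ==> \<bar>k d y\<bar> <= C / d"
  "!!d y. 0 < d ==> d < d0 ==> \<bar>y\<bar> <= L ==> \<bar>k d y\<bar> * y^2 <= C * d"
 shows "((%d. LINT y|M. k d y * (f (x - y) - f x)) \<longlongrightarrow> 0) (at_right 0)"
 by (rule approximate_identity[OF _ x[unfolded lebesgue_point_def] k])
  (use periodic_integral_reflect(1)[OF f p] in auto)

lemma pk_Re_Im:
 assumes "0 <= r" "r < 1"
 defines "\<theta> \<equiv> %y. pi / L * y"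
 shows "Re (pk r y) = (1 - r\<^sup>2) / ((1 - r)^2 + 2 * r * (1 - cos (\<theta> y)))"
  and "Im (pk r y) = 2 * r * sin (\<theta> y) / ((1 - r)^2 + 2 * r * (1 - cos (\<theta> y)))"
  and "0 < (1 - r)^2 + 2 * r * (1 - cos (\<theta> y))"
proof -
 define c s where "c = cos (\<theta> y)" and "s = sin (\<theta> y)"
 have cs1: "c * c + s * s = 1" using sin_cos_squared_add2[of "\<theta> y"] by (simp add: c_def s_def power2_eq_square)
 have ex: "Re (ex 1 y) = c" "Im (ex 1 y) = s" by (simp_all add: ex_def c_def s_def \<theta>_def)
 have c1: "c <= 1" by (simp add: c_def s_def)
 have D: "(1 - r * c)^2 + (r * s)^2 = (1 - r)^2 + 2 * r * (1 - c)"
 proof -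
  have "(1 - r * c)^2 + (r * s)^2 = 1 - 2 * r * c + r^2 * (c * c + s * s)"
   by (simp add: power2_eq_square algebra_simps)
  then show ?thesis unfolding cs1 by (simp add: power2_eq_square algebra_simps)
 qed
 have n: "(1 + r * c) * (1 - r * c) - (r * s) * (r * s) = 1 - r\<^sup>2"
 proof -
  have "(1 + r * c) * (1 - r * c) - (r * s) * (r * s) = 1 - r\<^sup>2 * (c * c + s * s)"
   by (simp add: power2_eq_square algebra_simps)
  then show ?thesis unfolding cs1 by simp
 qed
 show "0 < (1 - r)^2 + 2 * r * (1 - cos (\<theta> y))"
  using assms c1 unfolding c_def s_def by (intro add_pos_nonneg) auto
 show "Re (pk r y) = (1 - r\<^sup>2) / ((1 - r)^2 + 2 * r * (1 - cos (\<theta> y)))"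
 proof -
  have "Re (pk r y) = ((1 + r * c) * (1 - r * c) - (r * s) * (r * s)) / ((1 - r * c)^2 + (r * s)^2)"
   by (simp add: pk_def Re_divide ex[unfolded One_nat_def])
  then show ?thesis unfolding n D unfolding c_def .
 qed
 show "Im (pk r y) = 2 * r * sin (\<theta> y) / ((1 - r)^2 + 2 * r * (1 - cos (\<theta> y)))"
 proof -
  have "Im (pk r y) = ((r * s) * (1 - r * c) + (1 + r * c) * (r * s)) / ((1 - r * c)^2 + (r * s)^2)"
   by (simp add: pk_def Im_divide ex[unfolded One_nat_def])
  also have "(r * s) * (1 - r * c) + (1 + r * c) * (r * s) = 2 * r * s" by (simp add: algebra_simps)
  finally show ?thesis unfolding D unfolding c_def s_def .
 qed
qed

lemma continuous_pk:
 assumes "0 <= r" "r < 1"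
 shows "continuous_on UNIV (pk r)"
proof -
 have "1 - of_real r * ex 1 y \<noteq> 0" for y
 proof
  assume "1 - of_real r * ex 1 y = 0"
  then have "cmod (of_real r * ex 1 y) = 1" by simp
  then show False using assms by (simp add: norm_mult)
 qed
 then show ?thesis unfolding pk_def[abs_def] by (intro continuous_intros) auto
qed

lemma measurable_pk:
 assumes "0 <= r" "r < 1"
 shows "(%y. Re (pk r y)) \<in> borel_measurable M" "(%y. Im (pk r y)) \<in> borel_measurable M"
proof -
 have "continuous_on UNIV (%y. Re (pk r y))" "continuous_on UNIV (%y. Im (pk r y))"
  by (intro continuous_intros continuous_pk assms)+
 then show "(%y. Re (pk r y)) \<in> borel_measurable M" "(%y. Im (pk r y)) \<in> borel_measurable M"
  by (auto intro!: measurable_restrict_space1 measurable_completion borel_measurable_continuous_onI)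
qed

text \<open>\<open>d\<close> is the distance of the radius \<open>1 - d\<close> to 1. The bound
  \<open>d^2\<close> serves near the origin and the quadratic one away from it;
  \<open>d < 1/2\<close> keeps the factor \<open>2 * (1 - d)\<close> above 1.\<close>

lemma denominator_bounds:
 assumes d: "0 < d" "d < 1/2" and y: "\<bar>y\<bar> <= L"
 defines "D \<equiv> d^2 + 2 * (1 - d) * (1 - cos (pi / L * y))"
 shows "d^2 <= D" "2 * y^2 / L^2 <= D" "2 * y^2 / L^2 <= 1 - cos (pi / L * y)"
proof -
 have "\<bar>pi / L * y\<bar> <= pi"
  using y L_pos by (simp add: abs_mult field_simps)
 from one_minus_cos_ge[OF this] show c: "2 * y^2 / L^2 <= 1 - cos (pi / L * y)"
  by (simp add: power_mult_distrib power_divide)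
 have c0: "0 <= 1 - cos (pi / L * y)" by simp
 show "d^2 <= D" unfolding D_def using d c0 by simp
 have "1 * (1 - cos (pi / L * y)) <= 2 * (1 - d) * (1 - cos (pi / L * y))"
  using d by (intro mult_right_mono) auto
 then show "2 * y^2 / L^2 <= D" unfolding D_def using c d by simp (smt (verit) zero_le_power2)
qed

lemma poisson_kernel_bounds:
 assumes d: "0 < d" "d < 1/2" and y: "\<bar>y\<bar> <= L"
 shows "\<bar>Re (pk (1 - d) y)\<bar> <= (2 + L^2) / d" "\<bar>Re (pk (1 - d) y)\<bar> * y^2 <= (2 + L^2) * d"
proof -
 define D where "D = d^2 + 2 * (1 - d) * (1 - cos (pi / L * y))"
 have D: "d^2 <= D" "2 * y^2 / L^2 <= D" unfolding D_def by (rule denominator_bounds[OF d y])+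
 have D0: "0 < D" using D d by (meson less_le_trans zero_less_power)
 have n: "0 <= 1 - (1 - d)\<^sup>2" "1 - (1 - d)\<^sup>2 <= 2 * d"
  using d by (simp_all add: power2_eq_square algebra_simps)
 have e: "\<bar>Re (pk (1 - d) y)\<bar> = (1 - (1 - d)\<^sup>2) / D"
  using pk_Re_Im(1)[of "1 - d" y] d n D0 by (simp add: D_def abs_of_nonneg)
 have "(1 - (1 - d)\<^sup>2) / D <= 2 * d / d^2"
  by (rule frac_le) (use n D d in auto)
 also have "... = 2 / d" using d by (simp add: power2_eq_square)
 also have "... <= (2 + L^2) / d" using d by (intro divide_right_mono) auto
 finally show "\<bar>Re (pk (1 - d) y)\<bar> <= (2 + L^2) / d" by (simp add: e)
 have yD: "y^2 <= L^2 * D / 2" using D(2) L_pos by (simp add: field_simps)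
 have "(1 - (1 - d)\<^sup>2) / D * y^2 <= (2 * d / D) * (L^2 * D / 2)"
  by (intro mult_mono divide_right_mono n yD) (use D0 d in auto)
 also have "... = L^2 * d" using D0 by simp
 also have "... <= (2 + L^2) * d" using d by (intro mult_right_mono) auto
 finally show "\<bar>Re (pk (1 - d) y)\<bar> * y^2 <= (2 + L^2) * d" by (simp add: e)
qed

section \<open>The Hilbert transform as a conjugate Fourier series\<close>

text \<open>Truncated cotangent minus conjugate Poisson kernel. The truncation radius is tied to the
  distance of the Abel radius to 1; only this matching makes the singular parts cancel up to a
  kernel of size \<open>1 / d\<close> near 0 and \<open>d / y^2\<close> away from it.\<close>

definition hk :: "real => real => real" where
 "hk d y = (if d <= \<bar>y\<bar> then cot (pi / (2 * L) * y) else 0) - Im (pk (1 - d) y)"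

text \<open>Inside the truncation radius only the Poisson part remains, of size
  \<open>1 / d\<close>. Outside, with \<open>c = 1 - cos \<theta>\<close>, the two parts combine to
  \<open>sin \<theta> * d^2 / (c * D)\<close>, which is of order \<open>d^2 / |y|^3\<close>; since
  \<open>d <= |y|\<close> this is within both bounds.\<close>

lemma hilbert_kernel_bounds:
 assumes d: "0 < d" "d < 1/2" and y: "\<bar>y\<bar> <= L"
 shows "\<bar>hk d y\<bar> <= (2 * pi / L + pi * L ^ 3) / d" "\<bar>hk d y\<bar> * y^2 <= (2 * pi / L + pi * L ^ 3) * d"
proof -
 define \<theta> where "\<theta> = pi / L * y"
 define c where "c = 1 - cos \<theta>"
 define D where "D = d^2 + 2 * (1 - d) * c"
 have D: "d^2 <= D" "2 * y^2 / L^2 <= D" "2 * y^2 / L^2 <= c"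
  unfolding D_def c_def \<theta>_def by (rule denominator_bounds[OF d y])+
 have D0: "0 < D" using D d by (meson less_le_trans zero_less_power)
 have I: "Im (pk (1 - d) y) = 2 * (1 - d) * sin \<theta> / D"
  using pk_Re_Im(2)[of "1 - d" y] d by (simp add: D_def c_def \<theta>_def)
 have s: "\<bar>sin \<theta>\<bar> <= pi / L * \<bar>y\<bar>"
  using abs_sin_x_le_abs_x[of \<theta>] L_pos by (simp add: \<theta>_def abs_mult)
 have piL: "0 < pi / L" using L_pos by simp
 have main: "\<bar>hk d y\<bar> <= (2 * pi / L + pi * L ^ 3) / d \<and> \<bar>hk d y\<bar> * y^2 <= (2 * pi / L + pi * L ^ 3) * d"
 proof (cases "d <= \<bar>y\<bar>")
  case False
  have "\<bar>hk d y\<bar> = 2 * (1 - d) * \<bar>sin \<theta>\<bar> / D"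
   using False d D0 by (simp add: hk_def I abs_mult)
  also have "... <= 2 * (pi / L * d) / d^2"
  proof (rule frac_le)
   have "2 * (1 - d) * \<bar>sin \<theta>\<bar> <= 2 * 1 * (pi / L * d)"
    by (intro mult_mono order_trans[OF s]) (use d False piL in auto)
   then show "2 * (1 - d) * \<bar>sin \<theta>\<bar> <= 2 * (pi / L * d)" by simp
  qed (use d D L_pos in auto)
  also have "... = 2 * pi / L / d" using d by (simp add: power2_eq_square)
  finally have 1: "\<bar>hk d y\<bar> <= 2 * pi / L / d" .
  have "y^2 <= d^2" using False by (metis abs_le_square_iff abs_of_pos d(1) less_imp_le not_le)
  then have "\<bar>hk d y\<bar> * y^2 <= 2 * pi / L / d * d^2" using 1 d piL by (intro mult_mono) auto
  also have "... = 2 * pi / L * d" using d by (simp add: power2_eq_square)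
  finally have 2: "\<bar>hk d y\<bar> * y^2 <= 2 * pi / L * d" .
  have le: "2 * pi / L <= 2 * pi / L + pi * L ^ 3" using L_pos by simp
  have "2 * pi / L / d <= (2 * pi / L + pi * L ^ 3) / d" "2 * pi / L * d <= (2 * pi / L + pi * L ^ 3) * d"
   by (rule divide_right_mono[OF le], use d in simp, rule mult_right_mono[OF le], use d in simp)
  then show ?thesis using 1 2 by linarith
 next
  case True
  then have y0: "y \<noteq> 0" using d by auto
  have c0: "0 < c" using D(3) y0 L_pos by (meson less_le_trans zero_less_divide_iff zero_less_mult_iff zero_less_numeral zero_less_power zero_less_power2)
  have cot: "cot (pi / (2 * L) * y) = sin \<theta> / c"
  proof -
   define b where "b = pi / (2 * L) * y"
   have \<theta>b: "\<theta> = 2 * b" using L_pos by (simp add: b_def \<theta>_def)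
   have cb: "c = 2 * (sin b)^2" unfolding c_def \<theta>b cos_double_sin by simp
   then have "sin b \<noteq> 0" using c0 by auto
   moreover have "sin \<theta> = 2 * sin b * cos b" unfolding \<theta>b by (rule sin_double)
   ultimately have "cot b = sin \<theta> / c" by (simp add: cb cot_def power2_eq_square)
   then show ?thesis by (simp only: b_def)
  qed
  have "hk d y = sin \<theta> * d^2 / (c * D)"
  proof -
   have "hk d y = sin \<theta> / c - 2 * (1 - d) * sin \<theta> / D" using True unfolding hk_def cot I by simp
   also have "... = sin \<theta> * (D - 2 * (1 - d) * c) / (c * D)"
    using c0 D0 by (simp add: field_simps)
   finally show ?thesis by (simp add: D_def)
  qed
  then have "\<bar>hk d y\<bar> = \<bar>sin \<theta>\<bar> * d^2 / (c * D)"
   using c0 D0 by (simp add: abs_mult)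
  also have "... <= (pi / L * \<bar>y\<bar>) * d^2 / ((2 * y^2 / L^2) * (2 * y^2 / L^2))"
  proof (rule frac_le)
   show "\<bar>sin \<theta>\<bar> * d^2 <= (pi / L * \<bar>y\<bar>) * d^2" by (rule mult_right_mono[OF s]) simp
   show "(2 * y^2 / L^2) * (2 * y^2 / L^2) <= c * D"
    by (rule mult_mono[OF D(3) D(2)]) (use c0 in auto)
  qed (use y0 L_pos in auto)
  also have "... = (pi * L ^ 3 / 4) * (d^2 / \<bar>y\<bar> ^ 3)"
  proof -
   have "(pi / L * a * d^2) / ((2 * a^2 / L^2) * (2 * a^2 / L^2)) = (pi * L ^ 3 / 4) * (d^2 / a ^ 3)" if "0 < a" for a
    using that L_pos by (simp add: divide_simps power2_eq_square power3_eq_cube)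
   from this[of "\<bar>y\<bar>"] show ?thesis using y0 by simp
  qed
  finally have h: "\<bar>hk d y\<bar> <= (pi * L ^ 3 / 4) * (d^2 / \<bar>y\<bar> ^ 3)" .
  have y3: "d ^ 3 <= \<bar>y\<bar> ^ 3" using True d by (intro power_mono) auto
  have "d^2 / \<bar>y\<bar> ^ 3 <= d^2 / d ^ 3" using d y3 by (intro divide_left_mono) auto
  also have "... = 1 / d" using d by (simp add: power2_eq_square power3_eq_cube)
  finally have "(pi * L ^ 3 / 4) * (d^2 / \<bar>y\<bar> ^ 3) <= (pi * L ^ 3 / 4) * (1 / d)"
   using L_pos by (intro mult_left_mono) auto
  then have 1: "\<bar>hk d y\<bar> <= (pi * L ^ 3 / 4) / d" using h by simp
  have "\<bar>hk d y\<bar> * y^2 <= (pi * L ^ 3 / 4) * (d^2 / \<bar>y\<bar> ^ 3) * y^2" by (intro mult_right_mono h) simp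
  also have "... = (pi * L ^ 3 / 4) * (d * (d / \<bar>y\<bar>))"
  proof -
   have "(pi * L ^ 3 / 4) * (d^2 / a ^ 3) * a^2 = (pi * L ^ 3 / 4) * (d * (d / a))" if "0 < a" for a
    using that by (simp add: divide_simps power2_eq_square power3_eq_cube)
   from this[of "\<bar>y\<bar>"] show ?thesis using y0 by simp
  qed
  also have "... <= (pi * L ^ 3 / 4) * (d * 1)"
   using True d L_pos y0 by (intro mult_left_mono) auto
  finally have 2: "\<bar>hk d y\<bar> * y^2 <= (pi * L ^ 3 / 4) * d" by simp
  have "pi * L ^ 3 / 4 <= 2 * pi / L + pi * L ^ 3" using L_pos by (simp add: add_increasing)
  note le = this
  have "(pi * L ^ 3 / 4) / d <= (2 * pi / L + pi * L ^ 3) / d" "(pi * L ^ 3 / 4) * d <= (2 * pi / L + pi * L ^ 3) * d"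
   by (rule divide_right_mono[OF le], use d in simp, rule mult_right_mono[OF le], use d in simp)
  then show ?thesis using 1 2 by linarith
 qed
 then show "\<bar>hk d y\<bar> <= (2 * pi / L + pi * L ^ 3) / d" "\<bar>hk d y\<bar> * y^2 <= (2 * pi / L + pi * L ^ 3) * d"
  by auto
qed

lemma measurable_hk:
 assumes "0 < d" "d < 1/2"
 shows "hk d \<in> borel_measurable M"
proof -
 have "(%y::real. if d <= \<bar>y\<bar> then cot (pi / (2 * L) * y) else 0) \<in> borel_measurable borel"
  unfolding cot_def by measurable
 then have "(%y::real. if d <= \<bar>y\<bar> then cot (pi / (2 * L) * y) else 0) \<in> borel_measurable M"
  by (intro measurable_restrict_space1 measurable_completion) simp
 then show ?thesis unfolding hk_def[abs_def] using measurable_pk(2)[of "1 - d"] assms by simp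
qed

definition ab :: "(nat => complex) => real => real => real" where
 "ab c r x = (\<Sum>n. r ^ n * tm c n x)"

text \<open>Real and imaginary part of the complex Poisson formula. Multiplying the coefficients by
  \<open>- \<i>\<close> turns real parts of the terms into imaginary ones, so the conjugate series
  is again an Abel mean.\<close>

lemma poisson_sum_Re_Im:
 fixes f :: "real => real"
 assumes f: "integrable M f" and p: "!!x. f (x + 2 * L) = f x" and r: "0 <= r" "r < 1"
 shows "ab (fc f) r x = (LINT y|M. Re (pk r y) * f (x - y)) / (2 * L)"
  and "ab (%n. - \<i> * fc f n) r x = (LINT y|M. Im (pk r y) * f (x - y)) / (2 * L)"
  and "integrable M (%y. Re (pk r y) * f (x - y))" and "integrable M (%y. Im (pk r y) * f (x - y))"
proof -
 note s = poisson_sum[OF f p r, of x]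
 have fi: "integrable M (%y. f (x - y))" by (rule periodic_integral_reflect(1)[OF f p])
 have bd: "cmod (pk r y) <= 2 / (1 - r)" for y
 proof -
  have "1 - r <= cmod (1 - of_real r * ex 1 y)"
   using norm_triangle_ineq2[of 1 "of_real r * ex 1 y"] r by (simp add: norm_mult)
  moreover have "cmod (1 + of_real r * ex 1 y) <= 2"
   using norm_triangle_ineq[of 1 "of_real r * ex 1 y"] r by (simp add: norm_mult)
  ultimately show ?thesis unfolding pk_def norm_divide using r by (intro frac_le) auto
 qed
 have pm: "pk r \<in> borel_measurable M"
  using continuous_pk[OF r] by (auto intro!: measurable_restrict_space1 measurable_completion borel_measurable_continuous_onI)
 have fm: "(%y. complex_of_real (f (x - y))) \<in> borel_measurable M" using fi by simp
 have i: "integrable M (%y. of_real (f (x - y)) * pk r y)"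
 proof (rule Bochner_Integration.integrable_bound)
  show "integrable M (%y. 2 / (1 - r) * \<bar>f (x - y)\<bar>)" using fi by simp
  show "AE y in M. norm (of_real (f (x - y)) * pk r y) <= norm (2 / (1 - r) * \<bar>f (x - y)\<bar>)"
   using mult_right_mono[OF bd, of "\<bar>f (x - y)\<bar>" for y] r by (auto simp: norm_mult abs_mult mult.commute)
 qed (use pm fm in simp)
 from integrable_Re[OF i] show iR: "integrable M (%y. Re (pk r y) * f (x - y))" by (simp add: mult.commute)
 from integrable_Im[OF i] show iI: "integrable M (%y. Im (pk r y) * f (x - y))" by (simp add: mult.commute)
 have t: "Re (of_real (wt n * r ^ n) * (fc f n * ex n x)) = r ^ n * tm (fc f) n x"
  "Im (of_real (wt n * r ^ n) * (fc f n * ex n x)) = r ^ n * tm (%n. - \<i> * fc f n) n x" for n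
  by (simp_all add: tm_def algebra_simps)
 have "Re ((LINT y|M. of_real (f (x - y)) * pk r y) / of_real (2 * L)) = (LINT y|M. Re (pk r y) * f (x - y)) / (2 * L)"
  using integral_Re[OF i] by (simp add: mult.commute Re_divide_of_real)
 with sums_Re[OF s] show "ab (fc f) r x = (LINT y|M. Re (pk r y) * f (x - y)) / (2 * L)"
  unfolding t ab_def by (simp add: sums_iff)
 have "Im ((LINT y|M. of_real (f (x - y)) * pk r y) / of_real (2 * L)) = (LINT y|M. Im (pk r y) * f (x - y)) / (2 * L)"
  using integral_Im[OF i] by (simp add: mult.commute Im_divide_of_real)
 with sums_Im[OF s] show "ab (%n. - \<i> * fc f n) r x = (LINT y|M. Im (pk r y) * f (x - y)) / (2 * L)"
  unfolding t ab_def by (simp add: sums_iff)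
qed

text \<open>The Poisson formula for the constant function 1, all of whose coefficients but the first
  vanish.\<close>

lemma integral_pk_Re:
 assumes "0 <= r" "r < 1"
 shows "(LINT y|M. Re (pk r y)) = 2 * L"
proof -
 have fc1: "fc (%_. 1) n = (if n = 0 then 1 else 0)" for n
  using ex_orth[of 0 n] integral_mult_ex[of "%_. 1" n] ex_orth'[of 0 n] L_pos
  by (cases "n = 0") (auto simp: fc_def ex_def[of 0] fc_0 measure_restrict_space)
 have i1: "integrable M (%_. 1 :: real)" by simp
 have "(LINT y|M. Re (pk r y)) / (2 * L) = ab (fc (%_. 1)) r 0"
  using poisson_sum_Re_Im(1)[OF i1 refl assms, of 0] by simp
 also have "... = (\<Sum>n. if n = 0 then 1 else 0)"
  unfolding ab_def by (intro arg_cong[where f = suminf] ext) (simp add: tm_def fc1 wt_def ex_def)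
 also have "... = 1" using sums_single[of 0 "%_. 1 :: real"] by (simp add: sums_iff)
 finally show ?thesis using L_pos by (simp add: field_simps)
qed

text \<open>The Poisson kernel has mean 1, so \<open>f x\<close> can be subtracted under the
  integral, where the Lebesgue point condition takes over.\<close>

lemma abel_limit:
 assumes f: "integrable M f" and p: "!!x. f (x + 2 * L) = f x" and x: "lebesgue_point f x"
 shows "((%d. ab (fc f) (1 - d) x) \<longlongrightarrow> f x) (at_right 0)"
proof -
 have "((%d. (LINT y|M. Re (pk (1 - d) y) * (f (x - y) - f x)) / (2 * L) + f x) \<longlongrightarrow> 0 / (2 * L) + f x) (at_right 0)"
  by (intro tendsto_intros approximate_identity_point[OF f p x, of "1/2" "2 + L^2"] measurable_pk poisson_kernel_bounds)
   (use L_pos in auto)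
 moreover have "\<forall>\<^sub>F d in at_right 0. (LINT y|M. Re (pk (1 - d) y) * (f (x - y) - f x)) / (2 * L) + f x = ab (fc f) (1 - d) x"
 proof -
  have "(LINT y|M. Re (pk (1 - d) y) * (f (x - y) - f x)) / (2 * L) + f x = ab (fc f) (1 - d) x" if d: "0 < d" "d < 1/2" for d
  proof -
   have r: "0 <= 1 - d" "1 - d < 1" using d by auto
   have i1: "integrable M (%y. Re (pk (1 - d) y))"
    using poisson_sum_Re_Im(3)[of "%_. 1", OF _ refl r] by simp
   have "(LINT y|M. Re (pk (1 - d) y) * (f (x - y) - f x)) = (LINT y|M. Re (pk (1 - d) y) * f (x - y) - Re (pk (1 - d) y) * f x)"
    by (simp add: right_diff_distrib)
   also have "... = (LINT y|M. Re (pk (1 - d) y) * f (x - y)) - 2 * L * f x"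
    using poisson_sum_Re_Im(3)[where f = f, OF f p r] i1 integral_pk_Re[OF r] by simp
   finally show ?thesis
    using poisson_sum_Re_Im(1)[where f = f, OF f p r, of x] L_pos by (simp add: diff_divide_distrib)
  qed
  then show ?thesis unfolding eventually_at_right_field by (intro exI[of _ "1/2"]) auto
 qed
 ultimately show ?thesis using Lim_transform_eventually by (simp add: tendsto_cong)
qed

text \<open>At common Lebesgue points of \<open>f\<close> and its conjugate function \<open>g\<close>, the truncated principal
 value differs from the conjugate Poisson integral by an odd kernel to which
 the approximate identity lemma applies.\<close>

lemma hilbert_at_lebesgue_point:
 assumes f: "integrable M f" and fp: "!!x. f (x + 2 * L) = f x" and x: "lebesgue_point f x"
  and g: "integrable M g" and gp: "!!x. g (x + 2 * L) = g x" and xg: "lebesgue_point g x"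
  and fg: "fc g = (%n. if n = 0 then 0 else - \<i> * fc f n)"
 shows "has_hilbert_per L f x (g x)"
proof -
 have ab_eq: "ab (%n. - \<i> * fc f n) r z = ab (fc g) r z" for r z
  unfolding ab_def by (intro arg_cong[where f = suminf] ext) (simp add: tm_def fg fc_0[OF f] ex_def)
 have "((%d. (LINT y|M. hk d y * (f (x - y) - f x)) / (2 * L) + ab (fc g) (1 - d) x) \<longlongrightarrow> 0 / (2 * L) + g x) (at_right 0)"
  by (intro tendsto_intros approximate_identity_point[OF f fp x, of "1/2" "2 * pi / L + pi * L ^ 3"]
    measurable_hk hilbert_kernel_bounds abel_limit g gp xg)
   (use L_pos in auto)
 moreover have "\<forall>\<^sub>F d in at_right 0. (LINT y|M. hk d y * (f (x - y) - f x)) / (2 * L) + ab (fc g) (1 - d) x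
  = 1 / (2 * L) * (LINT y:{y. d <= \<bar>y\<bar> \<and> \<bar>y\<bar> <= L}|lebesgue. cot (pi / (2 * L) * y) * f (x - y))"
 proof -
  have "(LINT y|M. hk d y * (f (x - y) - f x)) / (2 * L) + ab (fc g) (1 - d) x
   = 1 / (2 * L) * (LINT y:{y. d <= \<bar>y\<bar> \<and> \<bar>y\<bar> <= L}|lebesgue. cot (pi / (2 * L) * y) * f (x - y))"
   if d: "0 < d" "d < 1/2" for d
  proof -
   have r: "0 <= 1 - d" "1 - d < 1" using d by auto
   have fi: "integrable M (%y. f (x - y))" by (rule periodic_integral_reflect(1)[where F = f, OF f fp])
   have hi: "integrable M (%y. hk d y * u y)" if u: "integrable M u" for u
   proof (rule Bochner_Integration.integrable_bound)
    let ?C = "(2 * pi / L + pi * L ^ 3) / d"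
    show "integrable M (%y. ?C * u y)" using u by simp
    show "AE y in M. norm (hk d y * u y) <= norm (?C * u y)"
    proof (rule AE_I2)
     fix y assume "y \<in> space M"
     then have "\<bar>y\<bar> <= L" by (auto simp: abs_le_iff)
     from hilbert_kernel_bounds(1)[OF d this] have "\<bar>hk d y\<bar> <= \<bar>?C\<bar>" by linarith
     then show "norm (hk d y * u y) <= norm (?C * u y)"
      unfolding real_norm_def abs_mult by (intro mult_right_mono) auto
    qed
   qed (use measurable_hk[OF d] u in simp)
   \<comment> \<open>An odd kernel has integral zero, so the subtraction of \<open>f x\<close> that
     the approximate identity lemma requires changes nothing here.\<close>
   have odd: "hk d (- y) = - hk d y" for y
    using pk_Re_Im(2)[OF r, of y] pk_Re_Im(2)[OF r, of "-y"] by (simp add: hk_def cot_def)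
   have h1: "integrable M (hk d)" using hi[of "%_. 1"] by simp
   have "(LINT y|M. hk d y) = - (LINT y|M. hk d y)"
    using LINT_reflect[of "-L" L "hk d" 0] by (simp add: odd LINT_M)
   then have h0: "(LINT y|M. hk d y) = 0" by simp
   let ?ct = "%y. if d <= \<bar>y\<bar> then cot (pi / (2 * L) * y) else 0"
   have "(LINT y|M. hk d y * (f (x - y) - f x)) = (LINT y|M. hk d y * f (x - y) - hk d y * f x)"
    by (simp add: right_diff_distrib)
   also have "... = (LINT y|M. hk d y * f (x - y))"
    using hi[OF fi] h1 h0 by simp
   finally have 1: "(LINT y|M. hk d y * (f (x - y) - f x)) = (LINT y|M. hk d y * f (x - y))" .
   have 2: "(LINT y|M. hk d y * f (x - y)) + (LINT y|M. Im (pk (1 - d) y) * f (x - y))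
     = (LINT y|M. hk d y * f (x - y) + Im (pk (1 - d) y) * f (x - y))"
    using hi[OF fi] poisson_sum_Re_Im(4)[where f = f, OF f fp r] by simp
   have 3: "(LINT y|M. hk d y * f (x - y) + Im (pk (1 - d) y) * f (x - y)) = (LINT y|M. ?ct y * f (x - y))"
    by (intro Bochner_Integration.integral_cong refl) (simp add: hk_def algebra_simps)
   have 4: "(LINT y|M. ?ct y * f (x - y)) = (LINT y:{y. d <= \<bar>y\<bar> \<and> \<bar>y\<bar> <= L}|lebesgue. cot (pi / (2 * L) * y) * f (x - y))"
    unfolding LINT_M[symmetric] set_lebesgue_integral_def
    by (intro Bochner_Integration.integral_cong) (auto simp: indicator_def abs_le_iff)
   have "ab (fc g) (1 - d) x = (LINT y|M. Im (pk (1 - d) y) * f (x - y)) / (2 * L)"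
    using poisson_sum_Re_Im(2)[where f = f, OF f fp r, of x] unfolding ab_eq .
   then show ?thesis using 1 2 3 4 by (simp add: add_divide_distrib[symmetric])
  qed
  then show ?thesis unfolding eventually_at_right_field by (intro exI[of _ "1/2"]) auto
 qed
 ultimately show ?thesis unfolding has_hilbert_per_def by (simp add: tendsto_cong)
qed

section \<open>Abel limits as representatives, and Parseval's identity\<close>

text \<open>A representative computed from the coefficients alone. It recovers a function at its
  Lebesgue points and stays measurable jointly with a parameter on which the coefficients depend.
  The radii tend to 1 along a sequence, so that the limit is a countable operation.\<close>

definition abel :: "(nat => complex) => real => real" where
 "abel c x = lim (%j. ab c (1 - 1 / (real j + 2)) x)"

lemma abel_eq_at_lebesgue_point:
 assumes f: "integrable M f" and p: "!!x. f (x + 2 * L) = f x" and x: "lebesgue_point f x"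
 shows "abel (fc f) x = f x"
proof -
 have "filterlim (%j. 1 / (real j + 2)) (at_right 0) sequentially"
  unfolding filterlim_at
  using LIMSEQ_ignore_initial_segment[OF lim_1_over_n[where 'a = real], of 2]
  by (auto intro!: always_eventually simp: add.commute)
 from filterlim_compose[OF abel_limit[where f = f, OF f p x] this] show ?thesis
  unfolding abel_def by (rule limI)
qed

lemma tm_periodic: "tm c n (x + 2 * L) = tm c n x"
 by (simp add: tm_def ex_periodic)

lemma abel_periodic: "abel c (x + 2 * L) = abel c x"
 by (simp add: abel_def ab_def tm_periodic)

lemma borel_measurable_tm [measurable]: "tm c n \<in> borel_measurable borel"
 unfolding tm_def[abs_def] by (intro borel_measurable_continuous_onI continuous_intros)

lemma borel_measurable_abel: "abel c \<in> borel_measurable borel"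
 unfolding abel_def[abs_def] ab_def by measurable

lemma measurable_lebesgueI: "f \<in> borel_measurable borel ==> f \<in> borel_measurable lebesgue"
 by (intro measurable_completion) simp

lemma summable_fc:
 assumes "f \<in> L2_per L"
 shows "summable (%n. wt n * (cmod (fc f n))^2)"
proof (rule bounded_imp_summable)
 show "(\<Sum>k\<le>n. wt k * (cmod (fc f k))^2) <= (norm_L2 L f)^2 / (2 * L)" for n
  using bessel[OF assms, of n] L_pos by (simp add: field_simps)
qed (simp add: wt_pos)

lemma fc_0_real: "f \<in> L2_per L ==> Im (fc f 0) = 0"
 using fc_0[OF L2_integrable] by simp

lemma abel_AE: "f \<in> L2_per L ==> AE x in lebesgue. abel (fc f) x = f x"
 using lebesgue_point_AE[OF L2_integrable[of f] L2_perD(1)[of f]]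
  abel_eq_at_lebesgue_point[of f, OF L2_integrable[of f] L2_perD(1)[of f]] by auto

lemma fc_cong_AE:
 assumes "AE x in lebesgue. f x = g x" "integrable M f" "integrable M g"
 shows "fc f n = fc g n"
proof -
 have "(LINT x|M. of_real (f x) * cnj (ex n x)) = (LINT x|M. of_real (g x) * cnj (ex n x))"
  by (rule integral_cong_AE)
   (use integrable_mult_ex(2)[OF assms(2)] integrable_mult_ex(2)[OF assms(3)] assms(1) in \<open>auto simp: AE_M\<close>)
 then show ?thesis by (simp add: fc_def)
qed

text \<open>The Abel limit depends on the coefficients only and recovers either function almost
  everywhere.\<close>

lemma fc_unique:
 assumes "f \<in> L2_per L" "g \<in> L2_per L" "!!n. fc f n = fc g n"
 shows "AE x in lebesgue. f x = g x"
proof -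
 have "fc f = fc g" using assms(3) by auto
 then show ?thesis using abel_AE[OF assms(1)] abel_AE[OF assms(2)] by auto
qed

text \<open>Riesz-Fischer provides some function with these coefficients to which the partial sums
  converge; uniqueness of coefficients identifies it with \<open>f\<close>.\<close>

lemma fs_tendsto:
 assumes "f \<in> L2_per L"
 shows "(%m. norm_L2 L (%x. f x - fs (fc f) m x)) \<longlonglongrightarrow> 0"
proof -
 obtain g where g: "g \<in> L2_per L" "!!n. fc g n = fc f n"
  "(%m. norm_L2 L (%x. g x - fs (fc f) m x)) \<longlonglongrightarrow> 0"
  using riesz_fischer[of "fc f", OF summable_fc[OF assms] fc_0_real[OF assms]] by blast
 have "AE x in lebesgue. f x = g x" by (rule fc_unique) (use assms g in auto)
 then have "norm_L2 L (%x. f x - fs (fc f) m x) = norm_L2 L (%x. g x - fs (fc f) m x)" for m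
  by (intro norm_L2_cong_AE L2_diff fs_L2 assms g) auto
 then show ?thesis using g(3) by simp
qed

lemma L2_cong_AE:
 assumes "f \<in> L2_per L" "AE x in lebesgue. g x = f x" "g \<in> borel_measurable lebesgue" "!!x. g (x + 2 * L) = g x"
 shows "g \<in> L2_per L"
proof (rule L2_perI[OF assms(4,3)])
 have "integrable M (%x. (g x)^2) \<longleftrightarrow> integrable M (%x. (f x)^2)"
  by (rule integrable_cong_AE)
   (use assms L2_perD[OF assms(1)] measurable_restrict_space1[OF assms(3)] in \<open>auto simp: AE_M\<close>)
 then show "integrable M (%x. (g x)^2)" using L2_perD(4)[OF assms(1)] by simp
qed

lemma abel_L2:
 assumes "summable (%n. wt n * (cmod (c n))^2)" "Im (c 0) = 0"
 shows "abel c \<in> L2_per L" "fc (abel c) n = c n"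
proof -
 obtain f where f: "f \<in> L2_per L" "!!n. fc f n = c n"
  using riesz_fischer[of c, OF assms] by blast
 then have "fc f = c" by auto
 then have ae: "AE x in lebesgue. abel c x = f x" using abel_AE[OF f(1)] by simp
 show 1: "abel c \<in> L2_per L"
  by (rule L2_cong_AE[OF f(1) ae measurable_lebesgueI[OF borel_measurable_abel] abel_periodic])
 show "fc (abel c) n = c n"
  using fc_cong_AE[OF ae L2_integrable[OF 1] L2_integrable[OF f(1)]] f by simp
qed

text \<open>The identity is exact for the partial sums of \<open>f\<close>, and Cauchy-Schwarz
  carries it along their L2 convergence.\<close>

lemma parseval:
 assumes f: "f \<in> L2_per L" and g: "g \<in> L2_per L"
 shows "(%n. wt n * Re (fc f n * cnj (fc g n))) sums ((LINT x|M. g x * f x) / (2 * L))"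
proof -
 have "(%m. LINT x|M. g x * fs (fc f) m x) \<longlonglongrightarrow> (LINT x|M. g x * f x)"
 proof (rule LIM_zero_cancel, rule tendsto_rabs_zero_cancel, rule tendsto_sandwich[of "%_. 0"])
  show "\<forall>\<^sub>F m in sequentially. \<bar>(LINT x|M. g x * fs (fc f) m x) - (LINT x|M. g x * f x)\<bar>
    <= norm_L2 L g * norm_L2 L (%x. f x - fs (fc f) m x)"
  proof (rule always_eventually, rule allI)
   fix m
   have "(LINT x|M. g x * f x) - (LINT x|M. g x * fs (fc f) m x) = (LINT x|M. g x * (f x - fs (fc f) m x))"
    using L2_mult(1)[OF g f] L2_mult(1)[OF g fs_L2] by (simp add: right_diff_distrib)
   then show "\<bar>(LINT x|M. g x * fs (fc f) m x) - (LINT x|M. g x * f x)\<bar>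
    <= norm_L2 L g * norm_L2 L (%x. f x - fs (fc f) m x)"
    using L2_mult(2)[OF g L2_diff[OF f fs_L2], of "fc f" m] by (simp add: abs_minus_commute)
  qed
  show "(%m. norm_L2 L g * norm_L2 L (%x. f x - fs (fc f) m x)) \<longlonglongrightarrow> 0"
   using tendsto_mult[OF tendsto_const fs_tendsto[OF f]] by simp
 qed auto
 then have "(%m. 2 * L * (\<Sum>n\<le>m. wt n * Re (fc f n * cnj (fc g n))) / (2 * L)) \<longlonglongrightarrow> (LINT x|M. g x * f x) / (2 * L)"
  unfolding integral_mult_fs(2)[OF L2_integrable[OF g]] by (intro tendsto_intros) (use L_pos in auto)
 then show ?thesis using L_pos by (simp add: sums_def_le)
qed

lemma parseval_norm:
 assumes "f \<in> L2_per L"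
 shows "(%n. wt n * (cmod (fc f n))^2) sums ((norm_L2 L f)^2 / (2 * L))"
proof -
 have "Re (z * cnj z) = (cmod z)^2" for z by (simp add: cmod_power2 flip: power2_eq_square)
 then show ?thesis
  using parseval[OF assms assms] by (simp add: norm_L2_sq power2_eq_square[of "f _"])
qed

section \<open>Weak derivatives and C1 regularity in terms of Fourier coefficients\<close>

definition kp :: "nat => real" where "kp n = pi / L * real n"

lemma ex_eq: "ex n x = cis (kp n * x)"
 by (simp add: ex_def kp_def mult_ac)

lemma deriv_tm: "((%x. Re (z * ex n x)) has_real_derivative Re ((\<i> * of_real (kp n) * z) * ex n x)) (at x)"
 unfolding ex_eq by (auto intro!: derivative_eq_intros simp: algebra_simps)

lemma smooth_tm: "smooth (%x. Re (z * ex n x))"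
proof -
 have e: "(deriv ^^ k) (%x. Re (z * ex n x)) = (%x. Re (((\<i> * of_real (kp n)) ^ k * z) * ex n x))" for k
 proof (induction k)
  case (Suc k)
  show ?case
   unfolding funpow.simps comp_def Suc
   by (rule ext) (subst DERIV_imp_deriv[OF deriv_tm], simp only: power_Suc mult.assoc)
 qed simp
 show ?thesis unfolding smooth_def e
  using deriv_tm real_differentiable_def by blast
qed

text \<open>Real parts of multiples of exponentials are admissible test functions; the multiples
  \<open>z = 1\<close> and \<open>z = \<i>\<close> give the two real equations behind the complex
  one.\<close>

lemma weak_deriv_imp_fc:
 assumes f: "f \<in> L2_per L" and g: "g \<in> L2_per L" and w: "weak_deriv L f g"
 shows "fc g n = \<i> * of_real (kp n) * fc f n"
proof -
 have I: "(LINT x|M. u x * Re (z * ex n x)) = 2 * L * Re (z * cnj (fc u n))" if "u \<in> L2_per L" for u z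
 proof -
  have i: "integrable M (%x. z * (of_real (u x) * ex n x))"
   by (intro integrable_mult_right integrable_mult_ex L2_integrable that)
  have "(LINT x|M. u x * Re (z * ex n x)) = (LINT x|M. Re (z * (of_real (u x) * ex n x)))"
   by (simp add: algebra_simps)
  also have "... = Re (z * (of_real (2 * L) * cnj (fc u n)))"
   unfolding integral_Re[OF i] by (simp only: integral_mult_right_zero integral_mult_ex[OF L2_integrable[OF that]])
  finally show ?thesis by (simp add: algebra_simps)
 qed
 have "Re (z * (cnj (fc g n) + \<i> * of_real (kp n) * cnj (fc f n))) = 0" for z
 proof -
  have "(LINT x|M. f x * deriv (%x. Re (z * ex n x)) x) = - (LINT x|M. g x * Re (z * ex n x))"
   using w smooth_tm[of z n] unfolding weak_deriv_def LINT_M by (simp add: periodic_def ex_periodic)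
  then have "2 * L * Re ((\<i> * of_real (kp n) * z) * cnj (fc f n)) = - (2 * L * Re (z * cnj (fc g n)))"
   unfolding DERIV_imp_deriv[OF deriv_tm] I[OF f] I[OF g] .
  then have "2 * L * (Re ((\<i> * of_real (kp n) * z) * cnj (fc f n)) + Re (z * cnj (fc g n))) = 0"
   by (simp only: distrib_left)
  then have "Re ((\<i> * of_real (kp n) * z) * cnj (fc f n)) + Re (z * cnj (fc g n)) = 0" using L_pos by simp
  then show ?thesis by (simp add: algebra_simps)
 qed
 from this[of 1] this[of \<i>] have "cnj (fc g n) + \<i> * of_real (kp n) * cnj (fc f n) = 0"
  by (simp add: complex_eq_iff)
 then have "cnj (cnj (fc g n) + \<i> * of_real (kp n) * cnj (fc f n)) = 0" by simp
 then have "fc g n - \<i> * of_real (kp n) * fc f n = 0" by simp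
 then show ?thesis by simp
qed

lemma C1_integral_deriv:
 fixes F :: "real => 'a::euclidean_space"
 assumes "!!x. (F has_vector_derivative F' x) (at x)" "continuous_on UNIV F'" "F L = F (-L)"
 shows "(LINT x|M. F' x) = 0" "integrable M F'"
proof -
 show i: "integrable M F'"
  by (intro continuous_imp_integrable_real continuous_on_subset[OF assms(2)]) auto
 have "(F' has_integral (F L - F (-L))) {-L..L}"
  by (rule fundamental_theorem_of_calculus) (use L_pos assms(1) in \<open>auto intro: has_vector_derivative_at_within\<close>)
 moreover have "(F' has_integral (LINT x|M. F' x)) {-L..L}"
  using has_integral_set_lebesgue[of "{-L..L}" F'] i unfolding set_integrable_iff LINT_M by blast
 ultimately have "F L - F (-L) = (LINT x|M. F' x)" by (rule has_integral_unique)
 then show "(LINT x|M. F' x) = 0" using assms(3) by simp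
qed

lemma ex_L: "ex n L = ex n (-L)"
 using ex_periodic[of n "-L"] by simp

lemma fc_deriv:
 assumes F: "!!x. (F has_real_derivative F' x) (at x)" and c: "continuous_on UNIV F'" and p: "!!x. F (x + 2 * L) = F x"
 shows "fc F' n = \<i> * of_real (kp n) * fc F n"
proof -
 have cF: "continuous_on A F" for A
  using F by (meson DERIV_isCont continuous_at_imp_continuous_on)
 have ed: "((%x. cnj (ex n x)) has_vector_derivative - \<i> * of_real (kp n) * cnj (ex n x)) (at x)" for x
 proof -
  have "cnj (ex n x) = exp ((- \<i> * of_real (kp n)) * of_real x)" for x
   unfolding ex_eq cis_cnj unfolding cis_conv_exp by (simp add: mult.assoc)
  moreover have "((%z. exp ((- \<i> * of_real (kp n)) * z)) has_field_derivative (- \<i> * of_real (kp n)) * exp ((- \<i> * of_real (kp n)) * of_real x)) (at (of_real x))"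
   by (auto intro!: derivative_eq_intros)
  ultimately show ?thesis using has_vector_derivative_real_field by auto
 qed
 have Fd: "((%x. of_real (F x)) has_vector_derivative complex_of_real (F' x)) (at x)" for x
  using F[of x] has_vector_derivative_of_real has_real_derivative_iff_has_vector_derivative by blast
 let ?G = "%x. complex_of_real (F x) * cnj (ex n x)"
 let ?G' = "%x. of_real (F x) * (- \<i> * of_real (kp n) * cnj (ex n x)) + of_real (F' x) * cnj (ex n x)"
 have "(?G has_vector_derivative ?G' x) (at x)" for x
  by (rule has_vector_derivative_mult[OF Fd ed])
 moreover have "continuous_on UNIV ?G'"
  by (intro continuous_intros cF c)
 moreover have "?G L = ?G (-L)" using p[of "-L"] ex_L by simp
 ultimately have "(LINT x|M. ?G' x) = 0" by (rule C1_integral_deriv)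
 moreover have i: "integrable M F" "integrable M F'"
  by (intro continuous_imp_integrable_real continuous_on_subset[OF c] cF; simp)+
 have e: "?G' x = (- \<i> * of_real (kp n)) * (of_real (F x) * cnj (ex n x)) + of_real (F' x) * cnj (ex n x)" for x
  by (simp add: algebra_simps)
 have "(LINT x|M. ?G' x) = (- \<i> * of_real (kp n)) * (LINT x|M. of_real (F x) * cnj (ex n x)) + (LINT x|M. of_real (F' x) * cnj (ex n x))"
  unfolding e using integrable_mult_ex(2)[OF i(1), of n] integrable_mult_ex(2)[OF i(2), of n] by simp
 ultimately have "(LINT x|M. of_real (F' x) * cnj (ex n x)) = (\<i> * of_real (kp n)) * (LINT x|M. of_real (F x) * cnj (ex n x))"
  by (simp add: eq_neg_iff_add_eq_0[symmetric] add.commute)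
 then show ?thesis by (simp add: fc_def)
qed

lemma ii_mult: "\<i> * a * (\<i> * a * z) = - (a^2 * z)"
proof -
 have "\<i> * a * (\<i> * a * z) = (\<i> * \<i>) * (a^2 * z)" by (simp only: power2_eq_square ac_simps)
 then show ?thesis by simp
qed

lemma smooth_deriv:
 assumes "smooth \<phi>"
 shows "(\<phi> has_real_derivative deriv \<phi> x) (at x)" "continuous_on UNIV (deriv \<phi>)"
proof -
 have "(deriv ^^ 0) \<phi> differentiable at x" for x using assms unfolding smooth_def by blast
 then show "(\<phi> has_real_derivative deriv \<phi> x) (at x)"
  using DERIV_deriv_iff_real_differentiable[of \<phi> x] by simp
 have "(deriv ^^ 1) \<phi> differentiable at x" for x using assms unfolding smooth_def by blast
 then show "continuous_on UNIV (deriv \<phi>)"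
  by (auto intro!: continuous_at_imp_continuous_on simp: differentiable_imp_continuous_within)
qed

text \<open>Parseval moves the factor \<open>\<i> * kp n\<close> from the coefficients of the test
  function to those of \<open>f\<close>. With the converse above, weak differentiation becomes a
  condition on coefficients.\<close>

lemma weak_derivI:
 assumes f: "f \<in> L2_per L" and g: "g \<in> L2_per L" and fg: "!!n. fc g n = \<i> * of_real (kp n) * fc f n"
 shows "weak_deriv L f g"
 unfolding weak_deriv_def LINT_M
proof (intro allI impI)
 fix \<phi> assume "smooth \<phi> \<and> periodic L \<phi>"
 then have s: "smooth \<phi>" and p: "\<phi> (x + 2 * L) = \<phi> x" for x by (auto simp: periodic_def)
 note d = smooth_deriv[OF s]
 have cont: "continuous_on UNIV \<phi>"
  using d(1) by (meson DERIV_isCont continuous_at_imp_continuous_on)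
 have \<phi>: "\<phi> \<in> L2_per L" by (rule continuous_L2[OF cont p])
 have "deriv \<phi> (x + 2 * L) = deriv \<phi> x" for x
 proof -
  have "((%x. \<phi> (x + 2 * L)) has_real_derivative deriv \<phi> (x + 2 * L)) (at x)"
   using d(1)[of "x + 2 * L"] by (simp add: DERIV_shift)
  then show ?thesis using d(1)[of x] p DERIV_unique by simp
 qed
 then have \<phi>': "deriv \<phi> \<in> L2_per L" by (rule continuous_L2[OF d(2)])
 have "(%n. wt n * Re (fc (deriv \<phi>) n * cnj (fc f n))) sums ((LINT x|M. f x * deriv \<phi> x) / (2 * L))"
  by (rule parseval[OF \<phi>' f])
 moreover have "wt n * Re (fc (deriv \<phi>) n * cnj (fc f n)) = - (wt n * Re (fc \<phi> n * cnj (fc g n)))" for n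
  by (simp add: fc_deriv[OF d p] fg algebra_simps)
 moreover have "(%n. - (wt n * Re (fc \<phi> n * cnj (fc g n)))) sums - ((LINT x|M. g x * \<phi> x) / (2 * L))"
  by (rule sums_minus) (rule parseval[OF \<phi> g])
 ultimately have "(LINT x|M. f x * deriv \<phi> x) / (2 * L) = - ((LINT x|M. g x * \<phi> x) / (2 * L))"
  using sums_unique2 by auto
 then show "(LINT x|M. f x * deriv \<phi> x) = - (LINT x|M. g x * \<phi> x)" using L_pos by (simp add: field_simps)
qed

text \<open>The constant in the embedding of H2 into C1: it is what remains when Young's inequality
  splits the coefficient of the first derivative into that of the second, squared, and
  \<open>1 / (kp n)^2\<close>.\<close>

definition "KS = (\<Sum>n. 2 / (kp (Suc n))^2)"

lemma summable_kp: "summable (%n. 2 / (kp (Suc n))^2)"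
proof -
 have "summable (%n. 2 / (pi / L)^2 * (1 / (real (Suc n))^2))"
  using inverse_power_summable[of 2, where ?'a = real]
  by (intro summable_mult) (subst summable_Suc_iff, simp add: field_simps)
 moreover have "2 / (kp (Suc n))^2 = 2 / (pi / L)^2 * (1 / (real (Suc n))^2)" for n
  unfolding kp_def power_mult_distrib by simp
 ultimately show ?thesis by (simp only:)
qed

lemma C1_series:
 assumes c: "!!n. d n = - (of_real (kp n))\<^sup>2 * c n"
  and s: "summable (%n. wt n * (cmod (d n))^2)" and B: "(\<Sum>n. wt n * (cmod (d n))^2) <= B"
 shows "summable (%n. wt n * kp n * cmod (c n))" "(\<Sum>n. wt n * kp n * cmod (c n)) <= (B + KS) / 2"
  "summable (%n. wt n * cmod (c n))"
proof -
 let ?a = "%n. wt n * kp n * cmod (c n)"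
 have kp0: "kp 0 = 0" by (simp add: kp_def)
 have kp: "0 < kp (Suc n)" for n using L_pos by (simp add: kp_def)
 have le: "?a (Suc n) <= (wt (Suc n) * (cmod (d (Suc n)))^2 + 2 / (kp (Suc n))^2) / 2" for n
 proof -
  let ?k = "kp (Suc n)" and ?x = "cmod (c (Suc n))"
  have "cmod (d (Suc n)) = ?k^2 * ?x" unfolding c by (simp add: norm_mult norm_power)
  then have e: "?k * ?x = cmod (d (Suc n)) * (1 / ?k)" using kp[of n] by (simp add: power2_eq_square)
  have "2 * (cmod (d (Suc n)) * (1 / ?k)) <= (cmod (d (Suc n)))^2 + (1 / ?k)^2"
   using sum_squares_bound[of "cmod (d (Suc n))" "1 / ?k"] by simp
  then show ?thesis unfolding e[symmetric] by (simp add: wt_def power_divide)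
 qed
 have sd: "summable (%n. wt (Suc n) * (cmod (d (Suc n)))^2)"
  using s by (subst summable_Suc_iff)
 have sr: "summable (%n. (wt (Suc n) * (cmod (d (Suc n)))^2 + 2 / (kp (Suc n))^2) / 2)"
  by (intro summable_divide summable_add sd summable_kp)
 have nn: "0 <= ?a n" for n using L_pos by (simp add: kp_def wt_pos)
 have sS: "summable (%n. ?a (Suc n))"
  by (rule summable_comparison_test'[OF sr, where N = 0]) (use le nn in auto)
 then show sa: "summable ?a" by (subst (asm) summable_Suc_iff)
 have "suminf ?a = (\<Sum>n. ?a (Suc n))" using suminf_split_head[OF sa] by (simp add: kp0)
 also have "... <= (\<Sum>n. (wt (Suc n) * (cmod (d (Suc n)))^2 + 2 / (kp (Suc n))^2) / 2)"
  by (rule suminf_le[OF le sS sr])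
 also have "... = ((\<Sum>n. wt (Suc n) * (cmod (d (Suc n)))^2) + KS) / 2"
  unfolding KS_def using sd summable_kp by (simp add: suminf_divide suminf_add summable_add)
 also have "(\<Sum>n. wt (Suc n) * (cmod (d (Suc n)))^2) <= B"
  using suminf_split_head[OF s] B wt_pos(2)[of 0] by (simp add: c kp0)
 finally show "suminf ?a <= (B + KS) / 2" by simp
 have "wt (Suc n) * cmod (c (Suc n)) <= (L / pi) * ?a (Suc n)" for n
 proof -
  have "1 <= real (Suc n)" by simp
  then have "1 * (wt (Suc n) * cmod (c (Suc n))) <= real (Suc n) * (wt (Suc n) * cmod (c (Suc n)))"
   by (intro mult_right_mono) (auto simp: wt_pos)
  then show ?thesis using L_pos by (simp add: kp_def field_simps)
 qed
 then have "summable (%n. wt (Suc n) * cmod (c (Suc n)))"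
  by (intro summable_comparison_test'[OF summable_mult[OF sS, of "L / pi"], where N = 0]) (auto simp: wt_pos)
 then show "summable (%n. wt n * cmod (c n))" by (subst (asm) summable_Suc_iff)
qed

lemma abs_tm_le: "\<bar>tm c n x\<bar> <= wt n * cmod (c n)"
 unfolding tm_def abs_mult using abs_Re_le_cmod[of "c n * ex n x"] wt_pos[of n]
 by (simp add: norm_mult mult_left_mono)

lemma continuous_series:
 assumes "summable (%n. wt n * cmod (c n))"
 shows "continuous_on UNIV (%x. \<Sum>n. tm c n x)" "\<bar>\<Sum>n. tm c n x\<bar> <= (\<Sum>n. wt n * cmod (c n))"
  "summable (%n. tm c n x)" "uniform_limit UNIV (%m x. \<Sum>n<m. tm c n x) (%x. \<Sum>n. tm c n x) sequentially"
proof -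
 show u: "uniform_limit UNIV (%m x. \<Sum>n<m. tm c n x) (%x. \<Sum>n. tm c n x) sequentially"
  by (rule Weierstrass_m_test[OF _ assms]) (simp add: abs_tm_le)
 show "continuous_on UNIV (%x. \<Sum>n. tm c n x)"
  by (rule uniform_limit_theorem[OF _ u]) (auto intro!: always_eventually continuous_intros simp: tm_def)
 show s: "summable (%n. tm c n x)"
  by (rule summable_comparison_test'[OF assms, where N = 0]) (simp add: abs_tm_le)
 have sa: "summable (%n. \<bar>tm c n x\<bar>)"
  by (rule summable_comparison_test'[OF assms, where N = 0]) (simp add: abs_tm_le)
 show "\<bar>\<Sum>n. tm c n x\<bar> <= (\<Sum>n. wt n * cmod (c n))"
  by (rule order_trans[OF summable_rabs[OF sa] suminf_le[OF abs_tm_le sa assms]])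
qed

text \<open>Uniform convergence carries the coefficients over, since every partial sum that reaches
  index \<open>k\<close> already has \<open>c k\<close> as its coefficient there.\<close>

lemma fc_series:
 assumes s: "summable (%n. wt n * cmod (c n))" and c0: "Im (c 0) = 0"
 shows "(%x. \<Sum>n. tm c n x) \<in> L2_per L" "fc (%x. \<Sum>n. tm c n x) k = c k"
proof -
 let ?F = "%x. \<Sum>n. tm c n x"
 note cs = continuous_series[OF s]
 show F: "?F \<in> L2_per L" by (rule continuous_L2[OF cs(1)]) (simp add: tm_periodic)
 have "(%m. cmod (fc ?F k - c k)) \<longlonglongrightarrow> 0"
 proof (rule LIMSEQ_I)
  fix e :: real assume e: "0 < e"
  obtain m0 where m0: "!!m x. m \<ge> m0 ==> \<bar>(\<Sum>n<m. tm c n x) - ?F x\<bar> < e / 2"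
   using uniform_limitD[OF cs(4), of "e/2"] e unfolding eventually_sequentially dist_real_def by auto
  define m where "m = max m0 k"
  define g where "g = (%x. ?F x - fs c m x)"
  have fs: "fs c m x = (\<Sum>n<Suc m. tm c n x)" for x by (simp add: fs_def lessThan_Suc_atMost)
  have gb: "\<bar>g x\<bar> <= e / 2" for x
  proof -
   have "m0 <= Suc m" by (simp add: m_def)
   from m0[OF this, of x] show ?thesis unfolding g_def fs by linarith
  qed
  have g: "g \<in> L2_per L" unfolding g_def by (intro L2_diff F fs_L2)
  have "fc ?F k - c k = fc g k"
   unfolding g_def by (simp add: fc_diff[OF L2_integrable[OF F] L2_integrable[OF fs_L2]] fc_fs[where c = c, OF c0] m_def)
  moreover have "(norm_L2 L g)^2 <= (LINT x|M. (e / 2)^2)"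
   unfolding norm_L2_sq using L2_perD(4)[OF g] gb
   by (intro integral_mono) (auto simp: abs_le_square_iff[symmetric] e less_imp_le)
  then have "(norm_L2 L g)^2 <= (sqrt (2 * L) * (e / 2))^2"
   using L_pos by (simp add: measure_restrict_space power_mult_distrib power_divide)
  then have "norm_L2 L g <= sqrt (2 * L) * (e / 2)"
   by (rule power2_le_imp_le) (use e L_pos in simp)
  then have "cmod (fc g k) <= e / 2"
  proof -
   have "norm_L2 L g / sqrt (2 * L) <= e / 2"
    using \<open>norm_L2 L g <= sqrt (2 * L) * (e / 2)\<close> L_pos by (simp add: pos_divide_le_eq mult.commute)
   then show ?thesis using cmod_fc_le[OF g, of k] by linarith
  qed
  ultimately have "cmod (fc ?F k - c k) < e" using e by simp
  then show "\<exists>no. \<forall>n\<ge>no. norm (cmod (fc ?F k - c k) - 0) < e" by simp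
 qed
 then show "fc ?F k = c k" by (simp add: LIMSEQ_const_iff)
qed

text \<open>The representative and its derivative are returned together with their series, because
  joint measurability in time and space is later read off these formulas.\<close>

lemma C1_representation:
 assumes f: "f \<in> L2_per L" and g: "g \<in> L2_per L" and fg: "!!n. fc g n = - (of_real (kp n))\<^sup>2 * fc f n"
 obtains F F' where "!!x. (F has_real_derivative F' x) (at x)" "continuous_on UNIV F'"
  "!!x. F (x + 2 * L) = F x" "!!x. F' (x + 2 * L) = F' x" "AE x in lebesgue. f x = F x"
  "!!x. \<bar>F' x\<bar> <= ((norm_L2 L g)^2 / (2 * L) + KS) / 2" "!!n. fc F' n = \<i> * of_real (kp n) * fc f n"
  "F = (%x. \<Sum>n. tm (fc f) n x)" "F' = (%x. \<Sum>n. tm (%n. \<i> * of_real (kp n) * fc f n) n x)"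
proof -
 define c where "c = fc f"
 define d where "d = (%n. \<i> * of_real (kp n) * c n)"
 have B: "(\<Sum>n. wt n * (cmod (fc g n))^2) <= (norm_L2 L g)^2 / (2 * L)"
  using parseval_norm[OF g] by (simp add: sums_iff)
 note S = C1_series[of "fc g" c, OF fg[folded c_def] summable_fc[OF g] B]
 have kp0: "0 <= kp n" for n using L_pos by (simp add: kp_def)
 have e: "wt n * kp n * cmod (c n) = wt n * cmod (d n)" for n using kp0[of n] by (simp add: d_def norm_mult)
 define F F' where "F = (%x. \<Sum>n. tm c n x)" and "F' = (%x. \<Sum>n. tm d n x)"
 note c1 = continuous_series[OF S(3)] and d1 = continuous_series[OF S(1)[unfolded e]]
 have D: "(F has_real_derivative F' x) (at x)" for x
 proof -
  have "((%x. \<Sum>n. tm c n x) has_field_derivative (\<Sum>n. tm d n x)) (at x)"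
  proof (rule has_field_derivative_series'(2)[of UNIV "tm c" "tm d" x x])
   fix n y
   have "((%x. wt n * Re (c n * ex n x)) has_real_derivative wt n * Re ((\<i> * of_real (kp n) * c n) * ex n y)) (at y)"
    by (intro DERIV_cmult deriv_tm)
   then show "(tm c n has_field_derivative tm d n y) (at y within UNIV)"
    unfolding tm_def[abs_def] d_def by simp
  next
   show "uniformly_convergent_on UNIV (%n x. \<Sum>i<n. tm d i x)"
    using d1(4) uniformly_convergent_on_def by blast
  qed (use c1(3) in auto)
  then show ?thesis by (simp add: F_def F'_def)
 qed
 have Fp: "F (x + 2 * L) = F x" and Fp': "F' (x + 2 * L) = F' x" for x by (simp_all add: F_def F'_def tm_periodic)
 have c0: "Im (c 0) = 0" using fc_0_real[OF f] by (simp add: c_def)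
 have ae: "AE x in lebesgue. f x = F x"
  using fc_series[OF S(3) c0] f by (intro fc_unique) (auto simp: F_def c_def)
 have fF: "fc F n = fc f n" for n using fc_series(2)[OF S(3) c0] by (simp add: F_def c_def)
 have cF': "continuous_on UNIV F'" using d1(1) by (simp add: F'_def)
 have b: "\<bar>F' x\<bar> <= ((norm_L2 L g)^2 / (2 * L) + KS) / 2" for x
  using d1(2)[of x] S(2) by (simp add: F'_def e)
 show ?thesis
 proof (rule that[OF D cF' Fp Fp' ae b])
  show "fc F' n = \<i> * of_real (kp n) * fc f n" for n
   unfolding fc_deriv[OF D cF' Fp] fF ..
 qed (simp_all add: F_def F'_def c_def d_def)
qed

lemma hilbert_AE:
 assumes f: "f \<in> L2_per L" and g: "g \<in> L2_per L" and fg: "!!n. fc g n = (if n = 0 then 0 else - \<i> * fc f n)"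
 shows "AE x in lebesgue. has_hilbert_per L f x (g x)"
proof -
 have "fc g = (%n. if n = 0 then 0 else - \<i> * fc f n)" using fg by auto
 note h = hilbert_at_lebesgue_point[of f _ g, OF L2_integrable[OF f] L2_perD(1)[OF f] _ L2_integrable[OF g] L2_perD(1)[OF g] _ this]
 show ?thesis
  using lebesgue_point_AE[OF L2_integrable[OF f] L2_perD(1)[OF f]] lebesgue_point_AE[OF L2_integrable[OF g] L2_perD(1)[OF g]] h by auto
qed

lemma has_hilbert_per_unique: "has_hilbert_per L f x a ==> has_hilbert_per L f x b ==> a = b"
 unfolding has_hilbert_per_def by (rule tendsto_unique) auto

lemma conjugate_exists:
 assumes f: "f \<in> L2_per L"
 obtains g where "g \<in> L2_per L" "!!n. fc g n = (if n = 0 then 0 else - \<i> * fc f n)"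
  "AE x in lebesgue. has_hilbert_per L f x (g x)"
proof -
 let ?c = "%n. if n = 0 then 0 else - \<i> * fc f n"
 have s: "summable (%n. wt n * (cmod (?c n))^2)"
  by (rule summable_comparison_test'[OF summable_fc[OF f], where N = 0]) (auto simp: norm_mult wt_pos)
 note a = abel_L2[OF s]
 show ?thesis by (rule that[of "abel ?c"]) (use a hilbert_AE[OF f] in auto)
qed

end

section \<open>Smooth compactly supported test functions\<close>

text \<open>Iterated derivatives never leave the class, so no formula for the derivative of order
  \<open>k\<close> has to be found.\<close>

lemma smooth_coinduct:
 assumes "!!g. g \<in> S ==> (\<forall>x. g differentiable at x) \<and> deriv g \<in> S" "f \<in> S"
 shows "smooth f"
proof -
 have "(deriv ^^ k) f \<in> S" for k
  by (induction k) (use assms in auto)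
 then show ?thesis unfolding smooth_def using assms(1) by blast
qed

lemma smooth_differentiable: "smooth f ==> f differentiable at x"
 unfolding smooth_def by (metis funpow_0)

lemma smooth_deriv_iter: "smooth f ==> smooth ((deriv ^^ k) f)"
 unfolding smooth_def by (metis comp_apply funpow_add)

lemma smooth_primitive:
 assumes "!!x. (F has_real_derivative f x) (at x)" "smooth f"
 shows "smooth F"
proof -
 have d: "deriv F = f" using DERIV_imp_deriv[OF assms(1)] by auto
 have "(deriv ^^ k) F differentiable at x" for k x
 proof (cases k)
  case 0
  then show ?thesis using assms(1) real_differentiable_def by auto
 next
  case (Suc n)
  then have "(deriv ^^ k) F = (deriv ^^ n) f" by (simp add: funpow_swap1 d)
  then show ?thesis using assms(2) by (simp add: smooth_def)
 qed
 then show ?thesis by (simp add: smooth_def)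
qed

text \<open>The polynomial in \<open>1 / x\<close> makes the family closed under differentiation:
  \<open>p\<close> is replaced by \<open>y^2 * (p - p')\<close> in the variable
  \<open>y = 1 / x\<close>, also at the gluing point 0.\<close>

definition flat :: "real poly => real => real" where
 "flat p x = (if x > 0 then poly p (1 / x) * exp (- (1 / x)) else 0)"

lemma poly_exp_tendsto: "((%y. poly p y * exp (- y)) \<longlongrightarrow> (0::real)) at_top"
proof -
 have "((%y. \<Sum>i\<le>degree p. coeff p i * (y ^ i / exp y)) \<longlongrightarrow> (\<Sum>i\<le>degree p. coeff p i * 0)) at_top"
  by (intro tendsto_intros tendsto_power_div_exp_0)
 moreover have "poly p y * exp (- y) = (\<Sum>i\<le>degree p. coeff p i * (y ^ i / exp y))" for y :: real
  by (simp add: poly_altdef sum_distrib_right exp_minus divide_inverse mult.assoc)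
 ultimately show ?thesis by simp
qed

lemma flat_deriv: "(flat p has_real_derivative flat ([:0, 0, 1:] * (p - pderiv p)) x) (at x)"
proof -
 let ?q = "[:0, 0, 1:] * (p - pderiv p)"
 consider "x > 0" | "x < 0" | "x = 0" by linarith
 then show ?thesis
 proof cases
  case 1
  have "((%x. poly p (1 / x) * exp (- (1 / x))) has_real_derivative flat ?q x) (at x)"
   using 1 by (auto intro!: derivative_eq_intros DERIV_chain2[OF poly_DERIV] simp: flat_def field_simps power2_eq_square)
  moreover have ev: "\<forall>\<^sub>F y in nhds x. flat p y = poly p (1 / y) * exp (- (1 / y))"
   using eventually_nhds_in_open[of "{0<..}" x] 1 by (auto elim!: eventually_mono simp: flat_def)
  ultimately show ?thesis by (simp only: DERIV_cong_ev[OF refl ev refl])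
 next
  case 2
  have "\<forall>\<^sub>F y in nhds x. flat p y = 0"
   using eventually_nhds_in_open[of "{..<0}" x] 2 by (auto elim!: eventually_mono simp: flat_def)
  then show ?thesis using 2 by (subst DERIV_cong_ev[OF refl _ refl]) (auto simp: flat_def)
 next
  case 3
  have "((%h. flat p h / h) \<longlongrightarrow> 0) (at_left 0)"
  proof (rule tendsto_eventually)
   show "\<forall>\<^sub>F h in at_left 0. flat p h / h = 0"
    unfolding eventually_at_left_field by (intro exI[of _ "-1"]) (auto simp: flat_def)
  qed
  moreover have "((%h. flat p h / h) \<longlongrightarrow> 0) (at_right 0)"
  proof -
   have "((%h. poly ([:0, 1:] * p) (inverse h) * exp (- inverse h)) \<longlongrightarrow> 0) (at_right 0)"
    by (rule filterlim_compose[OF poly_exp_tendsto filterlim_inverse_at_top_right])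
   moreover have "\<forall>\<^sub>F h in at_right 0. poly ([:0, 1:] * p) (inverse h) * exp (- inverse h) = flat p h / h"
    unfolding eventually_at_right_field by (intro exI[of _ 1]) (auto simp: flat_def divide_inverse)
   ultimately show ?thesis by (rule Lim_transform_eventually)
  qed
  ultimately have "((%h. flat p h / h) \<longlongrightarrow> 0) (at 0)"
   by (rule filterlim_split_at_real)
  then show ?thesis using 3 by (simp add: DERIV_def flat_def)
 qed
qed

text \<open>Products of the two one-sided cutoffs are needed, and their derivatives are sums of such
  products; closing under both operations gives a class to which the coinduction rule
  applies.\<close>

inductive_set flat_algebra :: "(real => real) set" where
 base: "flat p \<in> flat_algebra"
| reflect: "(%x. flat p (1 - x)) \<in> flat_algebra"
| plus: "f \<in> flat_algebra ==> g \<in> flat_algebra ==> (%x. f x + g x) \<in> flat_algebra"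
| times: "f \<in> flat_algebra ==> g \<in> flat_algebra ==> (%x. f x * g x) \<in> flat_algebra"

lemma flat_algebra_deriv:
 assumes "f \<in> flat_algebra"
 shows "\<exists>g\<in>flat_algebra. \<forall>x. (f has_real_derivative g x) (at x)"
 using assms
proof induction
 case (base p)
 then show ?case using flat_deriv flat_algebra.base by blast
next
 case (reflect p)
 let ?q = "- ([:0, 0, 1:] * (p - pderiv p))"
 have "((%x. flat p (1 - x)) has_real_derivative flat ([:0, 0, 1:] * (p - pderiv p)) (1 - x) * (-1)) (at x)" for x
  by (rule DERIV_chain2[OF flat_deriv]) (auto intro!: derivative_eq_intros)
 moreover have "flat q y * (-1) = flat (- q) y" for q y by (simp add: flat_def)
 ultimately show ?case using flat_algebra.reflect[of ?q] by metis
next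
 case (plus f g)
 then obtain f' g' where d: "f' \<in> flat_algebra" "g' \<in> flat_algebra"
  "!!x. (f has_real_derivative f' x) (at x)" "!!x. (g has_real_derivative g' x) (at x)" by blast
 show ?case
  by (rule bexI[of _ "%x. f' x + g' x"]) (use d in \<open>auto intro: DERIV_add flat_algebra.plus\<close>)
next
 case (times f g)
 then obtain f' g' where d: "f' \<in> flat_algebra" "g' \<in> flat_algebra"
  "!!x. (f has_real_derivative f' x) (at x)" "!!x. (g has_real_derivative g' x) (at x)" by blast
 have "((%x. f x * g x) has_real_derivative f' x * g x + f x * g' x) (at x)" for x
  using DERIV_mult[OF d(3) d(4), of x] by (simp add: mult.commute add.commute)
 moreover have "(%x. f' x * g x + f x * g' x) \<in> flat_algebra"
  using times d by (intro flat_algebra.plus flat_algebra.times)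
 ultimately show ?case by (intro bexI[of _ "%x. f' x * g x + f x * g' x"]) auto
qed

lemma flat_algebra_smooth: "f \<in> flat_algebra ==> smooth f"
proof (rule smooth_coinduct[of flat_algebra])
 fix g assume "g \<in> flat_algebra"
 then obtain g' where g: "g' \<in> flat_algebra" "!!x. (g has_real_derivative g' x) (at x)"
  using flat_algebra_deriv by blast
 then have "deriv g = g'" by (intro ext DERIV_imp_deriv)
 then show "(\<forall>x. g differentiable at x) \<and> deriv g \<in> flat_algebra"
  using g real_differentiable_def by blast
qed

definition bump :: "real => real" where "bump x = flat 1 x * flat 1 (1 - x)"

lemma smooth_bump: "smooth bump"
proof -
 have "bump = (%x. flat 1 x * flat 1 (1 - x))" by (rule ext) (simp add: bump_def)
 moreover have "(%x. flat 1 x * flat 1 (1 - x)) \<in> flat_algebra" by (intro flat_algebra.intros)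
 ultimately show ?thesis using flat_algebra_smooth by simp
qed

lemma bump_props: "0 <= bump x" "x <= 0 \<or> 1 <= x ==> bump x = 0" "0 < x ==> x < 1 ==> 0 < bump x"
 by (auto simp: bump_def flat_def)

lemma continuous_bump: "continuous_on A bump"
 using smooth_differentiable[OF smooth_bump]
 by (meson continuous_at_imp_continuous_on differentiable_imp_continuous_within)

text \<open>A primitive of \<open>bump\<close>. Its total increase \<open>c\<close> is not
  normalised to 1, since it cancels where the function is used.\<close>

lemma smooth_step:
 obtains P c where "!!x. (P has_real_derivative bump x) (at x)" "0 < c" "!!x. x <= 0 ==> P x = 0"
  "!!x. 1 <= x ==> P x = c" "!!x. 0 <= P x \<and> P x <= c"
proof -
 obtain P0 where P0: "!!x. (P0 has_real_derivative bump x) (at x)"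
 proof -
  have "isCont bump x" for x using continuous_bump[of UNIV] by (simp add: continuous_on_eq_continuous_at)
  then have "\<exists>F. \<forall>x :: real. (-\<infinity>::ereal) < x \<longrightarrow> x < \<infinity> \<longrightarrow> (F has_vector_derivative bump x) (at x)"
   by (intro einterval_antiderivative) auto
  then show ?thesis using that by (auto simp: has_real_derivative_iff_has_vector_derivative)
 qed
 define P where "P = (%x. P0 x - P0 0)"
 have D: "(P has_real_derivative bump x) (at x)" for x
  unfolding P_def by (auto intro!: derivative_eq_intros P0)
 have mono: "x <= y ==> P x <= P y" for x y
  by (rule DERIV_nonneg_imp_nondecreasing[of x y P]) (use D bump_props(1) in blast)+
 have anti: "x <= y ==> (!!z. x <= z ==> z <= y ==> bump z = 0) ==> P y <= P x" for x y
  by (rule DERIV_nonpos_imp_nonincreasing[of x y P]) (use D in force)+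
 have P00: "P 0 = 0" by (simp add: P_def)
 have z: "P x = 0" if "x <= 0" for x
  using mono[OF that] anti[OF that] bump_props(2) P00 by force
 have o: "P x = P 1" if "1 <= x" for x
  using mono[OF that] anti[OF that] bump_props(2) by force
 have "P 0 < P 1"
  by (rule DERIV_pos_imp_increasing_open[of 0 1])
   (use D bump_props(3) in \<open>auto intro!: continuous_at_imp_continuous_on DERIV_isCont\<close>)
 then have pos: "0 < P 1" by (simp add: P00)
 have "0 <= P x" for x using z[of x] mono[of 0 x] P00 by (cases "x <= 0") auto
 moreover have "P x <= P 1" for x using o[of x] mono[of x 1] by (cases "1 <= x") auto
 ultimately show ?thesis by (intro that[OF D pos z o]) blast+
qed

text \<open>This is the derivative of the trapezoidal test function below. For the class to be
  closed under derivation, the two coefficients and the order of differentiation have to vary in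
  it.\<close>

lemma smooth_bump_comb: "smooth (%x. a * bump ((x - s) / e) + b * bump ((x - t) / e))"
proof (rule smooth_coinduct[of "{%x. a * (deriv ^^ k) bump ((x - s) / e) + b * (deriv ^^ k) bump ((x - t) / e) | a b k. True}"])
 fix g assume "g \<in> {%x. a * (deriv ^^ k) bump ((x - s) / e) + b * (deriv ^^ k) bump ((x - t) / e) | a b k. True}"
 then obtain a b k where g: "g = (%x. a * (deriv ^^ k) bump ((x - s) / e) + b * (deriv ^^ k) bump ((x - t) / e))" by blast
 have d: "((deriv ^^ k) bump has_real_derivative (deriv ^^ Suc k) bump y) (at y)" for y
  using smooth_differentiable[OF smooth_deriv_iter[OF smooth_bump]] by (simp add: DERIV_deriv_iff_real_differentiable)
 have c: "((%x. (deriv ^^ k) bump ((x - r) / e)) has_real_derivative (deriv ^^ Suc k) bump ((x - r) / e) * (1 / e)) (at x)" for r x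
  by (rule DERIV_chain2[OF d]) (auto intro!: derivative_eq_intros simp: divide_inverse)
 have D: "(g has_real_derivative (a / e) * (deriv ^^ Suc k) bump ((x - s) / e) + (b / e) * (deriv ^^ Suc k) bump ((x - t) / e)) (at x)" for x
  unfolding g using DERIV_add[OF DERIV_cmult[OF c[of s x], of a] DERIV_cmult[OF c[of t x], of b]] by (simp add: mult_ac)
 then have "deriv g = (%x. (a / e) * (deriv ^^ Suc k) bump ((x - s) / e) + (b / e) * (deriv ^^ Suc k) bump ((x - t) / e))"
  by (intro ext DERIV_imp_deriv)
 then show "(\<forall>x. g differentiable at x) \<and> deriv g \<in> {%x. a * (deriv ^^ k) bump ((x - s) / e) + b * (deriv ^^ k) bump ((x - t) / e) | a b k. True}"
  using D real_differentiable_def by blast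
next
 show "(%x. a * bump ((x - s) / e) + b * bump ((x - t) / e)) \<in> {%x. a * (deriv ^^ k) bump ((x - s) / e) + b * (deriv ^^ k) bump ((x - t) / e) | a b k. True}"
  by (rule CollectI, rule exI[of _ a], rule exI[of _ b], rule exI[of _ 0], simp)
qed

section \<open>Weak derivatives in time\<close>

definition test_fun :: "real => (real => real) => bool" where
 "test_fun T \<psi> \<longleftrightarrow> smooth \<psi> \<and> (\<exists>a b. 0 < a \<and> b < T \<and> (\<forall>t. \<psi> t \<noteq> 0 \<longrightarrow> t \<in> {a..b}))"

text \<open>The one-sided form suffices for the energy argument and spares the fundamental theorem of
 calculus for absolutely continuous functions.\<close>

lemma weak_growth:
 assumes st: "0 < s" "s < t" "t < T" and m: "continuous_on {0..T} m"
  and w: "!!\<psi>. test_fun T \<psi> ==> (LINT z':{0..T}|lebesgue. deriv \<psi> z' * m z') = - (LINT z':{0..T}|lebesgue. \<psi> z' * n z')"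
  and int: "!!\<psi>. continuous_on UNIV \<psi> ==> set_integrable lebesgue {0..T} (%z'. \<psi> z' * n z')"
  and e0: "0 < e0" and A: "0 <= A" "AE z' in lebesgue. s <= z' \<and> z' <= t + e0 \<and> z' <= T \<longrightarrow> n z' <= A"
 shows "m t - m s <= A * (t - s)"
proof -
 obtain P c where P: "!!x. (P has_real_derivative bump x) (at x)" "0 < c" "!!x. x <= 0 ==> P x = 0"
  "!!x. 1 <= x ==> P x = c" "!!x. 0 <= P x \<and> P x <= c" by (rule smooth_step) blast
 have "m t - m s <= A * (t - s) + \<eta>" if \<eta>: "0 < \<eta>" for \<eta>
 proof -
  define \<eta>' where "\<eta>' = \<eta> / 4"
  have "\<exists>d>0. \<forall>z'\<in>{0..T}. \<bar>z' - r\<bar> < d \<longrightarrow> \<bar>m z' - m r\<bar> < \<eta>'" if "r \<in> {0..T}" for r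
   using m that \<eta> unfolding continuous_on_iff dist_real_def \<eta>'_def by (metis divide_pos_pos zero_less_numeral)
  note mc = this
  obtain d1 where d1: "d1 > 0" "\<forall>z'\<in>{0..T}. \<bar>z' - s\<bar> < d1 \<longrightarrow> \<bar>m z' - m s\<bar> < \<eta>'"
   using mc[of s] st by auto
  obtain d2 where d2: "d2 > 0" "\<forall>z'\<in>{0..T}. \<bar>z' - t\<bar> < d2 \<longrightarrow> \<bar>m z' - m t\<bar> < \<eta>'"
   using mc[of t] st by auto
  note d = d1(1) d2(1) d1(2)[rule_format] d2(2)[rule_format]
  \<comment> \<open>\<open>e\<close> will be the width of the ramps. The entries keep the ramp
    behind \<open>t\<close> within \<open>t + e0\<close> and before \<open>T\<close>, make
    \<open>m\<close> vary by less than \<open>\<eta>'\<close> across each ramp, and limit the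
    contribution of the extra interval of length \<open>e\<close> to
    \<open>\<eta> / 4\<close>.\<close>
  define S where "S = {e0, (T - t) / 2, d1 / 2, d2 / 2, \<eta> / (4 * (A + 1))}"
  define e where "e = Min S"
  have S: "finite S" "S \<noteq> {}" "!!x. x \<in> S ==> 0 < x"
   using e0 st d1(1) d2(1) \<eta> A(1) by (auto simp: S_def)
  have e: "0 < e" unfolding e_def using Min_in[OF S(1,2)] S(3) by blast
  have "e <= e0" "e <= (T - t) / 2" "e <= d1 / 2" "e <= d2 / 2" "e <= \<eta> / (4 * (A + 1))"
   unfolding e_def by (rule Min_le[OF S(1)], simp add: S_def)+
  note e = e this
  have ed: "e < T - t" "e < d1" "e < d2" using e st d by auto
  \<comment> \<open>A smooth trapezoid: zero outside \<open>[s, t + e]\<close> and equal to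
    \<open>c\<close> on \<open>[s + e, t]\<close>. Its derivative consists of two bumps of mass
    \<open>c\<close>, which average \<open>m\<close> near \<open>s\<close> and near \<open>t\<close>
    with opposite signs.\<close>
  define \<psi> where "\<psi> = (%x. P ((x - s) / e) - P ((x - t) / e))"
  have D: "(\<psi> has_real_derivative (1/e) * bump ((x - s) / e) + (-1/e) * bump ((x - t) / e)) (at x)" for x
  proof -
   have "((%x. P ((x - r) / e)) has_real_derivative bump ((x - r) / e) * (1 / e)) (at x)" for r
    by (rule DERIV_chain2[OF P(1)]) (auto intro!: derivative_eq_intros simp: divide_inverse)
   from DERIV_diff[OF this[of s] this[of t]] show ?thesis unfolding \<psi>_def by (simp add: mult.commute)
  qed
  have \<psi>0: "\<psi> x = 0" if "x <= s \<or> t + e <= x" for x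
   using that st e P(3,4) unfolding \<psi>_def by (auto simp: field_simps)
  have Pmono: "x <= y ==> P x <= P y" for x y
   by (rule DERIV_nonneg_imp_nondecreasing[of x y P]) (use P(1) bump_props(1) in blast)+
  have \<psi>b: "0 <= \<psi> x" "\<psi> x <= c" for x
   using Pmono[of "(x - t) / e" "(x - s) / e"] st e P(5)[of "(x - t) / e"] P(5)[of "(x - s) / e"]
   by (auto simp: \<psi>_def divide_right_mono)
  have "test_fun T \<psi>"
   unfolding test_fun_def
  proof (intro conjI exI)
   show "smooth \<psi>" by (rule smooth_primitive[OF D smooth_bump_comb])
   show "\<forall>t'. \<psi> t' \<noteq> 0 \<longrightarrow> t' \<in> {s..t + e}" using \<psi>0 by (meson atLeastAtMost_iff linear)
  qed (use st ed in auto)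
  from w[OF this] have W: "(LINT z':{0..T}|lebesgue. deriv \<psi> z' * m z') = - (LINT z':{0..T}|lebesgue. \<psi> z' * n z')" .
  let ?M = "lebesgue_on {0..T}"
  have eq: "(LINT z':{0..T}|lebesgue. g z') = integral\<^sup>L ?M g" for g :: "real => real"
   by (simp add: set_lebesgue_integral_def integral_restrict_space)
  have ieq: "set_integrable lebesgue {0..T} g \<longleftrightarrow> integrable ?M g" for g :: "real => real"
   by (simp add: set_integrable_def integrable_restrict_space)
  have bc: "continuous_on {0..T} (%z'. (1/e) * bump ((z' - r) / e))" for r
   by (intro continuous_intros continuous_on_compose2[OF continuous_bump[of UNIV]]) (use e in auto)
  have key: "\<bar>(LINT z'|?M. (1/e) * bump ((z' - r) / e) * m z') - c * m r\<bar> <= \<eta>' * c"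
   if r: "0 < r" "r + e <= T" and mr: "!!z'. z' \<in> {0..T} ==> \<bar>z' - r\<bar> <= e ==> \<bar>m z' - m r\<bar> <= \<eta>'" for r
  proof -
   have ib: "integrable ?M (%z'. (1/e) * bump ((z' - r) / e))"
    by (rule continuous_imp_integrable_real[OF bc])
   have ibm: "integrable ?M (%z'. (1/e) * bump ((z' - r) / e) * m z')"
    by (rule continuous_imp_integrable_real[OF continuous_on_mult[OF bc m]])
   have "((%z'. (1/e) * bump ((z' - r) / e)) has_integral (P ((T - r) / e) - P ((0 - r) / e))) {0..T}"
   proof (rule fundamental_theorem_of_calculus)
    fix x
    have "((%x. P ((x - r) / e)) has_real_derivative bump ((x - r) / e) * (1 / e)) (at x within {0..T})"
     by (rule DERIV_chain2[OF P(1)]) (auto intro!: derivative_eq_intros simp: divide_inverse)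
    then show "((%x. P ((x - r) / e)) has_vector_derivative (1/e) * bump ((x - r) / e)) (at x within {0..T})"
     by (simp add: has_real_derivative_iff_has_vector_derivative mult.commute)
   qed (use st in auto)
   moreover have "P ((T - r) / e) = c" "P ((0 - r) / e) = 0"
    using r e by (auto intro!: P(3,4) simp: field_simps)
   ultimately have "((%z'. (1/e) * bump ((z' - r) / e)) has_integral c) {0..T}" by simp
   moreover have "((%z'. (1/e) * bump ((z' - r) / e)) has_integral (LINT z'|?M. (1/e) * bump ((z' - r) / e))) {0..T}"
    using has_integral_set_lebesgue[of "{0..T}" "%z'. (1/e) * bump ((z' - r) / e)"] ib unfolding eq ieq by blast
   ultimately have ic: "(LINT z'|?M. (1/e) * bump ((z' - r) / e)) = c"
    using has_integral_unique by blast
   have d_eq: "(LINT z'|?M. (1/e) * bump ((z' - r) / e) * m z') - c * m r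
    = (LINT z'|?M. (1/e) * bump ((z' - r) / e) * m z' - (1/e) * bump ((z' - r) / e) * m r)"
    unfolding Bochner_Integration.integral_diff[OF ibm integrable_mult_left[OF ib]] integral_mult_left_zero ic ..
   have d_le: "\<bar>LINT z'|?M. (1/e) * bump ((z' - r) / e) * m z' - (1/e) * bump ((z' - r) / e) * m r\<bar> <= (LINT z'|?M. \<eta>' * ((1/e) * bump ((z' - r) / e)))"
   proof (rule order_trans[OF integral_abs_bound integral_mono])
    show "integrable ?M (%z'. \<bar>(1/e) * bump ((z' - r) / e) * m z' - (1/e) * bump ((z' - r) / e) * m r\<bar>)"
     by (intro integrable_abs Bochner_Integration.integrable_diff ibm integrable_mult_left ib)
    show "integrable ?M (%z'. \<eta>' * ((1/e) * bump ((z' - r) / e)))" by (rule integrable_mult_right[OF ib])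
    fix z' assume "z' \<in> space ?M"
    then have z': "z' \<in> {0..T}" by simp
    have "\<bar>(1/e) * bump ((z' - r) / e) * m z' - (1/e) * bump ((z' - r) / e) * m r\<bar>
     = ((1/e) * bump ((z' - r) / e)) * \<bar>m z' - m r\<bar>"
    proof -
     have "\<bar>z * x - z * y\<bar> = z * \<bar>x - y\<bar>" if "0 <= z" for x y z :: real
      using that by (simp add: abs_mult flip: right_diff_distrib)
     moreover have "0 <= (1/e) * bump ((z' - r) / e)" using e(1) bump_props(1)[of "(z' - r) / e"] by simp
     ultimately show ?thesis by blast
    qed
    also have "... <= ((1/e) * bump ((z' - r) / e)) * \<eta>'"
    proof (cases "\<bar>z' - r\<bar> <= e")
     case True
     then show ?thesis using mr[OF z'] e bump_props(1) by (intro mult_left_mono) auto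
    next
     case False
     then have "bump ((z' - r) / e) = 0" using e by (intro bump_props(2)) (auto simp: field_simps)
     then show ?thesis by simp
    qed
    finally show "\<bar>(1/e) * bump ((z' - r) / e) * m z' - (1/e) * bump ((z' - r) / e) * m r\<bar>
     <= \<eta>' * ((1/e) * bump ((z' - r) / e))" by (simp add: mult.commute)
   qed
   have "(LINT z'|?M. \<eta>' * ((1/e) * bump ((z' - r) / e))) = \<eta>' * c"
    by (subst integral_mult_right_zero) (simp only: ic)
   then show ?thesis using d_le unfolding d_eq by (simp only:)
  qed
  have k1: "\<bar>(LINT z'|?M. (1/e) * bump ((z' - s) / e) * m z') - c * m s\<bar> <= \<eta>' * c"
   by (rule key) (use st ed d(3) in \<open>auto intro!: less_imp_le\<close>)
  have k2: "\<bar>(LINT z'|?M. (1/e) * bump ((z' - t) / e) * m z') - c * m t\<bar> <= \<eta>' * c"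
   by (rule key) (use st ed d(4) in \<open>auto intro!: less_imp_le\<close>)
  have "(LINT z':{0..T}|lebesgue. deriv \<psi> z' * m z')
   = (LINT z'|?M. (1/e) * bump ((z' - s) / e) * m z' - (1/e) * bump ((z' - t) / e) * m z')"
   unfolding eq DERIV_imp_deriv[OF D] by (intro Bochner_Integration.integral_cong refl) (simp add: algebra_simps)
  also have "... = (LINT z'|?M. (1/e) * bump ((z' - s) / e) * m z') - (LINT z'|?M. (1/e) * bump ((z' - t) / e) * m z')"
   by (intro Bochner_Integration.integral_diff continuous_imp_integrable_real[OF continuous_on_mult[OF bc m]])
  finally have 1: "c * m t - c * m s - 2 * (\<eta>' * c) <= (LINT z'|?M. \<psi> z' * n z')"
   using W k1 k2 unfolding eq by linarith
  have \<psi>c: "continuous_on UNIV \<psi>" using D by (meson DERIV_isCont continuous_at_imp_continuous_on)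
  let ?g = "%z'. A * c * indicator {s..t + e} z'"
  have "(LINT z'|?M. \<psi> z' * n z') <= (LINT z'|?M. ?g z')"
  proof (rule integral_mono_AE)
   show "integrable ?M (%z'. \<psi> z' * n z')" using int[OF \<psi>c] by (simp add: ieq)
   have "integrable lebesgue (%z'::real. indicator {0..T} z' * (A * c * indicator {s..t + e} z'))"
   proof -
    have "indicator {0..T} z' * (A * c * indicator {s..t + e} z') = A * c * indicator {s..t + e} z'" for z' :: real
     using st ed by (auto simp: indicator_def)
    moreover have "integrable lebesgue (indicator {s..t + e} :: real => real)"
     using lmeasurable_interval(1)[of s "t + e"] lmeasurable_iff_integrable by blast
    ultimately show ?thesis by (simp only:) (rule integrable_mult_right)
   qed
   moreover have R: "{0..T} \<inter> space lebesgue \<in> sets lebesgue" by simp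
   ultimately show "integrable ?M ?g" by (simp only: integrable_restrict_space[OF R] real_scaleR_def)
   show "AE z' in ?M. \<psi> z' * n z' <= ?g z'"
    unfolding AE_restrict_space_iff[of "{0..T}" lebesgue, simplified]
    using A(2)
   proof eventually_elim
    case (elim z')
    show ?case
    proof
     assume "0 <= z' \<and> z' <= T"
     show "\<psi> z' * n z' <= ?g z'"
     proof (cases "z' \<in> {s..t + e}")
      case True
      then have "n z' <= A" using elim e \<open>0 <= z' \<and> z' <= T\<close> by auto
      then have "\<psi> z' * n z' <= \<psi> z' * A" using \<psi>b by (intro mult_left_mono) auto
      also have "... <= c * A" using \<psi>b A by (intro mult_right_mono) auto
      finally show ?thesis using True by (simp add: mult.commute)
     next
      case False
      then have "\<psi> z' = 0" by (intro \<psi>0) auto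
      then show ?thesis using False by simp
     qed
    qed
   qed
  qed
  also have "... = A * c * (t + e - s)"
  proof -
   have "{0..T} \<inter> {s..t + e} = {s..t + e}" using st ed by auto
   then have i: "indicator {0..T} z' * (A * c * indicator {s..t + e} z') = A * c * indicator {s..t + e} z'" for z' :: real
    by (auto simp: indicator_def)
   have R: "{0..T} \<inter> space lebesgue \<in> sets lebesgue" by simp
   have "(LINT z'|?M. ?g z') = (LINT z'|lebesgue. A * c * indicator {s..t + e} z')"
    by (simp only: integral_restrict_space[OF R] real_scaleR_def i)
   also have "... = A * c * (t + e - s)" using st e by (subst integral_mult_right_zero) simp
   finally show ?thesis .
  qed
  finally have "c * (m t - m s) <= c * (A * (t + e - s) + 2 * \<eta>')"
   using 1 by (simp add: algebra_simps)
  then have "m t - m s <= A * (t + e - s) + 2 * \<eta>'" using P(2) by simp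
  also have "... = A * (t - s) + A * e + \<eta> / 2" by (simp add: \<eta>'_def algebra_simps)
  also have "A * e <= \<eta> / 4"
  proof -
   have "A * e <= A * (\<eta> / (4 * (A + 1)))" using e A by (intro mult_left_mono) auto
   also have "... = (\<eta> / 4) * (A / (A + 1))" by simp
   also have "... <= (\<eta> / 4) * 1" using \<eta> A by (intro mult_left_mono) auto
   finally show ?thesis by simp
  qed
  finally show ?thesis using \<eta> by simp
 qed
 then show ?thesis by (rule field_le_epsilon)
qed

section \<open>Borel versions of space-time functions and Fubini's theorem\<close>

text \<open>Passage from the completed measure to a Borel representative, for which Fubini's theorem
  on \<open>lborel \<Otimes>\<^sub>M lborel\<close> applies.\<close>

lemma lebesgue_version:
 fixes f g :: "'a::euclidean_space => real"
 assumes f: "f \<in> borel_measurable borel" and ae: "AE x in lborel. f x = g x"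
 shows "g \<in> borel_measurable lebesgue" "integrable lebesgue g \<longleftrightarrow> integrable lborel f"
  "integral\<^sup>L lebesgue g = integral\<^sup>L lborel f"
proof -
 have fl: "f \<in> borel_measurable lborel" using f by simp
 have fm: "f \<in> borel_measurable lebesgue" by (rule measurable_completion[OF fl])
 have ae': "AE x in lebesgue. f x = g x" using ae by (simp add: AE_completion_iff)
 show gm: "g \<in> borel_measurable lebesgue" by (rule borel_measurable_AE[OF fm ae'])
 show "integrable lebesgue g \<longleftrightarrow> integrable lborel f"
  using integrable_cong_AE[OF fm gm ae'] integrable_completion[OF fl] by simp
 show "integral\<^sup>L lebesgue g = integral\<^sup>L lborel f"
  using integral_cong_AE[OF fm gm ae'] integral_completion[OF fl] by simp
qed

context torus begin

text \<open>The null set where the Borel version differs from \<open>F\<close> has null sections at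
  almost every time and over almost every point. Both directions are stated, one for each order of
  integration.\<close>

lemma Linf_L2_borel:
 assumes "Linf_L2 L T F"
 obtains g C where "g \<in> borel_measurable borel" "0 <= C"
  "AE t in lborel. AE x in lborel. t \<in> {0..T} \<longrightarrow> g (t, x) = F t x"
  "AE x in lborel. AE t in lborel. t \<in> {0..T} \<longrightarrow> g (t, x) = F t x"
  "AE t in lborel. t \<in> {0..T} \<longrightarrow> F t \<in> L2_per L \<and> norm_L2 L (F t) <= C"
proof -
 let ?S = "{0..T} \<times> (UNIV :: real set)"
 have S: "?S \<in> sets lebesgue"
 proof -
  have "closed ?S" by (intro closed_Times) auto
  then have "?S \<in> sets lborel" by (simp add: borel_closed)
  then show ?thesis by (rule sets_completionI_sets)
 qed
 have "(%(t, x). F t x) \<in> borel_measurable (lebesgue_on ?S)" using assms by (simp add: Linf_L2_def)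
 from borel_measurable_if_I[OF this S]
 obtain g where g: "g \<in> borel_measurable lborel" "AE z in lborel. (if z \<in> ?S then (%(t, x). F t x) z else 0) = g z"
  using completion_ex_borel_measurable_real by blast
 obtain N where N: "N \<in> null_sets lborel" "{z. (if z \<in> ?S then (%(t, x). F t x) z else 0) \<noteq> g z} \<subseteq> N"
  using g(2) unfolding eventually_ae_filter by auto
 have out: "g (t, x) = F t x" if "(t, x) \<notin> N" "t \<in> {0..T}" for t x
 proof -
  have "(t, x) \<notin> {z. (if z \<in> ?S then (%(t, x). F t x) z else 0) \<noteq> g z}" using N(2) that(1) by blast
  then show ?thesis using that(2) by simp
 qed
 have NP: "N \<in> null_sets (lborel \<Otimes>\<^sub>M lborel)" using N(1) by (simp add: lborel_prod)
 have ae: "AE z in lborel \<Otimes>\<^sub>M lborel. (fst z, snd z) \<notin> N" using AE_not_in[OF NP] by simp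
 have meas: "{z \<in> space (lborel \<Otimes>\<^sub>M lborel). (fst z, snd z) \<notin> N} \<in> sets (lborel \<Otimes>\<^sub>M lborel)"
 proof -
  have "{z \<in> space (lborel \<Otimes>\<^sub>M lborel). (fst z, snd z) \<notin> N} = space (lborel \<Otimes>\<^sub>M lborel) - N" by auto
  then show ?thesis using sets.compl_sets[of N "lborel \<Otimes>\<^sub>M lborel"] null_setsD2[OF NP] by simp
 qed
 have 1: "AE t in lborel. AE x in lborel. (t, x) \<notin> N"
  using lborel_pair.AE_pair[OF ae] by simp
 have 2: "AE x in lborel. AE t in lborel. (t, x) \<notin> N"
  using lborel_pair.AE_commute[of "%t x. (t, x) \<notin> N", OF meas] 1 by simp
 obtain C where C: "AE t in lebesgue_on {0..T}. norm_L2 L (F t) <= C" using assms by (auto simp: Linf_L2_def)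
 have "AE t in lebesgue_on {0..T}. F t \<in> L2_per L" using assms by (simp add: Linf_L2_def)
 with C have "AE t in lebesgue_on {0..T}. F t \<in> L2_per L \<and> norm_L2 L (F t) <= max C 0"
  by eventually_elim auto
 then have 3: "AE t in lborel. t \<in> {0..T} \<longrightarrow> F t \<in> L2_per L \<and> norm_L2 L (F t) <= max C 0"
  by (subst (asm) AE_restrict_space_iff) (auto simp: AE_completion_iff)
 show ?thesis
 proof (rule that[of g "max C 0"])
  show "AE t in lborel. AE x in lborel. t \<in> {0..T} \<longrightarrow> g (t, x) = F t x"
   using 1 by eventually_elim (auto elim!: eventually_mono intro!: out)
  show "AE x in lborel. AE t in lborel. t \<in> {0..T} \<longrightarrow> g (t, x) = F t x"
   using 2 by eventually_elim (auto elim!: eventually_mono intro!: out)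
 qed (use g 3 in auto)
qed

lemma time_space_fubini:
 assumes F: "Linf_L2 L T F" and a: "continuous_on UNIV a" and \<phi>: "\<phi> \<in> L2_per L"
 shows "integrable M (%x. \<phi> x * (LINT t:{0..T}|lebesgue. a t * F t x))"
  "set_integrable lebesgue {0..T} (%t. a t * (LINT x|M. \<phi> x * F t x))"
  "(LINT x|M. \<phi> x * (LINT t:{0..T}|lebesgue. a t * F t x)) = (LINT t:{0..T}|lebesgue. a t * (LINT x|M. \<phi> x * F t x))"
proof -
 obtain g C where g: "g \<in> borel_measurable borel" "0 <= C"
  "AE t in lborel. AE x in lborel. t \<in> {0..T} \<longrightarrow> g (t, x) = F t x"
  "AE x in lborel. AE t in lborel. t \<in> {0..T} \<longrightarrow> g (t, x) = F t x"
  "AE t in lborel. t \<in> {0..T} \<longrightarrow> F t \<in> L2_per L \<and> norm_L2 L (F t) <= C"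
  by (rule Linf_L2_borel[OF F])
 obtain p where p: "p \<in> borel_measurable lborel" "AE x in lborel. \<phi> x = p x"
  using completion_ex_borel_measurable_real[OF L2_perD(2)[OF \<phi>]] by blast
 have am: "a \<in> borel_measurable borel" by (rule borel_measurable_continuous_onI[OF a])
 note [measurable] = g(1) am
 have [measurable]: "p \<in> borel_measurable borel" using p(1) by simp
 \<comment> \<open>The cutoffs in both variables are part of the integrand, so that Fubini's theorem
   runs over the whole plane.\<close>
 define k where "k = (%t x. (indicator {0..T} t * a t) * ((indicator {-L..L} x * p x) * g (t, x)))"
 have km[measurable]: "case_prod k \<in> borel_measurable (lborel \<Otimes>\<^sub>M lborel)"
  unfolding k_def by measurable
 have km1: "(%x. k t x) \<in> borel_measurable borel" "(%t. k t x) \<in> borel_measurable borel" for t x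
  unfolding k_def by measurable
 define b where "b = (%t. indicator {0..T} t * a t)"
 have IM: "integral\<^sup>L lebesgue (%x. indicator {-L..L} x * u x) = integral\<^sup>L M u"
  "integrable lebesgue (%x. indicator {-L..L} x * u x) \<longleftrightarrow> integrable M u" for u :: "real => real"
  by (simp_all add: integral_restrict_space integrable_restrict_space)
 have slice: "AE t in lborel. integrable lborel (k t) \<and> integral\<^sup>L lborel (k t) = b t * (LINT x|M. \<phi> x * F t x)
   \<and> (LINT x|lborel. \<bar>k t x\<bar>) <= \<bar>b t\<bar> * (norm_L2 L \<phi> * C)"
  using g(3,5)
 proof eventually_elim
  case (elim t)
  show ?case
  proof (cases "t \<in> {0..T}")
   case True
   then have Ft: "F t \<in> L2_per L" "norm_L2 L (F t) <= C" using elim by auto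
   let ?u = "%x. b t * (indicator {-L..L} x * (\<phi> x * F t x))"
   have ae: "AE x in lborel. k t x = ?u x"
    using elim(1) p(2) by eventually_elim (use True in \<open>simp add: k_def b_def\<close>)
   have ae': "AE x in lborel. \<bar>k t x\<bar> = \<bar>?u x\<bar>"
    using ae by eventually_elim simp
   have iu: "integrable lebesgue ?u"
    using L2_mult(1)[OF \<phi> Ft(1)] by (intro integrable_mult_right) (simp only: IM)
   have 1: "integrable lborel (k t)" using lebesgue_version(2)[OF km1(1) ae] iu by simp
   have 2: "integral\<^sup>L lborel (k t) = b t * (LINT x|M. \<phi> x * F t x)"
    unfolding lebesgue_version(3)[OF km1(1) ae, symmetric] by (simp only: integral_mult_right_zero IM)
   have "(LINT x|lborel. \<bar>k t x\<bar>) = (LINT x|lebesgue. \<bar>?u x\<bar>)"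
    by (rule lebesgue_version(3)[OF _ ae', symmetric]) (use km1(1)[of t] in simp)
   also have "(%x. \<bar>?u x\<bar>) = (%x. \<bar>b t\<bar> * (indicator {-L..L} x * \<bar>\<phi> x * F t x\<bar>))"
    by (simp add: abs_mult fun_eq_iff)
   also have "(LINT x|lebesgue. \<bar>b t\<bar> * (indicator {-L..L} x * \<bar>\<phi> x * F t x\<bar>)) = \<bar>b t\<bar> * (LINT x|M. \<bar>\<phi> x * F t x\<bar>)"
    by (simp only: integral_mult_right_zero IM)
   also have "... <= \<bar>b t\<bar> * (norm_L2 L \<phi> * C)"
    by (intro mult_left_mono order_trans[OF L2_mult(3)[OF \<phi> Ft(1)]] Ft(2)) auto
   finally show ?thesis using 1 2 by blast
  next
   case False
   then have "k t = (%x. 0)" "b t = 0" by (simp_all add: k_def b_def fun_eq_iff)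
   then show ?thesis by simp
  qed
 qed
 have "continuous_on {0..T} a" using a continuous_on_subset by blast
 then obtain A where "\<forall>t\<in>{0..T}. \<bar>a t\<bar> <= A"
  using compact_imp_bounded[OF compact_continuous_image, of "{0..T}" a] unfolding bounded_iff by auto
 note A = this[rule_format]
 have kint: "integrable (lborel \<Otimes>\<^sub>M lborel) (case_prod k)"
 proof (rule lborel_pair.Fubini_integrable[OF km])
  show "integrable lborel (%t. LINT x|lborel. norm (case_prod k (t, x)))"
  proof (rule Bochner_Integration.integrable_bound)
   show "integrable lborel (%t. (\<bar>A\<bar> * (norm_L2 L \<phi> * C)) * indicator {0..T} t)"
    by (intro integrable_mult_right integrable_real_indicator) (auto simp: emeasure_lborel_Icc_eq)
   show "(%t. LINT x|lborel. norm (case_prod k (t, x))) \<in> borel_measurable lborel"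
    by measurable
   show "AE t in lborel. norm (LINT x|lborel. norm (case_prod k (t, x))) <= norm ((\<bar>A\<bar> * (norm_L2 L \<phi> * C)) * indicator {0..T} t)"
    using slice
   proof eventually_elim
    case (elim t)
    have "\<bar>b t\<bar> * (norm_L2 L \<phi> * C) <= (\<bar>A\<bar> * indicator {0..T} t) * (norm_L2 L \<phi> * C)"
     using A[of t] g(2) by (intro mult_right_mono) (auto simp: b_def indicator_def intro: order_trans)
    then show ?case using elim g(2) by (simp add: abs_mult mult_ac)
   qed
  qed
  show "AE t in lborel. integrable lborel (%x. case_prod k (t, x))"
   using slice by eventually_elim simp
 qed
 have J: "AE t in lborel. (LINT x|lborel. k t x) = indicator {0..T} t *\<^sub>R (a t * (LINT x|M. \<phi> x * F t x))"
  using slice by eventually_elim (simp add: b_def)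
 have Jm: "(%t. LINT x|lborel. k t x) \<in> borel_measurable borel"
  using borel_measurable_integrable[OF lborel_pair.integrable_fst[OF kint]] by simp
 show "set_integrable lebesgue {0..T} (%t. a t * (LINT x|M. \<phi> x * F t x))"
  unfolding set_integrable_def lebesgue_version(2)[OF Jm J] by (rule lborel_pair.integrable_fst[OF kint])
 have K: "AE x in lborel. (LINT t|lborel. k t x) = indicator {-L..L} x * (\<phi> x * (LINT t:{0..T}|lebesgue. a t * F t x))"
  using g(4) p(2)
 proof eventually_elim
  case (elim x)
  have "(LINT t|lborel. k t x) = (indicator {-L..L} x * p x) * (LINT t|lborel. indicator {0..T} t * a t * g (t, x))"
   unfolding integral_mult_right_zero[symmetric] by (simp add: k_def mult_ac)
  also have "(LINT t|lborel. indicator {0..T} t * a t * g (t, x)) = (LINT t:{0..T}|lebesgue. a t * F t x)"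
   unfolding set_lebesgue_integral_def
  proof (rule lebesgue_version(3)[symmetric])
   show "(%t. indicator {0..T} t * a t * g (t, x)) \<in> borel_measurable borel" by measurable
   show "AE t in lborel. indicator {0..T} t * a t * g (t, x) = indicator {0..T} t *\<^sub>R (a t * F t x)"
    using elim(1) by eventually_elim (auto simp: indicator_def)
  qed
  finally show ?case using elim(2) by (simp add: mult_ac)
 qed
 have Km: "(%x. LINT t|lborel. k t x) \<in> borel_measurable borel"
  using borel_measurable_integrable[OF lborel_pair.integrable_snd[OF kint]] by simp
 show "integrable M (%x. \<phi> x * (LINT t:{0..T}|lebesgue. a t * F t x))"
  unfolding IM(2)[symmetric] lebesgue_version(2)[OF Km K] by (rule lborel_pair.integrable_snd[OF kint])
 have "(LINT x|M. \<phi> x * (LINT t:{0..T}|lebesgue. a t * F t x)) = (LINT x|lborel. LINT t|lborel. k t x)"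
  unfolding IM(1)[symmetric] lebesgue_version(3)[OF Km K] ..
 also have "... = (LINT t|lborel. LINT x|lborel. k t x)"
  using lborel_pair.Fubini_integral[OF kint] .
 also have "... = (LINT t:{0..T}|lebesgue. a t * (LINT x|M. \<phi> x * F t x))"
  unfolding set_lebesgue_integral_def lebesgue_version(3)[OF Jm J] ..
 finally show "(LINT x|M. \<phi> x * (LINT t:{0..T}|lebesgue. a t * F t x)) = (LINT t:{0..T}|lebesgue. a t * (LINT x|M. \<phi> x * F t x))" .
qed

end

section \<open>Uniqueness of strong solutions\<close>

text \<open>Divide \<open>[s, t]\<close> into \<open>n\<close> equal steps: the quadratic errors add
  up to O(1/n) and vanish, which leaves \<open>E t <= exp (k * (t - s)) * E s\<close>. Letting
  \<open>s\<close> tend to 0 gives zero at interior times, and continuity extends this to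
  \<open>T\<close>.\<close>

lemma discrete_gronwall_zero:
 fixes E :: "real => real"
 assumes c: "continuous_on {0..T} E" and E0: "E 0 = 0" and nn: "!!t. 0 <= E t" and k: "0 <= k" "0 <= D"
  and step: "!!s t. 0 < s ==> s < t ==> t < T ==> E t <= (1 + k * (t - s)) * E s + D * (t - s)^2"
  and t: "t \<in> {0..T}"
 shows "E t = 0"
proof -
 have 1: "E t <= exp (k * (t - s)) * E s" if st: "0 < s" "s < t" "t < T" for s t
 proof -
  have b: "E t <= exp (k * (t - s)) * (E s + D * (t - s)^2 / real (Suc n))" for n
  proof -
   define d where "d = (t - s) / real (Suc n)"
   have d: "0 < d" "real (Suc n) * d = t - s" using st by (simp_all add: d_def)
   have "i <= Suc n ==> E (s + real i * d) <= exp (k * (real i * d)) * (E s + real i * (D * d^2))" for i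
   proof (induction i)
    case (Suc i)
    define x where "x = E s + real i * (D * d^2)"
    have x: "0 <= x" using nn[of s] k by (simp add: x_def)
    have le: "real (Suc i) * d <= t - s" using Suc.prems d by (metis mult_right_mono less_imp_le of_nat_le_iff)
    have "E (s + real (Suc i) * d) <= (1 + k * (s + real (Suc i) * d - (s + real i * d))) * E (s + real i * d)
      + D * (s + real (Suc i) * d - (s + real i * d))^2"
     by (rule step) (use st d le in \<open>auto simp: algebra_simps intro: add_pos_nonneg\<close>)
    also have "s + real (Suc i) * d - (s + real i * d) = d" by (simp add: algebra_simps)
    also have "(1 + k * d) * E (s + real i * d) + D * d^2 <= exp (k * d) * (exp (k * (real i * d)) * x) + exp (k * (real (Suc i) * d)) * (D * d^2)"
    proof (rule add_mono[OF mult_mono])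
     show "1 + k * d <= exp (k * d)" by (rule exp_ge_add_one_self)
     show "E (s + real i * d) <= exp (k * (real i * d)) * x" using Suc by (simp add: x_def)
     have "1 * (D * d^2) <= exp (k * (real (Suc i) * d)) * (D * d^2)"
      using k d by (intro mult_right_mono) auto
     then show "D * d^2 <= exp (k * (real (Suc i) * d)) * (D * d^2)" by simp
    qed (use nn in auto)
    also have "... = exp (k * (real (Suc i) * d)) * (x + D * d^2)"
     by (simp add: algebra_simps exp_add)
    finally show ?case by (simp add: x_def algebra_simps)
   qed simp
   from this[of "Suc n"] have "E t <= exp (k * (t - s)) * (E s + real (Suc n) * (D * d^2))"
    unfolding d(2) by simp
   also have "real (Suc n) * (D * d^2) = D * (t - s)^2 / real (Suc n)"
    by (simp add: d_def power_divide power2_eq_square)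
   finally show ?thesis .
  qed
  have "(%n. exp (k * (t - s)) * (E s + D * (t - s)^2 / real (Suc n))) \<longlonglongrightarrow> exp (k * (t - s)) * (E s + 0)"
   by (intro tendsto_intros LIMSEQ_Suc[OF lim_const_over_n])
  from LIMSEQ_le_const[OF this] b show ?thesis by auto
 qed
 have 2: "E t = 0" if t: "0 < t" "t < T" for t
 proof -
  have "(E \<longlongrightarrow> E 0) (at 0 within {0..T})" using c t unfolding continuous_on_def by auto
  moreover have "at 0 within {0..T} = at_right 0" using t by (intro at_within_Icc_at_right) simp
  ultimately have "(E \<longlongrightarrow> 0) (at_right 0)" using E0 by simp
  then have "((%s. exp (k * (t - s)) * E s) \<longlongrightarrow> exp (k * (t - 0)) * 0) (at_right 0)"
   by (intro tendsto_intros)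
  then have "((%s. exp (k * (t - s)) * E s) \<longlongrightarrow> 0) (at_right 0)" by simp
  moreover have "\<forall>\<^sub>F s in at_right 0. E t <= exp (k * (t - s)) * E s"
   unfolding eventually_at_right_field using 1 t by (intro exI[of _ t]) auto
  ultimately have "E t <= 0" by (intro tendsto_lowerbound) auto
  then show ?thesis using nn[of t] by simp
 qed
 consider "t = 0" | "0 < t" "t < T" | "t = T" "0 < T" using t by fastforce
 then show ?thesis
 proof cases
  case 3
  have "(E \<longlongrightarrow> E T) (at T within {0..T})" using c 3 unfolding continuous_on_def by auto
  moreover have "at T within {0..T} = at_left T" using 3 by (intro at_within_Icc_at_left) simp
  ultimately have "(E \<longlongrightarrow> E T) (at_left T)" by simp
  moreover have "(E \<longlongrightarrow> 0) (at_left T)"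
   by (rule tendsto_eventually) (use 2 3 in \<open>auto simp: eventually_at_left_field intro!: exI[of _ 0]\<close>)
  ultimately have "E T = 0" by (rule tendsto_unique[rotated]) simp
  then show ?thesis using 3 by simp
 qed (use 2 E0 in auto)
qed

context torus begin

text \<open>What is available at almost every time: a C1 representative \<open>F\<close> of
  \<open>v\<close> with bounded slope, and a time derivative \<open>w\<close> equal to
  \<open>F * F'\<close> plus a function whose coefficients \<open>\<i> * (kp n)^2 * fc v n\<close>
  are those of the Hilbert transform of the second derivative.\<close>

abbreviation "sol_rep C v w \<equiv> v \<in> L2_per L \<and> norm_L2 L v <= C \<and> w \<in> L2_per L \<and> norm_L2 L w <= C \<and>
 (\<exists>F F' g. (\<forall>x. (F has_real_derivative F' x) (at x)) \<and> continuous_on UNIV F' \<and> (\<forall>x. F (x + 2 * L) = F x)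
  \<and> (AE x in lebesgue. v x = F x) \<and> (\<forall>x. \<bar>F' x\<bar> <= C)
  \<and> g \<in> L2_per L \<and> (\<forall>n. fc g n = \<i> * (of_real (kp n))^2 * fc v n)
  \<and> (AE x in lebesgue. w x = F x * F' x + g x))"

text \<open>The L2 bound on the second derivative gives slopes bounded uniformly in time through the
  C1 embedding. The principal value in the equation is replaced by the conjugate function, as the
  limit defining it is unique.\<close>

lemma strong_solution_parts:
 assumes "strong_solution L T u0 v"
 obtains vt C where "0 <= C" "Linf_L2 L T v" "Linf_L2 L T vt" "weak_time_deriv T v vt"
  "AE t in lebesgue. t \<in> {0..T} \<longrightarrow> sol_rep C (v t) (vt t)"
proof -
 obtain ux uxx ut where s: "Linf_L2 L T v" "Linf_L2 L T ux" "Linf_L2 L T uxx" "Linf_L2 L T ut"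
  "AE t in lebesgue_on {0..T}. weak_deriv L (v t) (ux t) \<and> weak_deriv L (ux t) (uxx t)"
  "weak_time_deriv T v ut"
  "AE t in lebesgue_on {0..T}. AE x in lebesgue. \<exists>h. has_hilbert_per L (uxx t) x h \<and> ut t x = v t x * ux t x + h"
  using assms unfolding strong_solution_def by blast
 have B: "\<exists>C. AE t in lebesgue_on {0..T}. F t \<in> L2_per L \<and> norm_L2 L (F t) <= C" if F: "Linf_L2 L T F" for F
 proof -
  obtain C where a: "AE t in lebesgue_on {0..T}. F t \<in> L2_per L" and b: "AE t in lebesgue_on {0..T}. norm_L2 L (F t) <= C"
   using F unfolding Linf_L2_def by (elim conjE exE) (rule that)
  have "AE t in lebesgue_on {0..T}. F t \<in> L2_per L \<and> norm_L2 L (F t) <= C" using a b by eventually_elim simp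
  then show ?thesis ..
 qed
 obtain C1 where c1: "AE t in lebesgue_on {0..T}. v t \<in> L2_per L \<and> norm_L2 L (v t) <= C1" using B[OF s(1)] ..
 obtain C2 where c2: "AE t in lebesgue_on {0..T}. ux t \<in> L2_per L \<and> norm_L2 L (ux t) <= C2" using B[OF s(2)] ..
 obtain C3 where c3: "AE t in lebesgue_on {0..T}. uxx t \<in> L2_per L \<and> norm_L2 L (uxx t) <= C3" using B[OF s(3)] ..
 obtain C4 where c4: "AE t in lebesgue_on {0..T}. ut t \<in> L2_per L \<and> norm_L2 L (ut t) <= C4" using B[OF s(4)] ..
 define C where "C = \<bar>C1\<bar> + \<bar>C4\<bar> + ((\<bar>C3\<bar>\<^sup>2 / (2 * L) + \<bar>KS\<bar>) / 2)"
 have Cn: "0 <= (\<bar>C3\<bar>\<^sup>2 / (2 * L) + \<bar>KS\<bar>) / 2" using L_pos by simp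
 have C0: "0 <= C" "C1 <= C" "C4 <= C" using Cn unfolding C_def by linarith+
 have "AE t in lebesgue_on {0..T}. sol_rep C (v t) (ut t)"
  using c1 c2 c3 c4 s(5,7)
 proof eventually_elim
  case (elim t)
  then have v: "v t \<in> L2_per L" and ux: "ux t \<in> L2_per L" and uxx: "uxx t \<in> L2_per L" by auto
  have f1: "fc (ux t) n = \<i> * of_real (kp n) * fc (v t) n" for n
   using weak_deriv_imp_fc[OF v ux] elim by blast
  have f2: "fc (uxx t) n = - (of_real (kp n))\<^sup>2 * fc (v t) n" for n
  proof -
   have "fc (uxx t) n = \<i> * of_real (kp n) * fc (ux t) n" using weak_deriv_imp_fc[OF ux uxx] elim by blast
   then show ?thesis by (simp add: f1 ii_mult)
  qed
  obtain F F' where F: "!!x. (F has_real_derivative F' x) (at x)" "continuous_on UNIV F'" "!!x. F (x + 2 * L) = F x"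
   "!!x. F' (x + 2 * L) = F' x" "AE x in lebesgue. v t x = F x"
   "!!x. \<bar>F' x\<bar> <= ((norm_L2 L (uxx t))^2 / (2 * L) + KS) / 2" "!!n. fc F' n = \<i> * of_real (kp n) * fc (v t) n"
   "F = (%x. \<Sum>n. tm (fc (v t)) n x)" "F' = (%x. \<Sum>n. tm (%n. \<i> * of_real (kp n) * fc (v t) n) n x)"
   by (rule C1_representation[OF v uxx f2]) (rule that)
  have F'L: "F' \<in> L2_per L" by (rule continuous_L2[OF F(2,4)])
  have uxF: "AE x in lebesgue. ux t x = F' x"
   by (rule fc_unique[OF ux F'L]) (simp add: F(7) f1)
  obtain g where g: "g \<in> L2_per L" "!!n. fc g n = (if n = 0 then 0 else - \<i> * fc (uxx t) n)"
   "AE x in lebesgue. has_hilbert_per L (uxx t) x (g x)" by (rule conjugate_exists[OF uxx]) (rule that)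
  have "AE x in lebesgue. ut t x = F x * F' x + g x"
   using elim(6) F(5) uxF g(3) by eventually_elim (auto dest: has_hilbert_per_unique)
  moreover have "fc g n = \<i> * (of_real (kp n))^2 * fc (v t) n" for n
   by (simp add: g(2) f2 kp_def)
  moreover have "\<bar>F' x\<bar> <= C" for x
  proof -
   have "(norm_L2 L (uxx t))^2 <= \<bar>C3\<bar>\<^sup>2" using elim by (intro power_mono) auto
   then have "((norm_L2 L (uxx t))^2 / (2 * L) + KS) / 2 <= (\<bar>C3\<bar>\<^sup>2 / (2 * L) + \<bar>KS\<bar>) / 2"
    using L_pos by (intro divide_right_mono add_mono) auto
   then show ?thesis using F(6)[of x] unfolding C_def by linarith
  qed
  moreover have "norm_L2 L (v t) <= C" "norm_L2 L (ut t) <= C" using elim C0 by linarith+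
  ultimately have "norm_L2 L (v t) <= C" "norm_L2 L (ut t) <= C" "\<forall>x. \<bar>F' x\<bar> <= C"
   "\<forall>n. fc g n = \<i> * (of_real (kp n))^2 * fc (v t) n" "AE x in lebesgue. ut t x = F x * F' x + g x"
   "\<forall>x. (F has_real_derivative F' x) (at x)" "\<forall>x. F (x + 2 * L) = F x" "ut t \<in> L2_per L"
   using F(1,3) elim by blast+
  then show ?case using v F(2,5) g(1) by (intro conjI exI[of _ F] exI[of _ F'] exI[of _ g])
 qed
 then have "AE t in lebesgue. t \<in> {0..T} \<longrightarrow> sol_rep C (v t) (ut t)"
  by (subst (asm) AE_restrict_space_iff) auto
 then show ?thesis using that C0(1) s by blast
qed

text \<open>The definition holds pointwise in \<open>x\<close> outside a null set depending on the
  test function; multiplying by \<open>\<phi>\<close> and exchanging the integrals gives a scalar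
  statement in time.\<close>

lemma inner_weak:
 assumes v: "Linf_L2 L T v" "Linf_L2 L T vt" "weak_time_deriv T v vt" and \<phi>: "\<phi> \<in> L2_per L" and \<psi>: "test_fun T \<psi>"
 shows "(LINT t:{0..T}|lebesgue. deriv \<psi> t * (LINT x|M. \<phi> x * v t x)) = - (LINT t:{0..T}|lebesgue. \<psi> t * (LINT x|M. \<phi> x * vt t x))"
proof -
 have s: "smooth \<psi>" using \<psi> by (simp add: test_fun_def)
 have c: "continuous_on UNIV \<psi>" using smooth_deriv(1)[OF s] by (meson DERIV_isCont continuous_at_imp_continuous_on)
 note f1 = time_space_fubini[OF v(1) smooth_deriv(2)[OF s] \<phi>] and f2 = time_space_fubini[OF v(2) c \<phi>]
 have "AE x in lebesgue. (LINT t:{0..T}|lebesgue. deriv \<psi> t * v t x) = - (LINT t:{0..T}|lebesgue. \<psi> t * vt t x)"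
  using v(3) \<psi> unfolding weak_time_deriv_def test_fun_def by blast
 then have "AE x in M. \<phi> x * (LINT t:{0..T}|lebesgue. deriv \<psi> t * v t x) = - (\<phi> x * (LINT t:{0..T}|lebesgue. \<psi> t * vt t x))"
  unfolding AE_M by eventually_elim simp
 then have "(LINT x|M. \<phi> x * (LINT t:{0..T}|lebesgue. deriv \<psi> t * v t x)) = (LINT x|M. - (\<phi> x * (LINT t:{0..T}|lebesgue. \<psi> t * vt t x)))"
  using f1(1) f2(1) by (intro integral_cong_AE) auto
 then show ?thesis unfolding f1(3) using f2(3) by simp
qed

text \<open>With \<open>W = F - G\<close> the nonlinear difference is
  \<open>W * F' + G * W'\<close>, so its pairing with \<open>W\<close> is
  \<open>W^2 * (F' - G' / 2)\<close> plus half the derivative of \<open>G * W^2\<close>, which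
  integrates to zero over a period. The dispersive parts cancel by Parseval, each mode contributing
  a purely imaginary number.\<close>

lemma solution_inner_energy:
 assumes a: "a \<in> L2_per L" and b: "b \<in> L2_per L" and at: "at' \<in> L2_per L" and bt: "bt' \<in> L2_per L"
  and F: "!!x. (F has_real_derivative F' x) (at x)" "continuous_on UNIV F'" "!!x. F (x + 2 * L) = F x"
   "AE x in lebesgue. a x = F x" "!!x. \<bar>F' x\<bar> <= C" "g \<in> L2_per L" "!!n. fc g n = \<i> * (of_real (kp n))^2 * fc a n"
   "AE x in lebesgue. at' x = F x * F' x + g x"
  and G: "!!x. (G has_real_derivative G' x) (at x)" "continuous_on UNIV G'" "!!x. G (x + 2 * L) = G x"
   "AE x in lebesgue. b x = G x" "!!x. \<bar>G' x\<bar> <= C" "h \<in> L2_per L" "!!n. fc h n = \<i> * (of_real (kp n))^2 * fc b n"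
   "AE x in lebesgue. bt' x = G x * G' x + h x"
 shows "(LINT x|M. (a x - b x) * (at' x - bt' x)) <= 3 / 2 * C * (norm_L2 L (%x. a x - b x))^2"
proof -
 have cF: "continuous_on A F" "continuous_on A G" for A
  using F(1) G(1) by (meson DERIV_isCont continuous_at_imp_continuous_on)+
 have C0: "0 <= C" using F(5)[of 0] by linarith
 define W where "W = (%x. F x - G x)"
 define gh where "gh = (%x. g x - h x)"
 have w: "(%x. a x - b x) \<in> L2_per L" and gh: "gh \<in> L2_per L" unfolding gh_def by (intro L2_diff a b F G)+
 have cont: "continuous_on A F'" "continuous_on A G'" "continuous_on A W" for A
  unfolding W_def by (intro continuous_intros cF continuous_on_subset[OF F(2)] continuous_on_subset[OF G(2)]; simp)+
 have WL: "W \<in> L2_per L" by (rule continuous_L2[OF cont(3)]) (simp add: W_def F G)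
 have Ww: "AE x in lebesgue. a x - b x = W x" using F(4) G(4) unfolding W_def by eventually_elim simp
 have skew: "(LINT x|M. W x * gh x) = 0"
 proof -
  have "(LINT x|M. W x * gh x) = (LINT x|M. (a x - b x) * gh x)"
   by (rule integral_cong_AE) (use Ww L2_perD(3)[OF w] L2_perD(3)[OF gh] L2_perD(3)[OF WL] in \<open>auto simp: AE_M\<close>)
  moreover have "wt n * Re (fc gh n * cnj (fc (%x. a x - b x) n)) = 0" for n
  proof -
   define z where "z = fc a n - fc b n"
   have "fc gh n = \<i> * (of_real (kp n))^2 * z"
    unfolding gh_def z_def by (simp add: fc_diff[OF L2_integrable[OF F(6)] L2_integrable[OF G(6)]] F(7) G(7) algebra_simps)
   moreover have "fc (%x. a x - b x) n = z" by (simp add: z_def fc_diff[OF L2_integrable[OF a] L2_integrable[OF b]])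
   moreover have "\<i> * (of_real (kp n))^2 * z * cnj z = \<i> * of_real ((kp n)^2 * (cmod z)^2)"
    by (simp add: mult.assoc complex_norm_square[symmetric])
   ultimately show ?thesis by simp
  qed
  then have "(%n. 0) sums ((LINT x|M. (a x - b x) * gh x) / (2 * L))" using parseval[OF gh w] by (simp only:)
  then have "(LINT x|M. (a x - b x) * gh x) / (2 * L) = 0" using sums_unique2 sums_zero by blast
  ultimately show ?thesis using L_pos by simp
 qed
 have Wd: "(W has_real_derivative F' x - G' x) (at x)" for x
  unfolding W_def by (rule DERIV_diff[OF F(1) G(1)])
 have "((%x. G x * (W x)^2) has_vector_derivative G' x * (W x)^2 + G x * (2 * W x * (F' x - G' x))) (at x)" for x
  unfolding has_real_derivative_iff_has_vector_derivative[symmetric]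
  by (auto intro!: derivative_eq_intros G(1) Wd simp: algebra_simps)
 then have tri: "(LINT x|M. G' x * (W x)^2 + G x * (2 * W x * (F' x - G' x))) = 0"
  by (rule C1_integral_deriv(1)) (use F(3)[of "-L"] G(3)[of "-L"] in \<open>auto intro!: continuous_intros cont cF simp: W_def\<close>)
 have i1: "integrable M (%x. (W x)^2 * (F' x - G' x / 2))"
  by (intro continuous_imp_integrable_real continuous_intros cont) auto
 have i2: "integrable M (%x. G' x * (W x)^2 + G x * (2 * W x * (F' x - G' x)))"
  by (intro continuous_imp_integrable_real continuous_intros cont cF)
 have i3: "integrable M (%x. W x * gh x)" by (rule L2_mult(1)[OF WL gh])
 have int3: "(LINT x|M. (p x + 1 / 2 * q x) + r x) = (LINT x|M. p x) + 1 / 2 * (LINT x|M. q x) + (LINT x|M. r x)"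
  if "integrable M p" "integrable M q" "integrable M r" for p q r :: "real => real"
  using that by simp
 have "(LINT x|M. (a x - b x) * (at' x - bt' x)) =
  (LINT x|M. ((W x)^2 * (F' x - G' x / 2) + 1 / 2 * (G' x * (W x)^2 + G x * (2 * W x * (F' x - G' x)))) + W x * gh x)"
 proof (rule integral_cong_AE)
  show "(%x. (a x - b x) * (at' x - bt' x)) \<in> borel_measurable M"
   using L2_perD(3)[OF w] L2_perD(3)[OF at] L2_perD(3)[OF bt] by simp
  show "AE x in M. (a x - b x) * (at' x - bt' x) =
   ((W x)^2 * (F' x - G' x / 2) + 1 / 2 * (G' x * (W x)^2 + G x * (2 * W x * (F' x - G' x)))) + W x * gh x"
   unfolding AE_M using F(4,8) G(4,8)
   by eventually_elim (simp add: W_def gh_def power2_eq_square field_simps)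
 qed (intro borel_measurable_integrable Bochner_Integration.integrable_add integrable_mult_right i1 i2 i3)
 also have "... = (LINT x|M. (W x)^2 * (F' x - G' x / 2)) + 1 / 2 * 0 + 0"
  unfolding int3[OF i1 i2 i3] tri skew ..
 also have "... = (LINT x|M. (W x)^2 * (F' x - G' x / 2))" by simp
 also have "... <= (LINT x|M. (W x)^2 * (3 / 2 * C))"
 proof (rule integral_mono[OF i1])
  show "integrable M (%x. (W x)^2 * (3 / 2 * C))" by (intro integrable_mult_left L2_perD(4)[OF WL])
  show "(W x)^2 * (F' x - G' x / 2) <= (W x)^2 * (3 / 2 * C)" for x
   using F(5)[of x] G(5)[of x] by (intro mult_left_mono) (auto simp: abs_le_iff)
 qed
 also have "... = 3 / 2 * C * (norm_L2 L W)^2" by (simp add: norm_L2_sq)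
 also have "norm_L2 L W = norm_L2 L (%x. a x - b x)"
  by (rule norm_L2_cong_AE[OF _ WL w]) (use Ww in \<open>auto elim!: eventually_mono\<close>)
 finally show ?thesis .
qed

text \<open>\<open>|w t|^2 - |w s|^2\<close> is the increment of the pairing of \<open>w\<close>
  with the fixed function \<open>w t + w s\<close>, to which the weak growth estimate applies.
  Lipschitz continuity of \<open>w\<close> in L2 then permits replacing that function by twice the
  value of \<open>w\<close> at the running time.\<close>

theorem strong_solution_unique:
 assumes u: "strong_solution L T u0 u" and v: "strong_solution L T u0 v" and t: "t \<in> {0..T}"
 shows "AE x in lebesgue. u t x = v t x"
proof -
 obtain ut C1 where U: "0 <= C1" "Linf_L2 L T u" "Linf_L2 L T ut" "weak_time_deriv T u ut"
  "AE t in lebesgue. t \<in> {0..T} \<longrightarrow> sol_rep C1 (u t) (ut t)"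
  by (rule strong_solution_parts[OF u])
 obtain vt C2 where V: "0 <= C2" "Linf_L2 L T v" "Linf_L2 L T vt" "weak_time_deriv T v vt"
  "AE t in lebesgue. t \<in> {0..T} \<longrightarrow> sol_rep C2 (v t) (vt t)"
  by (rule strong_solution_parts[OF v])
 define w where "w = (%t x. u t x - v t x)"
 define nw where "nw = (%t. norm_L2 L (w t))"
 define B where "B = C1 + C2"
 have B: "0 <= B" using U(1) V(1) by (simp add: B_def)
 have uL: "u t \<in> L2_per L" and vL: "v t \<in> L2_per L" if "t \<in> {0..T}" for t
  using u v that by (auto simp: strong_solution_def)
 have wL: "w t \<in> L2_per L" if "t \<in> {0..T}" for t unfolding w_def by (intro L2_diff uL vL that)
 have wc: "((%t. norm_L2 L (%x. w t x - w s x)) \<longlongrightarrow> 0) (at s within {0..T})" if s: "s \<in> {0..T}" for s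
 proof (rule tendsto_sandwich[of "%_. 0"])
  show "\<forall>\<^sub>F t in at s within {0..T}. norm_L2 L (%x. w t x - w s x)
   <= norm_L2 L (%x. u t x - u s x) + norm_L2 L (%x. v t x - v s x)"
   unfolding eventually_at_filter
  proof (intro always_eventually allI impI)
   fix t assume t: "t \<in> {0..T}"
   have "norm_L2 L (%x. w t x - w s x) = norm_L2 L (%x. (u t x - u s x) + (v s x - v t x))"
    by (simp add: w_def algebra_simps)
   also have "... <= norm_L2 L (%x. u t x - u s x) + norm_L2 L (%x. v s x - v t x)"
    by (intro norm_L2_triangle L2_diff uL vL s t)
   also have "norm_L2 L (%x. v s x - v t x) = norm_L2 L (%x. v t x - v s x)"
    by (simp add: norm_L2_eq power2_commute)
   finally show "norm_L2 L (%x. w t x - w s x) <= norm_L2 L (%x. u t x - u s x) + norm_L2 L (%x. v t x - v s x)" .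
  qed
  have "((%t. norm_L2 L (%x. u t x - u s x) + norm_L2 L (%x. v t x - v s x)) \<longlongrightarrow> 0 + 0) (at s within {0..T})"
   using u v s unfolding strong_solution_def by (intro tendsto_add) auto
  then show "((%t. norm_L2 L (%x. u t x - u s x) + norm_L2 L (%x. v t x - v s x)) \<longlongrightarrow> 0) (at s within {0..T})" by simp
 qed auto
 have mc: "continuous_on {0..T} (%t. LINT x|M. \<phi> x * w t x)" if \<phi>: "\<phi> \<in> L2_per L" for \<phi>
  unfolding continuous_on_def
 proof (rule ballI, rule LIM_zero_cancel)
  fix s assume s: "s \<in> {0..T}"
  show "((%t. (LINT x|M. \<phi> x * w t x) - (LINT x|M. \<phi> x * w s x)) \<longlongrightarrow> 0) (at s within {0..T})"
  proof (rule tendsto_rabs_zero_cancel, rule tendsto_sandwich[of "%_. 0"])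
   show "\<forall>\<^sub>F t in at s within {0..T}. \<bar>(LINT x|M. \<phi> x * w t x) - (LINT x|M. \<phi> x * w s x)\<bar>
    <= norm_L2 L \<phi> * norm_L2 L (%x. w t x - w s x)"
    unfolding eventually_at_filter
   proof (intro always_eventually allI impI)
    fix t assume t: "t \<in> {0..T}"
    have "(LINT x|M. \<phi> x * w t x) - (LINT x|M. \<phi> x * w s x) = (LINT x|M. \<phi> x * (w t x - w s x))"
     using L2_mult(1)[OF \<phi> wL[OF t]] L2_mult(1)[OF \<phi> wL[OF s]] by (simp add: right_diff_distrib)
    then show "\<bar>(LINT x|M. \<phi> x * w t x) - (LINT x|M. \<phi> x * w s x)\<bar> <= norm_L2 L \<phi> * norm_L2 L (%x. w t x - w s x)"
     using L2_mult(2)[OF \<phi> L2_diff[OF wL[OF t] wL[OF s]]] by simp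
   qed
   show "((%t. norm_L2 L \<phi> * norm_L2 L (%x. w t x - w s x)) \<longlongrightarrow> 0) (at s within {0..T})"
    using tendsto_mult[OF tendsto_const wc[OF s], of "norm_L2 L \<phi>"] by simp
  qed auto
 qed
 have nwt: "nw t <= nw s + norm_L2 L (%x. w t x - w s x)" if "t \<in> {0..T}" "s \<in> {0..T}" for t s
  using norm_L2_triangle[OF wL[OF that(2)] L2_diff[OF wL[OF that(1)] wL[OF that(2)]]] by (simp add: nw_def)
 have nwsym: "norm_L2 L (%x. w t x - w s x) = norm_L2 L (%x. w s x - w t x)" for s t
  by (simp add: norm_L2_eq power2_commute)
 have nwc: "continuous_on {0..T} nw"
  unfolding continuous_on_def
 proof (rule ballI, rule LIM_zero_cancel)
  fix s assume s: "s \<in> {0..T}"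
  show "((%t. nw t - nw s) \<longlongrightarrow> 0) (at s within {0..T})"
  proof (rule tendsto_rabs_zero_cancel, rule tendsto_sandwich[OF _ _ tendsto_const wc[OF s]])
   show "\<forall>\<^sub>F t in at s within {0..T}. \<bar>nw t - nw s\<bar> <= norm_L2 L (%x. w t x - w s x)"
    unfolding eventually_at_filter
   proof (intro always_eventually allI impI)
    fix t assume t: "t \<in> {0..T}"
    show "\<bar>nw t - nw s\<bar> <= norm_L2 L (%x. w t x - w s x)"
     using nwt[OF t s] nwt[OF s t] nwsym[of t s] by (simp add: abs_le_iff)
   qed
  qed auto
 qed
 have ae: "AE z' in lebesgue. z' \<in> {0..T} \<longrightarrow> (%x. ut z' x - vt z' x) \<in> L2_per L \<and> ut z' \<in> L2_per L \<and> vt z' \<in> L2_per L \<and>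
   norm_L2 L (%x. ut z' x - vt z' x) <= B \<and> (LINT x|M. w z' x * (ut z' x - vt z' x)) <= 3 / 2 * B * (nw z')^2"
  using U(5) V(5)
 proof eventually_elim
  case (elim z')
  show ?case
  proof
   assume z': "z' \<in> {0..T}"
   have L2: "ut z' \<in> L2_per L" "vt z' \<in> L2_per L" using elim z' by auto
   have "norm_L2 L (%x. ut z' x + (- 1) * vt z' x) <= norm_L2 L (ut z') + norm_L2 L (%x. (-1) * vt z' x)"
    using L2 L2_lincomb[OF L2(2,2), of "-1" 0] by (intro norm_L2_triangle) auto
   then have nb: "norm_L2 L (%x. ut z' x - vt z' x) <= B"
    using elim z' by (simp add: norm_L2_eq B_def)
   obtain F F' g where F: "!!x. (F has_real_derivative F' x) (at x)" "continuous_on UNIV F'" "!!x. F (x + 2 * L) = F x"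
    "AE x in lebesgue. u z' x = F x" "!!x. \<bar>F' x\<bar> <= C1" "g \<in> L2_per L" "!!n. fc g n = \<i> * (of_real (kp n))^2 * fc (u z') n"
    "AE x in lebesgue. ut z' x = F x * F' x + g x" using elim z' by blast
   obtain G G' h where G: "!!x. (G has_real_derivative G' x) (at x)" "continuous_on UNIV G'" "!!x. G (x + 2 * L) = G x"
    "AE x in lebesgue. v z' x = G x" "!!x. \<bar>G' x\<bar> <= C2" "h \<in> L2_per L" "!!n. fc h n = \<i> * (of_real (kp n))^2 * fc (v z') n"
    "AE x in lebesgue. vt z' x = G x * G' x + h x" using elim z' by blast
   have b: "\<bar>F' x\<bar> <= B" "\<bar>G' x\<bar> <= B" for x using F(5)[of x] G(5)[of x] U(1) V(1) by (auto simp: B_def)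
   show "(%x. ut z' x - vt z' x) \<in> L2_per L \<and> ut z' \<in> L2_per L \<and> vt z' \<in> L2_per L \<and>
    norm_L2 L (%x. ut z' x - vt z' x) <= B \<and> (LINT x|M. w z' x * (ut z' x - vt z' x)) <= 3 / 2 * B * (nw z')^2"
    using nb L2 L2_diff[OF L2] solution_inner_energy[OF uL[OF z'] vL[OF z'] L2 F(1-4) b(1) F(6-8) G(1-4) b(2) G(6-8)]
    by (simp add: w_def nw_def)
  qed
 qed
 have growth: "(LINT x|M. \<phi> x * w t x) - (LINT x|M. \<phi> x * w s x) <= A * (t - s)"
  if st: "0 < s" "s < t" "t < T" and \<phi>: "\<phi> \<in> L2_per L" and e0: "0 < e0" and A: "0 <= A"
   "AE z' in lebesgue. s <= z' \<and> z' <= t + e0 \<and> z' <= T \<longrightarrow> (LINT x|M. \<phi> x * (ut z' x - vt z' x)) <= A" for s t \<phi> e0 A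
 proof (rule weak_growth[OF st mc[OF \<phi>] _ _ e0 A(1), where n = "%z'. (LINT x|M. \<phi> x * ut z' x) - (LINT x|M. \<phi> x * vt z' x)"])
  have split: "set_integrable lebesgue {0..T} (%z'. \<psi> z' * (LINT x|M. \<phi> x * F z' x))" if "continuous_on UNIV \<psi>" "Linf_L2 L T F" for \<psi> F
   by (rule time_space_fubini(2)[OF that(2,1) \<phi>])
  show "(LINT z':{0..T}|lebesgue. deriv \<psi> z' * (LINT x|M. \<phi> x * w z' x)) =
   - (LINT z':{0..T}|lebesgue. \<psi> z' * ((LINT x|M. \<phi> x * ut z' x) - (LINT x|M. \<phi> x * vt z' x)))" if \<psi>: "test_fun T \<psi>" for \<psi>
  proof -
   have s: "smooth \<psi>" using \<psi> by (simp add: test_fun_def)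
   have c: "continuous_on UNIV \<psi>" using smooth_deriv(1)[OF s] by (meson DERIV_isCont continuous_at_imp_continuous_on)
   note c' = smooth_deriv(2)[OF s]
   have "(LINT z':{0..T}|lebesgue. deriv \<psi> z' * (LINT x|M. \<phi> x * w z' x)) =
    (LINT z':{0..T}|lebesgue. deriv \<psi> z' * (LINT x|M. \<phi> x * u z' x) - deriv \<psi> z' * (LINT x|M. \<phi> x * v z' x))"
   proof (rule set_lebesgue_integral_cong)
    show "\<forall>z'. z' \<in> {0..T} \<longrightarrow> deriv \<psi> z' * (LINT x|M. \<phi> x * w z' x) =
     deriv \<psi> z' * (LINT x|M. \<phi> x * u z' x) - deriv \<psi> z' * (LINT x|M. \<phi> x * v z' x)"
     using L2_mult(1)[OF \<phi> uL] L2_mult(1)[OF \<phi> vL] by (simp add: w_def right_diff_distrib)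
   qed simp
   also have "... = (LINT z':{0..T}|lebesgue. deriv \<psi> z' * (LINT x|M. \<phi> x * u z' x)) - (LINT z':{0..T}|lebesgue. deriv \<psi> z' * (LINT x|M. \<phi> x * v z' x))"
    by (rule set_integral_diff(2)[OF split[OF c' U(2)] split[OF c' V(2)]])
   also have "... = - ((LINT z':{0..T}|lebesgue. \<psi> z' * (LINT x|M. \<phi> x * ut z' x)) - (LINT z':{0..T}|lebesgue. \<psi> z' * (LINT x|M. \<phi> x * vt z' x)))"
    unfolding inner_weak[OF U(2-4) \<phi> \<psi>] inner_weak[OF V(2-4) \<phi> \<psi>] by simp
   also have "(LINT z':{0..T}|lebesgue. \<psi> z' * (LINT x|M. \<phi> x * ut z' x)) - (LINT z':{0..T}|lebesgue. \<psi> z' * (LINT x|M. \<phi> x * vt z' x))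
    = (LINT z':{0..T}|lebesgue. \<psi> z' * ((LINT x|M. \<phi> x * ut z' x) - (LINT x|M. \<phi> x * vt z' x)))"
    unfolding right_diff_distrib by (rule set_integral_diff(2)[OF split[OF c U(3)] split[OF c V(3)], symmetric])
   finally show ?thesis .
  qed
  show "set_integrable lebesgue {0..T} (%z'. \<psi> z' * ((LINT x|M. \<phi> x * ut z' x) - (LINT x|M. \<phi> x * vt z' x)))" if c: "continuous_on UNIV \<psi>" for \<psi>
   unfolding right_diff_distrib by (rule set_integral_diff(1)[OF split[OF c U(3)] split[OF c V(3)]])
  show "AE z' in lebesgue. s <= z' \<and> z' <= t + e0 \<and> z' <= T \<longrightarrow> (LINT x|M. \<phi> x * ut z' x) - (LINT x|M. \<phi> x * vt z' x) <= A"
   using A(2) ae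
  proof eventually_elim
   case (elim z')
   show ?case
   proof
    assume z': "s <= z' \<and> z' <= t + e0 \<and> z' <= T"
    then have "z' \<in> {0..T}" using st by auto
    then have "ut z' \<in> L2_per L" "vt z' \<in> L2_per L" using elim by auto
    then have "(LINT x|M. \<phi> x * (ut z' x - vt z' x)) = (LINT x|M. \<phi> x * ut z' x) - (LINT x|M. \<phi> x * vt z' x)"
     using L2_mult(1)[OF \<phi>] by (simp add: right_diff_distrib)
    then show "(LINT x|M. \<phi> x * ut z' x) - (LINT x|M. \<phi> x * vt z' x) <= A" using elim z' by simp
   qed
  qed
 qed
 have lip: "norm_L2 L (%x. w t x - w s x) <= B * (t - s)" if st: "0 < s" "s < t" "t < T" for s t
 proof -
  \<comment> \<open>The increment is paired with itself: its squared norm is at most its norm times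
    \<open>B * (t - s)\<close>, and division gives the Lipschitz bound.\<close>
  define \<phi> where "\<phi> = (%x. w t x - w s x)"
  have stT: "s \<in> {0..T}" "t \<in> {0..T}" using st by auto
  have \<phi>: "\<phi> \<in> L2_per L" unfolding \<phi>_def by (intro L2_diff wL stT)
  have "(norm_L2 L \<phi>)^2 = (LINT x|M. \<phi> x * w t x) - (LINT x|M. \<phi> x * w s x)"
   unfolding norm_L2_sq Bochner_Integration.integral_diff[OF L2_mult(1)[OF \<phi> wL[OF stT(2)]] L2_mult(1)[OF \<phi> wL[OF stT(1)]], symmetric]
   by (simp add: \<phi>_def power2_eq_square algebra_simps)
  also have "... <= (norm_L2 L \<phi> * B) * (t - s)"
  proof (rule growth[OF st \<phi>, of 1])
   show "AE z' in lebesgue. s <= z' \<and> z' <= t + 1 \<and> z' <= T \<longrightarrow> (LINT x|M. \<phi> x * (ut z' x - vt z' x)) <= norm_L2 L \<phi> * B"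
    using ae
   proof eventually_elim
    case (elim z')
    show ?case
    proof
     assume z': "s <= z' \<and> z' <= t + 1 \<and> z' <= T"
     then have d: "(%x. ut z' x - vt z' x) \<in> L2_per L" "norm_L2 L (%x. ut z' x - vt z' x) <= B" using elim st by auto
     have "(LINT x|M. \<phi> x * (ut z' x - vt z' x)) <= norm_L2 L \<phi> * norm_L2 L (%x. ut z' x - vt z' x)"
      using L2_mult(2)[OF \<phi> d(1)] by linarith
     also have "... <= norm_L2 L \<phi> * B" by (intro mult_left_mono d) simp
     finally show "(LINT x|M. \<phi> x * (ut z' x - vt z' x)) <= norm_L2 L \<phi> * B" .
    qed
   qed
  qed (use B in auto)
  finally have "norm_L2 L \<phi> * norm_L2 L \<phi> <= norm_L2 L \<phi> * (B * (t - s))" by (simp add: power2_eq_square mult_ac)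
  then have "norm_L2 L \<phi> <= B * (t - s)"
   using B st norm_L2_nonneg[of \<phi>] by (cases "norm_L2 L \<phi> = 0") auto
  then show ?thesis by (simp add: \<phi>_def)
 qed
 have "(nw t)^2 = 0"
 proof (rule discrete_gronwall_zero[where E = "%t. (nw t)^2" and T = T and k = "6 * B" and D = "24 * B ^ 3 * T + 8 * B^2"])
  show "continuous_on {0..T} (%t. (nw t)^2)" by (intro continuous_intros nwc)
  have "AE x in lebesgue. w 0 x = 0"
   using u v unfolding strong_solution_def w_def by (auto elim!: eventually_rev_mp)
  then have "norm_L2 L (w 0) = norm_L2 L (%_. 0)"
   by (rule norm_L2_cong_AE) (use t wL in \<open>auto intro: continuous_L2\<close>)
  then show "(nw 0)^2 = 0" by (simp add: nw_def norm_L2_eq)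
  fix s t assume st: "0 < s" "s < t" "t < T"
  have stT: "s \<in> {0..T}" "t \<in> {0..T}" using st by auto
  define r where "r = t - s"
  have r: "0 < r" "r <= T" using st by (auto simp: r_def)
  define \<phi> where "\<phi> = (%x. w t x + w s x)"
  have \<phi>: "\<phi> \<in> L2_per L" unfolding \<phi>_def by (intro L2_add wL stT)
  \<comment> \<open>The growth estimate looks slightly beyond \<open>t\<close>, up to the end of the
    ramp of its test function. This overhang is kept below \<open>r\<close> and before
    \<open>T\<close>, so all times involved are within \<open>2 * r\<close> of both \<open>s\<close>
    and \<open>t\<close>.\<close>
  define e0 where "e0 = min r ((T - t) / 2)"
  have e0: "0 < e0" "e0 <= r" "t + e0 < T"
  proof -
   have "e0 <= (T - t) / 2" unfolding e0_def by (rule min.cobounded2)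
   then have "t + e0 <= t + (T - t) / 2" by (rule add_left_mono)
   also have "... = (t + T) / 2" by (simp add: field_simps)
   also have "... < T" using st by simp
   finally show "t + e0 < T" .
  qed (use st r in \<open>auto simp: e0_def\<close>)
  \<comment> \<open>The pairing at a running time is at most \<open>3 * B\<close> times the squared
    norm of \<open>w\<close> there plus \<open>4 * B^2 * r\<close>; the squared norm is at most
    \<open>2 * (nw s)^2 + 8 * B^2 * r^2\<close>, and \<open>r <= T\<close> absorbs one power of
    \<open>r\<close>.\<close>
  define A where "A = 6 * B * (nw s)^2 + (24 * B ^ 3 * T + 8 * B^2) * r"
  have "(nw t)^2 - (nw s)\<^sup>2 = (LINT x|M. \<phi> x * w t x) - (LINT x|M. \<phi> x * w s x)"
   unfolding nw_def norm_L2_sq Bochner_Integration.integral_diff[OF L2_mult(1)[OF \<phi> wL[OF stT(2)]] L2_mult(1)[OF \<phi> wL[OF stT(1)]], symmetric]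
    Bochner_Integration.integral_diff[OF L2_perD(4)[OF wL[OF stT(2)]] L2_perD(4)[OF wL[OF stT(1)]], symmetric]
   by (simp add: \<phi>_def power2_eq_square algebra_simps)
  also have "... <= A * (t - s)"
  proof (rule growth[OF st \<phi> e0(1)])
   show "0 <= A" using B r by (simp add: A_def)
   show "AE z' in lebesgue. s <= z' \<and> z' <= t + e0 \<and> z' <= T \<longrightarrow> (LINT x|M. \<phi> x * (ut z' x - vt z' x)) <= A"
    using ae
   proof eventually_elim
    case (elim z')
    show ?case
    proof
     assume z': "s <= z' \<and> z' <= t + e0 \<and> z' <= T"
     then have z'T: "z' \<in> {0..T}" "0 < z'" "z' < T" using st e0 by auto
     define d where "d = (%x. ut z' x - vt z' x)"
     have d: "d \<in> L2_per L" "norm_L2 L d <= B" "(LINT x|M. w z' x * d x) <= 3 / 2 * B * (nw z')^2"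
      using elim z'T unfolding d_def by auto
     have near: "norm_L2 L (%x. w \<tau> x - w z' x) <= B * (2 * r)" if \<tau>: "\<tau> = t \<or> \<tau> = s" for \<tau>
     proof -
      have T\<tau>: "0 < \<tau>" "\<tau> < T" using \<tau> st by auto
      have dist: "\<bar>\<tau> - z'\<bar> <= 2 * r" using \<tau> z' e0 r by (auto simp: r_def)
      have "norm_L2 L (%x. w \<tau> x - w z' x) <= B * \<bar>\<tau> - z'\<bar>"
      proof (cases \<tau> z' rule: linorder_cases)
       case less
       then show ?thesis using lip[OF T\<tau>(1) less z'T(3)] nwsym[of \<tau> z'] by simp
      next
       case equal
       then show ?thesis by (simp add: norm_L2_eq)
      next
       case greater
       then show ?thesis using lip[OF z'T(2) greater T\<tau>(2)] by simp
      qed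
      also have "... <= B * (2 * r)" using dist B by (intro mult_left_mono) auto
      finally show ?thesis .
     qed
     have nd: "(LINT x|M. (w \<tau> x - w z' x) * d x) <= 2 * B^2 * r" if \<tau>: "\<tau> = t \<or> \<tau> = s" for \<tau>
     proof -
      have \<tau>T: "\<tau> \<in> {0..T}" using \<tau> stT by auto
      have "(LINT x|M. (w \<tau> x - w z' x) * d x) <= norm_L2 L (%x. w \<tau> x - w z' x) * norm_L2 L d"
       using L2_mult(2)[OF L2_diff[OF wL[OF \<tau>T] wL[OF z'T(1)]] d(1)] by linarith
      also have "... <= (B * (2 * r)) * B"
       using near[OF \<tau>] d(2) B r by (intro mult_mono) auto
      finally show ?thesis by (simp add: power2_eq_square mult_ac)
     qed
     have ints: "integrable M (%x. w z' x * d x)" "integrable M (%x. (w t x - w z' x) * d x)" "integrable M (%x. (w s x - w z' x) * d x)"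
      by (intro L2_mult(1) L2_diff wL z'T(1) stT d(1))+
     have "(LINT x|M. \<phi> x * d x) = (LINT x|M. 2 * (w z' x * d x) + ((w t x - w z' x) * d x + (w s x - w z' x) * d x))"
      by (intro Bochner_Integration.integral_cong refl) (simp add: \<phi>_def algebra_simps)
     also have "... = 2 * (LINT x|M. w z' x * d x) + ((LINT x|M. (w t x - w z' x) * d x) + (LINT x|M. (w s x - w z' x) * d x))"
      using ints by simp
     also have "... <= 3 * B * (nw z')^2 + 4 * B^2 * r"
      using nd[of t] nd[of s] d(3) by simp
     finally have 1: "(LINT x|M. \<phi> x * d x) <= 3 * B * (nw z')^2 + 4 * B^2 * r" .
     have "(nw z')^2 <= 2 * (nw s)^2 + 8 * B^2 * r^2"
     proof -
      have "nw z' <= nw s + B * (2 * r)"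
       using nwt[OF z'T(1) stT(1)] near[of s] nwsym[of z' s] by simp
      then have "(nw z')^2 <= (nw s + B * (2 * r))^2" by (intro power_mono) (simp_all add: nw_def)
      also have "... <= 2 * (nw s)^2 + 2 * (B * (2 * r))^2"
       using sum_squares_bound[of "nw s" "B * (2 * r)"] by (simp add: power2_sum)
      finally show ?thesis by (simp add: power_mult_distrib)
     qed
     then have 2: "3 * B * (nw z')^2 <= 3 * B * (2 * (nw s)^2 + 8 * B^2 * r^2)"
      using B by (intro mult_left_mono) auto
     have "3 * B * (2 * (nw s)^2 + 8 * B^2 * r^2) + 4 * B^2 * r <= A"
     proof -
      have "24 * B ^ 3 * (r * r) <= 24 * B ^ 3 * (T * r)" using B r by (intro mult_left_mono mult_right_mono) auto
      moreover have "4 * B^2 * r <= 8 * B^2 * r" using r by simp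
      ultimately show ?thesis unfolding A_def by (simp add: algebra_simps power2_eq_square power3_eq_cube)
     qed
     then show "(LINT x|M. \<phi> x * (ut z' x - vt z' x)) <= A" using 1 2 unfolding d_def by linarith
    qed
   qed
  qed
  finally show "(nw t)^2 <= (1 + 6 * B * (t - s)) * (nw s)^2 + (24 * B ^ 3 * T + 8 * B^2) * (t - s)^2"
   by (simp add: A_def r_def algebra_simps power2_eq_square)
 qed (use B t in auto)
 then have "norm_L2 L (w t) = 0" by (simp add: nw_def)
 from norm_L2_zero_imp_AE[OF wL[OF t] this] show ?thesis by (auto simp: w_def elim!: eventually_mono)
qed

end

section \<open>A criterion for strong solutions in terms of Fourier coefficients\<close>

lemma continuous_AE_eq:
 fixes f g :: "real => real"
 assumes "continuous_on UNIV f" "continuous_on UNIV g" "AE x in lebesgue. f x = g x"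
 shows "f = g"
proof -
 have "open {x. f x \<noteq> g x}" by (intro open_Collect_neq assms)
 moreover have "negligible {x. f x \<noteq> g x}" using assms(3) by (simp add: AE_lebesgue_iff_negligible)
 ultimately have "{x. f x \<noteq> g x} = {}" using open_not_negligible by blast
 then show ?thesis by auto
qed

lemma hoelder_continuous:
 fixes f :: "real => 'a::real_normed_vector"
 assumes "!!t s. norm (f t - f s) <= C * sqrt \<bar>t - s\<bar>"
 shows "continuous_on S f"
 unfolding continuous_on_def
proof (rule ballI, rule LIM_zero_cancel)
 fix s
 have "((%t. C * sqrt \<bar>t - s\<bar>) \<longlongrightarrow> C * sqrt \<bar>s - s\<bar>) (at s within S)" by (intro tendsto_intros)
 then have "((%t. C * sqrt \<bar>t - s\<bar>) \<longlongrightarrow> 0) (at s within S)" by simp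
 moreover have "\<forall>\<^sub>F t in at s within S. norm (f t - f s) <= C * sqrt \<bar>t - s\<bar>"
  by (intro always_eventually allI assms)
 ultimately show "((%t. f t - f s) \<longlongrightarrow> 0) (at s within S)" by (rule Lim_null_comparison[rotated])
qed

context torus begin

lemma norm_L2_le_sup:
 assumes f: "f \<in> L2_per L" and b: "!!x. \<bar>f x\<bar> <= e"
 shows "norm_L2 L f <= sqrt (2 * L) * e" "cmod (fc f n) <= e"
proof -
 have e: "0 <= e" using b[of 0] by linarith
 have "(norm_L2 L f)^2 <= (LINT x|M. e^2)"
  unfolding norm_L2_sq using L2_perD(4)[OF f] b e
  by (intro integral_mono) (auto simp: abs_le_square_iff[symmetric])
 then have "(norm_L2 L f)^2 <= (sqrt (2 * L) * e)^2"
  using L_pos by (simp add: measure_restrict_space power_mult_distrib)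
 then show 1: "norm_L2 L f <= sqrt (2 * L) * e"
  by (rule power2_le_imp_le) (use e L_pos in simp)
 have "norm_L2 L f / sqrt (2 * L) <= e"
  using 1 L_pos by (simp add: pos_divide_le_eq mult.commute)
 then show "cmod (fc f n) <= e" using cmod_fc_le[OF f, of n] by linarith
qed

lemma fc_time_continuous:
 assumes cu: "!!t. continuous_on UNIV (u t)" and Ho: "!!t s x. \<bar>u t x - u s x\<bar> <= Ho * sqrt \<bar>t - s\<bar>"
  and B: "!!t x. \<bar>u t x\<bar> <= B" and per: "!!t x. u t (x + 2 * L) = u t x"
 shows "continuous_on S (%t. fc (u t) k)" "continuous_on S (%t. fc (%x. (u t x)^2) k)"
proof -
 have B0: "0 <= B" using B[of 0 0] by linarith
 have uL: "u t \<in> L2_per L" for t by (rule continuous_L2[OF cu per])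
 have sL: "(%x. (u t x)^2) \<in> L2_per L" for t by (rule continuous_L2) (auto intro!: continuous_intros cu simp: per)
 show "continuous_on S (%t. fc (u t) k)"
 proof (rule hoelder_continuous)
  show "norm (fc (u t) k - fc (u s) k) <= Ho * sqrt \<bar>t - s\<bar>" for t s
   unfolding fc_diff[OF L2_integrable[OF uL] L2_integrable[OF uL], symmetric]
   by (rule norm_L2_le_sup(2)[OF L2_diff[OF uL uL]]) (rule Ho)
 qed
 show "continuous_on S (%t. fc (%x. (u t x)^2) k)"
 proof (rule hoelder_continuous)
  show "norm (fc (%x. (u t x)^2) k - fc (%x. (u s x)^2) k) <= (2 * B * Ho) * sqrt \<bar>t - s\<bar>" for t s
   unfolding fc_diff[OF L2_integrable[OF sL] L2_integrable[OF sL], symmetric]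
  proof (rule norm_L2_le_sup(2)[OF L2_diff[OF sL sL]])
   fix x
   have "\<bar>(u t x)^2 - (u s x)\<^sup>2\<bar> = \<bar>u t x + u s x\<bar> * \<bar>u t x - u s x\<bar>"
    unfolding abs_mult[symmetric] by (simp add: power2_eq_square algebra_simps)
   also have "... <= (2 * B) * (Ho * sqrt \<bar>t - s\<bar>)"
    using B[of t x] B[of s x] Ho B0 by (intro mult_mono) auto
   finally show "\<bar>(u t x)^2 - (u s x)\<^sup>2\<bar> <= (2 * B * Ho) * sqrt \<bar>t - s\<bar>" by (simp add: mult.assoc)
  qed
 qed
qed

lemma Linf_L2I:
 assumes "(%p. F (fst p) (snd p)) \<in> borel_measurable (borel :: (real \<times> real) measure)"
  and "!!t. F t \<in> L2_per L" "!!t. norm_L2 L (F t) <= C"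
 shows "Linf_L2 L T F"
 unfolding Linf_L2_def
proof (intro conjI exI[of _ C])
 have "(%p. F (fst p) (snd p)) \<in> borel_measurable lborel" using assms(1) by simp
 then have "(%p. F (fst p) (snd p)) \<in> borel_measurable lebesgue" by (rule measurable_completion)
 then show "(%(t, x). F t x) \<in> borel_measurable (lebesgue_on ({0..T} \<times> UNIV))"
  unfolding split_beta by (rule measurable_restrict_space1)
qed (use assms in auto)

lemma joint_measurable_tm:
 assumes "!!k. continuous_on UNIV (%t. c t k)"
 shows "(%p :: real \<times> real. tm (c (fst p)) n (snd p)) \<in> borel_measurable borel"
proof (rule borel_measurable_continuous_onI)
 have "continuous_on UNIV (%p :: real \<times> real. c (fst p) n)"
  by (rule continuous_on_compose2[OF assms]) (auto intro!: continuous_intros)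
 moreover have "continuous_on UNIV (%p :: real \<times> real. ex n (snd p))"
  by (rule continuous_on_compose2[OF continuous_ex[OF continuous_on_id]]) (auto intro!: continuous_intros)
 ultimately show "continuous_on UNIV (%p :: real \<times> real. tm (c (fst p)) n (snd p))"
  unfolding tm_def by (intro continuous_intros)
qed

text \<open>Each term is continuous in the pair, and countable sums and limits preserve
  measurability. A representative chosen separately at each time would not have this
  property.\<close>

lemma joint_measurable_series:
 assumes "!!k. continuous_on UNIV (%t. c t k)"
 shows "(%p :: real \<times> real. \<Sum>n. tm (c (fst p)) n (snd p)) \<in> borel_measurable borel"
  "(%p :: real \<times> real. abel (c (fst p)) (snd p)) \<in> borel_measurable borel"
proof -
 note [measurable] = joint_measurable_tm[of c, OF assms]
 show "(%p :: real \<times> real. \<Sum>n. tm (c (fst p)) n (snd p)) \<in> borel_measurable borel" by measurable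
 show "(%p :: real \<times> real. abel (c (fst p)) (snd p)) \<in> borel_measurable borel"
  unfolding abel_def ab_def by measurable
qed

text \<open>All ingredients are built from coefficients: \<open>bes\<close> supplies the two space
  derivatives and the Hilbert term, \<open>der\<close> the equation mode by mode. \<open>u\<close>
  lives on the whole time line, which spares boundary cases in the measurability arguments.\<close>

lemma strong_solutionI:
 assumes T: "0 < T" and per: "!!t x. u t (x + 2 * L) = u t x" and B: "!!t x. \<bar>u t x\<bar> <= B"
  and cont: "continuous_on UNIV (%(t, x). u t x)"
  and hold: "!!t s x. \<bar>u t x - u s x\<bar> <= C * sqrt \<bar>t - s\<bar>"
  and bes: "!!t n. (\<Sum>k\<le>n. wt k * ((kp k)^2 * cmod (fc (u t) k))^2) <= C2"
  and der: "!!t k. t \<in> {0..T} ==> ((%t. fc (u t) k) has_vector_derivative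
    \<i> * of_real (kp k) / 2 * fc (%x. (u t x)^2) k + \<i> * (of_real (kp k))^2 * fc (u t) k) (at t within {0..T})"
  and init: "!!x. u 0 x = u0 x"
 shows "strong_solution L T u0 u"
proof -
 have B0: "0 <= B" using B[of 0 0] by linarith
 have cu: "continuous_on UNIV (u t)" for t
  using continuous_on_compose2[OF cont, of UNIV "%x. (t, x)"] by (simp add: continuous_intros)
 have uL: "u t \<in> L2_per L" for t by (rule continuous_L2[OF cu per])
 have dL: "(%x. u t x - u s x) \<in> L2_per L" for t s by (intro L2_diff uL)
 have small: "((%t. K * (C * sqrt \<bar>t - s\<bar>)) \<longlongrightarrow> 0) (at s within S)" for K s S
 proof -
  have "((%t. K * (C * sqrt \<bar>t - s\<bar>)) \<longlongrightarrow> K * (C * sqrt \<bar>s - s\<bar>)) (at s within S)"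
   by (intro tendsto_intros)
  then show ?thesis by simp
 qed
 note fcc = fc_time_continuous[of u, OF cu hold B per]
 \<comment> \<open>\<open>dd\<close>, \<open>ee\<close> and \<open>ff\<close> are the coefficients
   of \<open>u_xx\<close>, of its Hilbert transform, and of \<open>u_x\<close>. The first two have
   equal modulus, so one bound covers both.\<close>
 define dd where "dd t k = - (of_real (kp k))\<^sup>2 * fc (u t) k" for t k
 define ee where "ee t k = \<i> * (of_real (kp k))^2 * fc (u t) k" for t k
 define ff where "ff t k = \<i> * of_real (kp k) * fc (u t) k" for t k
 have kp0: "kp 0 = 0" by (simp add: kp_def)
 have ndd: "(cmod (dd t k))^2 = ((kp k)^2 * cmod (fc (u t) k))^2" "(cmod (ee t k))^2 = ((kp k)^2 * cmod (fc (u t) k))^2" for t k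
  by (simp_all add: dd_def ee_def norm_mult norm_power)
 have summ: "summable (%k. wt k * ((kp k)^2 * cmod (fc (u t) k))^2)" for t
  by (rule bounded_imp_summable[OF _ bes]) (simp add: wt_pos)
 have sumle: "(\<Sum>k. wt k * ((kp k)^2 * cmod (fc (u t) k))^2) <= C2" for t
  by (rule LIMSEQ_le_const2[OF summable_LIMSEQ'[OF summ]]) (use bes in auto)
 have c0: "Im (dd t 0) = 0" "Im (ee t 0) = 0" for t by (simp_all add: dd_def ee_def kp0)
 define uxx where "uxx t = abel (dd t)" for t
 define hil where "hil t = abel (ee t)" for t
 have xx: "uxx t \<in> L2_per L" "fc (uxx t) k = dd t k" and hi: "hil t \<in> L2_per L" "fc (hil t) k = ee t k" for t k
  using abel_L2[of "dd t"] abel_L2[of "ee t"] summ c0 unfolding uxx_def hil_def ndd by auto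
 have nxx: "(norm_L2 L (uxx t))^2 / (2 * L) <= C2" and nhi: "(norm_L2 L (hil t))^2 / (2 * L) <= C2" for t
 proof -
  have "(norm_L2 L (uxx t))^2 / (2 * L) = (\<Sum>k. wt k * ((kp k)^2 * cmod (fc (u t) k))^2)"
   using parseval_norm[OF xx(1)[of t]] unfolding xx(2) ndd by (rule sums_unique)
  then show "(norm_L2 L (uxx t))^2 / (2 * L) <= C2" using sumle[of t] by (simp only:)
  have "(norm_L2 L (hil t))^2 / (2 * L) = (\<Sum>k. wt k * ((kp k)^2 * cmod (fc (u t) k))^2)"
   using parseval_norm[OF hi(1)[of t]] unfolding hi(2) ndd by (rule sums_unique)
  then show "(norm_L2 L (hil t))^2 / (2 * L) <= C2" using sumle[of t] by (simp only:)
 qed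
 have C20: "0 <= C2" using nxx[of 0] L_pos by (meson divide_nonneg_pos order_trans zero_le_power2 mult_pos_pos zero_less_numeral)
 have nb: "norm_L2 L f <= sqrt (2 * L * C2)" if "(norm_L2 L f)^2 / (2 * L) <= C2" for f
  by (rule power2_le_imp_le) (use that L_pos C20 in \<open>simp_all add: pos_divide_le_eq mult.commute\<close>)
 define K where "K = (C2 + KS) / 2"
 define ux where "ux t x = (\<Sum>n. tm (ff t) n x)" for t x
 have ux: "(u t has_real_derivative ux t x) (at x)" "continuous_on UNIV (ux t)" "ux t (x + 2 * L) = ux t x"
  "\<bar>ux t x\<bar> <= K" "fc (ux t) k = ff t k" for t x k
 proof -
  have e: "fc (uxx t) n = - (of_real (kp n))\<^sup>2 * fc (u t) n" for n by (simp add: xx dd_def)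
  obtain F F' where F: "!!x. (F has_real_derivative F' x) (at x)" "continuous_on UNIV F'"
   "!!x. F (x + 2 * L) = F x" "!!x. F' (x + 2 * L) = F' x" "AE x in lebesgue. u t x = F x"
   "!!x. \<bar>F' x\<bar> <= ((norm_L2 L (uxx t))^2 / (2 * L) + KS) / 2" "!!n. fc F' n = \<i> * of_real (kp n) * fc (u t) n"
   "F = (%x. \<Sum>n. tm (fc (u t)) n x)" "F' = (%x. \<Sum>n. tm (%n. \<i> * of_real (kp n) * fc (u t) n) n x)"
   by (rule C1_representation[OF uL xx(1) e]) (rule that)
  have "continuous_on UNIV F" using F(1) by (meson DERIV_isCont continuous_at_imp_continuous_on)
  then have uF: "u t = F" by (rule continuous_AE_eq[OF cu _ F(5)])
  have F': "F' = ux t" unfolding F(9) ux_def[abs_def] ff_def[abs_def] ..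
  show "(u t has_real_derivative ux t x) (at x)" "continuous_on UNIV (ux t)" "ux t (x + 2 * L) = ux t x" "fc (ux t) k = ff t k"
   using F(1,2,4,7) unfolding F' uF ff_def by auto
  show "\<bar>ux t x\<bar> <= K" using F(6)[of x] nxx[of t] unfolding F' K_def by (simp add: field_simps)
 qed
 have uxL: "ux t \<in> L2_per L" for t by (rule continuous_L2[OF ux(2,3)])
 define ut where "ut t x = u t x * ux t x + hil t x" for t x
 have pc: "continuous_on UNIV (%x. u t x * ux t x)" for t by (intro continuous_intros cu ux(2))
 have pL: "(%x. u t x * ux t x) \<in> L2_per L" for t by (rule continuous_L2[OF pc]) (simp add: per ux(3))
 have utL: "ut t \<in> L2_per L" for t unfolding ut_def[abs_def] by (intro L2_add pL hi)
 have nut: "norm_L2 L (ut t) <= sqrt (2 * L) * (B * K) + sqrt (2 * L * C2)" for t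
 proof -
  have "\<bar>u t x * ux t x\<bar> <= B * K" for x unfolding abs_mult using B ux(4) B0 by (intro mult_mono) auto
  then have "norm_L2 L (%x. u t x * ux t x) <= sqrt (2 * L) * (B * K)" by (rule norm_L2_le_sup(1)[OF pL])
  then show ?thesis
   using norm_L2_triangle[OF pL[of t] hi(1)[of t]] nb[OF nhi[of t]] unfolding ut_def[abs_def] by linarith
 qed
 have sq: "(%x. (u t x)^2) \<in> L2_per L" for t
  by (rule continuous_L2) (auto intro!: continuous_intros cu simp: per)
 \<comment> \<open>The product \<open>u * ux\<close> is half the derivative of \<open>u^2\<close>;
   this is how the coefficients of \<open>u^2\<close> in \<open>der\<close> become those of the
   nonlinear term.\<close>
 have fut: "fc (ut t) k = \<i> * of_real (kp k) / 2 * fc (%x. (u t x)^2) k + \<i> * (of_real (kp k))^2 * fc (u t) k" for t k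
 proof -
  have "fc (%x. 2 * (u t x * ux t x)) k = \<i> * of_real (kp k) * fc (%x. (u t x)^2) k"
  proof (rule fc_deriv)
   show "((%x. (u t x)^2) has_real_derivative 2 * (u t x * ux t x)) (at x)" for x
    using DERIV_power[OF ux(1)[of t x], of 2] by (simp add: mult_ac)
   show "continuous_on UNIV (%x. 2 * (u t x * ux t x))" by (intro continuous_on_mult_left pc)
  qed (simp add: per)
  moreover have "fc (%x. 2 * (u t x * ux t x)) k = 2 * fc (%x. u t x * ux t x) k"
   using fc_lincomb[OF L2_integrable[OF pL] L2_integrable[OF pL], of 2 t 0 t k] by simp
  ultimately have "2 * fc (%x. u t x * ux t x) k = \<i> * of_real (kp k) * fc (%x. (u t x)^2) k" by (simp only:)
  moreover have "X = \<i> * a / 2 * Y" if "2 * X = \<i> * a * Y" for X Y a :: complex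
   using arg_cong[OF that, of "%z. z / 2"] by simp
  ultimately have "fc (%x. u t x * ux t x) k = \<i> * of_real (kp k) / 2 * fc (%x. (u t x)^2) k" by blast
  then show ?thesis
   using fc_lincomb[OF L2_integrable[OF pL] L2_integrable[OF hi(1)], of 1 t 1 t k]
   by (simp add: ut_def[abs_def] hi(2) ee_def)
 qed
 have cm: "(%p. u (fst p) (snd p)) \<in> borel_measurable borel"
  using cont by (intro borel_measurable_continuous_onI) (simp add: split_beta)
 have uxm: "(%p. ux (fst p) (snd p)) \<in> borel_measurable borel"
  unfolding ux_def by (rule joint_measurable_series(1)) (auto simp: ff_def intro!: continuous_intros fcc)
 have hm: "(%p. hil (fst p) (snd p)) \<in> borel_measurable borel"
  unfolding hil_def by (rule joint_measurable_series(2)) (auto simp: ee_def intro!: continuous_intros fcc)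
 have xxm: "(%p. uxx (fst p) (snd p)) \<in> borel_measurable borel"
  unfolding uxx_def by (rule joint_measurable_series(2)) (auto simp: dd_def intro!: continuous_intros fcc)
 have utm: "(%p. ut (fst p) (snd p)) \<in> borel_measurable borel"
  unfolding ut_def using cm uxm hm by measurable
 have Lu: "Linf_L2 L T u" by (rule Linf_L2I[OF cm uL norm_L2_le_sup(1)[OF uL B]])
 have Lux: "Linf_L2 L T ux" by (rule Linf_L2I[OF uxm uxL norm_L2_le_sup(1)[OF uxL ux(4)]])
 have Lxx: "Linf_L2 L T uxx" by (rule Linf_L2I[OF xxm xx(1) nb[OF nxx]])
 have Lut: "Linf_L2 L T ut" by (rule Linf_L2I[OF utm utL nut])
 have wd: "weak_deriv L (u t) (ux t)" "weak_deriv L (ux t) (uxx t)" for t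
 proof -
  show "weak_deriv L (u t) (ux t)" by (rule weak_derivI[OF uL uxL]) (simp add: ux(5) ff_def)
  show "weak_deriv L (ux t) (uxx t)"
   by (rule weak_derivI[OF uxL xx(1)]) (simp add: ux(5) xx(2) dd_def ff_def ii_mult)
 qed
 have hh: "AE x in lebesgue. \<exists>h. has_hilbert_per L (uxx t) x h \<and> ut t x = u t x * ux t x + h" for t
 proof -
  have "AE x in lebesgue. has_hilbert_per L (uxx t) x (hil t x)"
   by (rule hilbert_AE[OF xx(1) hi(1)]) (simp add: hi(2) xx(2) ee_def dd_def kp0)
  then show ?thesis by eventually_elim (auto simp: ut_def)
 qed
 have wt: "weak_time_deriv T u ut"
  unfolding weak_time_deriv_def
 proof (intro allI impI, elim conjE exE)
  fix \<psi> a b assume s: "smooth \<psi>" and ab: "0 < a" "b < T" "\<forall>t. \<psi> t \<noteq> 0 \<longrightarrow> t \<in> {a..b}"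
  have \<psi>0: "\<psi> 0 = 0" "\<psi> T = 0" using ab(1,2) ab(3)[rule_format, of 0] ab(3)[rule_format, of T] by fastforce+
  note d = smooth_deriv[OF s]
  have c\<psi>: "continuous_on S \<psi>" for S using d(1) by (meson DERIV_isCont continuous_at_imp_continuous_on)
  have c\<psi>': "continuous_on S (deriv \<psi>)" for S using d(2) continuous_on_subset by blast
  \<comment> \<open>The weak time derivative identity says that \<open>\<Phi>\<close> vanishes
    almost everywhere. Its pairing with an exponential is, after exchanging integrals, the time
    integral of the derivative of the test function times a Fourier coefficient, which is
    zero.\<close>
  define \<Phi> where "\<Phi> x = (LINT t:{0..T}|lebesgue. deriv \<psi> t * u t x) + (LINT t:{0..T}|lebesgue. \<psi> t * ut t x)" for x
  have P: "\<Phi> (x + 2 * L) = \<Phi> x" for x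
   by (simp add: \<Phi>_def per L2_perD(1)[OF utL])
  have zero: "(LINT t:{0..T}|lebesgue. deriv \<psi> t * a (fc (u t) k)) + (LINT t:{0..T}|lebesgue. \<psi> t * a (fc (ut t) k)) = 0"
   if a: "bounded_linear a" for a :: "complex => real" and k
  proof -
   have D: "((%t. a (fc (u t) k)) has_vector_derivative a (fc (ut t) k)) (at t within {0..T})" if "t \<in> {0..T}" for t
    using bounded_linear.has_vector_derivative[OF a der[OF that]] unfolding fut .
   have ca: "continuous_on {0..T} (%t. a (fc (u t) k))"
    by (rule bounded_linear.continuous_on[OF a fcc(1)])
   have cat: "continuous_on {0..T} (%t. a (fc (ut t) k))"
    unfolding fut by (intro bounded_linear.continuous_on[OF a] continuous_intros fcc)
   have I: "set_integrable lebesgue {0..T} (%t. f t)" if "continuous_on {0..T} f" for f :: "real => real"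
    using continuous_imp_integrable_real[OF that] by (simp add: set_integrable_def integrable_restrict_space)
   have hi: "((%t. deriv \<psi> t * a (fc (u t) k) + \<psi> t * a (fc (ut t) k)) has_integral
     \<psi> T * a (fc (u T) k) - \<psi> 0 * a (fc (u 0) k)) {0..T}"
   proof (rule fundamental_theorem_of_calculus)
    fix t assume t: "t \<in> {0..T}"
    have "(\<psi> has_real_derivative deriv \<psi> t) (at t within {0..T})"
     by (rule has_field_derivative_at_within[OF d(1)])
    from DERIV_mult[OF this D[OF t, unfolded has_real_derivative_iff_has_vector_derivative[symmetric]]]
    show "((%t. \<psi> t * a (fc (u t) k)) has_vector_derivative deriv \<psi> t * a (fc (u t) k) + \<psi> t * a (fc (ut t) k)) (at t within {0..T})"
     unfolding has_real_derivative_iff_has_vector_derivative by (simp add: add.commute mult.commute)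
   qed (use T in simp)
   have i1: "set_integrable lebesgue {0..T} (%t. deriv \<psi> t * a (fc (u t) k))" by (intro I continuous_intros c\<psi>' ca)
   have i2: "set_integrable lebesgue {0..T} (%t. \<psi> t * a (fc (ut t) k))" by (intro I continuous_intros c\<psi> cat)
   have "(LINT t:{0..T}|lebesgue. deriv \<psi> t * a (fc (u t) k) + \<psi> t * a (fc (ut t) k)) = 0"
    using has_integral_unique[OF has_integral_set_lebesgue[OF set_integral_add(1)[OF i1 i2]] hi] by (simp only: \<psi>0 mult_zero_left diff_zero)
   then show ?thesis using set_integral_add(2)[OF i1 i2] by simp
  qed
  have \<Phi>i: "integrable M (%x. \<phi> x * \<Phi> x)" and \<Phi>v: "(LINT x|M. \<phi> x * \<Phi> x) =
   (LINT t:{0..T}|lebesgue. deriv \<psi> t * (LINT x|M. \<phi> x * u t x)) + (LINT t:{0..T}|lebesgue. \<psi> t * (LINT x|M. \<phi> x * ut t x))"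
   if \<phi>: "\<phi> \<in> L2_per L" for \<phi>
  proof -
   note f1 = time_space_fubini[OF Lu c\<psi>' \<phi>] and f2 = time_space_fubini[OF Lut c\<psi> \<phi>]
   show "integrable M (%x. \<phi> x * \<Phi> x)" unfolding \<Phi>_def distrib_left by (rule Bochner_Integration.integrable_add[OF f1(1) f2(1)])
   show "(LINT x|M. \<phi> x * \<Phi> x) =
   (LINT t:{0..T}|lebesgue. deriv \<psi> t * (LINT x|M. \<phi> x * u t x)) + (LINT t:{0..T}|lebesgue. \<psi> t * (LINT x|M. \<phi> x * ut t x))"
    unfolding \<Phi>_def distrib_left Bochner_Integration.integral_add[OF f1(1) f2(1)] f1(3) f2(3) ..
  qed
  have int\<Phi>: "integrable M \<Phi>" using \<Phi>i[of "%_. 1"] continuous_L2[of "%_. 1"] by simp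
  have pair: "(LINT x|M. f x * Re (z * ex k x)) = 2 * L * Re (z * cnj (fc f k))" if f: "integrable M f" for f z k
  proof -
   have i: "integrable M (%x. z * (of_real (f x) * ex k x))"
    by (intro integrable_mult_right integrable_mult_ex f)
   have "(LINT x|M. f x * Re (z * ex k x)) = (LINT x|M. Re (z * (of_real (f x) * ex k x)))"
    by (simp add: algebra_simps)
   also have "... = Re (z * (of_real (2 * L) * cnj (fc f k)))"
    unfolding integral_Re[OF i] by (simp only: integral_mult_right_zero integral_mult_ex[OF f])
   finally show ?thesis by (simp add: algebra_simps)
  qed
  have "Re (z * cnj (fc \<Phi> k)) = 0" for z k
  proof -
   let ?\<phi> = "%x. Re (z * ex k x)"
   have \<phi>: "?\<phi> \<in> L2_per L" by (rule continuous_L2) (auto intro!: continuous_intros simp: ex_periodic)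
   have bl: "bounded_linear (%w. 2 * L * Re (z * cnj w))"
    by (intro bounded_linear_intros bounded_linear_compose[OF bounded_linear_Re] bounded_linear_cnj)
   have "2 * L * Re (z * cnj (fc \<Phi> k)) = (LINT x|M. ?\<phi> x * \<Phi> x)"
    unfolding pair[OF int\<Phi>, symmetric] by (simp only: mult.commute)
   also have "... = (LINT t:{0..T}|lebesgue. deriv \<psi> t * (2 * L * Re (z * cnj (fc (u t) k)))) + (LINT t:{0..T}|lebesgue. \<psi> t * (2 * L * Re (z * cnj (fc (ut t) k))))"
    unfolding \<Phi>v[OF \<phi>] pair[OF L2_integrable[OF uL], symmetric] pair[OF L2_integrable[OF utL], symmetric]
    by (simp only: mult.commute[of "Re _"])
   also have "... = 0" by (rule zero[OF bl])
   finally show ?thesis using L_pos by simp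
  qed
  from this[of 1] this[of \<i>] have "fc \<Phi> k = 0" for k by (simp add: complex_eq_iff)
  then have f0: "fc \<Phi> = (%_. 0)" by auto
  \<comment> \<open>For \<open>\<Phi>\<close> integrability has been established, so its vanishing
    is concluded from the Abel limit at Lebesgue points, which asks for no more.\<close>
  have "AE x in lebesgue. \<Phi> x = 0"
   using lebesgue_point_AE[OF int\<Phi> P]
  proof eventually_elim
   case (elim x)
   have "abel (%_. 0) x = \<Phi> x" using abel_eq_at_lebesgue_point[of \<Phi>, OF int\<Phi> P elim] by (simp add: f0)
   then show ?case by (simp add: abel_def ab_def tm_def)
  qed
  then show "AE x in lebesgue. (LINT t:{0..T}|lebesgue. deriv \<psi> t * u t x) = - (LINT t:{0..T}|lebesgue. \<psi> t * ut t x)"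
   by eventually_elim (simp add: \<Phi>_def)
 qed
 show ?thesis
  unfolding strong_solution_def
 proof (intro conjI ballI)
  show "AE x in lebesgue. u 0 x = u0 x" by (simp add: init)
  show "u t \<in> L2_per L" for t by (rule uL)
  fix s assume "s \<in> {0..T}"
  show "((%t. norm_L2 L (%x. u t x - u s x)) \<longlongrightarrow> 0) (at s within {0..T})"
  proof (rule Lim_null_comparison[OF always_eventually small[of "sqrt (2 * L)"]], rule allI)
   show "norm (norm_L2 L (%x. u t x - u s x)) <= sqrt (2 * L) * (C * sqrt \<bar>t - s\<bar>)" for t
    using norm_L2_le_sup(1)[where f = "%x. u t x - u s x", OF dL hold] by (simp only: real_norm_def abs_of_nonneg[OF norm_L2_nonneg])
  qed
 qed (rule exI[of _ ux], rule exI[of _ uxx], rule exI[of _ ut], intro conjI Lu Lux Lxx Lut wt, (use wd hh in auto))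
qed

end

section \<open>Consistency of the discrete Fourier coefficients\<close>

lemma riemann_sum_error:
 fixes F :: "real => complex"
 assumes c: "continuous_on {a..a + real n * h} F" and h: "0 < h"
  and e: "!!j x. j < n ==> a + real j * h <= x ==> x <= a + real (Suc j) * h ==> cmod (F x - F (a + real j * h)) <= e"
 shows "cmod (of_real h * (\<Sum>j<n. F (a + real j * h)) - integral {a..a + real n * h} F) <= e * (real n * h)"
 using c e
proof (induction n)
 case (Suc n)
 let ?b = "a + real n * h" and ?c = "a + real (Suc n) * h"
 have le: "a <= ?b" "?b <= ?c" using h by (auto simp: algebra_simps)
 have cb: "continuous_on {?b..?c} F" "continuous_on {a..?b} F"
  by (rule continuous_on_subset[OF Suc.prems(1)]; use le in auto)+
 have i: "F integrable_on {a..?c}" by (rule integrable_continuous_interval[OF Suc.prems(1)])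
 have 1: "integral {a..?b} F + integral {?b..?c} F = integral {a..?c} F"
  by (rule Henstock_Kurzweil_Integration.integral_combine[OF le i])
 have IH: "cmod (of_real h * (\<Sum>j<n. F (a + real j * h)) - integral {a..?b} F) <= e * (real n * h)"
  by (rule Suc.IH[OF cb(2)]) (rule Suc.prems(2); simp)
 have "cmod (integral {?b..?c} (%x. F x - F ?b)) <= e * (?c - ?b)"
 proof (rule integral_bound[OF le(2)])
  show "continuous_on {?b..?c} (%x. F x - F ?b)" by (intro continuous_on_diff cb(1) continuous_on_const)
  show "cmod (F x - F ?b) <= e" if "x \<in> {?b..?c}" for x by (rule Suc.prems(2)) (use that in auto)
 qed
 moreover have "integral {?b..?c} (%x. F x - F ?b) = integral {?b..?c} F - of_real h * F ?b"
 proof -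
  have "integral {?b..?c} (%x. F ?b) = of_real h * F ?b"
   using le(2) by (simp add: algebra_simps scaleR_conv_of_real)
  moreover have "integral {?b..?c} (%x. F x - F ?b) = integral {?b..?c} F - integral {?b..?c} (%x. F ?b)"
   by (intro Henstock_Kurzweil_Integration.integral_diff integrable_continuous_interval cb(1) continuous_on_const)
  ultimately show ?thesis by simp
 qed
 moreover have "?c - ?b = h" by (simp add: algebra_simps)
 ultimately have 2: "cmod (integral {?b..?c} F - of_real h * F ?b) <= e * h" by (simp only:)
 have "of_real h * (\<Sum>j<Suc n. F (a + real j * h)) - integral {a..?c} F =
  (of_real h * (\<Sum>j<n. F (a + real j * h)) - integral {a..?b} F) - (integral {?b..?c} F - of_real h * F ?b)"
  unfolding 1[symmetric] by (simp add: algebra_simps)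
 then have "cmod (of_real h * (\<Sum>j<Suc n. F (a + real j * h)) - integral {a..?c} F) <= e * (real n * h) + e * h"
  using norm_triangle_ineq4[of "of_real h * (\<Sum>j<n. F (a + real j * h)) - integral {a..?b} F" "integral {?b..?c} F - of_real h * F ?b"]
   IH 2 by (simp only:)
 then show ?case by (simp add: algebra_simps)
qed simp

lemma cmod_cis_diff_le: "cmod (cis a - cis b) <= \<bar>a - b\<bar>"
proof -
 have half: "2 * ((a - b) / 2) = a - b" by simp
 have "(cmod (cis a - cis b))^2 = 4 * (sin ((a - b) / 2))^2"
 proof -
  have "(cmod (cis a - cis b))^2 = (cos a - cos b)^2 + (sin a - sin b)^2"
   by (simp add: cmod_power2)
  also have "... = ((cos a)^2 + (sin a)^2) + ((cos b)^2 + (sin b)^2) - 2 * (cos a * cos b + sin a * sin b)"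
   by (simp add: power2_eq_square algebra_simps)
  also have "... = 2 - 2 * cos (a - b)" by (simp add: cos_diff)
  also have "cos (a - b) = 1 - 2 * (sin ((a - b) / 2))^2"
   using cos_double_sin[of "(a - b) / 2"] unfolding half .
  finally show ?thesis by simp
 qed
 also have "... <= 4 * ((a - b) / 2)^2"
  by (intro mult_left_mono abs_le_square_iff[THEN iffD1] abs_sin_x_le_abs_x) simp
 also have "... = \<bar>a - b\<bar>\<^sup>2" by (simp add: power_divide)
 finally show ?thesis by (rule power2_le_imp_le) simp
qed

lemma floor_steps:
 fixes d :: "nat => real"
 assumes t: "0 <= t" and d: "!!i. 0 < d i"
 shows "real (nat \<lfloor>t / d i\<rfloor>) * d i <= t" "d \<longlonglongrightarrow> 0 ==> (%i. real (nat \<lfloor>t / d i\<rfloor>) * d i) \<longlonglongrightarrow> t"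
proof -
 have l: "real (nat \<lfloor>t / d i\<rfloor>) * d i <= t" "t - d i <= real (nat \<lfloor>t / d i\<rfloor>) * d i" for i
 proof -
  have "0 <= t / d i" using t d[of i] by simp
  then have a: "real (nat \<lfloor>t / d i\<rfloor>) <= t / d i" "t / d i - 1 <= real (nat \<lfloor>t / d i\<rfloor>)" by linarith+
  show "real (nat \<lfloor>t / d i\<rfloor>) * d i <= t" using a(1) d[of i] by (simp add: pos_le_divide_eq)
  have "(t / d i - 1) * d i <= real (nat \<lfloor>t / d i\<rfloor>) * d i" using a(2) d[of i] by (intro mult_right_mono) auto
  then show "t - d i <= real (nat \<lfloor>t / d i\<rfloor>) * d i" using d[of i] by (simp add: left_diff_distrib)
 qed
 show "real (nat \<lfloor>t / d i\<rfloor>) * d i <= t" by (rule l(1))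
 assume "d \<longlonglongrightarrow> 0"
 then have "(%i. t - d i) \<longlonglongrightarrow> t - 0" by (intro tendsto_intros)
 then have lt: "(%i. t - d i) \<longlonglongrightarrow> t" by simp
 show "(%i. real (nat \<lfloor>t / d i\<rfloor>) * d i) \<longlonglongrightarrow> t"
  by (rule tendsto_sandwich[OF _ _ lt tendsto_const]) (use l in \<open>auto intro!: always_eventually\<close>)
qed

text \<open>The Euler sums are Riemann sums of \<open>\<Psi>\<close>, so the limit of the defect
  relation says that \<open>f\<close> is \<open>f 0\<close> plus the integral of
  \<open>\<Psi>\<close>. Differentiability of \<open>f\<close> is thereby a conclusion.\<close>

lemma euler_limit:
 fixes f \<Psi> :: "real => complex"
 assumes T: "0 < T" and f: "continuous_on {0..T} f" and \<Psi>: "continuous_on {0..T} \<Psi>"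
  and d: "!!i :: nat. 0 < d i" "d \<longlonglongrightarrow> 0" and \<theta>: "\<theta> \<longlonglongrightarrow> 0"
  and e: "!!i n. real n * d i <= T ==> cmod (f (real n * d i) - f 0 - of_real (d i) * (\<Sum>l<n. \<Psi> (real l * d i))) <= \<theta> i"
  and t: "t \<in> {0..T}"
 shows "(f has_vector_derivative \<Psi> t) (at t within {0..T})"
proof -
 have eq: "f t = f 0 + integral {0..t} \<Psi>" if t: "t \<in> {0..T}" for t
 proof -
  define n where "n i = nat \<lfloor>t / d i\<rfloor>" for i
  have t0: "0 <= t" using t by simp
  have n: "real (n i) * d i <= t" for i unfolding n_def by (rule floor_steps(1)[OF t0 d(1)])
  have nt: "(%i. real (n i) * d i) \<longlonglongrightarrow> t" unfolding n_def by (rule floor_steps(2)[OF t0 d])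
  have nT: "real (n i) * d i \<in> {0..T}" for i using n[of i] d(1)[of i] t by auto
  define X where "X i = f (real (n i) * d i) - f 0 - integral {0..real (n i) * d i} \<Psi>" for i
  have "X \<longlonglongrightarrow> f t - f 0 - integral {0..t} \<Psi>"
   unfolding X_def
   by (intro tendsto_intros continuous_on_tendsto_compose[OF f nt t] always_eventually allI nT
     continuous_on_tendsto_compose[OF indefinite_integral_continuous_1[OF integrable_continuous_interval[OF \<Psi>]] nt t])
  moreover have "X \<longlonglongrightarrow> 0"
  proof (rule metric_LIMSEQ_I)
   fix r :: real assume r: "0 < r"
   define s where "s = r / (2 * T)"
   have s: "0 < s" "s * T = r / 2" using r T by (simp_all add: s_def)
   obtain \<delta> where \<delta>: "0 < \<delta>" "!!x y. x \<in> {0..T} ==> y \<in> {0..T} ==> dist y x < \<delta> ==> dist (\<Psi> y) (\<Psi> x) < s"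
    using compact_uniformly_continuous[OF \<Psi>] s(1) unfolding uniformly_continuous_on_def by (metis compact_Icc)
   have "\<forall>\<^sub>F i in sequentially. d i < \<delta> \<and> \<theta> i < r / 2"
    using order_tendstoD(2)[OF d(2) \<delta>(1)] order_tendstoD(2)[OF \<theta>, of "r / 2"] r by (auto elim: eventually_elim2)
   then obtain i0 where i0: "!!i. i \<ge> i0 ==> d i < \<delta> \<and> \<theta> i < r / 2" unfolding eventually_sequentially by blast
   have "dist (X i) 0 < r" if i: "i \<ge> i0" for i
   proof -
    have "cmod (of_real (d i) * (\<Sum>l<n i. \<Psi> (0 + real l * d i)) - integral {0..0 + real (n i) * d i} \<Psi>) <= s * (real (n i) * d i)"
    proof (rule riemann_sum_error[OF _ d(1)])
     show "continuous_on {0..0 + real (n i) * d i} \<Psi>" by (rule continuous_on_subset[OF \<Psi>]) (use nT[of i] in auto)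
     fix j x assume j: "j < n i" "0 + real j * d i <= x" "x <= 0 + real (Suc j) * d i"
     have "real (Suc j) * d i <= real (n i) * d i" using j(1) d(1)[of i] by (intro mult_right_mono) auto
     moreover have "0 <= real j * d i" "real j * d i <= real (Suc j) * d i"
      using d(1)[of i] by (auto intro!: mult_right_mono)
     ultimately have "x \<in> {0..T}" "real j * d i \<in> {0..T}"
      using j(2,3) nT[of i] unfolding atLeastAtMost_iff by linarith+
     moreover have "dist x (real j * d i) < \<delta>" using j(2,3) i0[OF i] by (auto simp: dist_real_def algebra_simps)
     ultimately show "cmod (\<Psi> x - \<Psi> (0 + real j * d i)) <= s" using \<delta>(2)[of "real j * d i" x] by (simp add: dist_norm)
    qed
    also have "... <= s * T" using nT[of i] s by (intro mult_left_mono) auto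
    finally have 1: "cmod (of_real (d i) * (\<Sum>l<n i. \<Psi> (real l * d i)) - integral {0..real (n i) * d i} \<Psi>) <= r / 2" by (simp add: s)
    have 2: "cmod (f (real (n i) * d i) - f 0 - of_real (d i) * (\<Sum>l<n i. \<Psi> (real l * d i))) < r / 2"
     using e[of "n i" i] nT[of i] i0[OF i] by auto
    have "X i = (f (real (n i) * d i) - f 0 - of_real (d i) * (\<Sum>l<n i. \<Psi> (real l * d i)))
     + (of_real (d i) * (\<Sum>l<n i. \<Psi> (real l * d i)) - integral {0..real (n i) * d i} \<Psi>)" by (simp add: X_def)
    then have "cmod (X i) <= cmod (f (real (n i) * d i) - f 0 - of_real (d i) * (\<Sum>l<n i. \<Psi> (real l * d i)))
     + cmod (of_real (d i) * (\<Sum>l<n i. \<Psi> (real l * d i)) - integral {0..real (n i) * d i} \<Psi>)"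
     by (simp only: norm_triangle_ineq)
    then have "cmod (X i) < r" using 1 2 by linarith
    then show ?thesis by simp
   qed
   then show "\<exists>no. \<forall>n\<ge>no. dist (X n) 0 < r" by blast
  qed
  ultimately have "f t - f 0 - integral {0..t} \<Psi> = 0" by (rule LIMSEQ_unique)
  then show ?thesis by (simp add: algebra_simps)
 qed
 have "((%t. f 0 + integral {0..t} \<Psi>) has_vector_derivative 0 + \<Psi> t) (at t within {0..T})"
  by (intro has_vector_derivative_add has_vector_derivative_const integral_has_vector_derivative[OF \<Psi> t])
 then have "((%t. f 0 + integral {0..t} \<Psi>) has_vector_derivative \<Psi> t) (at t within {0..T})" by simp
 then show ?thesis by (rule has_vector_derivative_transform[OF t, rotated]) (rule eq)
qed

lemma cis_symbol_limit:
 assumes "d \<longlonglongrightarrow> 0" "!!i :: nat. d i \<noteq> 0"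
 shows "(%i. (cis (c * d i) - 1) / of_real (d i)) \<longlonglongrightarrow> \<i> * of_real c"
proof -
 have "((%z. exp (\<i> * of_real c * z)) has_field_derivative \<i> * of_real c * exp (\<i> * of_real c * 0)) (at 0)"
  by (auto intro!: derivative_eq_intros)
 then have "((%z. (exp (\<i> * of_real c * z) - 1) / z) \<longlongrightarrow> \<i> * of_real c) (at 0)"
  by (simp add: has_field_derivative_iff)
 moreover have "filterlim (%i. complex_of_real (d i)) (at 0) sequentially"
  unfolding filterlim_at using tendsto_of_real[OF assms(1), where ?'a = complex] assms(2) by (auto intro: always_eventually)
 ultimately have "(%i. (exp (\<i> * of_real c * of_real (d i)) - 1) / of_real (d i)) \<longlonglongrightarrow> \<i> * of_real c"
  by (rule filterlim_compose)
 moreover have "exp (\<i> * of_real c * of_real (d i)) = cis (c * d i)" for i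
  by (simp add: cis_conv_exp mult.assoc)
 ultimately show ?thesis by simp
qed

text \<open>The symbols of the difference operators in the Fourier form of \<open>G\<close>, and
  that of D+ D-. The limits \<open>\<i> * c / 3\<close> and \<open>\<i> * c / 6\<close> add up to
  \<open>\<i> * c / 2\<close>, the symbol that produces \<open>u * u_x\<close> from
  \<open>u^2\<close>.\<close>

lemma symbol_limits:
 assumes d: "d \<longlonglongrightarrow> 0" "!!i :: nat. d i \<noteq> 0"
 shows "(%i. (cis (c * d i) - cis (- (c * d i))) / of_real (6 * d i)) \<longlonglongrightarrow> \<i> * of_real c / 3"
  "(%i. (1 - cis (- (c * d i))) / of_real (6 * d i)) \<longlonglongrightarrow> \<i> * of_real c / 6"
  "(%i. (2 * cos (c * d i) - 2) / (d i)^2) \<longlonglongrightarrow> - (c^2)"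
proof -
 note p = cis_symbol_limit[of d, OF d, of c] and n = cis_symbol_limit[of d, OF d, of "- c"]
 have "(%i. ((cis (c * d i) - 1) / of_real (d i) - (cis (- c * d i) - 1) / of_real (d i)) / 6) \<longlonglongrightarrow> (\<i> * of_real c - \<i> * of_real (- c)) / 6"
  by (intro tendsto_intros p n) simp
 moreover have "((cis (c * d i) - 1) / of_real (d i) - (cis (- c * d i) - 1) / of_real (d i)) / 6 = (cis (c * d i) - cis (- (c * d i))) / of_real (6 * d i)" for i
  using d(2)[of i] by (simp add: field_simps)
 moreover have "(\<i> * of_real c - \<i> * of_real (- c)) / 6 = \<i> * of_real c / 3" by simp
 ultimately show "(%i. (cis (c * d i) - cis (- (c * d i))) / of_real (6 * d i)) \<longlonglongrightarrow> \<i> * of_real c / 3" by (simp only:)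
 have "(%i. - ((cis (- c * d i) - 1) / of_real (d i)) / 6) \<longlonglongrightarrow> - (\<i> * of_real (- c)) / 6"
  by (intro tendsto_intros n) simp
 moreover have "- ((cis (- c * d i) - 1) / of_real (d i)) / 6 = (1 - cis (- (c * d i))) / of_real (6 * d i)" for i
  using d(2)[of i] by (simp add: field_simps)
 moreover have "- (\<i> * of_real (- c)) / 6 = \<i> * of_real c / 6" by simp
 ultimately show "(%i. (1 - cis (- (c * d i))) / of_real (6 * d i)) \<longlonglongrightarrow> \<i> * of_real c / 6" by (simp only:)
 have "(%i. Im ((cis ((c / 2) * d i) - 1) / of_real (d i))) \<longlonglongrightarrow> Im (\<i> * of_real (c / 2))"
  by (intro tendsto_intros cis_symbol_limit d)
 then have "(%i. - (2 * Im ((cis ((c / 2) * d i) - 1) / of_real (d i)))\<^sup>2) \<longlonglongrightarrow> - (2 * Im (\<i> * of_real (c / 2)))\<^sup>2"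
  by (intro tendsto_minus tendsto_power tendsto_mult tendsto_const)
 moreover have "- (2 * Im ((cis ((c / 2) * d i) - 1) / of_real (d i)))\<^sup>2 = (2 * cos (c * d i) - 2) / (d i)^2" for i
 proof -
  have "cos (c * d i) = 1 - 2 * (sin (c / 2 * d i))^2" using cos_double_sin[of "c / 2 * d i"] by simp
  moreover have "Im ((cis ((c / 2) * d i) - 1) / of_real (d i)) = sin (c / 2 * d i) / d i" by (simp add: Im_divide_of_real)
  ultimately show ?thesis by (simp only: power_mult_distrib power_divide) (simp add: field_simps)
 qed
 moreover have "- (2 * Im (\<i> * of_real (c / 2)))\<^sup>2 = - (c^2)" by simp
 ultimately show "(%i. (2 * cos (c * d i) - 2) / (d i)^2) \<longlonglongrightarrow> - (c^2)" by (simp only:)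
qed

locale torus_grid = odd_grid L N + torus L for L N
begin

lemma kp_h: "kp k * h = 2 * pi * real k / N"
 using odd_grid.L_pos[OF odd_grid_axioms] by (simp add: kp_def dx_def)

lemma om_1: "om N k 1 = cis (kp k * h)" "om N k (-1) = cis (- (kp k * h))"
 by (simp_all add: om_def kp_h)

text \<open>The sign comes from the grid starting at \<open>- L\<close>, where \<open>ex k\<close>
  equals \<open>(-1) ^ k\<close>.\<close>

lemma ex_gridpt: "ex k (gridpt L N j) = (-1) ^ k * om N k j"
proof -
 have L0: "L \<noteq> 0" using odd_grid.L_pos[OF odd_grid_axioms] by simp
 have e: "real k * (pi / L * gridpt L N j) = - (real k * pi) + 2 * pi * real k * real_of_int j / real N"
  using L0 N_pos by (simp add: gridpt_def dx_def field_simps)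
 have "cis (real k * pi) = (-1) ^ k" using Complex.DeMoivre[of pi k] by simp
 then have "cis (- (real k * pi)) = (-1) ^ k" using cis_cnj[of "real k * pi"] by simp
 then show ?thesis unfolding ex_def e om_def cis_mult[symmetric] by simp
qed

text \<open>\<open>dft\<close> with the sign of the left end point removed; it is a Riemann sum of
  \<open>fc\<close>.\<close>

definition dc :: "(int => real) => nat => complex" where
 "dc p k = (-1) ^ k * dft N p k"

lemma dc_eq: "dc p k = (\<Sum>j<N. of_real (p (int j)) * cnj (ex k (gridpt L N (int j)))) / of_nat N"
 by (simp add: dc_def dft_def ex_gridpt sum_distrib_left mult_ac)

lemma dc_bound:
 assumes "!!j. j < N ==> \<bar>p (int j)\<bar> <= B"
 shows "cmod (dc p k) <= B"
proof -
 have "cmod (\<Sum>j<N. of_real (p (int j)) * cnj (ex k (gridpt L N (int j)))) <= (\<Sum>j<N. B)"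
  by (rule order_trans[OF norm_sum sum_mono]) (use assms in \<open>simp add: norm_mult\<close>)
 then show ?thesis unfolding dc_eq using N_pos by (simp add: norm_divide field_simps)
qed

lemma dc_linear: "dc (%j. a * p j + b * q j) k = of_real a * dc p k + of_real b * dc q k"
 by (simp add: dc_def dft_linear algebra_simps)

lemma dc_diff: "dc (%j. p j - q j) k = dc p k - dc q k"
 using dc_linear[of 1 p "-1" q k] by simp

lemma dc_shift: "grid_fun N p ==> dc (%j. p (j + a)) k = om N k a * dc p k"
 by (simp add: dc_def dft_shift)

text \<open>Two errors add up: the nodal error \<open>e\<close>, and the Riemann sum error of the
  integrand, which is Lipschitz with constant \<open>K + B * kp k\<close>.\<close>

lemma dc_near:
 assumes F: "!!x y. \<bar>F x - F y\<bar> <= K * \<bar>x - y\<bar>" "!!x. \<bar>F x\<bar> <= B"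
  and p: "!!j. \<bar>p j - F (gridpt L N j)\<bar> <= e"
 shows "cmod (dc p k - fc F k) <= e + (K + B * kp k) * h"
proof -
 have kp0: "0 <= kp k" using odd_grid.L_pos[OF odd_grid_axioms] by (simp add: kp_def)
 have K0: "0 <= K" using F(1)[of 1 0] by simp
 have B0: "0 <= B" using F(2)[of 0] by simp
 define E where "E x = of_real (F x) * cnj (ex k x)" for x
 have lip: "cmod (E x - E y) <= (K + B * kp k) * \<bar>x - y\<bar>" for x y
 proof -
  have "cmod (ex k x - ex k y) <= kp k * \<bar>x - y\<bar>"
   using cmod_cis_diff_le[of "kp k * x" "kp k * y"] kp0
   by (simp add: ex_eq right_diff_distrib[symmetric] abs_mult)
  then have 1: "cmod (of_real (F y) * cnj (ex k x - ex k y)) <= B * (kp k * \<bar>x - y\<bar>)"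
   unfolding norm_mult complex_mod_cnj using F(2)[of y] B0 by (intro mult_mono) auto
  have 2: "cmod (of_real (F x - F y) * cnj (ex k x)) <= K * \<bar>x - y\<bar>"
   unfolding norm_mult complex_mod_cnj norm_of_real using F(1)[of x y] by simp
  have "E x - E y = of_real (F x - F y) * cnj (ex k x) + of_real (F y) * cnj (ex k x - ex k y)"
   by (simp add: E_def algebra_simps)
  then have "cmod (E x - E y) <= cmod (of_real (F x - F y) * cnj (ex k x)) + cmod (of_real (F y) * cnj (ex k x - ex k y))"
   by (simp only: norm_triangle_ineq)
  then show ?thesis using 1 2 by (simp add: algebra_simps)
 qed
 have cE: "continuous_on S E" for S
 proof -
  have "(K + B * kp k)-lipschitz_on S E" using lip K0 B0 kp0 by (intro lipschitz_onI) (auto simp: dist_norm)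
  then show ?thesis by (rule lipschitz_on_continuous_on)
 qed
 have NL: "- L + real N * h = L" using h_N by (simp add: mult.commute)
 have gp: "gridpt L N (int j) = - L + real j * h" for j by (simp add: gridpt_def)
 have R: "cmod (of_real h * (\<Sum>j<N. E (- L + real j * h)) - integral {- L..- L + real N * h} E) <= ((K + B * kp k) * h) * (real N * h)"
 proof (rule riemann_sum_error[OF cE h_pos])
  fix j x assume "- L + real j * h <= x" "x <= - L + real (Suc j) * h"
  then have "\<bar>x - (- L + real j * h)\<bar> <= h" by (simp add: algebra_simps)
  then have "(K + B * kp k) * \<bar>x - (- L + real j * h)\<bar> <= (K + B * kp k) * h" using K0 B0 kp0 by (intro mult_left_mono) auto
  then show "cmod (E x - E (- L + real j * h)) <= (K + B * kp k) * h" using lip[of x "- L + real j * h"] by linarith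
 qed
 have fc: "fc F k = integral {- L..L} E / of_real (2 * L)"
 proof -
  have "integrable M E" by (intro continuous_imp_integrable_real cE)
  then have "(E has_integral (LINT x|M. E x)) {- L..L}"
   using has_integral_set_lebesgue[of "{-L..L}" E] unfolding set_integrable_iff LINT_M by blast
  then show ?thesis by (simp add: fc_def E_def[abs_def] integral_unique)
 qed
 have L2: "real N * h = 2 * L" using h_N by (simp add: mult.commute)
 have L0: "2 * L > 0" using odd_grid.L_pos[OF odd_grid_axioms] by simp
 have "dc p k - fc F k = dc (%j. p j - F (gridpt L N j)) k + (dc (%j. F (gridpt L N j)) k - fc F k)"
  by (simp add: dc_diff)
 also have "cmod ... <= e + (K + B * kp k) * h"
 proof (rule norm_triangle_le[OF add_mono])
  show "cmod (dc (%j. p j - F (gridpt L N j)) k) <= e" by (rule dc_bound) (rule p)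
  have "dc (%j. F (gridpt L N j)) k = (\<Sum>j<N. E (- L + real j * h)) / of_nat N"
   by (simp add: dc_eq E_def gp)
  also have "... = (of_real h * (\<Sum>j<N. E (- L + real j * h))) / of_real (2 * L)"
   unfolding L2[symmetric] using h_pos N_pos by simp
  finally have "dc (%j. F (gridpt L N j)) k - fc F k =
   (of_real h * (\<Sum>j<N. E (- L + real j * h)) - integral {- L..- L + real N * h} E) / of_real (2 * L)"
   unfolding fc NL by (simp only: diff_divide_distrib)
  then have "cmod (dc (%j. F (gridpt L N j)) k - fc F k) =
   cmod (of_real h * (\<Sum>j<N. E (- L + real j * h)) - integral {- L..- L + real N * h} E) / (2 * L)"
   using L0 by (simp only: norm_divide norm_of_real abs_of_pos)
  also have "... <= ((K + B * kp k) * h) * (2 * L) / (2 * L)"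
   using R L0 unfolding L2 by (intro divide_right_mono) auto
  finally show "cmod (dc (%j. F (gridpt L N j)) k - fc F k) <= (K + B * kp k) * h" using L0 by simp
 qed
 finally show ?thesis .
qed

text \<open>For \<open>1 <= k <= m\<close> the discrete transform multiplies by
  \<open>- \<i>\<close>; at \<open>k = 0\<close> both sides vanish because
  \<open>dsym 0 = 0\<close>.\<close>

lemma dc_H_Q:
 assumes p: "grid_fun N p" and k: "k <= m"
 shows "dc (H (Q p)) k = - \<i> * of_real (dsym k) * dc p k"
proof (cases "k = 0")
 case True
 then show ?thesis by (simp add: dc_def dft_H_0 dsym_def)
next
 case False
 then have "1 <= k" by simp
 from dft_H[OF this k] show ?thesis by (simp add: dc_def dft_Q[OF p])
qed

text \<open>\<open>6 * h * G v j\<close> is a two-step difference of the squares plus a backward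
  difference of \<open>v j * v (j + 1)\<close>. In this conservation form the coefficients of
  \<open>G v\<close> need only those of the two products, which converge when \<open>v\<close>
  does.\<close>

lemma dc_G:
 assumes v: "grid_fun N v"
 shows "dc (G v) k = (om N k 1 - om N k (-1)) / of_real (6 * h) * dc (%j. (v j)^2) k
  + (1 - om N k (-1)) / of_real (6 * h) * dc (%j. v j * v (j + 1)) k"
proof -
 define s w where "s j = (v j)^2" and "w j = v j * v (j + 1)" for j
 have g: "grid_fun N s" "grid_fun N w"
  using v unfolding grid_fun_def s_def w_def by (simp_all, metis add.assoc add.commute)
 let ?r = "1 / (6 * h)"
 have "G v j = 1 * (?r * s (j + 1) + (- ?r) * s (j + -1)) + 1 * (?r * w j + (- ?r) * w (j + -1))" for j
  using h_pos unfolding G_eq by (simp add: s_def w_def power2_eq_square field_simps)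
 then have "dc (G v) k = dc (%j. 1 * (?r * s (j + 1) + (- ?r) * s (j + -1)) + 1 * (?r * w j + (- ?r) * w (j + -1))) k"
  by presburger
 also have "... = of_real ?r * (om N k 1 * dc s k) + of_real (- ?r) * (om N k (-1) * dc s k) +
   (of_real ?r * dc w k + of_real (- ?r) * (om N k (-1) * dc w k))"
  unfolding dc_linear dc_shift[OF g(1)] dc_shift[OF g(2)] by simp
 also have "... = (om N k 1 - om N k (-1)) / of_real (6 * h) * dc s k + (1 - om N k (-1)) / of_real (6 * h) * dc w k"
  using h_pos by (simp add: field_simps)
 finally show ?thesis by (simp only: s_def[abs_def] w_def[abs_def])
qed

lemma scheme_dc:
 assumes v: "grid_fun N v" and s: "scheme_step L N dt v v'" and k: "k <= m"
 defines "w \<equiv> %i. (v i + v' i) / 2"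
 shows "dc v' k - dc v k = of_real dt * (dc (G w) k - \<i> * of_real (dsym k) * dc w k)"
proof -
 have v': "grid_fun N v'" using s unfolding scheme_step_def by blast
 have eq: "v' j - v j = dt * G w j + dt * H (Q w) j" for j
 proof -
  have "v' j = v j + dt * G w j + dt * H (Q w) j" using s unfolding scheme_step_def w_def by blast
  then show ?thesis by linarith
 qed
 have w: "grid_fun N w" using v v' unfolding grid_fun_def w_def by simp
 have "dc v' k - dc v k = dc (%j. dt * G w j + dt * H (Q w) j) k"
  unfolding dc_diff[symmetric] eq ..
 then show ?thesis unfolding dc_linear dc_H_Q[OF w k] by (simp add: algebra_simps)
qed

lemma bessel_dc:
 assumes p: "grid_fun N p" and K: "K <= m"
 shows "(\<Sum>k=1..K. (dsym k * cmod (dc p k))^2) <= (nrm (Q p))^2 / (4 * L)"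
proof -
 have e: "(cmod (dft N (Q p) k))^2 = (dsym k * cmod (dc p k))^2" for k
  by (simp add: dft_Q[OF p] dc_def norm_mult norm_power power_mult_distrib)
 have "2 * N * (\<Sum>k=1..K. (cmod (dft N (Q p) k))^2) <= 2 * N * (\<Sum>k=1..m. (cmod (dft N (Q p) k))^2)"
  using K by (intro mult_left_mono sum_mono2) auto
 also have "... <= gsum N (%j. (Q p j)^2)" by (rule bessel_grid)
 finally have "h * (2 * N * (\<Sum>k=1..K. (cmod (dft N (Q p) k))^2)) <= (nrm (Q p))^2"
  unfolding nrm_sq using h_pos by (intro mult_left_mono) auto
 moreover have "h * (real (2 * N) * S) = S * (4 * L)" for S :: real using h_N by (simp add: algebra_simps)
 ultimately have "(\<Sum>k=1..K. (dsym k * cmod (dc p k))^2) * (4 * L) <= (nrm (Q p))^2" by (simp only: e)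
 then show ?thesis using odd_grid.L_pos[OF odd_grid_axioms] by (simp add: pos_le_divide_eq)
qed

end

section \<open>Interpolants: bounds and moduli of continuity\<close>

text \<open>Points in different cells are joined through the node to the right of the smaller and
  the node to the left of the larger one. None of the three pieces is longer than the whole, hence
  the factor 3. It serves interpolation both in space and in time.\<close>

lemma modulus_from_cells:
 fixes f w :: "real => real"
 assumes h: "0 < h" and mono: "!!r s. 0 <= r ==> r <= s ==> w r <= w s"
  and cell: "!!j x y. x \<in> {l..u} ==> y \<in> {l..u} ==> a + real_of_int j * h <= x ==> x <= a + real_of_int (j + 1) * h ==>
   a + real_of_int j * h <= y ==> y <= a + real_of_int (j + 1) * h ==> \<bar>f x - f y\<bar> <= w \<bar>x - y\<bar>"
  and node: "!!i j. a + real_of_int i * h \<in> {l..u} ==> a + real_of_int j * h \<in> {l..u} ==>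
   \<bar>f (a + real_of_int i * h) - f (a + real_of_int j * h)\<bar> <= w \<bar>(a + real_of_int i * h) - (a + real_of_int j * h)\<bar>"
  and xy: "x \<in> {l..u}" "y \<in> {l..u}"
 shows "\<bar>f x - f y\<bar> <= 3 * w \<bar>x - y\<bar>"
proof -
 have main: "\<bar>f x - f y\<bar> <= 3 * w \<bar>x - y\<bar>" if xy: "x \<in> {l..u}" "y \<in> {l..u}" "x <= y" for x y
 proof -
  define jx jy where "jx = \<lfloor>(x - a) / h\<rfloor>" and "jy = \<lfloor>(y - a) / h\<rfloor>"
  have fl: "a + real_of_int \<lfloor>(z - a) / h\<rfloor> * h <= z" "z <= a + real_of_int (\<lfloor>(z - a) / h\<rfloor> + 1) * h" for z
  proof -
   have "real_of_int \<lfloor>(z - a) / h\<rfloor> * h <= (z - a) / h * h" using h by (intro mult_right_mono) auto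
   then show "a + real_of_int \<lfloor>(z - a) / h\<rfloor> * h <= z" using h by simp
   have "(z - a) / h * h <= real_of_int (\<lfloor>(z - a) / h\<rfloor> + 1) * h" using h by (intro mult_right_mono) linarith+
   then show "z <= a + real_of_int (\<lfloor>(z - a) / h\<rfloor> + 1) * h" using h by simp
  qed
  note x = fl[of x, folded jx_def] and y = fl[of y, folded jy_def]
  show ?thesis
  proof (cases "jx = jy")
   case True
   have "\<bar>f x - f y\<bar> <= w \<bar>x - y\<bar>" by (rule cell[of x y jx]) (use xy x y True in auto)
   then show ?thesis by linarith
  next
   case False
   have "jx <= jy" unfolding jx_def jy_def using xy h by (intro floor_mono divide_right_mono) auto
   then have j: "jx + 1 <= jy" using False by simp
   define p q where "p = a + real_of_int (jx + 1) * h" and "q = a + real_of_int jy * h"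
   have "real_of_int (jx + 1) * h <= real_of_int jy * h" using j h by (intro mult_right_mono) auto
   then have pq: "x <= p" "p <= q" "q <= y" using x y by (auto simp: p_def q_def)
   have pql: "p \<in> {l..u}" "q \<in> {l..u}" using pq xy by auto
   have "\<bar>f x - f p\<bar> <= w \<bar>x - p\<bar>" by (rule cell[of x p jx]) (use xy pql x h in \<open>auto simp: p_def algebra_simps\<close>)
   also have "... <= w \<bar>x - y\<bar>" by (rule mono) (use pq in auto)
   finally have 1: "\<bar>f x - f p\<bar> <= w \<bar>x - y\<bar>" .
   have "\<bar>f p - f q\<bar> <= w \<bar>p - q\<bar>" using node[of "jx + 1" jy] pql unfolding p_def q_def by blast
   also have "... <= w \<bar>x - y\<bar>" by (rule mono) (use pq in auto)
   finally have 2: "\<bar>f p - f q\<bar> <= w \<bar>x - y\<bar>" .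
   have "\<bar>f q - f y\<bar> <= w \<bar>q - y\<bar>" by (rule cell[of q y jy]) (use xy pql y h in \<open>auto simp: q_def algebra_simps\<close>)
   also have "... <= w \<bar>x - y\<bar>" by (rule mono) (use pq in auto)
   finally have 3: "\<bar>f q - f y\<bar> <= w \<bar>x - y\<bar>" .
   show ?thesis using 1 2 3 by linarith
  qed
 qed
 show ?thesis
 proof (cases "x <= y")
  case False
  then show ?thesis using main[of y x] xy by (simp add: abs_minus_commute)
 qed (use main xy in blast)
qed

context odd_grid begin

abbreviation "P \<equiv> interp_space L N"

lemma gridpt_Suc: "gridpt L N (j + 1) = gridpt L N j + h"
 by (simp add: gridpt_def algebra_simps)

lemma gridpt_period: "gridpt L N (j + int N) = gridpt L N j + 2 * L"
 using h_N by (simp add: gridpt_def algebra_simps)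

text \<open>The definition covers half-open cells. At the right node the quadratic of cell
  \<open>j\<close> takes the value \<open>p (j + 1)\<close>, so the formula extends to the closed
  cell and the interpolant is continuous.\<close>

lemma interp_space_cell:
 assumes "gridpt L N j <= x" "x <= gridpt L N (j + 1)"
 shows "P p x = p j + (x - gridpt L N j) * Dcent L N p j + (x - gridpt L N j)^2 / 2 * Q p j"
proof -
 have cell: "P p z = p i + (z - gridpt L N i) * Dcent L N p i + (z - gridpt L N i)^2 / 2 * Q p i"
  if "gridpt L N i <= z" "z < gridpt L N (i + 1)" for i z
 proof -
  have "\<lfloor>(z + L) / h\<rfloor> = i"
   using that h_pos by (intro floor_unique) (auto simp: gridpt_def field_simps)
  then show ?thesis by (simp add: interp_space_def Let_def)
 qed
 show ?thesis
 proof (cases "x < gridpt L N (j + 1)")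
  case True
  then show ?thesis by (rule cell[OF assms(1)])
 next
  case False
  then have x: "x = gridpt L N (j + 1)" using assms by simp
  have c: "gridpt L N (j + 1) <= x" "x < gridpt L N (j + 1 + 1)"
   using h_pos unfolding gridpt_Suc[of "j + 1"] x by simp_all
  have "P p x = p (j + 1)" using cell[OF c] by (simp add: x)
  moreover have "x - gridpt L N j = h" by (simp add: x gridpt_Suc)
  ultimately show ?thesis using h_pos unfolding Dcent_eq Q_eq by (simp add: field_simps power2_eq_square)
 qed
qed

lemma interp_space_node: "P p (gridpt L N j) = p j"
 using interp_space_cell[of j "gridpt L N j" p] h_pos by (simp add: gridpt_Suc)

lemma cell_exists:
 obtains j where "gridpt L N j <= x" "x <= gridpt L N (j + 1)"
proof -
 define j where "j = \<lfloor>(x + L) / h\<rfloor>"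
 have j: "real_of_int j <= (x + L) / h" "(x + L) / h <= real_of_int j + 1" by (simp_all add: j_def)
 show thesis
  by (rule that[of j]) (use j h_pos in \<open>auto simp: gridpt_def field_simps\<close>)
qed

lemma interp_space_diff: "P (%j. p j - q j) x = P p x - P q x"
proof -
 obtain j where j: "gridpt L N j <= x" "x <= gridpt L N (j + 1)" by (rule cell_exists)
 have "Dcent L N (%j. p j - q j) j = Dcent L N p j - Dcent L N q j" by (simp add: Dcent_eq diff_divide_distrib)
 moreover have "Q (%j. p j - q j) j = Q p j - Q q j"
  unfolding Q_eq diff_divide_distrib[symmetric] by (simp add: algebra_simps)
 ultimately show ?thesis unfolding interp_space_cell[OF j] by (simp only:) (simp add: algebra_simps)
qed

text \<open>On a cell the constant, linear and quadratic terms are at most \<open>B\<close>,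
  \<open>B\<close> and \<open>2 * B\<close>; the powers of \<open>h\<close> cancel those lost in the
  difference quotients.\<close>

lemma interp_space_bound:
 assumes B: "!!i. \<bar>p i\<bar> <= B"
 shows "\<bar>P p x\<bar> <= 4 * B"
proof -
 obtain j where j: "gridpt L N j <= x" "x <= gridpt L N (j + 1)" by (rule cell_exists)
 define y where "y = x - gridpt L N j"
 have y: "0 <= y" "y <= h" using j by (auto simp: y_def gridpt_Suc)
 have B0: "0 <= B" using B[of 0] by linarith
 have "\<bar>y * Dcent L N p j\<bar> <= h * (B / h)"
  unfolding abs_mult using y Dplus_le_sup[of p B j, OF B] h_pos B0 by (intro mult_mono) auto
 then have 1: "\<bar>y * Dcent L N p j\<bar> <= B" using h_pos by simp
 have "\<bar>p (j + 1) - 2 * p j + p (j - 1)\<bar> <= 4 * B" using B[of "j + 1"] B[of j] B[of "j - 1"] by linarith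
 then have "\<bar>Q p j\<bar> <= 4 * B / h^2" unfolding Q_eq abs_divide using h_pos by (simp add: divide_right_mono)
 moreover have "\<bar>y^2 / 2\<bar> <= h^2 / 2" using y by (simp add: power_mono)
 ultimately have "\<bar>y^2 / 2 * Q p j\<bar> <= (h^2 / 2) * (4 * B / h^2)" unfolding abs_mult by (intro mult_mono) auto
 then have 2: "\<bar>y^2 / 2 * Q p j\<bar> <= 2 * B" using h_pos by simp
 show ?thesis unfolding interp_space_cell[OF j, of p] y_def[symmetric] using 1 2 B[of j] by linarith
qed

lemma Q_Dplus: "h * Q p j = Dplus L N p j - Dplus L N p (j - 1)"
 unfolding Q_eq using h_pos by (simp add: Dplus_def field_simps power2_eq_square)

text \<open>Within a cell the difference factors through a slope plus a multiple of
  \<open>Q p j\<close>, at most \<open>M + 2 * M\<close> because \<open>h * Q p j\<close> is a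
  difference of two slopes. The passage across cells triples this.\<close>

lemma interp_space_lipschitz:
 assumes M: "!!i. \<bar>Dplus L N p i\<bar> <= M"
 shows "\<bar>P p x - P p y\<bar> <= 9 * M * \<bar>x - y\<bar>"
proof -
 have M0: "0 <= M" using M[of 0] by linarith
 have gp: "- L + real_of_int j * h = gridpt L N j" for j by (simp add: gridpt_def)
 have "\<bar>P p x - P p y\<bar> <= 3 * ((3 * M) * \<bar>x - y\<bar>)"
 proof (rule modulus_from_cells[of h "%r. (3 * M) * r" "min x y" "max x y" "- L"])
  show "(3 * M) * r <= (3 * M) * s" if "r <= s" for r s using that M0 by (intro mult_left_mono) auto
 next
  fix j x y
  assume x: "- L + real_of_int j * h <= x" "x <= - L + real_of_int (j + 1) * h" and y: "- L + real_of_int j * h <= y" "y <= - L + real_of_int (j + 1) * h"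
  define a b where "a = x - gridpt L N j" and "b = y - gridpt L N j"
  have ab: "0 <= a" "a <= h" "0 <= b" "b <= h" using x y unfolding gp gridpt_Suc a_def b_def by auto
  have "P p x - P p y = (x - y) * (Dcent L N p j + (a + b) / 2 * Q p j)"
   using interp_space_cell[OF x[unfolded gp], of p] interp_space_cell[OF y[unfolded gp], of p]
   by (simp add: a_def b_def power2_eq_square field_simps)
  moreover have "\<bar>Dcent L N p j + (a + b) / 2 * Q p j\<bar> <= 3 * M"
  proof -
   have "\<bar>h * Q p j\<bar> <= 2 * M" unfolding Q_Dplus using M[of j] M[of "j - 1"] by linarith
   moreover have "\<bar>(a + b) / 2 * Q p j\<bar> <= \<bar>h * Q p j\<bar>" unfolding abs_mult using ab by (intro mult_right_mono) auto
   ultimately show ?thesis using Dcent_le[of p M j, OF M] by linarith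
  qed
  ultimately show "\<bar>P p x - P p y\<bar> <= (3 * M) * \<bar>x - y\<bar>"
   by (simp add: abs_mult mult.commute mult_left_mono)
 next
  have le: "\<bar>p (j + int n) - p j\<bar> <= M * (real n * h)" for j n
  proof (induction n)
   case (Suc n)
   have "j + int (Suc n) = j + int n + 1" by simp
   then have "p (j + int (Suc n)) - p (j + int n) = h * Dplus L N p (j + int n)"
    using h_pos by (simp only: Dplus_def) simp
   then have "\<bar>p (j + int (Suc n)) - p (j + int n)\<bar> <= h * M" using M h_pos by (simp add: abs_mult)
   then have "\<bar>p (j + int (Suc n)) - p j\<bar> <= h * M + M * (real n * h)" using Suc by linarith
   then show ?case by (simp add: algebra_simps)
  qed simp
  fix i j :: int
  have "\<bar>p i - p j\<bar> <= (3 * M) * \<bar>real_of_int i * h - real_of_int j * h\<bar>"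
  proof -
   have "\<bar>p i - p j\<bar> <= M * (real (nat \<bar>i - j\<bar>) * h)"
    using le[of j "nat (i - j)"] le[of i "nat (j - i)"] by (cases "i <= j") (auto simp: abs_minus_commute)
   also have "... = M * \<bar>real_of_int i * h - real_of_int j * h\<bar>"
    using h_pos by (simp add: left_diff_distrib[symmetric] abs_mult)
   also have "... <= (3 * M) * \<bar>real_of_int i * h - real_of_int j * h\<bar>" using M0 by (intro mult_right_mono) auto
   finally show ?thesis .
  qed
  then show "\<bar>P p (- L + real_of_int i * h) - P p (- L + real_of_int j * h)\<bar>
   <= (3 * M) * \<bar>(- L + real_of_int i * h) - (- L + real_of_int j * h)\<bar>"
   unfolding gp interp_space_node by (simp add: gridpt_def)
 qed (use h_pos in auto)
 then show ?thesis by simp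
qed

lemma interp_space_periodic:
 assumes "grid_fun N p"
 shows "P p (x + 2 * L) = P p x"
proof -
 obtain j where j: "gridpt L N j <= x" "x <= gridpt L N (j + 1)" by (rule cell_exists)
 note g = gridpt_period
 have e: "j + int N + 1 = j + 1 + int N" by simp
 have per: "p (i + int N) = p i" "p (i + int N + 1) = p (i + 1)" "p (i + int N - 1) = p (i - 1)" for i
  using assms unfolding grid_fun_def by (metis add.assoc add.commute, metis add.assoc add.commute, metis add_diff_eq add.commute diff_add_eq)
 have "P p (x + 2 * L) = p (j + int N) + (x + 2 * L - gridpt L N (j + int N)) * Dcent L N p (j + int N)
  + (x + 2 * L - gridpt L N (j + int N))^2 / 2 * Q p (j + int N)"
  by (rule interp_space_cell) (use j in \<open>simp_all add: g e\<close>)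
 then show ?thesis unfolding interp_space_cell[OF j, of p] Q_eq Dcent_eq g per by simp
qed

lemma nrm_le_sup:
 assumes "!!j. \<bar>p j\<bar> <= B"
 shows "nrm p <= sqrt (2 * L) * B"
proof (rule nrm_leI)
 have B0: "0 <= B" using assms[of 0] by linarith
 have "gsum N (%j. (p j)^2) <= gsum N (%j. B^2)"
  by (rule gsum_mono) (use assms B0 in \<open>auto simp: abs_le_square_iff[symmetric]\<close>)
 then have "h * gsum N (%j. (p j)^2) <= h * gsum N (%j. B^2)" using h_pos by (intro mult_left_mono) auto
 also have "... = (sqrt (2 * L) * B)^2" using h_N L_pos by (simp add: gsum_def power_mult_distrib)
 finally show "h * gsum N (%j. (p j)^2) <= (sqrt (2 * L) * B)^2" .
qed (use assms[of 0] L_pos in auto)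

text \<open>The increment is of order \<open>dt\<close> in the L2 norm: the Hilbert term is
  controlled by \<open>nrm (Q w)\<close> and has no pointwise bound uniform in the grid at this
  stage.\<close>

lemma time_increment_bound:
 assumes v: "grid_fun N v" "grid_fun N v'" and s: "scheme_step L N dt v v'" and dt: "0 < dt"
  and B: "!!i. \<bar>v i\<bar> <= B" "!!i. \<bar>v' i\<bar> <= B" and M: "!!i. \<bar>Dplus L N v i\<bar> <= M" "!!i. \<bar>Dplus L N v' i\<bar> <= M"
  and R: "nrm (Q v) <= R" "nrm (Q v') <= R"
 shows "nrm (%j. v' j - v j) <= dt * (sqrt (2 * L) * (B * M) + R)"
proof -
 define w where "w i = (v i + v' i) / 2" for i
 have w: "grid_fun N w" using v unfolding grid_fun_def w_def by simp
 have eq: "v' j - v j = dt * (G w j + H (Q w) j)" for j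
 proof -
  have "v' j = v j + dt * G w j + dt * H (Q w) j" using s unfolding scheme_step_def w_def[abs_def] by blast
  then show ?thesis by (simp add: distrib_left)
 qed
 have B0: "0 <= B" using B(1)[of 0] by linarith
 have wB: "\<bar>w i\<bar> <= B" for i using abs_mean_le[OF B(1)[of i] B(2)[of i]] by (simp add: w_def)
 have wD: "Dplus L N w i = (Dplus L N v i + Dplus L N v' i) / 2" for i
  using h_pos by (simp add: w_def Dplus_def field_simps)
 have wM: "\<bar>Dplus L N w i\<bar> <= M" for i unfolding wD by (rule abs_mean_le[OF M(1) M(2)])
 have "\<bar>G w j\<bar> <= B * M" for j
  unfolding Gop_def abs_mult using avg3_le[of w B j, OF wB] Dcent_le[of w M j, OF wM] B0 by (intro mult_mono) auto
 then have 1: "nrm (G w) <= sqrt (2 * L) * (B * M)" by (rule nrm_le_sup)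
 have "nrm (Q w) <= R"
 proof -
  have "Q w = (%i. (Q v i + Q v' i) / 2)" unfolding w_def[abs_def] by (rule Q_mean)
  then show ?thesis using nrm_mean_le[of "Q v" "Q v'"] R by simp
 qed
 then have 2: "nrm (H (Q w)) <= R" using nrm_H_le[of "Q w"] by linarith
 have "nrm (%j. v' j - v j) = dt * nrm (%j. G w j + H (Q w) j)" unfolding eq nrm_cmult using dt by simp
 also have "... <= dt * (nrm (G w) + nrm (H (Q w)))" using nrm_triangle[of "G w" "H (Q w)"] dt by (intro mult_left_mono) auto
 also have "... <= dt * (sqrt (2 * L) * (B * M) + R)" using 1 2 dt by (intro mult_left_mono add_mono) auto
 finally show ?thesis .
qed

lemma interp_cell:
 assumes dt: "0 < dt" and t: "real n * dt <= t" "t <= real (Suc n) * dt"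
 shows "interp L N dt U t x = P (U n) x + (t - real n * dt) / dt * (P (U (Suc n)) x - P (U n) x)"
proof -
 have cell: "interp L N dt U t x = P (U n) x + (t - real n * dt) / dt * (P (U (Suc n)) x - P (U n) x)"
  if "real n * dt <= t" "t < real (Suc n) * dt" for n
 proof -
  have "real n <= t / dt" "t / dt < real n + 1" using that dt by (simp_all add: field_simps)
  then have "\<lfloor>t / dt\<rfloor> = int n" by (intro floor_unique) simp_all
  then show ?thesis by (simp add: interp_def Let_def)
 qed
 show ?thesis
 proof (cases "t < real (Suc n) * dt")
  case True
  then show ?thesis by (rule cell[OF t(1)])
 next
  case False
  then have te: "t = real (Suc n) * dt" using t by simp
  have "interp L N dt U t x = P (U (Suc n)) x" using cell[of "Suc n"] dt by (simp add: te)
  moreover have "(t - real n * dt) / dt = 1" using dt by (simp add: te field_simps)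
  ultimately show ?thesis by simp
 qed
qed

lemma interp_node:
 assumes "0 < dt"
 shows "interp L N dt U (real n * dt) x = P (U n) x"
 using interp_cell[of dt n "real n * dt" U x] assms by simp

text \<open>Adding up increments gives Lipschitz continuity in time in the grid L2 norm. The slopes
  of a difference of levels stay bounded, and \<open>sup_sq_le\<close> converts this into a square
  root modulus in the sup norm.\<close>

lemma grid_time_modulus:
 assumes dt: "0 < dt" and g: "!!n. n <= nm ==> grid_fun N (U n)"
  and B: "!!n i. n <= nm ==> \<bar>U n i\<bar> <= B" and M: "!!n i. n <= nm ==> \<bar>Dplus L N (U n) i\<bar> <= M"
  and R: "!!n. n <= nm ==> nrm (Q (U n)) <= R"
  and s: "!!n. n < nm ==> scheme_step L N dt (U n) (U (Suc n))"
  and Tb: "real nm * dt <= Tb" and nm: "n <= nm" "l <= nm"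
 defines "C \<equiv> sqrt (2 * L) * (B * M) + R"
 shows "\<bar>U n i - U l i\<bar> <= sqrt ((C^2 * Tb / (2 * L) + 4 * C * (sqrt (2 * L) * M)) * \<bar>real n * dt - real l * dt\<bar>)"
proof -
 have M0: "0 <= M" using M[of 0 0] by simp
 have B0: "0 <= B" using B[of 0 0] by simp
 have R0: "0 <= R" using order_trans[OF nrm_nonneg R[of 0]] by simp
 have C0: "0 <= C" using M0 B0 R0 L_pos by (simp add: C_def)
 have inc: "nrm (%j. U (l + d) j - U l j) <= real d * dt * C" if "l + d <= nm" for l d
  using that
 proof (induction d)
  case 0
  then show ?case using nrm_cmult[of 0 "%_. 0"] by simp
 next
  case (Suc d)
  have e: "(%j. U (l + Suc d) j - U l j) = (%j. (U (l + Suc d) j - U (l + d) j) + (U (l + d) j - U l j))" by simp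
  have "nrm (%j. U (Suc (l + d)) j - U (l + d) j) <= dt * C"
   unfolding C_def by (rule time_increment_bound[OF g g s dt B B M M R R]) (use Suc.prems in auto)
  then have "nrm (%j. U (l + Suc d) j - U l j) <= dt * C + real d * dt * C"
   unfolding e using nrm_triangle[of "%j. U (l + Suc d) j - U (l + d) j" "%j. U (l + d) j - U l j"] Suc.IH Suc.prems by simp
  then show ?case by (simp add: algebra_simps)
 qed
 have main: "\<bar>U (l + d) i - U l i\<bar> <= sqrt ((C^2 * Tb / (2 * L) + 4 * C * (sqrt (2 * L) * M)) * (real d * dt))" if ld: "l + d <= nm" for l d
 proof -
  define p where "p j = U (l + d) j - U l j" for j
  define \<delta> where "\<delta> = real d * dt"
  have "real d * dt <= real nm * dt" using ld dt by (intro mult_right_mono) auto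
  then have \<delta>: "0 <= \<delta>" "\<delta> <= Tb"
   using Tb dt mult_nonneg_nonneg[of "real d" dt] unfolding \<delta>_def by linarith+
  have p: "grid_fun N p" using g[of "l + d"] g[of l] ld unfolding grid_fun_def p_def by simp
  have np: "nrm p <= \<delta> * C" using inc[OF ld] by (simp add: p_def[abs_def] \<delta>_def)
  have "\<bar>Dplus L N p j\<bar> <= 2 * M" for j
  proof -
   have "Dplus L N p j = Dplus L N (U (l + d)) j - Dplus L N (U l) j" by (simp add: p_def Dplus_def diff_divide_distrib)
   then show ?thesis using M[of "l + d" j] M[of l j] ld by auto
  qed
  then have nD: "nrm (Dplus L N p) <= sqrt (2 * L) * (2 * M)" by (rule nrm_le_sup)
  have "(nrm p)^2 <= (\<delta> * C)^2" using np by (intro power_mono) auto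
  also have "... = C^2 * (\<delta> * \<delta>)" by (simp add: power2_eq_square mult_ac)
  also have "... <= C^2 * (Tb * \<delta>)" using \<delta> by (intro mult_left_mono mult_right_mono) auto
  finally have "(nrm p)^2 / (2 * L) <= C^2 * (Tb * \<delta>) / (2 * L)" using L_pos by (intro divide_right_mono) auto
  moreover have "2 * nrm p * nrm (Dplus L N p) <= 2 * (\<delta> * C) * (sqrt (2 * L) * (2 * M))"
   using np nD M0 C0 \<delta> L_pos by (intro mult_mono) auto
  ultimately have "(p i)^2 <= C^2 * (Tb * \<delta>) / (2 * L) + 2 * (\<delta> * C) * (sqrt (2 * L) * (2 * M))"
   using sup_sq_le[OF p, of i] by linarith
  also have "... = (C^2 * Tb / (2 * L) + 4 * C * (sqrt (2 * L) * M)) * \<delta>" by (simp add: algebra_simps)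
  finally have "sqrt ((p i)^2) <= sqrt ((C^2 * Tb / (2 * L) + 4 * C * (sqrt (2 * L) * M)) * \<delta>)" by (rule real_sqrt_le_mono)
  then show ?thesis by (simp add: p_def \<delta>_def)
 qed
 show ?thesis
 proof (cases "l <= n")
  case True
  have "real n * dt - real l * dt = real (n - l) * dt" using True by (simp add: of_nat_diff algebra_simps)
  then show ?thesis using main[of l "n - l"] True nm dt by simp
 next
  case False
  have "real l * dt - real n * dt = real (l - n) * dt" using False by (simp add: of_nat_diff algebra_simps)
  moreover have "\<bar>U n i - U l i\<bar> = \<bar>U l i - U n i\<bar>" "\<bar>real n * dt - real l * dt\<bar> = \<bar>real l * dt - real n * dt\<bar>" by simp_all
  ultimately show ?thesis using main[of n "l - n"] False nm dt by simp
 qed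
qed

lemma interp_time_modulus:
 assumes dt: "0 < dt" and T: "T < real nm * dt" and C: "0 <= C"
  and m: "!!n l i. n <= nm ==> l <= nm ==> \<bar>U n i - U l i\<bar> <= sqrt (C * \<bar>real n * dt - real l * dt\<bar>)"
  and ts: "t \<in> {0..T}" "s \<in> {0..T}"
 shows "\<bar>interp L N dt U t x - interp L N dt U s x\<bar> <= 12 * sqrt (C * \<bar>t - s\<bar>)"
proof -
 have Pd: "\<bar>P (U n) x - P (U l) x\<bar> <= 4 * sqrt (C * \<bar>real n * dt - real l * dt\<bar>)" if "n <= nm" "l <= nm" for n l
  unfolding interp_space_diff[symmetric] by (rule interp_space_bound) (rule m[OF that])
 have nn: "\<exists>n. j = int n" if "0 <= real_of_int (j + 1) * dt" "j \<noteq> -1" for j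
 proof -
  have "0 <= j + 1" using that(1) dt by (simp add: zero_le_mult_iff del: of_int_add)
  then show ?thesis using that(2) by (intro exI[of _ "nat j"]) auto
 qed
 have "\<bar>interp L N dt U t x - interp L N dt U s x\<bar> <= 3 * (4 * sqrt (C * \<bar>t - s\<bar>))"
 proof (rule modulus_from_cells[of dt "%r. 4 * sqrt (C * r)" 0 T 0, OF dt _ _ _ ts])
  show "4 * sqrt (C * r) <= 4 * sqrt (C * s)" if "r <= s" for r s using that C by (simp add: mult_left_mono)
 next
  fix j :: int and t s :: real
  assume T0: "t \<in> {0..T}" "s \<in> {0..T}" and t: "0 + real_of_int j * dt <= t" "t <= 0 + real_of_int (j + 1) * dt"
   and s: "0 + real_of_int j * dt <= s" "s <= 0 + real_of_int (j + 1) * dt"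
  show "\<bar>interp L N dt U t x - interp L N dt U s x\<bar> <= 4 * sqrt (C * \<bar>t - s\<bar>)"
  \<comment> \<open>The cell of index -1 meets \<open>[0, T]\<close> only at its right end, so both
    times are 0.\<close>
  proof (cases "j = -1")
   case True
   then have "t = 0" "s = 0" using T0 t s by auto
   then show ?thesis by simp
  next
   case False
   then obtain n where n: "j = int n" using nn[of j] t T0 by (metis add_0 atLeastAtMost_iff order_trans)
   have tn: "real n * dt <= t" "t <= real (Suc n) * dt" and sn: "real n * dt <= s" "s <= real (Suc n) * dt"
    using t s by (simp_all add: n algebra_simps)
   have "real n * dt < real nm * dt" using tn T T0 by simp
   then have nnm: "Suc n <= nm" using dt by simp
   have "interp L N dt U t x - interp L N dt U s x = (t - s) / dt * (P (U (Suc n)) x - P (U n) x)"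
    unfolding interp_cell[OF dt tn] interp_cell[OF dt sn] by (simp add: diff_divide_distrib algebra_simps)
   moreover have "\<bar>P (U (Suc n)) x - P (U n) x\<bar> <= 4 * sqrt (C * dt)"
    using Pd[of "Suc n" n] nnm dt by (simp add: algebra_simps)
   ultimately have "\<bar>interp L N dt U t x - interp L N dt U s x\<bar> <= \<bar>t - s\<bar> / dt * (4 * sqrt (C * dt))"
    using dt by (simp add: abs_mult mult_left_mono divide_right_mono)
   \<comment> \<open>Within one time step the ratio is at most 1 and hence below its square root, so
     linear interpolation keeps the Hoelder exponent of the levels.\<close>
   also have "\<bar>t - s\<bar> / dt <= sqrt (\<bar>t - s\<bar> / dt)"
   proof -
    have "\<bar>t - s\<bar> <= dt" using tn sn by (simp add: algebra_simps abs_le_iff)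
    then have "\<bar>t - s\<bar> / dt <= 1" "0 <= \<bar>t - s\<bar> / dt" using dt by simp_all
    then have "(\<bar>t - s\<bar> / dt)^2 <= \<bar>t - s\<bar> / dt" using mult_left_le[of "\<bar>t - s\<bar> / dt" "\<bar>t - s\<bar> / dt"] by (simp add: power2_eq_square)
    then show ?thesis by (rule real_le_rsqrt)
   qed
   then have "\<bar>t - s\<bar> / dt * (4 * sqrt (C * dt)) <= sqrt (\<bar>t - s\<bar> / dt) * (4 * sqrt (C * dt))"
    using C dt by (intro mult_right_mono) auto
   also have "... = 4 * sqrt (C * \<bar>t - s\<bar>)"
   proof -
    have "\<bar>t - s\<bar> / dt * (C * dt) = C * \<bar>t - s\<bar>" using dt by simp
    then show ?thesis using real_sqrt_mult[of "\<bar>t - s\<bar> / dt" "C * dt"] by simp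
   qed
   finally show ?thesis .
  qed
 next
  fix i j :: int
  assume ij: "0 + real_of_int i * dt \<in> {0..T}" "0 + real_of_int j * dt \<in> {0..T}"
  have "\<exists>n\<le>nm. i = int n" if "0 + real_of_int i * dt \<in> {0..T}" for i
  proof -
   have "0 <= i" using that dt by (auto simp: zero_le_mult_iff)
   moreover have "real_of_int i * dt < real nm * dt" using that T by auto
   then have "i < int nm" using dt by simp
   ultimately show ?thesis by (intro exI[of _ "nat i"]) auto
  qed
  then obtain n l where nl: "n <= nm" "i = int n" "l <= nm" "j = int l" using ij by meson
  show "\<bar>interp L N dt U (0 + real_of_int i * dt) x - interp L N dt U (0 + real_of_int j * dt) x\<bar>
   <= 4 * sqrt (C * \<bar>0 + real_of_int i * dt - (0 + real_of_int j * dt)\<bar>)"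
   using Pd[OF nl(1,3)] by (simp add: nl interp_node[OF dt])
 qed
 then show ?thesis by simp
qed

end

section \<open>Data in H2 restricted to the grid\<close>

text \<open>Cauchy-Schwarz, obtained by integrating \<open>(q x - a)^2 >= 0\<close> with
  \<open>a\<close> the mean slope.\<close>

lemma deriv_integral_sq_le:
 fixes p q :: "real => real"
 assumes d: "!!x. (p has_real_derivative q x) (at x)" and c: "continuous_on UNIV q" and rs: "r <= s"
 shows "(p s - p r)^2 <= (s - r) * integral {r..s} (%x. (q x)^2)"
proof (cases "r = s")
 case False
 define a where "a = (p s - p r) / (s - r)"
 define I where "I = integral {r..s} (%x. (q x)^2)"
 have a: "p s - p r = a * (s - r)" using False by (simp add: a_def)
 have cq: "continuous_on {r..s} q" by (rule continuous_on_subset[OF c]) simp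
 have "(q has_integral p s - p r) {r..s}"
  using fundamental_theorem_of_calculus[OF rs, of p q] d
  by (simp add: has_real_derivative_iff_has_vector_derivative has_vector_derivative_at_within)
 moreover have "((%x. (q x)^2) has_integral I) {r..s}"
  unfolding I_def by (intro integrable_integral integrable_continuous_interval continuous_intros cq)
 moreover have "((%x. a^2) has_integral a^2 * (s - r)) {r..s}"
  using has_integral_const_real[of "a^2" r s] rs by (simp add: mult.commute)
 ultimately have "((%x. (q x)^2 - (2 * a) * q x + a^2) has_integral I - (2 * a) * (p s - p r) + a^2 * (s - r)) {r..s}"
  by (intro has_integral_add has_integral_diff has_integral_mult_right)
 moreover have "0 <= (q x)^2 - (2 * a) * q x + a^2" for x
  using zero_le_power2[of "q x - a"] by (simp add: power2_diff algebra_simps)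
 ultimately have "0 <= I - (2 * a) * (p s - p r) + a^2 * (s - r)" by (rule has_integral_nonneg)
 then have "a^2 * (s - r) <= I" unfolding a by (simp add: power2_eq_square algebra_simps)
 then have "(s - r) * (a^2 * (s - r)) <= (s - r) * I" using rs by (intro mult_left_mono) auto
 then show ?thesis unfolding a I_def by (simp add: power2_eq_square mult_ac)
qed simp

context torus begin

text \<open>The norm refers to weak derivatives picked by \<open>SOME\<close>. Any two weak
  derivatives have the same coefficients, so a second derivative of one first derivative is also one
  of the other, and both choices are made from nonempty sets.\<close>

lemma H2_coefficients:
 assumes "u0 \<in> H2_per L"
 obtains g where "u0 \<in> L2_per L" "g \<in> L2_per L" "!!n. fc g n = - (of_real (kp n))\<^sup>2 * fc u0 n"
  "norm_L2 L u0 <= norm_H2 L u0" "norm_L2 L g <= norm_H2 L u0"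
proof -
 obtain a b where ab: "u0 \<in> L2_per L" "a \<in> L2_per L" "b \<in> L2_per L" "weak_deriv L u0 a" "weak_deriv L a b"
  using assms unfolding H2_per_def by blast
 define a' where "a' = wderiv L u0"
 have a': "a' \<in> L2_per L \<and> weak_deriv L u0 a'"
  unfolding a'_def wderiv_def by (rule someI[of _ a]) (use ab in blast)
 have fa: "fc a n = \<i> * of_real (kp n) * fc u0 n" "fc a' n = \<i> * of_real (kp n) * fc u0 n" "fc b n = \<i> * of_real (kp n) * fc a n" for n
  using weak_deriv_imp_fc ab a' by blast+
 define b' where "b' = wderiv L a'"
 have wb: "weak_deriv L a' b" by (rule weak_derivI) (use a' ab fa in auto)
 have b': "b' \<in> L2_per L \<and> weak_deriv L a' b'"
  unfolding b'_def wderiv_def by (rule someI[of _ b]) (use ab wb in blast)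
 have r: "(norm_H2 L u0)^2 = (norm_L2 L u0)^2 + (norm_L2 L a')^2 + (norm_L2 L b')^2" "0 <= norm_H2 L u0"
  by (simp_all add: norm_H2_def a'_def b'_def)
 show ?thesis
 proof (rule that[of b'])
  show "fc b' n = - (of_real (kp n))\<^sup>2 * fc u0 n" for n
   using weak_deriv_imp_fc[of a' b' n] a' b' by (simp add: fa(2) ii_mult)
  show "norm_L2 L u0 <= norm_H2 L u0" "norm_L2 L b' <= norm_H2 L u0"
   by (rule power2_le_imp_le; use r in simp)+
 qed (use ab b' in auto)
qed

lemma H2_representation:
 assumes f: "f \<in> L2_per L" and cont: "continuous_on UNIV f" and g: "g \<in> L2_per L"
  and fg: "!!n. fc g n = - (of_real (kp n))\<^sup>2 * fc f n"
 shows "(%m. fs (fc f) m x) \<longlonglongrightarrow> f x"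
  "\<bar>f x\<bar> <= norm_L2 L f / sqrt (2 * L) + L / pi * (((norm_L2 L g)^2 / (2 * L) + KS) / 2)"
proof -
 obtain F F' where F: "!!x. (F has_real_derivative F' x) (at x)" "continuous_on UNIV F'"
  "!!x. F (x + 2 * L) = F x" "!!x. F' (x + 2 * L) = F' x" "AE x in lebesgue. f x = F x"
  "!!x. \<bar>F' x\<bar> <= ((norm_L2 L g)^2 / (2 * L) + KS) / 2" "!!n. fc F' n = \<i> * of_real (kp n) * fc f n"
  "F = (%x. \<Sum>n. tm (fc f) n x)" "F' = (%x. \<Sum>n. tm (%n. \<i> * of_real (kp n) * fc f n) n x)"
  by (rule C1_representation[OF f g fg]) (rule that)
 have "continuous_on UNIV F" using F(1) by (meson DERIV_isCont continuous_at_imp_continuous_on)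
 then have "f = F" by (rule continuous_AE_eq[OF cont _ F(5)])
 then have fF: "f x = (\<Sum>n. tm (fc f) n x)" using F(8) by metis
 have B: "(\<Sum>n. wt n * (cmod (fc g n))^2) <= (norm_L2 L g)^2 / (2 * L)"
  using sums_unique[OF parseval_norm[OF g]] by simp
 note S = C1_series[of "fc g" "fc f", OF fg summable_fc[OF g] B]
 note cs = continuous_series[OF S(3)]
 show "(%m. fs (fc f) m x) \<longlonglongrightarrow> f x"
  unfolding fF fs_def by (rule summable_LIMSEQ'[OF cs(3)])
 let ?a = "%n. wt n * kp n * cmod (fc f n)"
 have le: "wt (Suc n) * cmod (fc f (Suc n)) <= L / pi * ?a (Suc n)" for n
 proof -
  have "1 * (wt (Suc n) * cmod (fc f (Suc n))) <= real (Suc n) * (wt (Suc n) * cmod (fc f (Suc n)))"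
   by (intro mult_right_mono) (auto simp: wt_pos)
  then show ?thesis using L_pos by (simp add: kp_def field_simps)
 qed
 have s1: "summable (%n. L / pi * ?a (Suc n))" by (intro summable_mult) (subst summable_Suc_iff, rule S(1))
 have s2: "summable (%n. wt (Suc n) * cmod (fc f (Suc n)))" by (subst summable_Suc_iff) (rule S(3))
 have "\<bar>f x\<bar> <= (\<Sum>n. wt n * cmod (fc f n))" unfolding fF by (rule cs(2))
 also have "... = cmod (fc f 0) + (\<Sum>n. wt (Suc n) * cmod (fc f (Suc n)))"
  using suminf_split_head[OF S(3)] by (simp add: wt_def)
 also have "... <= norm_L2 L f / sqrt (2 * L) + L / pi * (((norm_L2 L g)^2 / (2 * L) + KS) / 2)"
 proof (rule add_mono[OF cmod_fc_le[OF f]])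
  have "(\<Sum>n. wt (Suc n) * cmod (fc f (Suc n))) <= (\<Sum>n. L / pi * ?a (Suc n))" by (rule suminf_le[OF le s2 s1])
  also have "... = L / pi * (\<Sum>n. ?a (Suc n))" by (rule suminf_mult) (subst summable_Suc_iff, rule S(1))
  also have "(\<Sum>n. ?a (Suc n)) = (\<Sum>n. ?a n)" using suminf_split_head[OF S(1)] by (simp add: kp_def)
  also have "L / pi * (\<Sum>n. ?a n) <= L / pi * (((norm_L2 L g)^2 / (2 * L) + KS) / 2)"
   using S(2) L_pos by (intro mult_left_mono) auto
  finally show "(\<Sum>n. wt (Suc n) * cmod (fc f (Suc n))) <= L / pi * (((norm_L2 L g)^2 / (2 * L) + KS) / 2)" .
 qed
 finally show "\<bar>f x\<bar> <= norm_L2 L f / sqrt (2 * L) + L / pi * (((norm_L2 L g)^2 / (2 * L) + KS) / 2)" .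
qed

lemma fs_deriv: "(fs c m has_real_derivative fs (%n. \<i> * of_real (kp n) * c n) m x) (at x)"
 unfolding fs_def[abs_def] tm_def by (intro DERIV_sum DERIV_cmult deriv_tm)

lemma integral_shift_period:
 fixes f :: "real => real"
 assumes c: "continuous_on UNIV f" and p: "!!x. f (x + 2 * L) = f x"
 shows "integral {a + 2 * L..b + 2 * L} f = integral {a..b} f"
proof -
 have I: "set_integrable lebesgue {a..b} f" for a b
  using continuous_imp_integrable_real[OF continuous_on_subset[OF c, of "{a..b}"]]
  by (simp add: set_integrable_def integrable_restrict_space)
 have "integral {a + 2 * L..b + 2 * L} f = (LINT x:{a + 2 * L..b + 2 * L}|lebesgue. f x)"
  by (rule set_lebesgue_integral_eq_integral(2)[OF I, symmetric])
 also have "... = (LINT x:{a..b}|lebesgue. f (2 * L + x))" by (rule LINT_shift[symmetric])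
 also have "... = (LINT x:{a..b}|lebesgue. f x)" using p by (simp add: add.commute)
 also have "... = integral {a..b} f" by (rule set_lebesgue_integral_eq_integral(2)[OF I])
 finally show ?thesis .
qed

end

context odd_grid begin

text \<open>By the mean value theorem the second difference quotient is a difference of two values
  of \<open>\<phi>'\<close> over \<open>h\<close>. Each half is bounded by the integral of
  \<open>q^2\<close> over an adjacent cell; the factor 2 from squaring a sum and the double count of
  the cells make 4.\<close>

lemma nrm_Q_C2_le:
 assumes d: "!!x. (\<phi> has_real_derivative \<phi>' x) (at x)" "!!x. (\<phi>' has_real_derivative q x) (at x)"
  and c: "continuous_on UNIV q" and p: "!!x. q (x + 2 * L) = q x"
 shows "(nrm (Q (%j. \<phi> (gridpt L N j))))^2 <= 4 * integral {-L..L} (%x. (q x)^2)"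
proof -
 define V where "V j = integral {gridpt L N j..gridpt L N (j + 1)} (%x. (q x)^2)" for j
 have c2: "continuous_on S (%x. (q x)^2)" for S by (intro continuous_intros continuous_on_subset[OF c]) simp
 have V0: "0 <= V j" for j unfolding V_def by (intro Henstock_Kurzweil_Integration.integral_nonneg integrable_continuous_interval c2) simp
 interpret torus L by unfold_locales (rule L_pos)
 have Vper: "V (j + int N) = V j" for j
 proof -
  have e: "j + int N + 1 = (j + 1) + int N" by simp
  show ?thesis unfolding V_def e gridpt_period by (rule integral_shift_period[OF c2]) (simp add: p)
 qed
 have step: "(\<phi>' s - \<phi>' r)^2 <= h * V j" if "gridpt L N j <= r" "r <= s" "s <= gridpt L N (j + 1)" for r s j
 proof -
  have "(\<phi>' s - \<phi>' r)^2 <= (s - r) * integral {r..s} (%x. (q x)^2)" by (rule deriv_integral_sq_le[OF d(2) c that(2)])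
  also have "... <= h * V j"
  proof (rule mult_mono)
   show "s - r <= h" using that gridpt_Suc[of j] by linarith
   show "integral {r..s} (%x. (q x)^2) <= V j"
    unfolding V_def by (intro integral_subset_le integrable_continuous_interval c2) (use that in auto)
   show "0 <= integral {r..s} (%x. (q x)^2)"
    by (intro Henstock_Kurzweil_Integration.integral_nonneg integrable_continuous_interval c2) simp
  qed (use h_pos in simp)
  finally show ?thesis .
 qed
 have Qb: "(Q (%j. \<phi> (gridpt L N j)) j)^2 <= 2 * (V j + V (j - 1)) / h" for j
 proof -
  define x where "x = gridpt L N j"
  have xm: "gridpt L N (j - 1) = x - h" using gridpt_Suc[of "j - 1"] by (simp add: x_def)
  have xp: "gridpt L N (j + 1) = x + h" by (simp add: gridpt_Suc x_def)
  obtain a where a: "x < a" "a < x + h" "\<phi> (x + h) - \<phi> x = h * \<phi>' a"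
   using MVT2[of x "x + h" \<phi> \<phi>'] h_pos d(1) by (auto simp: mult.commute)
  obtain b where b: "x - h < b" "b < x" "\<phi> x - \<phi> (x - h) = h * \<phi>' b"
   using MVT2[of "x - h" x \<phi> \<phi>'] h_pos d(1) by (auto simp: mult.commute)
  have 1: "(\<phi>' a - \<phi>' x)^2 <= h * V j" by (rule step) (use a xp in \<open>auto simp: x_def\<close>)
  have 2: "(\<phi>' x - \<phi>' b)^2 <= h * V (j - 1)" by (rule step) (use b xm in \<open>auto simp: x_def\<close>)
  have "Q (%j. \<phi> (gridpt L N j)) j = (h * \<phi>' a - h * \<phi>' b) / h^2"
   unfolding Q_eq xm xp a(3)[symmetric] b(3)[symmetric] x_def[symmetric] by simp
  also have "... = ((\<phi>' a - \<phi>' x) + (\<phi>' x - \<phi>' b)) / h" using h_pos by (simp add: power2_eq_square field_simps)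
  finally have "(Q (%j. \<phi> (gridpt L N j)) j)^2 = ((\<phi>' a - \<phi>' x) + (\<phi>' x - \<phi>' b))^2 / h^2" by (simp add: power_divide)
  also have "... <= (2 * (h * V j) + 2 * (h * V (j - 1))) / h^2"
  proof (rule divide_right_mono)
   have "(y + z)^2 <= 2 * y^2 + 2 * z^2" for y z :: real using zero_le_power2[of "y - z"] by (simp add: power2_sum power2_diff)
   from this[of "\<phi>' a - \<phi>' x" "\<phi>' x - \<phi>' b"] show "((\<phi>' a - \<phi>' x) + (\<phi>' x - \<phi>' b))^2 <= 2 * (h * V j) + 2 * (h * V (j - 1))"
    using 1 2 by linarith
  qed simp
  also have "... = 2 * (V j + V (j - 1)) / h" using h_pos by (simp add: power2_eq_square field_simps)
  finally show ?thesis .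
 qed
 have sumV: "gsum N V = integral {-L..L} (%x. (q x)^2)"
 proof -
  have "(\<Sum>j<n. V (int j)) = integral {-L..gridpt L N (int n)} (%x. (q x)^2)" for n
  proof (induction n)
   case 0
   then show ?case by (simp add: gridpt_def)
  next
   case (Suc n)
   have n0: "- L <= gridpt L N (int n)" "gridpt L N (int n) <= gridpt L N (int n + 1)"
    using h_pos by (simp_all add: gridpt_def algebra_simps)
   have "integral {-L..gridpt L N (int n)} (%x. (q x)^2) + V (int n) = integral {-L..gridpt L N (int n + 1)} (%x. (q x)^2)"
    unfolding V_def by (rule Henstock_Kurzweil_Integration.integral_combine[OF n0 integrable_continuous_interval[OF c2]])
   moreover have "int (Suc n) = int n + 1" by simp
   ultimately show ?case using Suc.IH by (simp only: sum.lessThan_Suc)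
  qed
  from this[of N] show ?thesis using h_N by (simp add: gsum_def gridpt_def mult.commute)
 qed
 have "(nrm (Q (%j. \<phi> (gridpt L N j))))^2 <= h * gsum N (%j. 2 / h * (V j + V (j - 1)))"
  unfolding nrm_sq using Qb h_pos by (intro mult_left_mono gsum_mono) auto
 also have "... = 2 * (gsum N V + gsum N (%j. V (j - 1)))"
  unfolding gsum_cmult gsum_add using h_pos by simp
 also have "gsum N (%j. V (j - 1)) = gsum N V" by (rule gsum_minus1[where f = V, OF Vper])
 finally show ?thesis by (simp add: sumV)
qed

text \<open>The C2 bound is applied to Fourier partial sums and passed to the limit at the grid
  points; Bessel's inequality makes the right side independent of their order.\<close>

lemma nrm_Q_H2_le:
 assumes f: "f \<in> L2_per L" "continuous_on UNIV f" and g: "g \<in> L2_per L"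
  and fg: "!!n. torus.fc L g n = - (of_real (torus.kp L n))\<^sup>2 * torus.fc L f n"
 shows "nrm (Q (%j. f (gridpt L N j))) <= 2 * norm_L2 L g"
proof -
 interpret torus L by unfold_locales (rule L_pos)
 have gc: "(%n. \<i> * of_real (kp n) * (\<i> * of_real (kp n) * fc f n)) = fc g"
  by (simp add: fun_eq_iff ii_mult fg)
 have "(%k. nrm (Q (%j. fs (fc f) k (gridpt L N j)))) \<longlonglongrightarrow> nrm (Q (%j. f (gridpt L N j)))"
  by (rule tendsto_nrm[OF tendsto_Q]) (rule H2_representation(1)[OF f g fg])
 moreover have "nrm (Q (%j. fs (fc f) k (gridpt L N j))) <= 2 * norm_L2 L g" for k
 proof (rule power2_le_imp_le)
  let ?q = "fs (fc g) k"
  have d2: "(fs (%n. \<i> * of_real (kp n) * fc f n) k has_real_derivative ?q x) (at x)" for x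
   using fs_deriv[of "%n. \<i> * of_real (kp n) * fc f n" k x] unfolding gc .
  have cq: "continuous_on S (%x. (?q x)^2)" for S
   by (intro continuous_intros continuous_on_subset[OF continuous_fs]) simp
  have I: "set_integrable lebesgue {-L..L} (%x. (?q x)^2)"
   unfolding set_integrable_iff by (rule continuous_imp_integrable_real[OF cq])
  have "(nrm (Q (%j. fs (fc f) k (gridpt L N j))))^2 <= 4 * integral {-L..L} (%x. (?q x)^2)"
   by (rule nrm_Q_C2_le[OF fs_deriv d2 continuous_fs fs_periodic])
  also have "integral {-L..L} (%x. (?q x)^2) = (norm_L2 L ?q)^2"
   using set_lebesgue_integral_eq_integral(2)[OF I] unfolding LINT_M norm_L2_sq by simp
  also have "(norm_L2 L ?q)^2 <= (norm_L2 L g)^2"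
   using bessel[OF g, of k] norm_fs_sq[of "fc g" k] fc_0_real[OF g] by simp
  finally show "(nrm (Q (%j. fs (fc f) k (gridpt L N j))))^2 <= (2 * norm_L2 L g)^2" by (simp add: power_mult_distrib)
 qed simp
 ultimately show ?thesis by (intro LIMSEQ_le_const2) auto
qed

section \<open>Uniform estimates for the interpolants of scheme solutions\<close>

text \<open>This and the slope bound use \<open>2 * R\<close> for the second differences:
  interpolation up to \<open>T\<close> involves one level beyond \<open>T\<close>, which is only
  known to lie within that radius.\<close>

definition "sup_const R = CS * (3 * R)"
definition "slope_const R = sqrt (2 * L) * (2 * R)"
text \<open>\<open>grid_time_modulus\<close> at these bounds. The time
  \<open>T + 2 * L / (100 * CS * R)\<close> covers the extra level, since
  \<open>dt * (100 * CS * R) <= h <= 2 * L\<close>.\<close>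

definition "hoelder_const R T =
 (sqrt (2 * L) * (sup_const R * slope_const R) + 2 * R)^2 * (T + 2 * L / (100 * CS * R)) / (2 * L)
  + 4 * (sqrt (2 * L) * (sup_const R * slope_const R) + 2 * R) * (sqrt (2 * L) * slope_const R)"

lemma consts_nonneg:
 assumes "0 < R" "0 <= T"
 shows "0 <= sup_const R" "0 <= slope_const R" "0 <= hoelder_const R T"
proof -
 show 1: "0 <= sup_const R" "0 <= slope_const R" using assms CS_pos L_pos by (simp_all add: sup_const_def slope_const_def)
 then have "0 <= sqrt (2 * L) * (sup_const R * slope_const R) + 2 * R" using assms L_pos by simp
 then show "0 <= hoelder_const R T" unfolding hoelder_const_def using 1 assms CS_pos L_pos by simp
qed

text \<open>\<open>nm\<close> is the first level beyond \<open>T\<close>. The levels before it are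
  covered by the stability bound, and it inherits its own bounds through one further step.\<close>

lemma solution_levels:
 assumes sol: "scheme_solution L N dt T u0 U" and per: "!!x. u0 (x + 2 * L) = u0 x"
  and u0: "nrm (%j. u0 (gridpt L N j)) <= R / 2" "nrm (Q (%j. u0 (gridpt L N j))) <= R / 2"
  and R: "0 < R" and dt: "0 < dt" "dt * (100 * CS * R) <= h" and T: "18 * sqrt (2 * L) * R * T <= 1" "0 <= T"
 obtains nm where "T < real nm * dt" "real nm * dt <= T + 2 * L / (100 * CS * R)"
  "!!n. real n * dt <= T ==> n < nm"
  "!!n. n <= nm ==> grid_fun N (U n)" "!!n i. n <= nm ==> \<bar>U n i\<bar> <= sup_const R"
  "!!n i. n <= nm ==> \<bar>Dplus L N (U n) i\<bar> <= slope_const R" "!!n. n <= nm ==> nrm (Q (U n)) <= 2 * R"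
  "!!n. n < nm ==> scheme_step L N dt (U n) (U (Suc n))"
proof -
 define n0 where "n0 = nat \<lfloor>T / dt\<rfloor>"
 have "0 <= T / dt" using T dt by simp
 then have "real n0 = of_int \<lfloor>T / dt\<rfloor>" by (simp add: n0_def)
 then have "real n0 <= T / dt" "T / dt < real n0 + 1" by linarith+
 then have n0: "real n0 * dt <= T" "T < real (Suc n0) * dt" using dt by (simp_all add: field_simps)
 have le: "real n * dt <= T" if "n <= n0" for n
 proof -
  have "real n * dt <= real n0 * dt" using that dt by (intro mult_right_mono) auto
  then show ?thesis using n0 by linarith
 qed
 have step: "scheme_step L N dt (U n) (U (Suc n))" if "n < Suc n0" for n
  using sol le[of n] that unfolding scheme_solution_def by auto
 have U0: "U 0 = (%j. u0 (gridpt L N j))" using sol unfolding scheme_solution_def by auto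
 have gU0: "grid_fun N (U 0)" unfolding grid_fun_def U0 using per by (simp add: gridpt_period)
 have b: "grid_fun N (U n) \<and> nrm (U n) <= R / 2 \<and> nrm (Q (U n)) <= R" if "n <= n0" for n
  by (rule scheme_bounds[OF gU0 _ _ R dt T(1) step le[OF that]]) (use u0 U0 that in auto)
 have c: "grid_fun N (U n)" "nrm (U n) <= R / 2" "nrm (Q (U n)) <= 2 * R" if "n <= Suc n0" for n
 proof -
  have "grid_fun N (U n) \<and> nrm (U n) <= R / 2 \<and> nrm (Q (U n)) <= 2 * R"
  proof (cases "n <= n0")
   case True
   then show ?thesis using b[OF True] R by auto
  next
   case False
   then have n: "n = Suc n0" using that by simp
   have b0: "grid_fun N (U n0)" "nrm (U n0) <= R / 2" "nrm (U n0) <= R" "nrm (Q (U n0)) <= R" using b[of n0] R by auto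
   have st: "scheme_step L N dt (U n0) (U (Suc n0))" by (rule step) simp
   from scheme_step_bounds[OF b0(1) st R b0(3,4) dt] b0(2) show ?thesis by (simp add: n)
  qed
  then show "grid_fun N (U n)" "nrm (U n) <= R / 2" "nrm (Q (U n)) <= 2 * R" by blast+
 qed
 show thesis
 proof (rule that[of "Suc n0"])
  show "T < real (Suc n0) * dt" by (rule n0)
  have pos: "0 < 100 * CS * R" using CS_pos R by simp
  have "dt <= 2 * L / (100 * CS * R)" unfolding pos_le_divide_eq[OF pos] by (rule order_trans[OF dt(2) h_le])
  then show "real (Suc n0) * dt <= T + 2 * L / (100 * CS * R)" using n0(1) by (simp add: algebra_simps)
  show "n < Suc n0" if "real n * dt <= T" for n
  proof -
   have "real n * dt < real (Suc n0) * dt" using that n0(2) by linarith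
   then show ?thesis using dt by simp
  qed
  show "\<bar>U n i\<bar> <= sup_const R" if "n <= Suc n0" for n i
  proof -
   have "CS * (nrm (U n) + nrm (Q (U n))) <= CS * (3 * R)" using c(2,3)[OF that] R CS_pos by (intro mult_left_mono) auto
   then show ?thesis using sup_le[OF c(1)[OF that], of i] unfolding sup_const_def by linarith
  qed
  show "\<bar>Dplus L N (U n) i\<bar> <= slope_const R" if "n <= Suc n0" for n i
  proof -
   have "sqrt (2 * L) * nrm (Q (U n)) <= sqrt (2 * L) * (2 * R)" using c(3)[OF that] L_pos by (intro mult_left_mono) auto
   then show ?thesis using sup_Dplus_le[OF c(1)[OF that], of i] unfolding slope_const_def by linarith
  qed
 qed (use c step in auto)
qed

lemma interp_estimates:
 assumes sol: "scheme_solution L N dt T u0 U" and per: "!!x. u0 (x + 2 * L) = u0 x"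
  and u0: "nrm (%j. u0 (gridpt L N j)) <= R / 2" "nrm (Q (%j. u0 (gridpt L N j))) <= R / 2"
  and R: "0 < R" and dt: "0 < dt" "dt * (100 * CS * R) <= h" and T: "18 * sqrt (2 * L) * R * T <= 1" "0 <= T"
  and t: "t \<in> {0..T}"
 shows "\<bar>interp L N dt U t x\<bar> <= 12 * sup_const R"
  "\<bar>interp L N dt U t x - interp L N dt U t y\<bar> <= 27 * slope_const R * \<bar>x - y\<bar>"
  "s \<in> {0..T} ==> \<bar>interp L N dt U t x - interp L N dt U s x\<bar> <= 12 * sqrt (hoelder_const R T * \<bar>t - s\<bar>)"
  "interp L N dt U t (x + 2 * L) = interp L N dt U t x"
  "x' = gridpt L N j ==> \<bar>x - x'\<bar> <= h ==> \<bar>interp L N dt U 0 x - u0 x'\<bar> <= 9 * slope_const R * h"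
proof -
 obtain nm where nm: "T < real nm * dt" "real nm * dt <= T + 2 * L / (100 * CS * R)"
  "!!n. real n * dt <= T ==> n < nm"
  "!!n. n <= nm ==> grid_fun N (U n)" "!!n i. n <= nm ==> \<bar>U n i\<bar> <= sup_const R"
  "!!n i. n <= nm ==> \<bar>Dplus L N (U n) i\<bar> <= slope_const R" "!!n. n <= nm ==> nrm (Q (U n)) <= 2 * R"
  "!!n. n < nm ==> scheme_step L N dt (U n) (U (Suc n))"
  by (rule solution_levels[OF sol per u0 R dt T]) (rule that)
 note cn = consts_nonneg[OF R T(2)]
 define n where "n = nat \<lfloor>t / dt\<rfloor>"
 have "0 <= t / dt" using t dt by simp
 then have "real n = of_int \<lfloor>t / dt\<rfloor>" by (simp add: n_def)
 then have "real n <= t / dt" "t / dt <= real n + 1" by linarith+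
 then have tn: "real n * dt <= t" "t <= real (Suc n) * dt" using dt by (simp_all add: field_simps)
 have nn: "n <= nm" "Suc n <= nm" using nm(3)[of n] tn t by auto
 define \<theta> where "\<theta> = (t - real n * dt) / dt"
 have \<theta>: "\<bar>\<theta>\<bar> <= 1" using tn dt by (simp add: \<theta>_def field_simps)
 have mix: "\<bar>a + \<theta> * (b - a)\<bar> <= 3 * K" if "\<bar>a\<bar> <= K" "\<bar>b\<bar> <= K" for a b K
 proof -
  have "\<bar>\<theta> * (b - a)\<bar> <= 1 * (2 * K)" unfolding abs_mult using \<theta> that by (intro mult_mono) auto
  then show ?thesis using that by linarith
 qed
 note ic = interp_cell[OF dt(1) tn, of U, folded \<theta>_def]
 have "\<bar>P (U i) x\<bar> <= 4 * sup_const R" if "i <= nm" for i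
  by (rule interp_space_bound) (rule nm(5)[OF that])
 from mix[OF this[OF nn(1)] this[OF nn(2)]] show "\<bar>interp L N dt U t x\<bar> <= 12 * sup_const R" unfolding ic by simp
 have lip: "\<bar>P (U i) x - P (U i) y\<bar> <= 9 * slope_const R * \<bar>x - y\<bar>" if "i <= nm" for i x y
  by (rule interp_space_lipschitz) (rule nm(6)[OF that])
 have "interp L N dt U t x - interp L N dt U t y =
  (P (U n) x - P (U n) y) + \<theta> * ((P (U (Suc n)) x - P (U (Suc n)) y) - (P (U n) x - P (U n) y))"
  unfolding ic by (simp add: algebra_simps)
 then show "\<bar>interp L N dt U t x - interp L N dt U t y\<bar> <= 27 * slope_const R * \<bar>x - y\<bar>"
  using mix[OF lip[OF nn(1), of x y] lip[OF nn(2), of x y]] by simp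
 show "\<bar>interp L N dt U t x - interp L N dt U s x\<bar> <= 12 * sqrt (hoelder_const R T * \<bar>t - s\<bar>)" if s: "s \<in> {0..T}"
 proof (rule interp_time_modulus[OF dt(1) nm(1) cn(3) _ t s])
  show "\<bar>U n i - U l i\<bar> <= sqrt (hoelder_const R T * \<bar>real n * dt - real l * dt\<bar>)" if "n <= nm" "l <= nm" for n l i
   unfolding hoelder_const_def
   by (rule grid_time_modulus[where U = U and nm = nm, OF dt(1) nm(4) nm(5) nm(6) nm(7) nm(8) nm(2) that])
 qed
 show "interp L N dt U t (x + 2 * L) = interp L N dt U t x"
  unfolding ic interp_space_periodic[OF nm(4)[OF nn(1)]] interp_space_periodic[OF nm(4)[OF nn(2)]] ..
 show "\<bar>interp L N dt U 0 x - u0 x'\<bar> <= 9 * slope_const R * h" if x: "x' = gridpt L N j" "\<bar>x - x'\<bar> <= h"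
 proof -
  have "interp L N dt U 0 x = P (U 0) x" using interp_node[OF dt(1), of U 0 x] by simp
  moreover have "u0 x' = P (U 0) x'" using sol unfolding x(1) interp_space_node scheme_solution_def by simp
  moreover have "9 * slope_const R * \<bar>x - x'\<bar> <= 9 * slope_const R * h" using x cn by (intro mult_left_mono) auto
  ultimately show ?thesis using lip[of 0 x x'] by simp
 qed
qed

end

context torus_grid begin

section \<open>The uniform limit solves the equation\<close>

text \<open>One step changes \<open>dc\<close> by \<open>dt\<close> times symbols acting on the
  coefficients of the midpoint and of its products. Replacing these coefficients by those of
  \<open>u\<close> costs \<open>\<rho>\<close>, replacing the symbols by their limits costs the rest
  of \<open>\<eta>\<close>. The local errors sum to at most \<open>T * \<eta>\<close>, and each end
  of the time interval costs another \<open>\<rho>\<close>.\<close>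

lemma step_consistency:
 fixes u :: "real => real => real"
 assumes K: "!!t x y. \<bar>u t x - u t y\<bar> <= K * \<bar>x - y\<bar>" and B: "!!t x. \<bar>u t x\<bar> <= B"
  and Ho: "!!t s x. \<bar>u t x - u s x\<bar> <= Ho * sqrt \<bar>t - s\<bar>"
  and dt: "0 < dt" and k: "k <= m"
  and U: "!!n j. real n * dt <= T ==> \<bar>U n j - u (real n * dt) (gridpt L N j)\<bar> <= e"
   "!!n j. real n * dt <= T ==> \<bar>U n j\<bar> <= B" "!!n. real n * dt <= T ==> grid_fun N (U n)"
   "!!n. real n * dt <= T ==> scheme_step L N dt (U n) (U (Suc n))"
  and n: "real n * dt <= T"
 defines "A1 \<equiv> (cis (kp k * h) - cis (- (kp k * h))) / of_real (6 * h)"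
  and "A2 \<equiv> (1 - cis (- (kp k * h))) / of_real (6 * h)"
  and "A3 \<equiv> (2 * cos (kp k * h) - 2) / h^2"
  and "\<Psi> \<equiv> %t. \<i> * of_real (kp k) / 2 * fc (%x. (u t x)^2) k + \<i> * (of_real (kp k))^2 * fc (u t) k"
  and "\<rho> \<equiv> (1 + 2 * B) * (e + Ho * sqrt dt) + (K + B * kp k + B * K + 2 * B * K + B^2 * kp k) * h"
 defines "\<eta> \<equiv> (cmod A1 + cmod A2 + \<bar>A3\<bar>) * \<rho> + (cmod (A1 - \<i> * of_real (kp k) / 3) + cmod (A2 - \<i> * of_real (kp k) / 6)) * B^2
  + \<bar>A3 + (kp k)^2\<bar> * B"
 shows "cmod (fc (u (real n * dt)) k - fc (u 0) k - of_real dt * (\<Sum>l<n. \<Psi> (real l * dt))) <= 2 * \<rho> + T * \<eta>"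
  "cmod (dc (U n) k - fc (u (real n * dt)) k) <= \<rho>"
proof -
 have T0: "0 <= T" using n dt by (meson mult_nonneg_nonneg of_nat_0_le_iff less_imp_le order_trans)
 have kp0: "0 <= kp k" using odd_grid.L_pos[OF odd_grid_axioms] by (simp add: kp_def)
 have K0: "0 <= K" using K[of 0 1 0] by simp
 have B0: "0 <= B" using B[of 0 0] by simp
 have Ho0: "0 <= Ho" using Ho[of 1 0 0] by simp
 have e0: "0 <= e" using U(1)[of 0 0] T0 by simp
 \<comment> \<open>Nodal error plus the change of \<open>u\<close> over one time step, because the
   midpoint contains the later level as well.\<close>
 define \<delta> where "\<delta> = e + Ho * sqrt dt"
 have \<delta>0: "0 <= \<delta>" "e <= \<delta>" using e0 Ho0 dt by (simp_all add: \<delta>_def)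
 have h0: "0 <= h" using h_pos by simp
 have BK: "0 <= K * h" "0 <= B * kp k * h" "0 <= B * K * h" "0 <= B^2 * kp k * h" "0 <= B * \<delta>"
  using K0 B0 kp0 h0 \<delta>0 by simp_all
 have \<rho>: "\<rho> = \<delta> + 2 * (B * \<delta>) + K * h + B * kp k * h + 3 * (B * K * h) + B^2 * kp k * h"
  unfolding \<rho>_def \<delta>_def by (simp add: algebra_simps)
 have \<rho>0: "0 <= \<rho>" unfolding \<rho> using BK \<delta>0 by linarith
 have Ksq: "\<bar>(u t x)^2 - (u t y)\<^sup>2\<bar> <= (2 * B * K) * \<bar>x - y\<bar>" for t x y
 proof -
  have "\<bar>(u t x)^2 - (u t y)\<^sup>2\<bar> = \<bar>u t x + u t y\<bar> * \<bar>u t x - u t y\<bar>"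
   unfolding abs_mult[symmetric] by (simp add: power2_eq_square algebra_simps)
  also have "... <= (2 * B) * (K * \<bar>x - y\<bar>)" using B[of t x] B[of t y] K B0 by (intro mult_mono) auto
  finally show ?thesis by (simp add: mult_ac)
 qed
 have Bsq: "\<bar>(u t x)^2\<bar> <= B^2" for t x using B[of t x] by (simp add: abs_le_square_iff[symmetric])
 have fcB: "cmod (fc (u t) k) <= B" "cmod (fc (%x. (u t x)^2) k) <= B^2" if "real l * dt = t" "real l * dt <= T" for t l
 proof -
  have "cmod (fc f k) <= b" if lip: "!!x y. \<bar>f x - f y\<bar> <= C * \<bar>x - y\<bar>" and b: "!!x. \<bar>f x\<bar> <= b" for f C b
  proof -
   have C0: "0 <= C" using lip[of 1 0] by simp
   have cf: "continuous_on S f" for S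
    by (rule lipschitz_on_continuous_on[of C]) (use lip C0 in \<open>auto intro!: lipschitz_onI simp: dist_real_def\<close>)
   have i: "integrable M (%x. of_real (f x) * cnj (ex k x))"
    by (intro continuous_imp_integrable_real continuous_intros cf)
   have "cmod (LINT x|M. of_real (f x) * cnj (ex k x)) <= (LINT x|M. b)"
    by (rule Bochner_Integration.integral_norm_bound_integral[OF i]) (use b in \<open>auto simp: norm_mult\<close>)
   also have "... = b * (2 * L)" using odd_grid.L_pos[OF odd_grid_axioms] by (simp add: measure_restrict_space)
   finally show ?thesis using odd_grid.L_pos[OF odd_grid_axioms] by (simp add: fc_def norm_divide pos_divide_le_eq)
  qed
  from this[OF K B] this[OF Ksq Bsq] show "cmod (fc (u t) k) <= B" "cmod (fc (%x. (u t x)^2) k) <= B^2" .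
 qed
 have near: "cmod (dc (U l) k - fc (u (real l * dt)) k) <= \<rho>" if l: "real l * dt <= T" for l
 proof -
  have "cmod (dc (U l) k - fc (u (real l * dt)) k) <= e + (K + B * kp k) * h"
   by (rule dc_near[OF K B U(1)[OF l]])
  also have "... = e + K * h + B * kp k * h" by (simp add: algebra_simps)
  also have "... <= \<rho>" unfolding \<rho> using BK \<delta>0 by linarith
  finally show ?thesis .
 qed
 show "cmod (dc (U n) k - fc (u (real n * dt)) k) <= \<rho>" by (rule near[OF n])
 have step: "cmod (dc (U (Suc l)) k - dc (U l) k - of_real dt * \<Psi> (real l * dt)) <= dt * \<eta>" if l: "real (Suc l) * dt <= T" for l
 proof -
  have l': "real l * dt <= T" using l dt by (simp add: algebra_simps)
  define t where "t = real l * dt"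
  define w where "w i = (U l i + U (Suc l) i) / 2" for i
  have wB: "\<bar>w i\<bar> <= B" for i unfolding w_def by (rule abs_mean_le[OF U(2)[OF l'] U(2)[OF l]])
  have wg: "grid_fun N w" using U(3)[OF l'] U(3)[OF l] unfolding grid_fun_def w_def by simp
  have w\<delta>: "\<bar>w i - u t (gridpt L N i)\<bar> <= \<delta>" for i
  proof -
   have a: "\<bar>U l i - u t (gridpt L N i)\<bar> <= \<delta>" using U(1)[OF l', of i] \<delta>0 by (simp add: t_def)
   have "\<bar>u (real (Suc l) * dt) (gridpt L N i) - u t (gridpt L N i)\<bar> <= Ho * sqrt dt"
    using Ho[of "real (Suc l) * dt" "gridpt L N i" t] dt by (simp add: t_def algebra_simps)
   then have b: "\<bar>U (Suc l) i - u t (gridpt L N i)\<bar> <= \<delta>" using U(1)[OF l, of i] unfolding \<delta>_def by linarith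
   have "w i - u t (gridpt L N i) = ((U l i - u t (gridpt L N i)) + (U (Suc l) i - u t (gridpt L N i))) / 2"
    by (simp add: w_def field_simps)
   then show ?thesis using abs_mean_le[OF a b] by (simp only:)
  qed
  define X Y where "X = fc (%x. (u t x)^2) k" and "Y = fc (u t) k"
  have Xb: "cmod X <= B^2" and Yb: "cmod Y <= B" using fcB[of l t] l' by (simp_all add: X_def Y_def t_def)
  have e1: "cmod (dc w k - Y) <= \<rho>"
  proof -
   have "cmod (dc w k - Y) <= \<delta> + (K + B * kp k) * h" unfolding Y_def by (rule dc_near[OF K B w\<delta>])
   also have "... = \<delta> + K * h + B * kp k * h" by (simp add: algebra_simps)
   also have "... <= \<rho>" unfolding \<rho> using BK \<delta>0 by linarith
   finally show ?thesis .
  qed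
  have prod: "\<bar>a * b - c * c\<bar> <= B * p + B * q" if "\<bar>a - c\<bar> <= p" "\<bar>b - c\<bar> <= q" "\<bar>b\<bar> <= B" "\<bar>c\<bar> <= B" for a b c p q
  proof -
   have "\<bar>(a - c) * b\<bar> <= p * B" unfolding abs_mult using that by (intro mult_mono) auto
   moreover have "\<bar>c * (b - c)\<bar> <= B * q" unfolding abs_mult using that B0 by (intro mult_mono) auto
   moreover have "a * b - c * c = (a - c) * b + c * (b - c)" by (simp add: algebra_simps)
   ultimately have "\<bar>a * b - c * c\<bar> <= p * B + B * q" by (metis order_trans[OF abs_triangle_ineq add_mono])
   then show ?thesis by (simp add: mult.commute)
  qed
  have e2: "cmod (dc (%j. (w j)^2) k - X) <= \<rho>"
  proof -
   have "cmod (dc (%j. (w j)^2) k - X) <= (B * \<delta> + B * \<delta>) + (2 * B * K + B^2 * kp k) * h"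
    unfolding X_def
   proof (rule dc_near[OF Ksq Bsq])
    show "\<bar>(w j)^2 - (u t (gridpt L N j))\<^sup>2\<bar> <= B * \<delta> + B * \<delta>" for j
     unfolding power2_eq_square by (rule prod[OF w\<delta> w\<delta> wB B])
   qed
   also have "... = 2 * (B * \<delta>) + 2 * (B * K * h) + B^2 * kp k * h" by (simp add: algebra_simps)
   also have "... <= \<rho>" unfolding \<rho> using BK \<delta>0 by linarith
   finally show ?thesis .
  qed
  have e3: "cmod (dc (%j. w j * w (j + 1)) k - X) <= \<rho>"
  proof -
   have "cmod (dc (%j. w j * w (j + 1)) k - X) <= (B * \<delta> + B * (\<delta> + K * h)) + (2 * B * K + B^2 * kp k) * h"
    unfolding X_def
   proof (rule dc_near[OF Ksq Bsq])
    fix j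
    have "\<bar>u t (gridpt L N (j + 1)) - u t (gridpt L N j)\<bar> <= K * h"
     using K[of t "gridpt L N (j + 1)" "gridpt L N j"] h_pos by (simp add: gridpt_Suc)
    then have "\<bar>w (j + 1) - u t (gridpt L N j)\<bar> <= \<delta> + K * h" using w\<delta>[of "j + 1"] by linarith
    from prod[OF w\<delta>[of j] this wB B] show "\<bar>w j * w (j + 1) - (u t (gridpt L N j))\<^sup>2\<bar> <= B * \<delta> + B * (\<delta> + K * h)"
     unfolding power2_eq_square .
   qed
   also have "... = 2 * (B * \<delta>) + 3 * (B * K * h) + B^2 * kp k * h" by (simp add: algebra_simps)
   also have "... <= \<rho>" unfolding \<rho> using BK \<delta>0 by linarith
   finally show ?thesis .
  qed
  have A3: "dsym k = A3" by (simp add: dsym_def A3_def kp_h)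
  define a b c where "a = dc (%j. (w j)^2) k" and "b = dc (%j. w j * w (j + 1)) k" and "c = dc w k"
  have "dc (U (Suc l)) k - dc (U l) k = of_real dt * (A1 * a + A2 * b - \<i> * of_real A3 * c)"
   using scheme_dc[OF U(3)[OF l'] U(4)[OF l'] k, folded w_def[abs_def]]
   unfolding dc_G[OF wg] om_1 A3 a_def b_def c_def A1_def A2_def by simp
  moreover have "\<Psi> t = \<i> * of_real (kp k) / 2 * X + \<i> * (of_real (kp k))^2 * Y" by (simp add: \<Psi>_def X_def Y_def)
  ultimately have "dc (U (Suc l)) k - dc (U l) k - of_real dt * \<Psi> t = of_real dt *
   (A1 * (a - X) + A2 * (b - X) + (- \<i> * of_real A3) * (c - Y) + (A1 - \<i> * of_real (kp k) / 3) * X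
    + (A2 - \<i> * of_real (kp k) / 6) * X + (- \<i> * of_real (A3 + (kp k)^2)) * Y)"
   by (simp add: algebra_simps)
  then have "cmod (dc (U (Suc l)) k - dc (U l) k - of_real dt * \<Psi> t) = dt *
   cmod (A1 * (a - X) + A2 * (b - X) + (- \<i> * of_real A3) * (c - Y) + (A1 - \<i> * of_real (kp k) / 3) * X
    + (A2 - \<i> * of_real (kp k) / 6) * X + (- \<i> * of_real (A3 + (kp k)^2)) * Y)"
   using dt by (simp only: norm_mult norm_of_real abs_of_pos)
  also have "... <= dt * (cmod A1 * \<rho> + cmod A2 * \<rho> + \<bar>A3\<bar> * \<rho> + cmod (A1 - \<i> * of_real (kp k) / 3) * B^2
    + cmod (A2 - \<i> * of_real (kp k) / 6) * B^2 + \<bar>A3 + (kp k)^2\<bar> * B)"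
  proof (rule mult_left_mono)
   have nm: "cmod (z * y) <= cmod z * r" if "cmod y <= r" for z y r using that by (simp add: norm_mult mult_left_mono)
   have i3: "cmod (- \<i> * of_real x) = \<bar>x\<bar>" for x by (simp add: norm_mult)
   show "cmod (A1 * (a - X) + A2 * (b - X) + (- \<i> * of_real A3) * (c - Y) + (A1 - \<i> * of_real (kp k) / 3) * X
    + (A2 - \<i> * of_real (kp k) / 6) * X + (- \<i> * of_real (A3 + (kp k)^2)) * Y)
    <= cmod A1 * \<rho> + cmod A2 * \<rho> + \<bar>A3\<bar> * \<rho> + cmod (A1 - \<i> * of_real (kp k) / 3) * B^2
    + cmod (A2 - \<i> * of_real (kp k) / 6) * B^2 + \<bar>A3 + (kp k)^2\<bar> * B"
    unfolding i3[symmetric]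
    by (rule norm_triangle_mono norm_triangle_mono norm_triangle_mono norm_triangle_mono norm_triangle_mono
      | rule nm e2[folded a_def] e3[folded b_def] e1[folded c_def] Xb Yb)+
  qed (use dt in simp)
  also have "... = dt * \<eta>" by (simp add: \<eta>_def algebra_simps)
  finally show ?thesis by (simp add: t_def)
 qed
 have "0 <= \<eta>" unfolding \<eta>_def using \<rho>0 B0 by simp
 have sum: "cmod (dc (U n) k - dc (U 0) k - of_real dt * (\<Sum>l<n. \<Psi> (real l * dt))) <= (real n * dt) * \<eta>" if "real n * dt <= T" for n
  using that
 proof (induction n)
  case (Suc n)
  have "real n * dt <= T" using Suc.prems dt by (simp add: algebra_simps)
  then have IH: "cmod (dc (U n) k - dc (U 0) k - of_real dt * (\<Sum>l<n. \<Psi> (real l * dt))) <= (real n * dt) * \<eta>" by (rule Suc.IH)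
  have "dc (U (Suc n)) k - dc (U 0) k - of_real dt * (\<Sum>l<Suc n. \<Psi> (real l * dt)) =
   (dc (U n) k - dc (U 0) k - of_real dt * (\<Sum>l<n. \<Psi> (real l * dt))) + (dc (U (Suc n)) k - dc (U n) k - of_real dt * \<Psi> (real n * dt))"
   by (simp add: algebra_simps)
  then have "cmod (dc (U (Suc n)) k - dc (U 0) k - of_real dt * (\<Sum>l<Suc n. \<Psi> (real l * dt))) <= (real n * dt) * \<eta> + dt * \<eta>"
   using norm_triangle_mono[OF IH step[OF Suc.prems]] by (simp only:)
  then show ?case by (simp add: algebra_simps)
 qed simp
 have "(real n * dt) * \<eta> <= T * \<eta>" using n \<open>0 <= \<eta>\<close> by (intro mult_right_mono)
 then have 1: "cmod (dc (U n) k - dc (U 0) k - of_real dt * (\<Sum>l<n. \<Psi> (real l * dt))) <= T * \<eta>" using sum[OF n] by linarith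
 have 2: "cmod (dc (U 0) k - fc (u 0) k) <= \<rho>" using near[of 0] T0 by simp
 have 3: "cmod (fc (u (real n * dt)) k - dc (U n) k) <= \<rho>" using near[OF n] by (simp add: norm_minus_commute)
 have "fc (u (real n * dt)) k - fc (u 0) k - of_real dt * (\<Sum>l<n. \<Psi> (real l * dt)) =
  (dc (U n) k - dc (U 0) k - of_real dt * (\<Sum>l<n. \<Psi> (real l * dt))) + (dc (U 0) k - fc (u 0) k) + (fc (u (real n * dt)) k - dc (U n) k)"
  by simp
 then show "cmod (fc (u (real n * dt)) k - fc (u 0) k - of_real dt * (\<Sum>l<n. \<Psi> (real l * dt))) <= 2 * \<rho> + T * \<eta>"
  using norm_triangle_mono[OF norm_triangle_mono[OF 1 2] 3] by simp
qed

end

lemma lipschitz_hoelder_continuous: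
 fixes u :: "real => real => real"
 assumes K: "!!t x y. \<bar>u t x - u t y\<bar> <= K * \<bar>x - y\<bar>" and Ho: "!!t s x. \<bar>u t x - u s x\<bar> <= Ho * sqrt \<bar>t - s\<bar>"
 shows "continuous_on S (%(t, x). u t x)"
 unfolding continuous_on_def
proof (rule ballI, rule LIM_zero_cancel)
 fix p :: "real \<times> real"
 have "((%z. Ho * sqrt \<bar>fst z - fst p\<bar> + K * \<bar>snd z - snd p\<bar>) \<longlongrightarrow> Ho * sqrt \<bar>fst p - fst p\<bar> + K * \<bar>snd p - snd p\<bar>) (at p within S)"
  by (intro tendsto_intros)
 then have "((%z. Ho * sqrt \<bar>fst z - fst p\<bar> + K * \<bar>snd z - snd p\<bar>) \<longlongrightarrow> 0) (at p within S)" by simp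
 moreover have "norm ((case z of (t, x) => u t x) - (case p of (t, x) => u t x)) <= Ho * sqrt \<bar>fst z - fst p\<bar> + K * \<bar>snd z - snd p\<bar>" for z
  using Ho[of "fst z" "snd z" "fst p"] K[of "fst p" "snd z" "snd p"] unfolding split_beta real_norm_def by linarith
 then have "\<forall>\<^sub>F z in at p within S. norm ((case z of (t, x) => u t x) - (case p of (t, x) => u t x)) <= Ho * sqrt \<bar>fst z - fst p\<bar> + K * \<bar>snd z - snd p\<bar>"
  by (intro always_eventually allI)
 ultimately show "((%z. (case z of (t, x) => u t x) - (case p of (t, x) => u t x)) \<longlongrightarrow> 0) (at p within S)"
  by (rule Lim_null_comparison[rotated])
qed

text \<open>A frequency \<open>k\<close> is resolved by the grid as soon as
  \<open>2 * k + 1 < N\<close>; limits taken mode by mode start at an index that depends on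
  \<open>k\<close>.\<close>

lemma odd_grid_m_large:
 assumes "(%k :: nat. dx L (N k)) \<longlonglongrightarrow> 0" and L: "0 < L" and odd: "!!k. odd (N k)"
 obtains i0 where "!!i. i \<ge> i0 ==> k <= odd_grid.m (N i)"
proof -
 have "\<forall>\<^sub>F i in sequentially. dx L (N i) < 2 * L / (2 * real k + 1)"
  by (rule order_tendstoD(2)[OF assms(1)]) (use L in simp)
 then obtain i0 where i0: "!!i. i \<ge> i0 ==> dx L (N i) < 2 * L / (2 * real k + 1)" unfolding eventually_sequentially by blast
 show thesis
 proof (rule that[of i0])
  fix i assume i: "i \<ge> i0"
  interpret odd_grid L "N i" by unfold_locales (rule L, rule odd)
  have "2 * L * (2 * real k + 1) < 2 * L * real (N i)"
   using i0[OF i] N_pos by (simp add: dx_def divide_less_eq less_divide_eq mult_ac add_pos_nonneg)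
  then have "2 * real k + 1 < real (N i)" using L by (simp only: mult_less_cancel_left_pos)
  then have "2 * k + 1 < N i" by linarith
  then show "k <= odd_grid.m (N i)" unfolding m_def by presburger
 qed
qed

context torus begin

text \<open>The hypothesis \<open>clamp\<close> says that \<open>u\<close> takes no new values
  outside \<open>[0, T]\<close>, so bounds derived from the scheme on that interval hold at all
  times, as the criterion for strong solutions demands.\<close>

lemma grid_limit_is_solution:
 fixes N :: "nat => nat" and dt e :: "nat => real" and U :: "nat => nat => int => real"
 assumes T: "0 < T" and N: "!!i. odd (N i)" "(%i. dx L (N i)) \<longlonglongrightarrow> 0" and dt: "!!i. 0 < dt i" "dt \<longlonglongrightarrow> 0" and e: "e \<longlonglongrightarrow> 0"
  and K: "!!t x y. \<bar>u t x - u t y\<bar> <= K * \<bar>x - y\<bar>" and Ho: "!!t s x. \<bar>u t x - u s x\<bar> <= Ho * sqrt \<bar>t - s\<bar>"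
  and B: "!!t x. \<bar>u t x\<bar> <= B" and per: "!!t x. u t (x + 2 * L) = u t x"
  and clamp: "!!t. \<exists>s\<in>{0..T}. u t = u s" and init: "!!x. u 0 x = u0 x"
  and U: "!!i n j. real n * dt i <= T ==> \<bar>U i n j - u (real n * dt i) (gridpt L (N i) j)\<bar> <= e i"
   "!!i n j. real n * dt i <= T ==> \<bar>U i n j\<bar> <= B" "!!i n. real n * dt i <= T ==> grid_fun (N i) (U i n)"
   "!!i n. real n * dt i <= T ==> scheme_step L (N i) (dt i) (U i n) (U i (Suc n))"
   "!!i n. real n * dt i <= T ==> gnorm L (N i) (DD L (N i) (U i n)) <= R"
 shows "strong_solution L T u0 u"
proof -
 have tg: "torus_grid L (N i)" and og: "odd_grid L (N i)" for i
  using L_pos N(1) by (auto intro!: torus_grid.intro odd_grid.intro torus.intro)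
 have dx0: "dx L (N i) \<noteq> 0" for i using odd_grid.h_pos[OF og, of i] by simp
 have cu: "continuous_on UNIV (u t)" for t
 proof -
  have "K-lipschitz_on UNIV (u t)" using K[of t] K[of t 1 0] by (intro lipschitz_onI) (auto simp: dist_real_def)
  then show ?thesis by (rule lipschitz_on_continuous_on)
 qed
 note fcc = fc_time_continuous[of u, OF cu Ho B per]
 define \<Psi> where "\<Psi> k t = \<i> * of_real (kp k) / 2 * fc (%x. (u t x)^2) k + \<i> * (of_real (kp k))^2 * fc (u t) k" for k t
 define A1 where "A1 k i = (cis (kp k * dx L (N i)) - cis (- (kp k * dx L (N i)))) / of_real (6 * dx L (N i))" for k i
 define A2 where "A2 k i = (1 - cis (- (kp k * dx L (N i)))) / of_real (6 * dx L (N i))" for k i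
 define A3 where "A3 k i = (2 * cos (kp k * dx L (N i)) - 2) / (dx L (N i))^2" for k i
 define \<rho> where "\<rho> k i = (1 + 2 * B) * (e i + Ho * sqrt (dt i)) + (K + B * kp k + B * K + 2 * B * K + B^2 * kp k) * dx L (N i)" for k i
 define \<eta> where "\<eta> k i = (cmod (A1 k i) + cmod (A2 k i) + \<bar>A3 k i\<bar>) * \<rho> k i
  + (cmod (A1 k i - \<i> * of_real (kp k) / 3) + cmod (A2 k i - \<i> * of_real (kp k) / 6)) * B^2 + \<bar>A3 k i + (kp k)^2\<bar> * B" for k i
 have A: "A1 k \<longlonglongrightarrow> \<i> * of_real (kp k) / 3" "A2 k \<longlonglongrightarrow> \<i> * of_real (kp k) / 6" "A3 k \<longlonglongrightarrow> - ((kp k)^2)" for k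
  unfolding A1_def A2_def A3_def by (rule symbol_limits[OF N(2) dx0])+
 have \<rho>0: "\<rho> k \<longlonglongrightarrow> 0" for k
 proof -
  have "\<rho> k \<longlonglongrightarrow> (1 + 2 * B) * (0 + Ho * sqrt 0) + (K + B * kp k + B * K + 2 * B * K + B^2 * kp k) * 0"
   unfolding \<rho>_def by (intro tendsto_intros e dt N)
  then show ?thesis by simp
 qed
 have \<eta>0: "\<eta> k \<longlonglongrightarrow> 0" for k
 proof -
  have "\<eta> k \<longlonglongrightarrow> (cmod (\<i> * of_real (kp k) / 3) + cmod (\<i> * of_real (kp k) / 6) + \<bar>- ((kp k)^2)\<bar>) * 0
   + (cmod (\<i> * of_real (kp k) / 3 - \<i> * of_real (kp k) / 3) + cmod (\<i> * of_real (kp k) / 6 - \<i> * of_real (kp k) / 6)) * B^2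
   + \<bar>- ((kp k)^2) + (kp k)^2\<bar> * B"
   unfolding \<eta>_def by (intro tendsto_add tendsto_mult tendsto_norm tendsto_rabs tendsto_diff tendsto_const A \<rho>0)
  then show ?thesis by simp
 qed
 have cons: "cmod (fc (u (real n * dt i)) k - fc (u 0) k - of_real (dt i) * (\<Sum>l<n. \<Psi> k (real l * dt i))) <= 2 * \<rho> k i + T * \<eta> k i"
  "cmod (torus_grid.dc (N i) (U i n) k - fc (u (real n * dt i)) k) <= \<rho> k i"
  if "k <= odd_grid.m (N i)" "real n * dt i <= T" for n i k
  unfolding \<eta>_def \<rho>_def A1_def A2_def A3_def \<Psi>_def
  by (rule torus_grid.step_consistency[OF tg K B Ho dt(1) that(1) U(1-4) that(2)]; assumption)+
 show ?thesis
 proof (rule strong_solutionI[OF T per B lipschitz_hoelder_continuous[OF K Ho] Ho _ _ init])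
  fix t k assume t: "t \<in> {0..T}"
  obtain i0 where i0: "!!i. i \<ge> i0 ==> k <= odd_grid.m (N i)" by (rule odd_grid_m_large[OF N(2) L_pos N(1)]) (rule that)
  have "((%t. fc (u t) k) has_vector_derivative \<Psi> k t) (at t within {0..T})"
  proof (rule euler_limit[OF T fcc(1), where d = "%i. dt (i + i0)" and \<theta> = "%i. 2 * \<rho> k (i + i0) + T * \<eta> k (i + i0)"])
   show "continuous_on {0..T} (\<Psi> k)" unfolding \<Psi>_def by (intro continuous_intros fcc)
   show "(%i. dt (i + i0)) \<longlonglongrightarrow> 0" by (rule LIMSEQ_ignore_initial_segment[OF dt(2)])
   have "(%i. 2 * \<rho> k i + T * \<eta> k i) \<longlonglongrightarrow> 2 * 0 + T * 0" by (intro tendsto_intros \<rho>0 \<eta>0)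
   from LIMSEQ_ignore_initial_segment[OF this, of i0]
   show "(%i. 2 * \<rho> k (i + i0) + T * \<eta> k (i + i0)) \<longlonglongrightarrow> 0" by simp
   show "cmod (fc (u (real n * dt (i + i0))) k - fc (u 0) k - of_real (dt (i + i0)) * (\<Sum>l<n. \<Psi> k (real l * dt (i + i0))))
    <= 2 * \<rho> k (i + i0) + T * \<eta> k (i + i0)" if "real n * dt (i + i0) <= T" for i n
    by (rule cons(1)[OF i0 that]) simp
  qed (use dt t in auto)
  then show "((%t. fc (u t) k) has_vector_derivative \<i> * of_real (kp k) / 2 * fc (%x. (u t x)^2) k
   + \<i> * (of_real (kp k))^2 * fc (u t) k) (at t within {0..T})" unfolding \<Psi>_def .
 next
  fix t0 n
  obtain t where t: "t \<in> {0..T}" "u t0 = u t" using clamp by blast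
  obtain i0 where i0: "!!i. i \<ge> i0 ==> n <= odd_grid.m (N i)" by (rule odd_grid_m_large[OF N(2) L_pos N(1)]) (rule that)
  \<comment> \<open>The last time level not after \<open>t\<close>. The second differences are
    bounded there, and as these times tend to \<open>t\<close> the discrete coefficients converge to
    those of \<open>u t\<close>.\<close>
  define l where "l i = nat \<lfloor>t / dt i\<rfloor>" for i
  have t0: "0 <= t" using t by simp
  have l: "real (l i) * dt i <= t" for i unfolding l_def by (rule floor_steps(1)[OF t0 dt(1)])
  have lt: "(%i. real (l i) * dt i) \<longlonglongrightarrow> t" unfolding l_def by (rule floor_steps(2)[OF t0 dt])
  have lT: "real (l i) * dt i <= T" for i using l[of i] t by auto
  define a where "a k i = torus_grid.dc (N i) (U i (l i)) k" for k i
  have alim: "(%i. a k (i + i0)) \<longlonglongrightarrow> fc (u t) k" if k: "k <= n" for k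
  proof -
   have 1: "(%i. fc (u (real (l i) * dt i)) k) \<longlonglongrightarrow> fc (u t) k"
    by (rule continuous_on_tendsto_compose[OF fcc(1)[of UNIV k] lt]) auto
   have "(%i. a k (i + i0) - fc (u (real (l (i + i0)) * dt (i + i0))) k) \<longlonglongrightarrow> 0"
   proof (rule Lim_null_comparison[OF always_eventually LIMSEQ_ignore_initial_segment[OF \<rho>0[of k]]], rule allI)
    fix i
    have "k <= odd_grid.m (N (i + i0))" using i0[of "i + i0"] k by simp
    then show "cmod (a k (i + i0) - fc (u (real (l (i + i0)) * dt (i + i0))) k) <= \<rho> k (i + i0)"
     unfolding a_def by (rule cons(2)[OF _ lT])
   qed
   from tendsto_add[OF this LIMSEQ_ignore_initial_segment[OF 1, of i0]] show ?thesis by simp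
  qed
  have "(%i. \<Sum>k=1..n. (A3 k (i + i0) * cmod (a k (i + i0)))^2) \<longlonglongrightarrow> (\<Sum>k=1..n. (- ((kp k)^2) * cmod (fc (u t) k))^2)"
   by (intro tendsto_sum tendsto_power tendsto_mult tendsto_norm alim LIMSEQ_ignore_initial_segment[OF A(3)]) auto
  moreover have "(\<Sum>k=1..n. (A3 k (i + i0) * cmod (a k (i + i0)))^2) <= R^2 / (4 * L)" for i
  proof -
   let ?i = "i + i0"
   have "odd_grid.dsym L (N ?i) k = A3 k ?i" for k
    unfolding odd_grid.dsym_def[OF og] A3_def torus_grid.kp_h[OF tg] ..
   then have "(\<Sum>k=1..n. (A3 k ?i * cmod (a k ?i))^2) <= (gnorm L (N ?i) (DD L (N ?i) (U ?i (l ?i))))^2 / (4 * L)"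
    using torus_grid.bessel_dc[OF tg U(3)[OF lT] i0, of ?i] unfolding a_def by simp
   also have "... <= R^2 / (4 * L)"
    using U(5)[OF lT, of ?i] L_pos odd_grid.nrm_nonneg[OF og] by (intro divide_right_mono power_mono) auto
   finally show ?thesis .
  qed
  ultimately have b: "(\<Sum>k=1..n. (- ((kp k)^2) * cmod (fc (u t) k))^2) <= R^2 / (4 * L)"
   by (intro LIMSEQ_le_const2) auto
  \<comment> \<open>Mode 0, which the discrete Bessel inequality does not see, carries the factor
    \<open>kp 0 = 0\<close>.\<close>
  have "(\<Sum>k\<le>n. wt k * ((kp k)^2 * cmod (fc (u t) k))^2) = (\<Sum>k=1..n. wt k * ((kp k)^2 * cmod (fc (u t) k))^2)"
   by (rule sum.mono_neutral_right) (auto simp: kp_def Suc_le_eq)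
  also have "... <= (\<Sum>k=1..n. 2 * (- ((kp k)^2) * cmod (fc (u t) k))^2)"
   by (intro sum_mono) (simp add: wt_pos mult_right_mono)
  also have "... <= 2 * (R^2 / (4 * L))" using b by (simp add: sum_distrib_left[symmetric])
  finally show "(\<Sum>k\<le>n. wt k * ((kp k)^2 * cmod (fc (u t0) k))^2) <= 2 * (R^2 / (4 * L))" unfolding t(2) .
 qed
qed

section \<open>Compactness and convergence of the whole sequence\<close>

lemma convergent_subsequence:
 fixes N :: "nat => nat" and dt :: "nat => real" and U :: "nat => nat => int => real"
 assumes T: "0 < T" "18 * sqrt (2 * L) * R * T <= 1" and R: "0 < R"
  and N: "!!i. odd (N i)" "(%i. dx L (N i)) \<longlonglongrightarrow> 0"
  and dt: "!!i. 0 < dt i" "!!i. dt i * (100 * odd_grid.CS L * R) <= dx L (N i)"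
  and u0: "!!x. u0 (x + 2 * L) = u0 x" "continuous_on UNIV u0"
   "!!i. gnorm L (N i) (%j. u0 (gridpt L (N i) j)) <= R / 2" "!!i. gnorm L (N i) (DD L (N i) (%j. u0 (gridpt L (N i) j))) <= R / 2"
  and sol: "!!i. scheme_solution L (N i) (dt i) T u0 (U i)"
 obtains r u where "strict_mono (r :: nat => nat)" "strong_solution L T u0 u" "continuous_on UNIV (%(t, x). u t x)"
  "uniform_limit (UNIV \<times> {0..T}) (%k (x, t). interp L (N (r k)) (dt (r k)) (U (r k)) t x) (%(x, t). u t x) sequentially"
proof -
 have og: "odd_grid L (N i)" for i using L_pos N(1) by (auto intro!: odd_grid.intro)
 define I where "I i t x = interp L (N i) (dt i) (U i) t x" for i t x
 define B where "B = 12 * odd_grid.sup_const L R"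
 define K where "K = 27 * odd_grid.slope_const L R"
 define Ho where "Ho = 12 * sqrt (odd_grid.hoelder_const L R T)"
 have T0: "0 <= T" using T by simp
 note cn = odd_grid.consts_nonneg[OF og[of 0] R T0]
 have nn: "0 <= B" "0 <= K" "0 <= Ho" using cn by (simp_all add: B_def K_def Ho_def)
 note est = odd_grid.interp_estimates[OF og sol u0(1) u0(3,4) R dt T(2) T0, folded I_def]
 have IB: "\<bar>I i t x\<bar> <= B" and IK: "\<bar>I i t x - I i t y\<bar> <= K * \<bar>x - y\<bar>" and IP: "I i t (x + 2 * L) = I i t x" if "t \<in> {0..T}" for i t x y
  using est(1,2,4)[OF that] by (simp_all add: B_def K_def)
 have IH: "\<bar>I i t x - I i s x\<bar> <= Ho * sqrt \<bar>t - s\<bar>" if "t \<in> {0..T}" "s \<in> {0..T}" for i t s x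
  unfolding Ho_def mult.assoc real_sqrt_mult[symmetric] by (rule est(3)[OF that])
 define S where "S = {-L..L} \<times> {0..T}"
 have "compact S" unfolding S_def by (intro compact_Times compact_Icc)
 moreover have "norm (I i (snd p) (fst p)) <= B" if "p \<in> S" for i p
  using IB[of "snd p" i "fst p"] that by (auto simp: S_def)
 moreover have "\<exists>d>0. \<forall>i y. y \<in> S \<and> norm (p - y) < d \<longrightarrow> norm (I i (snd p) (fst p) - I i (snd y) (fst y)) < e"
  if p: "p \<in> S" and e: "0 < e" for p e
 proof -
  have "((%d. K * d + Ho * sqrt d) \<longlongrightarrow> K * 0 + Ho * sqrt 0) (at_right 0)" by (intro tendsto_intros)
  then have "\<forall>\<^sub>F d in at_right 0. K * d + Ho * sqrt d < e" using e by (intro order_tendstoD(2)) auto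
  then obtain b where b: "0 < b" "!!d. 0 < d ==> d < b ==> K * d + Ho * sqrt d < e"
   unfolding eventually_at_right_field by auto
  have "norm (I i (snd p) (fst p) - I i (snd y) (fst y)) < e" if y: "y \<in> S" "norm (p - y) < b / 2" for i y
  proof -
   have f: "\<bar>fst p - fst y\<bar> <= b / 2" "\<bar>snd p - snd y\<bar> <= b / 2"
    using norm_fst_le[of "fst (p - y)" "snd (p - y)"] norm_snd_le[of "snd (p - y)" "fst (p - y)"] y(2)
    unfolding minus_prod_def fst_conv snd_conv real_norm_def by linarith+
   have "\<bar>I i (snd p) (fst p) - I i (snd p) (fst y)\<bar> <= K * \<bar>fst p - fst y\<bar>" using IK p by (auto simp: S_def)
   also have "... <= K * (b / 2)" using f nn by (intro mult_left_mono) auto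
   finally have 1: "\<bar>I i (snd p) (fst p) - I i (snd p) (fst y)\<bar> <= K * (b / 2)" .
   have "\<bar>I i (snd p) (fst y) - I i (snd y) (fst y)\<bar> <= Ho * sqrt \<bar>snd p - snd y\<bar>" using IH p y by (auto simp: S_def)
   also have "... <= Ho * sqrt (b / 2)" using f nn by (intro mult_left_mono) auto
   finally have 2: "\<bar>I i (snd p) (fst y) - I i (snd y) (fst y)\<bar> <= Ho * sqrt (b / 2)" .
   show ?thesis using 1 2 b(2)[of "b / 2"] b(1) unfolding real_norm_def by linarith
  qed
  then show ?thesis using b(1) by (intro exI[of _ "b / 2"]) auto
 qed
 ultimately obtain g r where r: "strict_mono (r :: nat => nat)"
  and g: "!!e. 0 < e ==> \<exists>n0. \<forall>n p. n \<ge> n0 \<and> p \<in> S \<longrightarrow> norm (I (r n) (snd p) (fst p) - g p) < e"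
  using Arzela_Ascoli[of S "%i p. I i (snd p) (fst p)" B] by metis
 \<comment> \<open>Compactness gives the limit on one period and on \<open>[0, T]\<close>;
   \<open>wrap\<close> extends it periodically in space and \<open>clamp\<close> freezes it outside
   the time interval.\<close>
 define wrap where "wrap x = x - 2 * L * of_int \<lfloor>(x + L) / (2 * L)\<rfloor>" for x
 define clamp where "clamp t = max 0 (min T t)" for t :: real
 define u where "u t x = g (wrap x, clamp t)" for t x
 have wrap: "wrap x \<in> {-L..L}" for x
 proof -
  have L2: "0 < 2 * L" using L_pos by simp
  have "of_int \<lfloor>(x + L) / (2 * L)\<rfloor> <= (x + L) / (2 * L)" "(x + L) / (2 * L) <= of_int \<lfloor>(x + L) / (2 * L)\<rfloor> + 1" by linarith+
  then have "of_int \<lfloor>(x + L) / (2 * L)\<rfloor> * (2 * L) <= x + L" "x + L <= (of_int \<lfloor>(x + L) / (2 * L)\<rfloor> + 1) * (2 * L)"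
   unfolding pos_le_divide_eq[OF L2] pos_divide_le_eq[OF L2] .
  then show ?thesis unfolding wrap_def by (simp add: algebra_simps)
 qed
 have clamp: "clamp t \<in> {0..T}" for t using T0 by (simp add: clamp_def)
 have clamp_id: "clamp t = t" if "t \<in> {0..T}" for t using that by (simp add: clamp_def)
 have uc: "u t = u (clamp t)" for t unfolding u_def clamp_id[OF clamp] ..
 have Iw: "I i t x = I i t (wrap x)" if "t \<in> {0..T}" for i t x
  using periodic_int[of "I i t" "wrap x" "\<lfloor>(x + L) / (2 * L)\<rfloor>"] IP[OF that] by (simp add: wrap_def)
 have unif: "\<exists>n0. \<forall>n\<ge>n0. \<forall>t\<in>{0..T}. \<forall>x. \<bar>I (r n) t x - u t x\<bar> < e" if e: "0 < e" for e
 proof -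
  obtain n0 where n0: "!!n p. n \<ge> n0 ==> p \<in> S ==> norm (I (r n) (snd p) (fst p) - g p) < e" using g[OF e] by blast
  have "\<bar>I (r n) t x - u t x\<bar> < e" if "n \<ge> n0" "t \<in> {0..T}" for n t x
   using n0[of n "(wrap x, t)"] that wrap[of x] unfolding Iw[OF that(2), of _ x] u_def clamp_id[OF that(2)] by (simp add: S_def)
  then show ?thesis by blast
 qed
 have lim: "(%n. I (r n) (clamp t) x) \<longlonglongrightarrow> u t x" for t x
 proof (rule LIMSEQ_I)
  fix e :: real assume "0 < e"
  from unif[OF this] show "\<exists>no. \<forall>n\<ge>no. norm (I (r n) (clamp t) x - u t x) < e"
   using clamp[of t] unfolding uc[of t] real_norm_def by meson
 qed
 have uB: "\<bar>u t x\<bar> <= B" for t x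
  by (rule LIMSEQ_le_const2[OF tendsto_rabs[OF lim]]) (use IB[OF clamp] in blast)
 have uK: "\<bar>u t x - u t y\<bar> <= K * \<bar>x - y\<bar>" for t x y
  by (rule LIMSEQ_le_const2[OF tendsto_rabs[OF tendsto_diff[OF lim lim]]]) (use IK[OF clamp] in blast)
 have uH: "\<bar>u t x - u s x\<bar> <= Ho * sqrt \<bar>t - s\<bar>" for t s x
 proof -
  have "\<bar>clamp t - clamp s\<bar> <= \<bar>t - s\<bar>" by (simp add: clamp_def max_def min_def)
  then have "Ho * sqrt \<bar>clamp t - clamp s\<bar> <= Ho * sqrt \<bar>t - s\<bar>" using nn by (intro mult_left_mono) auto
  then have "\<bar>I i (clamp t) x - I i (clamp s) x\<bar> <= Ho * sqrt \<bar>t - s\<bar>" for i using IH[OF clamp clamp] order_trans by blast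
  then show ?thesis by (intro LIMSEQ_le_const2[OF tendsto_rabs[OF tendsto_diff[OF lim lim]]]) blast
 qed
 have uP: "u t (x + 2 * L) = u t x" for t x
  using lim[of t "x + 2 * L"] lim[of t x] IP[OF clamp] LIMSEQ_unique by simp
 have dx0: "(%n. dx L (N (r n))) \<longlonglongrightarrow> 0" using LIMSEQ_subseq_LIMSEQ[OF N(2) r] by (simp add: o_def)
 have CS: "0 < 100 * odd_grid.CS L * R" using odd_grid.CS_pos[OF og[of 0]] R by simp
 have dt0: "(%n. dt (r n)) \<longlonglongrightarrow> 0"
 proof (rule tendsto_sandwich[OF _ _ tendsto_const])
  have "(%n. dx L (N (r n)) / (100 * odd_grid.CS L * R)) \<longlonglongrightarrow> 0 / (100 * odd_grid.CS L * R)"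
   by (intro tendsto_divide dx0 tendsto_const) (rule less_imp_neq[OF CS, symmetric])
  then show "(%n. dx L (N (r n)) / (100 * odd_grid.CS L * R)) \<longlonglongrightarrow> 0" by simp
  show "\<forall>\<^sub>F n in sequentially. dt (r n) <= dx L (N (r n)) / (100 * odd_grid.CS L * R)"
   unfolding pos_le_divide_eq[OF CS] using dt(2) by (intro always_eventually allI)
 qed (use dt(1) in \<open>auto intro!: always_eventually less_imp_le\<close>)
 have u00: "u 0 x = u0 x" for x
 proof -
  have "\<exists>j. gridpt L (N i) j <= x \<and> x <= gridpt L (N i) (j + 1)" for i
   by (rule odd_grid.cell_exists[OF og, of i x]) blast
  then obtain j where j: "!!i. gridpt L (N i) (j i) <= x" "!!i. x <= gridpt L (N i) (j i + 1)" by metis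
  define y where "y n = gridpt L (N (r n)) (j (r n))" for n
  have y: "\<bar>x - y n\<bar> <= dx L (N (r n))" for n
   using j[of "r n"] unfolding y_def odd_grid.gridpt_Suc[OF og] by linarith
  have "(%n. y n - x) \<longlonglongrightarrow> 0"
   by (rule Lim_null_comparison[OF always_eventually dx0]) (use y in \<open>simp add: abs_minus_commute\<close>)
  then have "y \<longlonglongrightarrow> x" by (rule LIM_zero_cancel)
  then have "(%n. u0 (y n)) \<longlonglongrightarrow> u0 x" by (intro continuous_on_tendsto_compose[OF u0(2)]) auto
  moreover have z: "0 \<in> {0..T}" using T0 by simp
  moreover have "(%n. I (r n) 0 x - u0 (y n)) \<longlonglongrightarrow> 0"
  proof (rule Lim_null_comparison[OF always_eventually])
   have "(%n. 9 * odd_grid.slope_const L R * dx L (N (r n))) \<longlonglongrightarrow> 9 * odd_grid.slope_const L R * 0" by (intro tendsto_intros dx0)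
   then show "(%n. 9 * odd_grid.slope_const L R * dx L (N (r n))) \<longlonglongrightarrow> 0" by simp
   show "\<forall>n. norm (I (r n) 0 x - u0 (y n)) <= 9 * odd_grid.slope_const L R * dx L (N (r n))"
    using est(5)[OF z y_def y] by simp
  qed
  ultimately have "(%n. I (r n) 0 x - u0 (y n) + u0 (y n)) \<longlonglongrightarrow> 0 + u0 x" by (intro tendsto_add)
  moreover have "clamp 0 = 0" using T0 by (simp add: clamp_def)
  ultimately show ?thesis using lim[of 0 x] LIMSEQ_unique by simp
 qed
 \<comment> \<open>The uniform error as one null sequence; at the nodes, where interpolants equal
   grid values, it is the error required for consistency.\<close>
 define E where "E n = (SUP p\<in>{0..T} \<times> UNIV. \<bar>I (r n) (fst p) (snd p) - u (fst p) (snd p)\<bar>)" for n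
 have bdd: "bdd_above ((%p. \<bar>I (r n) (fst p) (snd p) - u (fst p) (snd p)\<bar>) ` ({0..T} \<times> UNIV))" for n
 proof (rule bdd_aboveI2)
  fix p :: "real \<times> real" assume "p \<in> {0..T} \<times> UNIV"
  then show "\<bar>I (r n) (fst p) (snd p) - u (fst p) (snd p)\<bar> <= 2 * B"
   using IB[of "fst p" "r n" "snd p"] uB[of "fst p" "snd p"] by auto
 qed
 have E: "\<bar>I (r n) t x - u t x\<bar> <= E n" if "t \<in> {0..T}" for n t x
  using cSUP_upper[OF _ bdd[of n], of "(t, x)"] that by (simp add: E_def)
 have E0: "E \<longlonglongrightarrow> 0"
 proof (rule LIMSEQ_I)
  fix e :: real assume e: "0 < e"
  obtain n0 where n0: "!!n t x. n \<ge> n0 ==> t \<in> {0..T} ==> \<bar>I (r n) t x - u t x\<bar> < e / 2" using unif[OF half_gt_zero[OF e]] by meson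
  have "norm (E n - 0) < e" if n: "n \<ge> n0" for n
  proof -
   have "E n <= e / 2" unfolding E_def by (rule cSUP_least) (use n0[OF n] T0 in \<open>auto intro: less_imp_le\<close>)
   moreover have "0 <= E n" using E[of 0 n 0] T0 by auto
   ultimately show ?thesis using e by simp
  qed
  then show "\<exists>no. \<forall>n\<ge>no. norm (E n - 0) < e" by blast
 qed
 have node: "I (r i) (real n * dt (r i)) (gridpt L (N (r i)) j) = U (r i) n j" for i n j
  unfolding I_def odd_grid.interp_node[OF og dt(1)] by (rule odd_grid.interp_space_node[OF og])
 have tT: "real n * dt i \<in> {0..T}" if "real n * dt i <= T" for n i
  using that dt(1)[of i] by (simp add: less_imp_le)
 have "strong_solution L T u0 u"
 proof (rule grid_limit_is_solution[where N = "%i. N (r i)" and dt = "%i. dt (r i)" and U = "%i. U (r i)" and e = E and R = "2 * R",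
   OF T(1) N(1) dx0 dt(1) dt0 E0 uK uH uB uP _ u00])
  show "\<exists>s\<in>{0..T}. u t = u s" for t using uc clamp by blast
  fix i n assume n: "real n * dt (r i) <= T"
  show "\<bar>U (r i) n j - u (real n * dt (r i)) (gridpt L (N (r i)) j)\<bar> <= E i" for j
   using E[OF tT[OF n]] unfolding node[symmetric] by blast
  show "\<bar>U (r i) n j\<bar> <= B" for j using IB[OF tT[OF n]] unfolding node[symmetric] by blast
  show "scheme_step L (N (r i)) (dt (r i)) (U (r i) n) (U (r i) (Suc n))"
   using sol n unfolding scheme_solution_def by blast
  obtain nm where "!!n. real n * dt (r i) <= T ==> n < nm"
   "!!n. n <= nm ==> grid_fun (N (r i)) (U (r i) n)" "!!n. n <= nm ==> gnorm L (N (r i)) (DD L (N (r i)) (U (r i) n)) <= 2 * R"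
   by (rule odd_grid.solution_levels[OF og sol u0(1) u0(3,4) R dt T(2) T0, of "r i"]) (rule that)
  from this(1)[OF n] this(2,3)[of n]
  show "grid_fun (N (r i)) (U (r i) n)" "gnorm L (N (r i)) (DD L (N (r i)) (U (r i) n)) <= 2 * R" by auto
 qed
 moreover have "uniform_limit (UNIV \<times> {0..T}) (%k (x, t). I (r k) t x) (%(x, t). u t x) sequentially"
 proof (rule uniform_limitI)
  fix e :: real assume "0 < e"
  from unif[OF this] show "\<forall>\<^sub>F n in sequentially. \<forall>p\<in>UNIV \<times> {0..T}. dist (case p of (x, t) => I (r n) t x) (case p of (x, t) => u t x) < e"
   unfolding eventually_sequentially dist_real_def by auto
 qed
 ultimately show thesis
  using that[OF r _ lipschitz_hoelder_continuous[OF uK uH]] unfolding I_def by blast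
qed

end

text \<open>If convergence failed, some subsequence would stay at a fixed distance from the limit,
  and so would all of its further subsequences.\<close>

lemma uniform_limit_subseqI:
 assumes "!!q :: nat => nat. strict_mono q ==> \<exists>r :: nat => nat. uniform_limit S (%k. f (q (r k))) l sequentially"
 shows "uniform_limit S f l sequentially"
proof (rule uniform_limitI, rule ccontr)
 fix e :: real assume e: "0 < e" and n: "\<not> (\<forall>\<^sub>F k in sequentially. \<forall>x\<in>S. dist (f k x) (l x) < e)"
 obtain q :: "nat => nat" where q: "strict_mono q" "!!k. \<not> (\<forall>x\<in>S. dist (f (q k) x) (l x) < e)"
  using not_eventually_sequentiallyD[OF n] by blast
 obtain r :: "nat => nat" where r: "uniform_limit S (%k. f (q (r k))) l sequentially" using assms[OF q(1)] by blast
 from uniform_limitD[OF r e] q(2) show False unfolding eventually_sequentially by blast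
qed

context torus begin

text \<open>Bound on the sup norm of a continuous H2 function of norm \<open>r\<close>: the mean is
  controlled by the L2 norm, the other coefficients by the C1 series.\<close>

definition "data_bound r = r / sqrt (2 * L) + L / pi * ((r^2 / (2 * L) + KS) / 2)"
text \<open>More than twice a bound for both grid norms of the data:
  \<open>sqrt (2 * L) * data_bound r\<close> for the values and \<open>2 * r\<close> for the second
  differences. The added 1 keeps it positive when \<open>r = 0\<close>.\<close>

definition "run_bound r = 2 * (sqrt (2 * L) * data_bound r + 2 * r) + 1"
text \<open>Equality in the stability condition \<open>18 * sqrt (2 * L) * R * T <= 1\<close> at
  \<open>R = run_bound r\<close>.\<close>

definition "life_span r = 1 / (18 * sqrt (2 * L) * run_bound r)"

lemma run_bound:
 assumes "0 <= r"
 shows "0 <= data_bound r" "0 < run_bound r" "0 < life_span r" "18 * sqrt (2 * L) * run_bound r * life_span r <= 1"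
proof -
 have "0 <= KS" unfolding KS_def by (intro suminf_nonneg summable_kp) simp
 then show 1: "0 <= data_bound r" using assms L_pos by (simp add: data_bound_def)
 then show 2: "0 < run_bound r" using assms L_pos unfolding run_bound_def by (intro add_nonneg_pos) auto
 then show "0 < life_span r" "18 * sqrt (2 * L) * run_bound r * life_span r <= 1" using L_pos by (simp_all add: life_span_def)
qed

lemma initial_grid_bounds:
 assumes u0: "u0 \<in> H2_per L" "continuous_on UNIV u0" and N: "odd N"
 defines "r \<equiv> norm_H2 L u0"
 shows "gnorm L N (%j. u0 (gridpt L N j)) <= run_bound r / 2" "gnorm L N (DD L N (%j. u0 (gridpt L N j))) <= run_bound r / 2"
proof -
 have og: "odd_grid L N" using L_pos N by (auto intro!: odd_grid.intro)
 obtain g where g: "u0 \<in> L2_per L" "g \<in> L2_per L" "!!n. fc g n = - (of_real (kp n))\<^sup>2 * fc u0 n"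
  "norm_L2 L u0 <= r" "norm_L2 L g <= r"
  by (rule H2_coefficients[OF u0(1), folded r_def]) (rule that)
 have r0: "0 <= r" using g(4) norm_L2_nonneg[of u0] by linarith
 have b: "\<bar>u0 x\<bar> <= data_bound r" for x
 proof -
  have "norm_L2 L u0 / sqrt (2 * L) <= r / sqrt (2 * L)" using g(4) L_pos by (intro divide_right_mono) auto
  moreover have "(norm_L2 L g)^2 / (2 * L) <= r^2 / (2 * L)" using g(5) L_pos by (intro divide_right_mono power_mono) auto
  then have "L / pi * (((norm_L2 L g)^2 / (2 * L) + KS) / 2) <= L / pi * ((r^2 / (2 * L) + KS) / 2)"
   using L_pos by (intro mult_left_mono) auto
  ultimately show ?thesis using H2_representation(2)[OF g(1) u0(2) g(2,3), of x] unfolding data_bound_def by linarith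
 qed
 have half: "run_bound r / 2 = sqrt (2 * L) * data_bound r + 2 * r + 1 / 2" by (simp add: run_bound_def field_simps)
 have nn: "0 <= sqrt (2 * L) * data_bound r" using run_bound(1)[OF r0] L_pos by simp
 have "gnorm L N (%j. u0 (gridpt L N j)) <= sqrt (2 * L) * data_bound r" by (rule odd_grid.nrm_le_sup[OF og]) (rule b)
 then show "gnorm L N (%j. u0 (gridpt L N j)) <= run_bound r / 2" unfolding half using r0 by linarith
 have "gnorm L N (DD L N (%j. u0 (gridpt L N j))) <= 2 * norm_L2 L g"
  by (rule odd_grid.nrm_Q_H2_le[OF og g(1) u0(2) g(2,3)])
 then show "gnorm L N (DD L N (%j. u0 (gridpt L N j))) <= run_bound r / 2" unfolding half using g(5) nn by linarith
qed

lemma scheme_converges: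
 assumes u0: "u0 \<in> H2_per L" "continuous_on UNIV u0"
 defines "T \<equiv> life_span (norm_H2 L u0)"
 shows "\<exists>lam0>0. \<exists>u.
     strong_solution L T u0 u \<and>
     (\<forall>v. strong_solution L T u0 v \<longrightarrow> (\<forall>t\<in>{0..T}. AE x in lebesgue. v t x = u t x)) \<and>
     continuous_on (UNIV \<times> {0..T}) (%(x, t). u t x) \<and>
     (\<forall>(N :: nat => nat) (dt :: nat => real).
      (\<forall>k. odd (N k)) \<and> ((%k. dx L (N k)) \<longlonglongrightarrow> 0) \<and>
      (\<forall>k. 0 < dt k \<and> dt k / dx L (N k) <= lam0) \<longrightarrow>
      (\<forall>k. \<exists>U. scheme_solution L (N k) (dt k) T u0 U) \<and>
      (\<forall>U. (\<forall>k. scheme_solution L (N k) (dt k) T u0 (U k)) \<longrightarrow>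
       uniform_limit (UNIV \<times> {0..T})
        (%k (x, t). interp L (N k) (dt k) (U k) t x)
        (%(x, t). u t x) sequentially))"
proof -
 define r where "r = norm_H2 L u0"
 define R where "R = run_bound r"
 have r0: "0 <= r" by (simp add: r_def norm_H2_def)
 have R: "0 < R" and T: "0 < T" "18 * sqrt (2 * L) * R * T <= 1"
  using run_bound[OF r0] by (simp_all add: R_def T_def r_def)
 have per: "u0 (x + 2 * L) = u0 x" for x using u0(1) by (auto simp: H2_per_def L2_per_def periodic_def)
 \<comment> \<open>The step restriction that keeps the fixed point iteration in its ball and
   contracting; it involves \<open>L\<close> and the norm of the data, not the grid.\<close>
 define lam0 where "lam0 = 1 / (100 * odd_grid.CS L * R)"
 have "odd_grid L 1" using L_pos by (auto intro!: odd_grid.intro)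
 then have CS: "0 < 100 * odd_grid.CS L * R" using odd_grid.CS_pos R by simp
 then have lam0: "0 < lam0" by (simp add: lam0_def)
 have dtl: "dt * (100 * odd_grid.CS L * R) <= dx L N" if "odd N" "dt / dx L N <= lam0" for dt N
 proof -
  have dx: "0 < dx L N" using L_pos odd_pos[OF that(1)] by (simp add: dx_def)
  from that(2) show ?thesis unfolding lam0_def pos_divide_le_eq[OF dx] using CS by (simp add: pos_le_divide_eq)
 qed
 note ib = initial_grid_bounds[OF u0, folded r_def, folded R_def]
 have ex: "\<exists>U. scheme_solution L N dt T u0 U" if N: "odd N" and dt: "0 < dt" "dt / dx L N <= lam0" for N dt
 proof -
  have og: "odd_grid L N" using L_pos N by (auto intro!: odd_grid.intro)
  have gf: "grid_fun N (%j. u0 (gridpt L N j))"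
   unfolding grid_fun_def using per by (simp add: odd_grid.gridpt_period[OF og])
  show ?thesis by (rule odd_grid.scheme_solution_exists[OF og gf ib[OF N] R dt(1) dtl[OF N dt(2)] T(2)])
 qed
 have sub: "\<exists>r u. strict_mono (r :: nat => nat) \<and> strong_solution L T u0 u \<and> continuous_on UNIV (%(t, x). u t x) \<and>
   uniform_limit (UNIV \<times> {0..T}) (%k (x, t). interp L (N (r k)) (dt (r k)) (U (r k)) t x) (%(x, t). u t x) sequentially"
  if "!!k. odd (N k)" "(%k. dx L (N k)) \<longlonglongrightarrow> 0" "!!k. 0 < dt k" "!!k. dt k / dx L (N k) <= lam0"
   "!!k. scheme_solution L (N k) (dt k) T u0 (U k)" for N :: "nat => nat" and dt :: "nat => real" and U
  by (rule convergent_subsequence[OF T R that(1,2,3) dtl[OF that(1,4)] per u0(2) ib[OF that(1)] that(5)]) blast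
 obtain u where u: "strong_solution L T u0 u" "continuous_on UNIV (%(t, x). u t x)"
 proof -
  \<comment> \<open>A sample sequence of grids with the largest admissible time step produces
    \<open>u\<close>; uniqueness then identifies every other subsequential limit with it.\<close>
  define N where "N k = 2 * k + 1" for k :: nat
  define dt where "dt k = lam0 * dx L (N k)" for k
  have N: "odd (N k)" for k by (simp add: N_def)
  have dx: "0 < dx L (N k)" for k using L_pos by (simp add: dx_def N_def add_pos_nonneg)
  have "(%k. 2 * L / real (2 * k + 1)) \<longlonglongrightarrow> 0" by real_asymp
  then have N0: "(%k. dx L (N k)) \<longlonglongrightarrow> 0" by (simp add: dx_def N_def)
  have dt: "0 < dt k" "dt k / dx L (N k) <= lam0" for k using lam0 dx[of k] by (simp_all add: dt_def)
  have "\<forall>k. \<exists>U. scheme_solution L (N k) (dt k) T u0 U" using ex[OF N dt] by blast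
  then obtain U where "!!k. scheme_solution L (N k) (dt k) T u0 (U k)" by metis
  from sub[OF N N0 dt this] show thesis using that by blast
 qed
 have uni: "AE x in lebesgue. v t x = u t x" if "strong_solution L T u0 v" "t \<in> {0..T}" for v t
  by (rule strong_solution_unique[OF that(1) u(1) that(2)])
 have sw: "continuous_on (UNIV \<times> {0..T}) (%(x, t). u t x)"
 proof -
  have "continuous_on (UNIV \<times> {0..T}) (%p. case (snd p, fst p) of (t, x) => u t x)"
   by (rule continuous_on_compose2[OF u(2)]) (auto intro!: continuous_intros)
  then show ?thesis by (simp add: split_beta)
 qed
 show ?thesis
 proof (intro exI[of _ lam0] exI[of _ u] conjI lam0 u(1) sw allI impI ballI)
  fix v t assume "strong_solution L T u0 v" "t \<in> {0..T}"
  then show "AE x in lebesgue. v t x = u t x" by (rule uni)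
 next
  fix N :: "nat => nat" and dt :: "nat => real" and k
  assume "(\<forall>k. odd (N k)) \<and> (%k. dx L (N k)) \<longlonglongrightarrow> 0 \<and> (\<forall>k. 0 < dt k \<and> dt k / dx L (N k) <= lam0)"
  then show "\<exists>U. scheme_solution L (N k) (dt k) T u0 U" by (intro ex) auto
 next
  fix N :: "nat => nat" and dt :: "nat => real" and U
  assume a: "(\<forall>k. odd (N k)) \<and> (%k. dx L (N k)) \<longlonglongrightarrow> 0 \<and> (\<forall>k. 0 < dt k \<and> dt k / dx L (N k) <= lam0)"
   and "\<forall>k. scheme_solution L (N k) (dt k) T u0 (U k)"
  then have N: "odd (N k)" and N0: "(%k. dx L (N k)) \<longlonglongrightarrow> 0" and dt: "0 < dt k" "dt k / dx L (N k) <= lam0"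
   and sol: "scheme_solution L (N k) (dt k) T u0 (U k)" for k by auto
  show "uniform_limit (UNIV \<times> {0..T}) (%k (x, t). interp L (N k) (dt k) (U k) t x) (%(x, t). u t x) sequentially"
  proof (rule uniform_limit_subseqI)
   fix q :: "nat => nat" assume q: "strict_mono q"
   have Nq: "(%k. dx L (N (q k))) \<longlonglongrightarrow> 0" using LIMSEQ_subseq_LIMSEQ[OF N0 q] by (simp add: o_def)
   obtain r v where v: "strong_solution L T u0 v" "continuous_on UNIV (%(t, x). v t x)"
    and l: "uniform_limit (UNIV \<times> {0..T}) (%k (x, t). interp L (N (q (r k))) (dt (q (r k))) (U (q (r k))) t x) (%(x, t). v t x) sequentially"
    using sub[of "%k. N (q k)" "%k. dt (q k)" "%k. U (q k)", OF N Nq dt sol] by blast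
   \<comment> \<open>Uniqueness of solutions gives equality almost everywhere; uniform convergence
     concerns every point, so continuity in space is used to remove the null set.\<close>
   have "v t = u t" if t: "t \<in> {0..T}" for t
   proof (rule continuous_AE_eq[OF _ _ uni[OF v(1) t]])
    show "continuous_on UNIV (v t)" using continuous_on_compose2[OF v(2), of UNIV "%x. (t, x)"] by (simp add: continuous_intros)
    show "continuous_on UNIV (u t)" using continuous_on_compose2[OF u(2), of UNIV "%x. (t, x)"] by (simp add: continuous_intros)
   qed
   then have "uniform_limit (UNIV \<times> {0..T}) (%k (x, t). interp L (N (q (r k))) (dt (q (r k))) (U (q (r k))) t x) (%(x, t). u t x) sequentially"
    using l by (subst uniform_limit_cong'[where g = "%k (x, t). interp L (N (q (r k))) (dt (q (r k))) (U (q (r k))) t x" and i = "%(x, t). v t x"]) auto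
   then show "\<exists>r. uniform_limit (UNIV \<times> {0..T}) (%k (x, t). interp L (N (q (r k))) (dt (q (r k))) (U (q (r k))) t x) (%(x, t). u t x) sequentially" by (rule exI[of _ r])
  qed
 qed
qed

end

text \<open>\<open>Tmax\<close> is quantified before \<open>u0\<close>, which expresses that the
  time depends on the norm alone. Continuity of \<open>u0\<close> selects the representative of the
  H2 class whose values at the grid points are meant.\<close>

theorem theorem3p2:
  fixes L :: real
  assumes "L > 0"
  shows "\<exists>Tmax :: real \<Rightarrow> real. (\<forall>r\<ge>0. Tmax r > 0) \<and>
    (\<forall>u0. u0 \<in> H2_per L \<and> continuous_on UNIV u0 \<longrightarrow>
      (let T = Tmax (norm_H2 L u0) in
        \<exists>lam0>0. \<exists>u.
          strong_solution L T u0 u \<and>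
          (\<forall>v. strong_solution L T u0 v \<longrightarrow> (\<forall>t\<in>{0..T}. AE x in lebesgue. v t x = u t x)) \<and>
          continuous_on (UNIV \<times> {0..T}) (\<lambda>(x, t). u t x) \<and>
          (\<forall>(N :: nat \<Rightarrow> nat) (dt :: nat \<Rightarrow> real).
            (\<forall>k. odd (N k)) \<and> ((\<lambda>k. dx L (N k)) \<longlonglongrightarrow> 0) \<and>
            (\<forall>k. 0 < dt k \<and> dt k / dx L (N k) \<le> lam0) \<longrightarrow>
            (\<forall>k. \<exists>U. scheme_solution L (N k) (dt k) T u0 U) \<and>
            (\<forall>U. (\<forall>k. scheme_solution L (N k) (dt k) T u0 (U k)) \<longrightarrow>
              uniform_limit (UNIV \<times> {0..T})
                (\<lambda>k (x, t). interp L (N k) (dt k) (U k) t x)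
                (\<lambda>(x, t). u t x) sequentially))))"
proof -
 interpret torus L by unfold_locales (rule assms)
 show ?thesis
 proof (intro exI[of _ life_span] conjI allI impI, goal_cases)
  case (1 r)
  then show ?case by (rule run_bound(3))
 next
  case (2 u0)
  then have u0: "u0 \<in> H2_per L" "continuous_on UNIV u0" by auto
  show ?case unfolding Let_def by (rule scheme_converges[OF u0])
 qed
qed

end
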